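(* Let $(\mu_t)_{t>0}$ be a family of Borel probability measures on $\mathbb R^d$ and let $(\psi_t)_{t>0}$ be a family of functions $\mathbb R^d\to\mathbb R^d$. Assume: (1) for every $\varphi\in C_c^\infty(\mathbb R^d)$, the limit $\lim_{h\downarrow0}\int_{\mathbb R^d}\frac{\varphi(y)-\varphi(0)}{h}\,\mu_h(dy)\in\mathbb R$ exists; (2) for every $\varepsilon>0$ there exists $M_\varepsilon>0$ such that $\limsup_{h\downarrow0}\frac1h\,\mu_h(\{y\in\mathbb R^d:|y|>M_\varepsilon\})<\varepsilon$; (3) there exist $\omega\ge0$, $\delta>0$ and $h_0>0$ such that $\sup_{h\in(0,h_0)}\sup_{x\in\mathbb R^d}\frac{|\psi_h(x+u)-\psi_h(x)-u|}{h}\le\omega|u|$ for all $u\in\mathbb R^d$ with $|u|\le\delta$, and, for every $x\in\mathbb R^d$, the limit $F(x):=\lim_{h\downarrow0}\frac{\psi_h(x)-x}{h}$ exists in $\mathbb R^d$. Then there exists a unique (in law) Lévy process $(Y_t)_{t\ge0}$ on some probability space $(\Omega,\mathcal F,\mathbb P)$ such that, for every null sequence $(h_n)_{n\in\mathbb N}\subset(0,\infty)$, all $t\ge0$, $f\in C_b(\mathbb R^d)$, $(k_n)_{n\in\mathbb N}\subset\mathbb N$ with $k_nh_n\to t$, $(f_n)_{n\in\mathbb N}\subset C_b(\mathbb R^d)$ with $f_n\to f$ in the mixed topology, and $r\ge0$, $$\sup_{|x|\le r}\Big|\big(P_{h_n}^{k_n}f_n\big)(x)-\mathbb E_{\mathbb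 P}[f(X_t^x)]\Big|\to0\quad\text{as }n\to\infty,$$ where, for each $x\in\mathbb R^d$, $(X_t^x)_{t\ge0}$ is the unique strong solution of $dX_t^x=F(X_t^x)\,dt+dY_t$, $X_0^x=x$. If $f\in C_b(\mathbb R^d)$ is such that $\lim_{h\downarrow0}\frac{P_hf-f}{h}$ exists in the mixed topology, then $$\sup_{h>0}\Big\|\frac{\mathbb E_{\mathbb P}[f(X_h^{\,\cdot})]-P_hf}{h}\Big\|_\infty<\infty\quad\text{and}\quad\lim_{h\downarrow0}\sup_{|x|\le r}\Big|\frac{\mathbb E_{\mathbb P}[f(X_h^x)]-(P_hf)(x)}{h}\Big|=0\quad\text{for all }r\ge0.$$
   Context: $d\in\mathbb N$; $|\cdot|$ is the Euclidean norm. $C_b(\mathbb R^d)$ is the space of bounded continuous functions $\mathbb R^d\to\mathbb R$, with supremum norm $\|\cdot\|_\infty$; $C_c^\infty(\mathbb R^d)$ is the space of smooth compactly supported real functions. A null sequence is a sequence converging to $0$. $f_n\to f$ in the mixed topology (for $f_n,f\in C_b(\mathbb R^d)$) means $\sup_n\|f_n\|_\infty<\infty$ and $\sup_{|x|\le r}|f_n(x)-f(x)|\to0$ for all $r\ge0$. For a family, $f=\lim_{h\downarrow0}f_h$ in the mixed topology means $f_{h_n}\to f$ in the mixed topology for every null sequence $(h_n)\subset(0,\infty)$. For $t>0$, $f\in C_b(\mathbb R^d)$, $x\in\mathbb R^d$, define $(P_tf)(x):=\int_{\mathbb R^d}f(\psi_t(x)+y)\,\mu_t(dy)$. It is a standing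 convention that the $\psi_t$ are such that each $P_t$ is an operator $C_b(\mathbb R^d)\to C_b(\mathbb R^d)$. $P_t^k$ is the $k$-fold composition. A Lévy process $(Y_t)_{t\ge0}$ is an $\mathbb R^d$-valued process with $Y_0=0$ a.s., stationary independent increments, stochastically continuous, with a.s. càdlàg paths. The SDE means $X_t^x=x+\int_0^tF(X_s^x)\,ds+Y_t$ for all $t\geq 0$ a.s. *)

theory Defs
  imports "HOL-Probability.Probability"
begin

section \<open>Function spaces\<close>

text \<open>
  Suprema are taken in \<^typ>\<open>ereal\<close>, where they always exist, so that finiteness and upper bounds
  are genuine claims.  The space of bounded continuous real functions is the set
  \<^const>\<open>bcontfun\<close> of the library.
\<close>

definition sup_abs_on :: "'a set \<Rightarrow> ('a \<Rightarrow> real) \<Rightarrow> ereal" where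
  "sup_abs_on S f = (SUP x\<in>S. ereal \<bar>f x\<bar>)"

abbreviation sup_norm :: "('a \<Rightarrow> real) \<Rightarrow> ereal" where
  "sup_norm f \<equiv> sup_abs_on UNIV f"

primrec Ck :: "nat \<Rightarrow> ('a::euclidean_space \<Rightarrow> real) \<Rightarrow> bool" where
  "Ck 0 f \<longleftrightarrow> continuous_on UNIV f"
| "Ck (Suc k) f \<longleftrightarrow> (\<forall>x. f differentiable (at x)) \<and>
     (\<forall>v. Ck k (\<lambda>x. frechet_derivative f (at x) v))"

definition Cc_infinity :: "('a::euclidean_space \<Rightarrow> real) set" where
  "Cc_infinity = {f. (\<forall>k. Ck k f) \<and> compact (closure {x. f x \<noteq> 0})}"

definition null_seq :: "(nat \<Rightarrow> real) \<Rightarrow> bool" where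
  "null_seq hs \<longleftrightarrow> (\<forall>n. 0 < hs n) \<and> hs \<longlonglongrightarrow> 0"

definition mixed_tendsto ::
  "(nat \<Rightarrow> 'a::euclidean_space \<Rightarrow> real) \<Rightarrow> ('a \<Rightarrow> real) \<Rightarrow> bool" where
  "mixed_tendsto fs f \<longleftrightarrow> (\<forall>n. fs n \<in> bcontfun) \<and> f \<in> bcontfun \<and>
     (SUP n. sup_norm (fs n)) < \<infinity> \<and>
     (\<forall>r\<ge>0. (\<lambda>n. sup_abs_on {x. norm x \<le> r} (\<lambda>x. fs n x - f x)) \<longlonglongrightarrow> 0)"

definition mixed_tendsto_at_right_0 ::
  "(real \<Rightarrow> 'a::euclidean_space \<Rightarrow> real) \<Rightarrow> ('a \<Rightarrow> real) \<Rightarrow> bool" where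
  "mixed_tendsto_at_right_0 g f \<longleftrightarrow>
     (\<forall>hs. null_seq hs \<longrightarrow> mixed_tendsto (\<lambda>n. g (hs n)) f)"

definition transition_op ::
  "(real \<Rightarrow> 'a::euclidean_space measure) \<Rightarrow> (real \<Rightarrow> 'a \<Rightarrow> 'a) \<Rightarrow> real \<Rightarrow> ('a \<Rightarrow> real) \<Rightarrow> 'a \<Rightarrow> real"
  where "transition_op \<mu> \<psi> t f x = (LINT y|\<mu> t. f (\<psi> t x + y))"

section \<open>L\'evy processes and strong solutions\<close>

text \<open>
  Processes have type \<^typ>\<open>real \<Rightarrow> 'w \<Rightarrow> 'a\<close>; only their values at times \<open>t \<ge> 0\<close> matter.
\<close>

definition cadlag :: "(real \<Rightarrow> 'a::euclidean_space) \<Rightarrow> bool" where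
  "cadlag p \<longleftrightarrow> (\<forall>t\<ge>0. continuous (at_right t) p) \<and> (\<forall>t>0. \<exists>l. (p \<longlongrightarrow> l) (at_left t))"

definition levy_process :: "'w measure \<Rightarrow> (real \<Rightarrow> 'w \<Rightarrow> 'a::euclidean_space) \<Rightarrow> bool" where
  "levy_process M Y \<longleftrightarrow>
     prob_space M \<and>
     (\<forall>t\<ge>0. Y t \<in> borel_measurable M) \<and>
     (AE \<omega> in M. Y 0 \<omega> = 0) \<and>
     (\<forall>s\<ge>0. \<forall>h\<ge>0. distr M borel (\<lambda>\<omega>. Y (s + h) \<omega> - Y s \<omega>) = distr M borel (\<lambda>\<omega>. Y h \<omega> - Y 0 \<omega>)) \<and>
     (\<forall>(n::nat) t. 0 \<le> t 0 \<and> (\<forall>i<n. t i < t (Suc i)) \<longrightarrow>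
        prob_space.indep_vars M (\<lambda>_. borel) (\<lambda>i \<omega>. Y (t (Suc i)) \<omega> - Y (t i) \<omega>) {..<n}) \<and>
     (\<forall>s\<ge>0. \<forall>\<epsilon>>0. ((\<lambda>t. measure M {\<omega> \<in> space M. norm (Y t \<omega> - Y s \<omega>) > \<epsilon>}) \<longlongrightarrow> 0)
        (at s within {0..})) \<and>
     (AE \<omega> in M. cadlag (\<lambda>t. Y t \<omega>))"

definition process_law ::
  "'w measure \<Rightarrow> (real \<Rightarrow> 'w \<Rightarrow> 'a::euclidean_space) \<Rightarrow> (real \<Rightarrow> 'a) measure" where
  "process_law M Y = distr M (PiM {0..} (\<lambda>_. borel)) (\<lambda>\<omega>. restrict (\<lambda>t. Y t \<omega>) {0..})"

text \<open>
  The natural filtration of \<open>Y\<close>, augmented by the measurable null sets of \<open>M\<close>; \<open>M\<close> is not assumed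
  to be complete.
\<close>

definition augmented_filtration ::
  "'w measure \<Rightarrow> (real \<Rightarrow> 'w \<Rightarrow> 'a::euclidean_space) \<Rightarrow> real \<Rightarrow> 'w measure" where
  "augmented_filtration M Y t =
     sigma (space M) ({Y s -` A \<inter> space M | s A. 0 \<le> s \<and> s \<le> t \<and> A \<in> sets borel} \<union> null_sets M)"

definition strong_solution ::
  "'w measure \<Rightarrow> (real \<Rightarrow> 'w \<Rightarrow> 'a::euclidean_space) \<Rightarrow> ('a \<Rightarrow> 'a) \<Rightarrow> 'a \<Rightarrow> (real \<Rightarrow> 'w \<Rightarrow> 'a) \<Rightarrow> bool"
  where
  "strong_solution M Y F x X \<longleftrightarrow>
     (\<forall>t\<ge>0. X t \<in> borel_measurable (augmented_filtration M Y t)) \<and>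
     (AE \<omega> in M. \<forall>t\<ge>0. set_integrable lborel {0..t} (\<lambda>s. F (X s \<omega>)) \<and>
        X t \<omega> = x + (LINT s:{0..t}|lborel. F (X s \<omega>)) + Y t \<omega>)"

text \<open>Uniqueness is up to indistinguishability.\<close>

definition unique_strong_solution ::
  "'w measure \<Rightarrow> (real \<Rightarrow> 'w \<Rightarrow> 'a::euclidean_space) \<Rightarrow> ('a \<Rightarrow> 'a) \<Rightarrow> 'a \<Rightarrow> (real \<Rightarrow> 'w \<Rightarrow> 'a) \<Rightarrow> bool"
  where
  "unique_strong_solution M Y F x X \<longleftrightarrow> strong_solution M Y F x X \<and>
     (\<forall>X'. strong_solution M Y F x X' \<longrightarrow> (AE \<omega> in M. \<forall>t\<ge>0. X' t \<omega> = X t \<omega>))"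

text \<open>
  \<open>X\<close> is the family of solutions indexed by the initial value.
\<close>

definition scheme_converges ::
  "(real \<Rightarrow> 'a::euclidean_space measure) \<Rightarrow> (real \<Rightarrow> 'a \<Rightarrow> 'a) \<Rightarrow>
   'w measure \<Rightarrow> ('a \<Rightarrow> real \<Rightarrow> 'w \<Rightarrow> 'a) \<Rightarrow> bool" where
  "scheme_converges \<mu> \<psi> M X \<longleftrightarrow>
     (\<forall>hs t f ks fs r.
        null_seq hs \<and> 0 \<le> t \<and> f \<in> bcontfun \<and>
        (\<lambda>n. real (ks n) * hs n) \<longlonglongrightarrow> t \<and> mixed_tendsto fs f \<and> 0 \<le> r \<longrightarrow>
        (\<lambda>n. sup_abs_on {x. norm x \<le> r}
           (\<lambda>x. (transition_op \<mu> \<psi> (hs n) ^^ ks n) (fs n) x - (LINT \<omega>|M. f (X x t \<omega>)))) \<longlonglongrightarrow> 0)"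

definition scheme_limit ::
  "(real \<Rightarrow> 'a::euclidean_space measure) \<Rightarrow> (real \<Rightarrow> 'a \<Rightarrow> 'a) \<Rightarrow> ('a \<Rightarrow> 'a) \<Rightarrow>
   'w measure \<Rightarrow> (real \<Rightarrow> 'w \<Rightarrow> 'a) \<Rightarrow> bool" where
  "scheme_limit \<mu> \<psi> F M Y \<longleftrightarrow>
     (\<exists>X. (\<forall>x. unique_strong_solution M Y F x (X x)) \<and> scheme_converges \<mu> \<psi> M X)"

end

theory Submission
  imports Defs
begin

text \<open>
  The characteristic functions of the \<open>\<mu> h\<close> have a derivative \<open>\<eta>\<close> at \<open>h = 0\<close>: trigonometric functions are
  approximated by test functions up to the tails, which the second hypothesis controls. Hence the random walks
  with steps from \<open>\<mu> h\<close> converge in law to the L\'evy process \<open>Y\<close> with exponent \<open>\<eta>\<close>; it is constructed as a limit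
  of these walks on the dyadic times, followed by a regularization of the paths. The drift \<open>F\<close> is Lipschitz,
  so the equation is solved path by path.

  In a block of \<open>k\<close> steps with \<open>k * h = s\<close> all jumps may be made first and all deterministic steps afterwards: as
  \<open>\<psi> h\<close> almost commutes with translations, this costs only \<open>o(s)\<close>. Thus the scheme is close to an alternation of
  increments of \<open>Y\<close> and pieces of the flow of \<open>F\<close>, with an error that vanishes as the blocks shrink, and this
  alternation converges to the solution of the equation.

  Two driving processes with the same limit semigroup have characteristic functions that differ by \<open>o(s)\<close> at
  time \<open>s\<close>, since the solution started at \<open>0\<close> is \<open>Y s\<close> plus the flow up to an error negligible on short times;
  taking powers, they agree. The last claim follows by telescoping \<open>P_h^k f - f\<close> and applying the convergence
  theorem to the difference quotients of \<open>f\<close> at small times.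
\<close>

section \<open>Smooth cutoff functions\<close>

text \<open>Neither the laws \<open>\<mu> h\<close> nor the limit process need have moments, so
  jumps are truncated at a level \<open>K\<close> beyond which \<open>\<mu> h\<close> has mass at
  most \<open>eps * h\<close>. This is a small multiple of \<open>h\<close> but not o(h), hence the
  order of choices: first \<open>eps\<close> (and with it \<open>K\<close>), then the number of
  blocks, and only then does the step size tend to 0. Bounded Lipschitz functions
  (\<open>blip\<close>) are the working test functions: the scheme preserves them with constants
  that depend on the elapsed time only, and equi-Lipschitz bounds turn pointwise into locally
  uniform convergence. Compactness yields the process along a subsequence only; this is harmless, as
  \<open>\<eta>\<close> determines its laws. For uniqueness the obstacle is that within a time
  \<open>s\<close> a path may become large with a probability of order \<open>s\<close>. Two levels
  are used: exceeding a high one has probability at most a small multiple of \<open>s\<close>, while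
  exceeding a low one merely has probability tending to 0, but below the high level the error is
  itself of order \<open>s\<close>.\<close>

notation LIMSEQ ("((_)/ ----> (_))" [60, 60] 60)

abbreviation eventually_seq :: "(nat \<Rightarrow> bool) \<Rightarrow> bool" (binder "EV " 10) where
  "eventually_seq P \<equiv> eventually P sequentially"

text \<open>A class closed under directional derivatives, so that membership alone gives
  \<open>Ck k\<close> for every \<open>k\<close>. In \<open>comp\<close> the outer function comes as
  a sequence in which each entry is the derivative of the one before, so its smoothness is part of
  the data.\<close>

inductive smooth_fn :: "('a::euclidean_space \<Rightarrow> real) \<Rightarrow> bool" where
  const: "smooth_fn (\<lambda>x. c)"
| inner: "smooth_fn (\<lambda>x. x \<bullet> v)"
| add: "smooth_fn f ==> smooth_fn g ==> smooth_fn (\<lambda>x. f x + g x)"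
| mult: "smooth_fn f ==> smooth_fn g ==> smooth_fn (\<lambda>x. f x * g x)"
| inverse: "smooth_fn f ==> (\<And>x. f x \<noteq> 0) ==> smooth_fn (\<lambda>x. inverse (f x))"
| comp: "smooth_fn f ==> (\<And>n x. (g n has_real_derivative g (Suc n) x) (at x)) ==>
    smooth_fn (\<lambda>x. g (0::nat) (f x))"

lemma smooth_fn_derivative:
  fixes f :: "'a::euclidean_space \<Rightarrow> real"
  assumes "smooth_fn f"
  shows "\<exists>f'. (\<forall>x. (f has_derivative (\<lambda>v. f' v x)) (at x)) \<and> (\<forall>v. smooth_fn (f' v))"
  using assms
proof induction
  case (const c)
  show ?case by (rule exI[of _ "\<lambda>v x. 0"]) (auto intro: smooth_fn.const)
next
  case (inner v)
  show ?case
    by (rule exI[of _ "\<lambda>w x. w \<bullet> v"]) (auto intro: smooth_fn.const intro!: derivative_eq_intros)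
next
  case (add f g)
  then obtain f' g' where "\<And>x. (f has_derivative (\<lambda>v. f' v x)) (at x)" "\<And>v. smooth_fn (f' v)"
    "\<And>x. (g has_derivative (\<lambda>v. g' v x)) (at x)" "\<And>v. smooth_fn (g' v)" by auto
  then show ?case by (intro exI[of _ "\<lambda>v x. f' v x + g' v x"]) (auto intro!: smooth_fn.add has_derivative_add)
next
  case (mult f g)
  then obtain f' g' where *: "\<And>x. (f has_derivative (\<lambda>v. f' v x)) (at x)" "\<And>v. smooth_fn (f' v)"
    "\<And>x. (g has_derivative (\<lambda>v. g' v x)) (at x)" "\<And>v. smooth_fn (g' v)" by auto
  show ?case by (rule exI[of _ "\<lambda>v x. f x * g' v x + f' v x * g x"])
       (auto intro!: smooth_fn.add smooth_fn.mult has_derivative_mult * mult)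
next
  case (inverse f)
  then obtain f' where *: "\<And>x. (f has_derivative (\<lambda>v. f' v x)) (at x)" "\<And>v. smooth_fn (f' v)" by auto
  have "((\<lambda>x. inverse (f x)) has_derivative (\<lambda>v. (-1) * (inverse (f x) * f' v x * inverse (f x)))) (at x)" for x
    using Deriv.has_derivative_inverse[OF inverse(2) *(1)] by simp
  moreover have "smooth_fn (\<lambda>x. (-1) * (inverse (f x) * f' v x * inverse (f x)))" for v
    using inverse * by (intro smooth_fn.mult smooth_fn.const smooth_fn.inverse) auto
  ultimately show ?case by (intro exI[of _ "\<lambda>v x. (-1) * (inverse (f x) * f' v x * inverse (f x))"]) auto
next
  case (comp f g)
  then obtain f' where *: "\<And>x. (f has_derivative (\<lambda>v. f' v x)) (at x)" "\<And>v. smooth_fn (f' v)" by auto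
  have "((\<lambda>x. g 0 (f x)) has_derivative (\<lambda>v. g (Suc 0) (f x) * f' v x)) (at x)" for x
    using has_derivative_compose[OF *(1) comp(2)[of 0, unfolded has_field_derivative_def]] by simp
  moreover have "smooth_fn (\<lambda>x. g (Suc 0) (f x) * f' v x)" for v
    using comp * smooth_fn.comp[of f "\<lambda>n. g (Suc n)"] by (intro smooth_fn.mult) auto
  ultimately show ?case by (intro exI[of _ "\<lambda>v x. g (Suc 0) (f x) * f' v x"]) auto
qed

lemma smooth_fn_continuous: "smooth_fn f ==> continuous_on S f" using smooth_fn_derivative[of f]
  by (meson continuous_at_imp_continuous_on has_derivative_continuous)

lemma smooth_fn_Ck: "smooth_fn f ==> Ck k f"
proof (induction k arbitrary: f)
  case 0
  then show ?case by (simp add: smooth_fn_continuous)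
next
  case (Suc k)
  obtain f' where f': "\<And>x. (f has_derivative (\<lambda>v. f' v x)) (at x)" "\<And>v. smooth_fn (f' v)"
    using smooth_fn_derivative[OF Suc.prems] by auto
  have "frechet_derivative f (at x) = (\<lambda>v. f' v x)" for x using frechet_derivative_at[OF f'(1)] by simp
  then show ?case using f' Suc.IH by (auto simp: differentiable_def)
qed

lemma smooth_fn_sum: "finite A ==> (\<And>i. i \<in> A ==> smooth_fn (f i)) ==> smooth_fn (\<lambda>x. \<Sum>i\<in>A. f i x)"
  by (induction A rule: finite_induct) (auto intro: smooth_fn.const smooth_fn.add)

lemma smooth_fn_norm_sq: "smooth_fn (\<lambda>x::'a::euclidean_space. (norm x)\<^sup>2)"
proof -
  have "smooth_fn (\<lambda>x::'a. \<Sum>b\<in>Basis. (x \<bullet> b) * (x \<bullet> b))"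
    by (intro smooth_fn_sum smooth_fn.mult smooth_fn.inner) auto
  moreover have "(\<Sum>b\<in>Basis. (x \<bullet> b) * (x \<bullet> b)) = (norm x)\<^sup>2" for x :: 'a
    unfolding power2_norm_eq_inner by (metis euclidean_inner)
  ultimately show ?thesis by simp
qed

lemma smooth_fn_cos:
  assumes "smooth_fn f" shows "smooth_fn (\<lambda>x. cos (f x))"
proof -
  \<comment> \<open>Differentiating the cosine shifts its argument by a quarter period, so one
    formula gives all derivatives.\<close>
  define g :: "nat \<Rightarrow> real \<Rightarrow> real" where "g n x = cos (x + real n * (pi / 2))" for n x
  have "cos (x + real (Suc n) * (pi / 2)) = - sin (x + real n * (pi / 2))" for n x
    using cos_add[of "x + real n * (pi / 2)" "pi / 2"] by (simp add: algebra_simps add_divide_distrib)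
  then have "(g n has_real_derivative g (Suc n) x) (at x)" for n x
    unfolding g_def[abs_def] by (auto intro!: derivative_eq_intros)
  from smooth_fn.comp[of f g, OF assms this] show ?thesis by (simp add: g_def)
qed

lemma smooth_fn_sin: "smooth_fn f ==> smooth_fn (\<lambda>x. sin (f x))"
  using smooth_fn_cos[OF smooth_fn.add[OF _ smooth_fn.const[of "- (pi/2)"]], of f] by (simp add: cos_diff)

section \<open>A smooth function that is flat at zero, and bump functions\<close>

text \<open>With \<open>s = 1 / t\<close> the derivative in \<open>t\<close> is \<open>- s^2\<close>
  times the derivative in \<open>s\<close>. Applied to \<open>p s * exp (- s)\<close> it gives
  \<open>s^2 * (p s - p' s) * exp (- s)\<close>, whence the recursion.\<close>

primrec flat_poly :: "nat \<Rightarrow> real poly" where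
  "flat_poly 0 = 1"
| "flat_poly (Suc n) = [:0, 0, 1:] * (flat_poly n - pderiv (flat_poly n))"

definition flat :: "nat \<Rightarrow> real \<Rightarrow> real" where
  "flat n t = (if t > 0 then poly (flat_poly n) (1 / t) * exp (- (1 / t)) else 0)"

lemma poly_div_exp_tendsto_0: "((\<lambda>s. poly p s * exp (- s)) \<longlongrightarrow> (0::real)) at_top"
proof -
  have "((\<lambda>s. \<Sum>i\<le>degree p. coeff p i * (s ^ i / exp s)) \<longlongrightarrow> (\<Sum>i\<le>degree p. coeff p i * 0)) at_top"
    by (intro tendsto_intros tendsto_power_div_exp_0)
  then show ?thesis by (simp add: poly_altdef sum_distrib_right exp_minus divide_inverse mult.assoc)
qed

lemma flat_has_derivative: "(flat n has_real_derivative flat (Suc n) t) (at t)"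
proof -
  consider "t > 0" | "t < 0" | "t = 0" by linarith
  then show ?thesis
  proof cases
    case 1
    have "((\<lambda>t. poly (flat_poly n) (1 / t) * exp (- (1 / t))) has_real_derivative flat (Suc n) t) (at t)"
      unfolding flat_def using 1 by (auto intro!: derivative_eq_intros simp: field_simps power2_eq_square)
    then show ?thesis
      by (rule has_field_derivative_transform_within_open[of _ _ _ "{0<..}"]) (use 1 in \<open>auto simp: flat_def\<close>)
  next
    case 2
    have "((\<lambda>t. 0) has_real_derivative flat (Suc n) t) (at t)" using 2 by (simp add: flat_def)
    then show ?thesis
      by (rule has_field_derivative_transform_within_open[of _ _ _ "{..<0}"]) (use 2 in \<open>auto simp: flat_def\<close>)
  next
    case 3
    \<comment> \<open>At 0 the right difference quotient is
      \<open>s * poly (flat_poly n) s * exp (- s)\<close> with \<open>s = 1 / h\<close>; the factor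
      \<open>[:0, 1:]\<close> is this \<open>s\<close>.\<close>
    have "((\<lambda>s. poly ([:0, 1:] * flat_poly n) s * exp (- s)) \<longlongrightarrow> 0) at_top"
      by (rule poly_div_exp_tendsto_0)
    then have "((\<lambda>h. poly ([:0, 1:] * flat_poly n) (inverse h) * exp (- (inverse h))) \<longlongrightarrow> 0) (at_right 0)"
      by (rule filterlim_compose[OF _ filterlim_inverse_at_top_right])
    then have "((\<lambda>h. flat n h / h) \<longlongrightarrow> 0) (at_right 0)" by (rule Lim_transform_eventually)
         (auto simp: eventually_at_right_less flat_def divide_inverse mult_ac intro!: eventually_at_rightI[of 0 1])
    moreover have "((\<lambda>h. flat n h / h) \<longlongrightarrow> 0) (at_left 0)"
      by (rule Lim_transform_eventually[OF tendsto_const]) (auto simp: flat_def intro!: eventually_at_leftI[of "-1" 0])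
    ultimately have "((\<lambda>h. flat n h / h) \<longlongrightarrow> 0) (at 0)" by (simp add: filterlim_split_at)
    then show ?thesis using 3 by (simp add: DERIV_def flat_def)
  qed
qed

lemma smooth_fn_flat: "smooth_fn f ==> smooth_fn (\<lambda>x. flat 0 (f x))"
  by (rule smooth_fn.comp[of f flat]) (auto intro: flat_has_derivative)

text \<open>A quotient \<open>a / (a + b)\<close> in which \<open>a\<close> vanishes outside the
  ball of radius \<open>2 * r\<close> and \<open>b\<close> inside the ball of radius
  \<open>r\<close>, never both at once. The norm enters squared because it is not smooth at
  0.\<close>

definition bump :: "real \<Rightarrow> 'a::euclidean_space \<Rightarrow> real" where
  "bump r x = flat 0 (4 * r\<^sup>2 - (norm x)\<^sup>2) * inverse (flat 0 (4 * r\<^sup>2 - (norm x)\<^sup>2) + flat 0 ((norm x)\<^sup>2 - r\<^sup>2))"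

lemma flat0_nonneg: "0 \<le> flat 0 t" and flat0_pos: "0 < t ==> 0 < flat 0 t" by (auto simp: flat_def)

lemma bump_denom_pos:
  assumes "r > 0" shows "0 < flat 0 (4 * r\<^sup>2 - (norm x)\<^sup>2) + flat 0 ((norm x)\<^sup>2 - r\<^sup>2)"
proof (cases "(norm x)\<^sup>2 < 4 * r\<^sup>2")
  case True
  then show ?thesis using flat0_nonneg flat0_pos by (simp add: add_pos_nonneg)
next
  case False
  moreover have "r\<^sup>2 < 4 * r\<^sup>2" using assms by simp
  ultimately have "0 < (norm x)\<^sup>2 - r\<^sup>2" by linarith
  then show ?thesis using flat0_nonneg flat0_pos by (intro add_nonneg_pos) auto
qed

lemma smooth_fn_bump:
  assumes "r > 0" shows "smooth_fn (bump r)"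
proof -
  have "smooth_fn (\<lambda>x. 4 * r\<^sup>2 + (-1) * (norm x)\<^sup>2)" "smooth_fn (\<lambda>x. (norm x)\<^sup>2 + (- r\<^sup>2))"
    by (intro smooth_fn.add smooth_fn.mult smooth_fn.const smooth_fn_norm_sq)+
  then have "smooth_fn (\<lambda>x. 4 * r\<^sup>2 - (norm x)\<^sup>2)" "smooth_fn (\<lambda>x. (norm x)\<^sup>2 - r\<^sup>2)" by simp_all
  then show ?thesis
    unfolding bump_def[abs_def] using bump_denom_pos[OF assms]
    by (intro smooth_fn.mult smooth_fn.inverse smooth_fn.add smooth_fn_flat) (auto simp: less_le)
qed

lemma bump_bounds: "r > 0 ==> 0 \<le> bump r x" "r > 0 ==> bump r x \<le> 1"
  using bump_denom_pos[of r x] flat0_nonneg by (auto simp: bump_def field_simps)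

lemma bump_eq_1: "r > 0 ==> norm x \<le> r ==> bump r x = 1"
proof -
  assume *: "r > 0" "norm x \<le> r"
  then have le: "(norm x)\<^sup>2 \<le> r\<^sup>2" by (simp add: power_mono)
  then have "flat 0 ((norm x)\<^sup>2 - r\<^sup>2) = 0" by (simp add: flat_def)
  then show ?thesis using bump_denom_pos[OF *(1), of x] by (simp add: bump_def)
qed

lemma bump_eq_0:
  assumes "r > 0" "2 * r \<le> norm x" shows "bump r x = 0"
proof -
  have "(2 * r)\<^sup>2 \<le> (norm x)\<^sup>2" using assms by (intro power_mono) auto
  then show ?thesis by (simp add: bump_def flat_def power_mult_distrib)
qed

lemma smooth_fn_bump_Cc_infinity:
  assumes "smooth_fn f" "r > 0"
  shows "(\<lambda>x. f x * bump r x) \<in> Cc_infinity"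
proof -
  have "{x. f x * bump r x \<noteq> 0} \<subseteq> cball 0 (2 * r)"
    using bump_eq_0[OF assms(2)] by (force simp: not_le[symmetric] dest: less_imp_le)
  then have "compact (closure {x. f x * bump r x \<noteq> 0})" by (meson bounded_cball bounded_subset compact_closure)
  then show ?thesis
    unfolding Cc_infinity_def using assms by (auto intro!: smooth_fn_Ck smooth_fn.mult smooth_fn_bump)
qed

section \<open>The characteristic exponent\<close>

definition charf :: "'a::euclidean_space measure \<Rightarrow> 'a \<Rightarrow> complex" where
  "charf N u = (LINT y|N. cis (u \<bullet> y))"

definition trunc :: "real \<Rightarrow> 'a::euclidean_space \<Rightarrow> 'a" where
  "trunc K y = (if norm y \<le> K then y else 0)"

lemma trunc_measurable [measurable]: "trunc K \<in> borel_measurable borel"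
  unfolding trunc_def by measurable

lemma norm_trunc_le: "0 \<le> K ==> norm (trunc K y) \<le> K" by (simp add: trunc_def)

lemma cis_measurable [measurable]: "cis \<in> borel_measurable borel"
  by (intro borel_measurable_continuous_onI continuous_intros)

text \<open>The limit is not identified: the limits of the approximants form a Cauchy sequence,
  since any two of them can be compared at a common argument, which exists because \<open>F\<close>
  is not \<open>bot\<close>. This serves the generator as well as the one-sided limits of
  paths.\<close>

lemma tendsto_from_approximants:
  fixes f :: "'b \<Rightarrow> 'c::complete_space"
  assumes "F \<noteq> bot"
    and approx: "\<And>eps::real. eps > 0 ==> \<exists>g L. (g \<longlongrightarrow> L) F \<and> (\<forall>\<^sub>F h in F. dist (f h) (g h) \<le> eps)"
  shows "\<exists>l. (f \<longlongrightarrow> l) F"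
proof -
  have "\<exists>L. \<forall>\<^sub>F h in F. dist (f h) L < 1 / Suc n" for n
  proof -
    obtain g L where g: "(g \<longlongrightarrow> L) F" "\<forall>\<^sub>F h in F. dist (f h) (g h) \<le> 1 / (2 * Suc n)"
      using approx[of "1 / (2 * Suc n)"] by auto
    have "\<forall>\<^sub>F h in F. dist (g h) L < 1 / (2 * Suc n)" using g(1) by (rule tendstoD) simp
    with g(2) have "\<forall>\<^sub>F h in F. dist (f h) L < 1 / Suc n"
    proof eventually_elim
      case (elim h)
      have "dist (f h) L < 1 / (2 * Suc n) + 1 / (2 * Suc n)" using elim dist_triangle[of "f h" L "g h"] by linarith
      then show ?case by (simp add: field_simps)
    qed
    then show ?thesis by auto
  qed
  then obtain L where L: "\<And>n. \<forall>\<^sub>F h in F. dist (f h) (L n) < 1 / Suc n" by metis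
  have dL: "dist (L n) (L m) < 1 / Suc n + 1 / Suc m" for n m
  proof -
    obtain h where "dist (f h) (L n) < 1 / Suc n" "dist (f h) (L m) < 1 / Suc m"
      using eventually_happens'[OF assms(1) eventually_conj[OF L[of n] L[of m]]] by auto
    then show ?thesis using dist_triangle2[of "L n" "L m" "f h"] by (simp add: dist_commute)
  qed
  have "Cauchy L"
  proof (rule metric_CauchyI)
    fix e :: real assume "e > 0"
    then obtain N where N: "1 / Suc N < e / 2" using nat_approx_posE[of "e/2"] by auto
    have "1 / real (Suc n) \<le> 1 / Suc N" if "n \<ge> N" for n using that by (intro divide_left_mono) auto
    then have "dist (L m) (L n) < e" if "m \<ge> N" "n \<ge> N" for m n
      using dL[of m n] N that by (smt (verit) field_sum_of_halves)
    then show "\<exists>M. \<forall>m\<ge>M. \<forall>n\<ge>M. dist (L m) (L n) < e" by blast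
  qed
  then obtain l where l: "L ----> l" using Cauchy_convergent convergent_def by blast
  have "(f \<longlongrightarrow> l) F"
  proof (rule tendstoI)
    fix e :: real assume "e > 0"
    obtain N where N: "1 / Suc N < e / 2" using nat_approx_posE[of "e/2"] \<open>e > 0\<close> by auto
    obtain N' where N': "\<And>n. n \<ge> N' ==> dist (L n) l < e / 2"
      using metric_LIMSEQ_D[OF l, of "e/2"] \<open>e > 0\<close> by auto
    define n where "n = max N N'"
    have "1 / real (Suc n) \<le> 1 / Suc N"
      unfolding n_def by (intro divide_left_mono) auto
    then have 1: "1 / real (Suc n) < e/2" using N by simp
    show "\<forall>\<^sub>F h in F. dist (f h) l < e" using L[of n]
    proof eventually_elim
      case (elim h)
      then show ?case using 1 N'[of n] dist_triangle[of "f h" l "L n"] by (simp add: n_def)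
    qed
  qed
  then show ?thesis ..
qed

lemma borel_prob_integrable:
  fixes f :: "'a::euclidean_space \<Rightarrow> 'b::{banach, second_countable_topology}"
  assumes "prob_space N" "sets N = sets borel" "f \<in> borel_measurable borel" "\<And>x. norm (f x) \<le> B"
  shows "integrable N f"
proof -
  interpret prob_space N by fact
  show ?thesis
    by (rule integrable_const_bound[of _ B]) (use assms in \<open>auto simp: measurable_cong_sets[OF assms(2)]\<close>)
qed

lemma charf_eq:
  assumes "prob_space N" "sets N = sets borel"
  shows "charf N u = Complex (LINT y|N. cos (u \<bullet> y)) (LINT y|N. sin (u \<bullet> y))"
proof -
  have i: "integrable N (\<lambda>y. cis (u \<bullet> y))"
    by (rule borel_prob_integrable[OF assms, of _ 1]) (auto simp del: cis.code simp: norm_cis)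
  have "Re (charf N u) = (LINT y|N. cos (u \<bullet> y))" "Im (charf N u) = (LINT y|N. sin (u \<bullet> y))"
    unfolding charf_def using integral_Re[OF i] integral_Im[OF i] by simp_all
  then show ?thesis by (simp add: complex_eq_iff)
qed

lemma norm_charf_le_1:
  assumes "prob_space N" "sets N = sets borel"
  shows "norm (charf N u) \<le> 1"
proof -
  interpret prob_space N by fact
  have "norm (charf N u) \<le> (LINT y|N. norm (cis (u \<bullet> y)))"
    unfolding charf_def by (rule integral_norm_bound)
  then show ?thesis by (simp add: prob_space)
qed

text \<open>Hypotheses on the jump laws alone; the Levy process is built from these, without
  reference to \<open>\<psi>\<close>.\<close>

locale jump_family =
  fixes \<mu> :: "real \<Rightarrow> 'a::euclidean_space measure"
  assumes prob: "\<And>t. t > 0 ==> prob_space (\<mu> t)"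
    and borel: "\<And>t. t > 0 ==> sets (\<mu> t) = sets borel"
    and A1: "\<And>\<phi>. \<phi> \<in> Cc_infinity ==>
      \<exists>L. ((\<lambda>h. LINT y|\<mu> h. (\<phi> y - \<phi> 0) / h) \<longlongrightarrow> L) (at_right 0)"
    and A2: "\<And>eps. eps > 0 ==>
      \<exists>K>0. Limsup (at_right 0) (\<lambda>h. ereal (1 / h * measure (\<mu> h) {y. norm y > K})) < ereal eps"
begin

lemma space_mu: "t > 0 ==> space (\<mu> t) = UNIV" using sets_eq_imp_space_eq[OF borel] by simp

lemma integrable_mu:
  fixes f :: "'a \<Rightarrow> 'b::{banach, second_countable_topology}"
  assumes "t > 0" "f \<in> borel_measurable borel" "\<And>x. norm (f x) \<le> B"
  shows "integrable (\<mu> t) f" by (rule borel_prob_integrable[OF prob borel]) (use assms in auto)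

lemma tail:
  assumes "eps > 0"
  shows "\<exists>K>0. \<exists>h1>0. \<forall>h. 0 < h \<and> h < h1 --> measure (\<mu> h) {y. norm y > K} \<le> eps * h"
proof -
  obtain K where K: "K > 0" "Limsup (at_right 0) (\<lambda>h. ereal (1 / h * measure (\<mu> h) {y. norm y > K})) < ereal eps"
    using A2[OF assms] by auto
  from Limsup_lessD[OF K(2)] obtain h1 where "h1 > 0"
    "\<And>h. 0 < h ==> h < h1 ==> 1 / h * measure (\<mu> h) {y. norm y > K} < eps"
    by (auto simp: eventually_at_right_field)
  then show ?thesis using K(1) by (intro exI[of _ K] conjI exI[of _ h1]) (auto simp: field_simps less_imp_le)
qed

text \<open>Multiplication by \<open>bump K\<close> gives a test function with the same value at 0.
  As \<open>f\<close> is bounded by 1, the error is at most the indicator of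
  \<open>norm y > K\<close>, whose integral divided by \<open>h\<close> is at most the prescribed
  \<open>eps\<close> by the tail hypothesis.\<close>

lemma smooth_bounded_generator:
  assumes f: "smooth_fn f" and bd: "\<And>x. \<bar>f x\<bar> \<le> 1"
  shows "\<exists>l. ((\<lambda>h. ((LINT y|\<mu> h. f y) - f 0) / h) \<longlongrightarrow> l) (at_right 0)"
proof (rule tendsto_from_approximants)
  show "at_right (0::real) \<noteq> bot" by simp
  fix eps :: real assume "eps > 0"
  then obtain K h1 where K: "K > 0" "h1 > 0"
      "\<And>h. 0 < h ==> h < h1 ==> measure (\<mu> h) {y. norm y > K} \<le> eps * h" using tail[of eps] by auto
  define \<phi> where "\<phi> y = f y * bump K y" for y
  have fm [measurable]: "f \<in> borel_measurable borel"
    using f by (intro borel_measurable_continuous_onI smooth_fn_continuous)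
  have \<phi>m [measurable]: "\<phi> \<in> borel_measurable borel"
    unfolding \<phi>_def[abs_def] using f K(1)
    by (intro borel_measurable_continuous_onI smooth_fn_continuous smooth_fn.mult smooth_fn_bump)
  have \<phi>b: "\<bar>\<phi> y\<bar> \<le> 1" for y
    unfolding \<phi>_def abs_mult using bd[of y] bump_bounds[OF K(1), of y] by (intro mult_le_one) auto
  obtain L where L: "((\<lambda>h. LINT y|\<mu> h. (\<phi> y - \<phi> 0) / h) \<longlongrightarrow> L) (at_right 0)"
    using A1[of \<phi>] smooth_fn_bump_Cc_infinity[OF f K(1)] unfolding \<phi>_def by auto
  have "\<forall>\<^sub>F h in at_right 0. dist (((LINT y|\<mu> h. f y) - f 0) / h) (LINT y|\<mu> h. (\<phi> y - \<phi> 0) / h) \<le> eps"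
    unfolding eventually_at_right_field
  proof (intro exI[of _ h1] conjI allI impI K(2))
    fix h assume h: "0 < h" "h < h1"
    interpret prob_space "\<mu> h" using prob h by simp
    have int: "integrable (\<mu> h) f" "integrable (\<mu> h) \<phi>"
      using h bd \<phi>b by (auto intro!: integrable_mu[where B=1])
    have iind: "integrable (\<mu> h) (indicator {y. norm y > K} :: 'a \<Rightarrow> real)"
      using h by (intro integrable_mu[where B=1]) (auto simp: indicator_def)
    have "(LINT y|\<mu> h. (\<phi> y - \<phi> 0) / h) = ((LINT y|\<mu> h. \<phi> y) - \<phi> 0) / h"
      using int by (simp add: prob_space)
    moreover have "\<phi> 0 = f 0" using K(1) by (simp add: \<phi>_def bump_eq_1)
    ultimately have "dist (((LINT y|\<mu> h. f y) - f 0) / h) (LINT y|\<mu> h. (\<phi> y - \<phi> 0) / h)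
        = \<bar>LINT y|\<mu> h. f y - \<phi> y\<bar> / h"
      using h int by (simp add: dist_real_def diff_divide_distrib[symmetric] abs_divide prob_space)
    also have "\<bar>LINT y|\<mu> h. f y - \<phi> y\<bar> \<le> (LINT y|\<mu> h. \<bar>f y - \<phi> y\<bar>)"
      by (rule integral_abs_bound)
    also have "\<dots> \<le> (LINT y|\<mu> h. indicator {y. norm y > K} y)"
    proof (rule integral_mono)
      fix y
      have "f y - \<phi> y = f y * (1 - bump K y)" by (simp add: \<phi>_def algebra_simps)
      then have "\<bar>f y - \<phi> y\<bar> = \<bar>f y\<bar> * (1 - bump K y)"
        using bump_bounds[OF K(1), of y] by (simp add: abs_mult)
      also have "\<dots> \<le> 1 * (1 - bump K y)" using bump_bounds[OF K(1), of y] bd by (intro mult_right_mono) auto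
      finally show "\<bar>f y - \<phi> y\<bar> \<le> indicator {y. norm y > K} y"
        using bump_bounds[OF K(1), of y] bump_eq_1[OF K(1), of y] by (auto simp: indicator_def)
    qed (use int iind in auto)
    also have "\<dots> = measure (\<mu> h) {y. norm y > K}" using h by (simp add: space_mu)
    also have "\<dots> \<le> eps * h" using K(3) h by simp
    finally show "dist (((LINT y|\<mu> h. f y) - f 0) / h) (LINT y|\<mu> h. (\<phi> y - \<phi> 0) / h) \<le> eps"
      using h by (simp add: divide_right_mono field_simps)
  qed
  with L show "\<exists>g L. (g \<longlongrightarrow> L) (at_right 0) \<and>
      (\<forall>\<^sub>F h in at_right 0. dist (((LINT y|\<mu> h. f y) - f 0) / h) (g h) \<le> eps)" by blast
qed

lemma char_exponent_exists:
  "\<exists>l. ((\<lambda>h. (charf (\<mu> h) u - 1) / of_real h) \<longlongrightarrow> l) (at_right 0)"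
proof -
  have s: "smooth_fn (\<lambda>y. y \<bullet> u)" by (rule smooth_fn.inner)
  obtain a b where ab: "((\<lambda>h. ((LINT y|\<mu> h. cos (y \<bullet> u)) - 1) / h) \<longlongrightarrow> a) (at_right 0)"
      "((\<lambda>h. (LINT y|\<mu> h. sin (y \<bullet> u)) / h) \<longlongrightarrow> b) (at_right 0)"
    using smooth_bounded_generator[OF smooth_fn_cos[OF s]] smooth_bounded_generator[OF smooth_fn_sin[OF s]] by auto
  have "((\<lambda>h. Complex (((LINT y|\<mu> h. cos (y \<bullet> u)) - 1) / h) ((LINT y|\<mu> h. sin (y \<bullet> u)) / h)) \<longlongrightarrow> Complex a b) (at_right 0)"
    by (intro tendsto_Complex ab)
  moreover have "\<forall>\<^sub>F h in at_right 0. Complex (((LINT y|\<mu> h. cos (y \<bullet> u)) - 1) / h) ((LINT y|\<mu> h. sin (y \<bullet> u)) / h)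
      = (charf (\<mu> h) u - 1) / of_real h" using eventually_at_right_less[of 0]
  proof eventually_elim
    case (elim h)
    then have "charf (\<mu> h) u = Complex (LINT y|\<mu> h. cos (y \<bullet> u)) (LINT y|\<mu> h. sin (y \<bullet> u))"
      using charf_eq[OF prob borel, of h u] by (simp add: inner_commute[of u])
    then show ?case by (simp add: complex_eq_iff)
  qed
  ultimately show ?thesis by (intro exI) (rule Lim_transform_eventually)
qed

definition \<eta> :: "'a \<Rightarrow> complex" where
  "\<eta> u = (SOME l. ((\<lambda>h. (charf (\<mu> h) u - 1) / of_real h) \<longlongrightarrow> l) (at_right 0))"

lemma char_exponent: "((\<lambda>h. (charf (\<mu> h) u - 1) / of_real h) \<longlongrightarrow> \<eta> u) (at_right 0)"
  unfolding \<eta>_def using char_exponent_exists by (rule someI_ex)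

lemma charf_minus_1_bound:
  "\<exists>C\<ge>0. \<exists>h1>0. \<forall>h. 0 < h \<and> h < h1 --> norm (charf (\<mu> h) u - 1) \<le> C * h"
proof -
  have "\<forall>\<^sub>F h in at_right 0. dist ((charf (\<mu> h) u - 1) / of_real h) (\<eta> u) < 1"
    by (rule tendstoD[OF char_exponent]) simp
  then obtain h1 where h1: "h1 > 0" "\<And>h. 0 < h ==> h < h1 ==> dist ((charf (\<mu> h) u - 1) / of_real h) (\<eta> u) < 1"
    by (auto simp: eventually_at_right_field)
  have "norm (charf (\<mu> h) u - 1) \<le> (norm (\<eta> u) + 1) * h" if "0 < h" "h < h1" for h
  proof -
    have "norm ((charf (\<mu> h) u - 1) / of_real h) \<le> norm (\<eta> u) + 1"
      using h1(2)[OF that] unfolding dist_norm by (smt (verit) norm_triangle_sub)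
    then show ?thesis using that by (simp add: norm_divide field_simps)
  qed
  then show ?thesis using h1(1) by (intro exI[of _ "norm (\<eta> u) + 1"]) (auto intro: exI[of _ h1])
qed

end

section \<open>Moments of the truncated jumps\<close>

text \<open>Real and imaginary part of one Taylor estimate: for \<open>\<bar>z\<bar> \<le> 1\<close>
  the remainder of \<open>exp (i z)\<close> after the quadratic term is at most
  \<open>z^2 / 6\<close>, and \<open>1/2 - 1/6 = 1/3\<close>.\<close>

lemma cos_le_quadratic: "\<bar>z\<bar> \<le> 1 ==> z\<^sup>2 \<le> 3 * (1 - cos z)"
  and sin_minus_id_le: "\<bar>z\<bar> \<le> 1 ==> \<bar>z - sin z\<bar> \<le> z\<^sup>2" for z :: real
proof -
  assume z: "\<bar>z\<bar> \<le> 1"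
  have *: "cmod (iexp z - (\<Sum>k\<le>2. (\<i> * z) ^ k / fact k)) \<le> \<bar>z\<bar> ^ Suc 2 / fact (Suc 2)"
    by (rule iexp_approx1)
  have s: "(\<Sum>k\<le>2. (\<i> * z) ^ k / fact k) = Complex (1 - z\<^sup>2/2) z"
    by (simp add: numeral_2_eq_2 complex_eq_iff power2_eq_square)
  have e: "iexp z = Complex (cos z) (sin z)" by (simp add: cis_conv_exp[symmetric] cis.code)
  have c: "\<bar>z\<bar> ^ Suc 2 \<le> z\<^sup>2"
  proof -
    have "\<bar>z\<bar> ^ Suc 2 = z\<^sup>2 * \<bar>z\<bar>" by (simp add: numeral_2_eq_2)
    also have "\<dots> \<le> z\<^sup>2 * 1" using z by (intro mult_left_mono) auto
    finally show ?thesis by simp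
  qed
  have f: "fact (Suc 2) = (6::real)" by (simp add: numeral_2_eq_2)
  have "\<bar>cos z - (1 - z\<^sup>2/2)\<bar> \<le> z\<^sup>2 / 6" "\<bar>sin z - z\<bar> \<le> z\<^sup>2 / 6"
    using * c abs_Re_le_cmod[of "iexp z - (\<Sum>k\<le>2. (\<i> * z) ^ k / fact k)"]
      abs_Im_le_cmod[of "iexp z - (\<Sum>k\<le>2. (\<i> * z) ^ k / fact k)"]
    unfolding s e f by simp_all
  then have "z\<^sup>2 / 3 \<le> 1 - cos z" and s: "\<bar>z - sin z\<bar> \<le> z\<^sup>2" using zero_le_power2[of z] by linarith+
  then show "z\<^sup>2 \<le> 3 * (1 - cos z)" by (simp add: pos_divide_le_eq mult.commute)
  show "\<bar>z - sin z\<bar> \<le> z\<^sup>2" by (rule s)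
qed

context jump_family begin

text \<open>The characteristic function at \<open>u = b /\<^sub>R K\<close> controls the moments
  along \<open>b\<close>: its cosine part gives the second moment, its sine part the mean, and both
  parts of \<open>charf (\<mu> h) u - 1\<close> are of order \<open>h\<close>. The scaling keeps
  \<open>\<bar>u \<bullet> y\<bar> \<le> 1\<close> on the ball of radius \<open>K\<close>, where the
  elementary estimates apply.\<close>

lemma truncated_moments:
  assumes "eps > 0"
  shows "\<exists>K>0. \<exists>C\<ge>0. \<exists>h1>0. \<forall>h. 0 < h \<and> h < h1 -->
    measure (\<mu> h) {y. norm y > K} \<le> eps * h \<and> norm (LINT y|\<mu> h. trunc K y) \<le> C * h \<and>
    (LINT y|\<mu> h. (norm (trunc K y))\<^sup>2) \<le> C * h"
proof -
  obtain K h0 where K: "K > 0" "h0 > 0"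
      "\<And>h. 0 < h ==> h < h0 ==> measure (\<mu> h) {y. norm y > K} \<le> eps * h" using tail[OF assms] by auto
  have "\<exists>C h1. C \<ge> 0 \<and> h1 > 0 \<and> (\<forall>h. 0 < h \<and> h < h1 --> norm (charf (\<mu> h) (b /\<^sub>R K) - 1) \<le> C * h)" for b :: 'a
    using charf_minus_1_bound[of "b /\<^sub>R K"] by blast
  then obtain C h1 where C: "\<And>b. C b \<ge> 0" "\<And>b. h1 b > (0::real)"
      "\<And>b h. 0 < h ==> h < h1 b ==> norm (charf (\<mu> h) (b /\<^sub>R K) - 1) \<le> C b * h" for b :: 'a by metis
  define h2 where "h2 = Min (insert h0 (h1 ` (Basis :: 'a set)))"
  have h2: "h2 > 0" "h2 \<le> h0" using C(2) K(2) by (auto simp: h2_def)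
  have h2b: "\<And>b. b \<in> Basis ==> h2 \<le> h1 b" unfolding h2_def by (rule Min_le) auto
  define C2 where "C2 = (\<Sum>b\<in>(Basis::'a set). K\<^sup>2 * (3 * C b))"
  \<comment> \<open>The summands of \<open>C1\<close> account for the second moment
    (\<open>3 * C b\<close>), the integral of the sine (\<open>C b\<close>) and the jumps beyond
    \<open>K\<close> (\<open>eps\<close>).\<close>
  define C1 where "C1 = (\<Sum>b\<in>(Basis::'a set). K * (3 * C b + C b + eps))"
  have C12: "C1 \<ge> 0" "C2 \<ge> 0" using C(1) K(1) assms by (auto simp: C1_def C2_def intro!: sum_nonneg)
  have step: "measure (\<mu> h) {y. norm y > K} \<le> eps * h \<and> norm (LINT y|\<mu> h. trunc K y) \<le> C1 * h \<and>
    (LINT y|\<mu> h. (norm (trunc K y))\<^sup>2) \<le> C2 * h" if h: "0 < h" "h < h2" for h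
  proof -
    interpret prob_space "\<mu> h" using prob h by simp
    have im: "integrable (\<mu> h) f" if "f \<in> borel_measurable borel" "\<And>x. norm (f x) \<le> B"
      for f :: "'a \<Rightarrow> real" and B using integrable_mu[OF h(1) that] .
    have iT: "integrable (\<mu> h) (trunc K :: 'a \<Rightarrow> 'a)"
      using K(1) by (intro integrable_mu[OF h(1), of _ K]) (auto simp: norm_trunc_le)
    have Tb: "\<bar>trunc K y \<bullet> b\<bar> \<le> K" if "b \<in> Basis" for y b :: 'a
      using Basis_le_norm[OF that, of "trunc K y"] norm_trunc_le[of K y] K(1) by linarith
    have Tb2: "(trunc K y \<bullet> b)\<^sup>2 \<le> K\<^sup>2" if "b \<in> Basis" for y b :: 'a
      using Tb[OF that, of y] K(1) by (metis abs_le_square_iff abs_of_pos)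
    have tl: "measure (\<mu> h) {y. norm y > K} \<le> eps * h" using K h h2 by auto
    have *: "(LINT y|\<mu> h. (trunc K y \<bullet> b)\<^sup>2) \<le> K\<^sup>2 * (3 * C b) * h \<and>
       \<bar>LINT y|\<mu> h. trunc K y \<bullet> b\<bar> \<le> K * (3 * C b + C b + eps) * h" if b: "b \<in> Basis" for b
    proof -
      let ?u = "b /\<^sub>R K"
      have iT2: "integrable (\<mu> h) (\<lambda>y. (trunc K y \<bullet> b)\<^sup>2)"
        using Tb2[OF b] by (intro im[of _ "K\<^sup>2"]) auto
      have ic: "integrable (\<mu> h) (\<lambda>y. cos (?u \<bullet> y))" "integrable (\<mu> h) (\<lambda>y. sin (?u \<bullet> y))"
        by (auto intro!: im[of _ 1])
      have iu: "integrable (\<mu> h) (\<lambda>y. trunc K y \<bullet> b / K)" using iT by auto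
      have ind: "integrable (\<mu> h) (indicator {y. norm y > K} :: 'a \<Rightarrow> real)"
        by (intro im[of _ 1]) (auto simp: indicator_def)
      have cf: "norm (charf (\<mu> h) ?u - 1) \<le> C b * h" using C(3)[of h b] h h2b[OF b] by force
      have cR: "1 - (LINT y|\<mu> h. cos (?u \<bullet> y)) \<le> C b * h"
        using cf abs_Re_le_cmod[of "charf (\<mu> h) ?u - 1"] h by (simp add: charf_eq[OF prob borel])
      have cI: "\<bar>LINT y|\<mu> h. sin (?u \<bullet> y)\<bar> \<le> C b * h"
        using cf abs_Im_le_cmod[of "charf (\<mu> h) ?u - 1"] h by (simp add: charf_eq[OF prob borel])
      have small: "\<bar>?u \<bullet> y\<bar> \<le> 1" if "norm y \<le> K" for y
        using that Basis_le_norm[OF b, of y] K(1) by (simp add: inner_commute field_simps)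
      have "(LINT y|\<mu> h. (trunc K y \<bullet> b)\<^sup>2) \<le> (LINT y|\<mu> h. K\<^sup>2 * (3 * (1 - cos (?u \<bullet> y))))"
      proof (rule integral_mono)
        show "integrable (\<mu> h) (\<lambda>y. K\<^sup>2 * (3 * (1 - cos (?u \<bullet> y))))" using ic by auto
        show "(trunc K y \<bullet> b)\<^sup>2 \<le> K\<^sup>2 * (3 * (1 - cos (?u \<bullet> y)))" for y
        proof (cases "norm y \<le> K")
          case True
          have "(?u \<bullet> y)\<^sup>2 \<le> 3 * (1 - cos (?u \<bullet> y))" by (rule cos_le_quadratic[OF small[OF True]])
          then have "K\<^sup>2 * (?u \<bullet> y)\<^sup>2 \<le> K\<^sup>2 * (3 * (1 - cos (?u \<bullet> y)))" by (intro mult_left_mono) auto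
          then show ?thesis using True K(1) by (simp add: trunc_def inner_commute power_mult_distrib field_simps)
        next
          case False
          then show ?thesis using cos_le_one[of "?u \<bullet> y"] by (simp add: trunc_def)
        qed
      qed (fact iT2)
      also have "\<dots> = K\<^sup>2 * (3 * (1 - (LINT y|\<mu> h. cos (?u \<bullet> y))))"
        using ic by (simp add: prob_space)
      also have "\<dots> \<le> K\<^sup>2 * (3 * (C b * h))" using cR by (intro mult_left_mono) auto
      finally have sq: "(LINT y|\<mu> h. (trunc K y \<bullet> b)\<^sup>2) \<le> K\<^sup>2 * (3 * C b) * h" by (simp add: mult_ac)
      have "\<bar>(LINT y|\<mu> h. trunc K y \<bullet> b / K) - (LINT y|\<mu> h. sin (?u \<bullet> y))\<bar>
          = \<bar>LINT y|\<mu> h. trunc K y \<bullet> b / K - sin (?u \<bullet> y)\<bar>"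
        using iu ic by (subst Bochner_Integration.integral_diff) auto
      also have "\<dots> \<le> (LINT y|\<mu> h. \<bar>trunc K y \<bullet> b / K - sin (?u \<bullet> y)\<bar>)" by (rule integral_abs_bound)
      \<comment> \<open>Inside the ball the argument and its sine differ by at most the square;
        outside, \<open>trunc\<close> is 0 and the sine is at most 1, which the indicator
        covers.\<close>
      also have "\<dots> \<le> (LINT y|\<mu> h. (trunc K y \<bullet> b)\<^sup>2 / K\<^sup>2 + indicator {y. norm y > K} y)"
      proof (rule integral_mono)
        show "\<bar>trunc K y \<bullet> b / K - sin (?u \<bullet> y)\<bar> \<le> (trunc K y \<bullet> b)\<^sup>2 / K\<^sup>2 + indicator {y. norm y > K} y" for y
        proof (cases "norm y \<le> K")
          case True
          have "\<bar>?u \<bullet> y - sin (?u \<bullet> y)\<bar> \<le> (?u \<bullet> y)\<^sup>2" using sin_minus_id_le[OF small[OF True]] .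
          moreover have "trunc K y \<bullet> b / K = ?u \<bullet> y" using True by (simp add: trunc_def inner_commute field_simps)
          ultimately show ?thesis using True by (simp only: power_divide[symmetric]) simp
        next
          case False
          then show ?thesis by (simp add: trunc_def abs_sin_le_one)
        qed
      qed (use iu ic iT2 ind in auto)
      also have "\<dots> = (LINT y|\<mu> h. (trunc K y \<bullet> b)\<^sup>2) / K\<^sup>2 + measure (\<mu> h) {y. norm y > K}"
        using iT2 ind h by (simp add: space_mu)
      also have "\<dots> \<le> (3 * C b) * h + eps * h" using sq tl K(1) by (intro add_mono) (auto simp: field_simps)
      finally have "\<bar>LINT y|\<mu> h. trunc K y \<bullet> b / K\<bar> \<le> (3 * C b + C b + eps) * h"
        using cI by (simp add: algebra_simps)
      then have "\<bar>LINT y|\<mu> h. trunc K y \<bullet> b\<bar> \<le> K * (3 * C b + C b + eps) * h"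
        using K(1) by (simp add: field_simps)
      with sq show ?thesis by simp
    qed
    have "norm (LINT y|\<mu> h. trunc K y) \<le> (\<Sum>b\<in>Basis. \<bar>(LINT y|\<mu> h. trunc K y) \<bullet> b\<bar>)"
      by (rule norm_le_l1)
    also have "\<dots> = (\<Sum>b\<in>Basis. \<bar>LINT y|\<mu> h. trunc K y \<bullet> b\<bar>)" using iT by simp
    also have "\<dots> \<le> C1 * h"
      unfolding C1_def sum_distrib_right by (intro sum_mono) (use * in auto)
    finally have 1: "norm (LINT y|\<mu> h. trunc K y) \<le> C1 * h" .
    have "(LINT y|\<mu> h. (norm (trunc K y))\<^sup>2) = (LINT y|\<mu> h. (\<Sum>b\<in>Basis. (trunc K y \<bullet> b)\<^sup>2))"
      unfolding power2_norm_eq_inner by (subst euclidean_inner) (simp add: power2_eq_square)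
    also have "\<dots> = (\<Sum>b\<in>Basis. (LINT y|\<mu> h. (trunc K y \<bullet> b)\<^sup>2))"
      by (rule Bochner_Integration.integral_sum)
         (rule im[of _ "K\<^sup>2"], use Tb2 in auto)
    also have "\<dots> \<le> C2 * h"
      unfolding C2_def sum_distrib_right by (intro sum_mono) (use * in auto)
    finally show ?thesis using 1 tl by simp
  qed
  have step2: "measure (\<mu> h) {y. norm y > K} \<le> eps * h \<and> norm (LINT y|\<mu> h. trunc K y) \<le> max C1 C2 * h \<and>
    (LINT y|\<mu> h. (norm (trunc K y))\<^sup>2) \<le> max C1 C2 * h" if h: "0 < h" "h < h2" for h
  proof -
    have "C1 * h \<le> max C1 C2 * h" "C2 * h \<le> max C1 C2 * h" using h by (auto intro: mult_right_mono)
    with step[OF h] show ?thesis by linarith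
  qed
  have C0: "max C1 C2 \<ge> 0" using C12 by simp
  have "\<forall>h. 0 < h \<and> h < h2 -->
    measure (\<mu> h) {y. norm y > K} \<le> eps * h \<and> norm (LINT y|\<mu> h. trunc K y) \<le> max C1 C2 * h \<and>
    (LINT y|\<mu> h. (norm (trunc K y))\<^sup>2) \<le> max C1 C2 * h" using step2 by simp
  with h2(1) have "\<exists>h1>0. \<forall>h. 0 < h \<and> h < h1 -->
    measure (\<mu> h) {y. norm y > K} \<le> eps * h \<and> norm (LINT y|\<mu> h. trunc K y) \<le> max C1 C2 * h \<and>
    (LINT y|\<mu> h. (norm (trunc K y))\<^sup>2) \<le> max C1 C2 * h" by (intro exI[of _ h2] conjI)
  then show ?thesis by - (rule exI[of _ K], rule conjI[OF K(1)], rule exI[of _ "max C1 C2"], rule conjI[OF C0])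
qed

text \<open>The powers are compared with \<open>exp (k * (z - 1))\<close>, which avoids a complex
  logarithm. Both bases have norm at most 1 (the exponential because \<open>Re z \<le> 1\<close>),
  so their \<open>k\<close>-th powers differ by at most \<open>k\<close> times the difference of the
  bases. That difference is quadratic in \<open>z - 1\<close>, whereas \<open>k * (z - 1)\<close>
  converges.\<close>

lemma charf_power_tendsto:
  assumes hs: "null_seq hs" and ks: "(\<lambda>n. real (ks n) * hs n) ----> t"
  shows "(\<lambda>n. charf (\<mu> (hs n)) u ^ ks n) ----> exp (of_real t * \<eta> u)"
proof -
  have hpos: "hs n > 0" for n using hs by (auto simp: null_seq_def)
  have hr: "filterlim hs (at_right 0) sequentially"
    using hs by (auto simp: null_seq_def filterlim_at less_imp_neq[symmetric])
  define z where "z n = charf (\<mu> (hs n)) u" for n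
  have z1: "norm (z n) \<le> 1" for n unfolding z_def using hpos by (intro norm_charf_le_1 prob borel) auto
  have q: "(\<lambda>n. (z n - 1) / of_real (hs n)) ----> \<eta> u"
    unfolding z_def using filterlim_compose[OF char_exponent hr] .
  have h0: "(\<lambda>n. complex_of_real (hs n)) ----> 0" using hs tendsto_of_real[of hs 0] by (auto simp: null_seq_def)
  have w0: "(\<lambda>n. z n - 1) ----> 0"
  proof -
    have "(z n - 1) / of_real (hs n) * of_real (hs n) = z n - 1" for n using hpos[of n] by simp
    then show ?thesis using tendsto_mult[OF q h0] by simp
  qed
  have kq: "(\<lambda>n. of_nat (ks n) * (z n - 1)) ----> of_real t * \<eta> u"
  proof -
    have "(\<lambda>n. of_real (real (ks n) * hs n) * ((z n - 1) / of_real (hs n))) ----> of_real t * \<eta> u"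
      by (intro tendsto_mult tendsto_of_real ks q)
    moreover have "of_real (real (ks n) * hs n) * ((z n - 1) / of_real (hs n)) = of_nat (ks n) * (z n - 1)" for n
      using hpos[of n] by simp
    ultimately show ?thesis by simp
  qed
  have e1: "norm (exp (z n - 1)) \<le> 1" for n
    using complex_Re_le_cmod[of "z n"] z1[of n] by (simp add: norm_exp_eq_Re)
  have "norm (z n ^ ks n - exp (of_nat (ks n) * (z n - 1))) \<le> exp 2 * norm (of_nat (ks n) * (z n - 1)) * norm (z n - 1)" for n
  proof -
    \<comment> \<open>\<open>z n\<close> is the first-order Taylor polynomial of the exponential,
      evaluated at \<open>z n - 1\<close>.\<close>
    have "norm (z n - exp (z n - 1)) = norm (exp (z n - 1) - (\<Sum>k\<le>1. (z n - 1) ^ k / fact k))"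
      by (simp add: norm_minus_commute)
    also have "\<dots> \<le> exp \<bar>Re (z n - 1)\<bar> * norm (z n - 1) ^ Suc 1 / fact 1" by (rule Taylor_exp)
    also have "\<dots> \<le> exp 2 * norm (z n - 1) ^ Suc 1 / fact 1"
    proof (intro divide_right_mono mult_right_mono)
      have "\<bar>Re (z n - 1)\<bar> \<le> norm (z n - 1)" by (rule abs_Re_le_cmod)
      also have "\<dots> \<le> 2" using norm_triangle_ineq4[of "z n" 1] z1[of n] by simp
      finally show "exp \<bar>Re (z n - 1)\<bar> \<le> exp 2" by simp
    qed auto
    finally have "real (ks n) * norm (z n - exp (z n - 1)) \<le> real (ks n) * (exp 2 * norm (z n - 1) ^ Suc 1 / fact 1)"
      by (rule mult_left_mono) simp
    moreover have "norm (z n ^ ks n - exp (z n - 1) ^ ks n) \<le> ks n * norm (z n - exp (z n - 1))"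
      by (rule norm_power_diff) (use z1 e1 in auto)
    ultimately show ?thesis by (simp add: exp_of_nat_mult norm_mult power2_eq_square mult_ac)
  qed
  then have ev: "EV n. norm (z n ^ ks n - exp (of_nat (ks n) * (z n - 1)))
      \<le> exp 2 * norm (of_nat (ks n) * (z n - 1)) * norm (z n - 1)" by simp
  have "(\<lambda>n. exp 2 * norm (of_nat (ks n) * (z n - 1)) * norm (z n - 1)) ----> 0"
    using tendsto_mult[OF tendsto_mult[OF tendsto_const[of "exp 2"] tendsto_norm[OF kq]] tendsto_norm[OF w0]] by simp
  with ev have "(\<lambda>n. z n ^ ks n - exp (of_nat (ks n) * (z n - 1))) ----> 0" by (rule Lim_null_comparison)
  from tendsto_add[OF this tendsto_exp[OF kq]] show ?thesis by (simp add: z_def)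
qed

end

section \<open>Weak convergence\<close>

text \<open>Trigonometric polynomials: \<open>charf\<close> determines their integrals, and they
  form an algebra because products of characters are characters.\<close>

inductive trig :: "('a::euclidean_space \<Rightarrow> complex) \<Rightarrow> bool" where
  base: "trig (\<lambda>x. c * cis (u \<bullet> x))"
| add: "trig f ==> trig g ==> trig (\<lambda>x. f x + g x)"

lemma trig_const: "trig (\<lambda>x. c)" using trig.base[of c 0] by simp

lemma trig_mult: "trig f ==> trig g ==> trig (\<lambda>x. f x * g x)"
proof (induction rule: trig.induct)
  case (base c u)
  from base show ?case
  proof (induction rule: trig.induct)
    case (base d v)
    then show ?case using trig.base[of "c * d" "u + v"] by (simp add: cis_mult[symmetric] inner_add_left mult_ac)
  next
    case (add f g)
    then show ?case using trig.add by (force simp: distrib_left)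
  qed
next
  case (add f g')
  then show ?case using trig.add[of "\<lambda>x. f x * g x" "\<lambda>x. g' x * g x"] by (simp add: distrib_right)
qed

lemma trig_sum: "finite A ==> (\<And>i. i \<in> A ==> trig (f i)) ==> trig (\<lambda>x. \<Sum>i\<in>A. f i x)"
  by (induction A rule: finite_induct) (auto intro: trig_const trig.add)

lemma trig_sin: "trig (\<lambda>x. of_real (sin (u \<bullet> x)))"
proof -
  have "trig (\<lambda>x. (1 / (2 * \<i>)) * cis (u \<bullet> x) + (- 1 / (2 * \<i>)) * cis ((- u) \<bullet> x))"
    by (intro trig.add trig.base)
  moreover have "(1 / (2 * \<i>)) * cis (u \<bullet> x) + (- 1 / (2 * \<i>)) * cis ((- u) \<bullet> x) = of_real (sin (u \<bullet> x))" for x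
    by (simp add: complex_eq_iff)
  ultimately show ?thesis by simp
qed

text \<open>Turns a polynomial approximation on the cube into a trigonometric one on the whole
  space, via the coordinatewise sine.\<close>

lemma trig_polynomial_sin:
  fixes q :: "'a::euclidean_space \<Rightarrow> real"
  assumes "real_polynomial_function q"
  shows "trig (\<lambda>x. of_real (q (\<Sum>b\<in>Basis. sin (c * (x \<bullet> b)) *\<^sub>R b)))" using assms
proof induction
  case (linear f)
  interpret bounded_linear f by fact
  have "trig (\<lambda>x. \<Sum>b\<in>Basis. of_real (sin ((c *\<^sub>R b) \<bullet> x)) * of_real (f b))"
    by (intro trig_sum trig_mult trig_sin trig_const) auto
  then show ?case by (simp add: sum scaleR inner_commute)
next
  case (mult f g)
  then show ?case using trig_mult by fastforce
next
  case (add f g)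
  then show ?case using trig.add by fastforce
qed (rule trig_const)

lemma bcontfun_bounded:
  fixes f :: "'a::topological_space \<Rightarrow> real"
  assumes "f \<in> bcontfun" obtains B where "B \<ge> 0" "\<And>x. \<bar>f x\<bar> \<le> B"
proof -
  obtain B where "\<And>x. \<bar>f x\<bar> \<le> B" using assms by (auto simp: bcontfun_def bounded_iff)
  then show ?thesis using that[of B] by (meson abs_ge_zero order_trans)
qed

lemma bcontfunI: "continuous_on UNIV f ==> (\<And>x. \<bar>f x\<bar> \<le> B) ==> f \<in> bcontfun" for f :: "'a::topological_space \<Rightarrow> real"
  by (auto simp: bcontfun_def bounded_iff)

text \<open>The map \<open>x \<mapsto> sin (x \<bullet> b / R)\<close> in each coordinate sends the
  space into the cube, and on the ball of radius \<open>R\<close> the arcsine inverts it, as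
  \<open>1 \<le> pi / 2\<close>. Thus \<open>f\<close> becomes the continuous function
  \<open>G\<close> on the cube, where Stone-Weierstrass applies. Since \<open>G\<close> is bounded
  by \<open>B\<close> on the whole cube, the approximant is bounded by \<open>B + eps\<close> on the
  whole space, and not only near the ball.\<close>

lemma trig_approximation:
  fixes f :: "'a::euclidean_space \<Rightarrow> real"
  assumes cont: "continuous_on UNIV f" and bd: "\<And>x. \<bar>f x\<bar> \<le> B" and R: "R > 0" and eps: "eps > 0"
  shows "\<exists>p. trig (\<lambda>x. of_real (p x)) \<and> (\<forall>x. \<bar>p x\<bar> \<le> B + eps) \<and> (\<forall>x. norm x \<le> R --> \<bar>p x - f x\<bar> \<le> eps)"
proof -
  define S where "S = cbox (- One) (One :: 'a)"
  define \<Theta> where "\<Theta> x = (\<Sum>b\<in>Basis. sin ((1 / R) * (x \<bullet> b)) *\<^sub>R b)" for x :: 'a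
  define G where "G s = f (\<Sum>b\<in>Basis. (R * arcsin (s \<bullet> b)) *\<^sub>R b)" for s
  have "continuous_on S (\<lambda>s. \<Sum>b\<in>Basis. (R * arcsin (s \<bullet> b)) *\<^sub>R b)"
    by (intro continuous_intros) (auto simp: S_def mem_box)
  then have "continuous_on S G"
    unfolding G_def[abs_def] by (rule continuous_on_compose2[OF cont]) auto
  then obtain q where q: "real_polynomial_function q" "\<And>s. s \<in> S ==> \<bar>G s - q s\<bar> < eps"
    using Stone_Weierstrass_real_polynomial_function[of S G eps] eps by (auto simp: S_def)
  have \<Theta>S: "\<Theta> x \<in> S" for x by (auto simp: \<Theta>_def S_def mem_box)
  have \<Theta>b: "\<Theta> x \<bullet> b = sin (x \<bullet> b / R)" if "b \<in> Basis" for x b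
    using that by (simp add: \<Theta>_def)
  have G\<Theta>: "G (\<Theta> x) = f x" if "norm x \<le> R" for x
  proof -
    have "R * arcsin (\<Theta> x \<bullet> b) = x \<bullet> b" if b: "b \<in> Basis" for b
    proof -
      have "\<bar>x \<bullet> b\<bar> \<le> R" using Basis_le_norm[OF b, of x] \<open>norm x \<le> R\<close> by linarith
      then have "\<bar>x \<bullet> b / R\<bar> \<le> 1" using R by (simp add: abs_divide)
      then have "arcsin (sin (x \<bullet> b / R)) = x \<bullet> b / R" using pi_ge_two by (intro arcsin_sin) linarith+
      then show ?thesis using R by (simp add: \<Theta>b[OF b])
    qed
    then have "(\<Sum>b\<in>Basis. (R * arcsin (\<Theta> x \<bullet> b)) *\<^sub>R b) = (\<Sum>b\<in>Basis. (x \<bullet> b) *\<^sub>R b)"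
      by (intro sum.cong) auto
    then show ?thesis by (simp add: G_def euclidean_representation)
  qed
  show ?thesis
  proof (intro exI[of _ "\<lambda>x. q (\<Theta> x)"] conjI allI impI)
    show "trig (\<lambda>x. of_real (q (\<Theta> x)))"
      unfolding \<Theta>_def by (rule trig_polynomial_sin[OF q(1)])
    show "\<bar>q (\<Theta> x)\<bar> \<le> B + eps" for x
      using q(2)[OF \<Theta>S[of x]] bd[of "\<Sum>b\<in>Basis. (R * arcsin (\<Theta> x \<bullet> b)) *\<^sub>R b"] unfolding G_def by linarith
    show "\<bar>q (\<Theta> x) - f x\<bar> \<le> eps" if "norm x \<le> R" for x
      using q(2)[OF \<Theta>S[of x]] G\<Theta>[OF that] by linarith
  qed
qed

section \<open>Bounded Lipschitz test functions and weak convergence\<close>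

text \<open>The constants are explicit because they are tracked through iterates of the operators
  and must not depend on the step size.\<close>

definition blip :: "real \<Rightarrow> real \<Rightarrow> ('a::real_normed_vector \<Rightarrow> real) \<Rightarrow> bool" where
  "blip B L f \<longleftrightarrow> (\<forall>x. \<bar>f x\<bar> \<le> B) \<and> (\<forall>x y. \<bar>f x - f y\<bar> \<le> L * norm (x - y))"

lemma norm_cis_diff: "norm (cis a - cis b) \<le> \<bar>a - b\<bar>"
proof -
  have "cis a - cis b = cis b * (cis (a - b) - 1)" by (simp add: algebra_simps cis_mult)
  then have "norm (cis a - cis b) = norm (cis (a - b) - 1)" by (simp add: norm_mult)
  also have "\<dots> \<le> \<bar>a - b\<bar>" using iexp_approx1[of "a - b" 0] by (simp add: cis_conv_exp)
  finally show ?thesis .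
qed

lemma trig_lipschitz: "trig f ==> \<exists>L\<ge>0. \<forall>x y. norm (f x - f y) \<le> L * norm (x - y)"
proof (induction rule: trig.induct)
  case (base c u)
  have "norm (c * cis (u \<bullet> x) - c * cis (u \<bullet> y)) \<le> (norm c * norm u) * norm (x - y)" for x y
  proof -
    have "norm (c * cis (u \<bullet> x) - c * cis (u \<bullet> y)) = norm c * norm (cis (u \<bullet> x) - cis (u \<bullet> y))"
      by (simp add: norm_mult flip: right_diff_distrib)
    also have "\<dots> \<le> norm c * \<bar>u \<bullet> (x - y)\<bar>"
      using norm_cis_diff[of "u \<bullet> x" "u \<bullet> y"] by (intro mult_left_mono) (auto simp: inner_diff_right)
    also have "\<dots> \<le> norm c * (norm u * norm (x - y))" by (intro mult_left_mono Cauchy_Schwarz_ineq2) auto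
    finally show ?thesis by (simp add: mult_ac)
  qed
  then show ?case by (intro exI[of _ "norm c * norm u"]) auto
next
  case (add f g)
  then obtain L L' where *: "L \<ge> 0" "L' \<ge> 0" "\<And>x y. norm (f x - f y) \<le> L * norm (x - y)"
    "\<And>x y. norm (g x - g y) \<le> L' * norm (x - y)" by auto
  have "norm (f x + g x - (f y + g y)) \<le> (L + L') * norm (x - y)" for x y
    using norm_triangle_ineq[of "f x - f y" "g x - g y"] *(3)[of x y] *(4)[of x y] by (simp add: algebra_simps)
  then show ?case using * by (intro exI[of _ "L + L'"]) auto
qed

lemma trig_blip:
  assumes "trig (\<lambda>x. of_real (p x))" "\<And>x. \<bar>p x\<bar> \<le> B" shows "\<exists>L\<ge>0. blip B L p"
  using trig_lipschitz[OF assms(1)] assms(2) by (auto simp: blip_def simp flip: of_real_diff)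

lemma blip_continuous: "blip B L f ==> continuous_on UNIV f"
proof -
  assume f: "blip B L f"
  have "\<bar>L\<bar>-lipschitz_on UNIV f"
  proof (rule lipschitz_onI)
    fix x y
    have "\<bar>f x - f y\<bar> \<le> L * norm (x - y)" using f by (auto simp: blip_def)
    also have "\<dots> \<le> \<bar>L\<bar> * norm (x - y)" by (intro mult_right_mono) auto
    finally show "dist (f x) (f y) \<le> \<bar>L\<bar> * dist x y" by (simp add: dist_norm)
  qed simp
  then show ?thesis by (rule lipschitz_on_continuous_on)
qed

lemma blip_bcontfun: "blip B L f ==> f \<in> bcontfun" by (intro bcontfunI blip_continuous) (auto simp: blip_def)

lemma bcontfun_measurable: "f \<in> bcontfun ==> f \<in> borel_measurable borel" for f :: "'a::topological_space \<Rightarrow> real"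
  by (auto simp: bcontfun_def intro: borel_measurable_continuous_onI)

lemma trig_bounded: "trig f ==> \<exists>B. \<forall>x. norm (f x) \<le> B"
proof (induction rule: trig.induct)
  case (base c u)
  show ?case by (intro exI[of _ "norm c"]) (auto simp: norm_mult)
next
  case (add f g)
  then obtain B B' where "\<And>x. norm (f x) \<le> B" "\<And>x. norm (g x) \<le> B'" by auto
  then show ?case by (intro exI[of _ "B + B'"]) (auto intro: order_trans[OF norm_triangle_ineq] add_mono)
qed

lemma trig_measurable: "trig f ==> f \<in> borel_measurable borel" by (induction rule: trig.induct) auto

lemma norm_tail_tendsto_0:
  fixes N :: "'a::euclidean_space measure"
  assumes "prob_space N" "sets N = sets borel" "eps > 0"
  shows "\<exists>R>0. measure N {x. norm x > R} \<le> eps"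
proof -
  interpret prob_space N by fact
  have "(\<lambda>n. measure N {x. norm x > real n}) ----> measure N (\<Inter>n. {x. norm x > real n})"
    by (rule finite_Lim_measure_decseq) (auto simp: assms(2) decseq_def)
  moreover have "(\<Inter>n. {x::'a. norm x > real n}) = {}"
  proof -
    have "\<exists>n. \<not> real n < norm x" for x :: 'a using real_arch_simple[of "norm x"] by (auto simp: not_less)
    then show ?thesis by blast
  qed
  ultimately have "(\<lambda>n. measure N {x. norm x > real n}) ----> 0" by simp
  then have "EV n. measure N {x. norm x > real n} < eps" by (rule order_tendstoD) fact
  then obtain n where n: "\<And>m. m \<ge> n ==> measure N {x. norm x > real m} < eps"
    by (auto simp: eventually_sequentially)
  show ?thesis using n[of "Suc n"] by (intro exI[of _ "real (Suc n)"]) auto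
qed

lemma integral_close_of_tail:
  fixes f g :: "'a::euclidean_space \<Rightarrow> real"
  assumes N: "prob_space N" "sets N = sets borel"
    and m: "f \<in> borel_measurable borel" "g \<in> borel_measurable borel"
    and b: "\<And>x. \<bar>f x\<bar> \<le> B" "\<And>x. \<bar>g x\<bar> \<le> B'"
    and close: "\<And>x. norm x \<le> R ==> \<bar>f x - g x\<bar> \<le> eps" and t: "measure N {x. norm x > R} \<le> \<delta>"
    and B: "0 \<le> B" "0 \<le> B'" "0 \<le> eps"
  shows "\<bar>(LINT x|N. f x) - (LINT x|N. g x)\<bar> \<le> eps + (B + B') * \<delta>"
proof -
  interpret prob_space N by fact
  have sp: "space N = UNIV" using sets_eq_imp_space_eq[OF N(2)] by simp
  have i: "integrable N f" "integrable N g" "integrable N (indicator {x. norm x > R} :: 'a \<Rightarrow> real)"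
    using borel_prob_integrable[OF N m(1), of B] borel_prob_integrable[OF N m(2), of B']
      borel_prob_integrable[OF N, of "indicator {x. norm x > R} :: 'a \<Rightarrow> real" 1] b
    by (auto simp: indicator_def)
  have "\<bar>(LINT x|N. f x) - (LINT x|N. g x)\<bar> = \<bar>LINT x|N. f x - g x\<bar>" using i by simp
  also have "\<dots> \<le> (LINT x|N. \<bar>f x - g x\<bar>)" by (rule integral_abs_bound)
  also have "\<dots> \<le> (LINT x|N. eps + (B + B') * indicator {x. norm x > R} x)"
  proof (rule integral_mono)
    show "\<bar>f x - g x\<bar> \<le> eps + (B + B') * indicator {x. norm x > R} x" for x
      using close[of x] b(1)[of x] b(2)[of x] B by (auto simp: indicator_def)
  qed (use i in auto)
  also have "\<dots> = eps + (B + B') * measure N {x. norm x > R}" using i prob_space by (simp add: sp)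
  also have "\<dots> \<le> eps + (B + B') * \<delta>" using t B by (intro add_left_mono mult_left_mono) auto
  finally show ?thesis .
qed

text \<open>With tightness at hand trigonometric polynomials suffice: one that is close to
  \<open>f\<close> on a large ball and bounded everywhere has nearly the same integral as
  \<open>f\<close> under \<open>N0\<close> and under \<open>N n\<close> for all large
  \<open>n\<close>.\<close>

lemma charf_tendsto_imp_weak:
  fixes N :: "nat \<Rightarrow> 'a::euclidean_space measure" and f :: "'a \<Rightarrow> real"
  assumes N: "\<And>n. prob_space (N n)" "\<And>n. sets (N n) = sets borel"
    and N0: "prob_space N0" "sets N0 = sets borel"
    and conv: "\<And>u. (\<lambda>n. charf (N n) u) ----> charf N0 u"
    and tight: "\<And>eps. eps > 0 ==> \<exists>R. EV n. measure (N n) {x. norm x > R} \<le> eps"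
    and f: "f \<in> bcontfun"
  shows "(\<lambda>n. LINT x|N n. f x) ----> (LINT x|N0. f x)"
proof -
  have trigconv: "(\<lambda>n. LINT x|N n. p x) ----> (LINT x|N0. p x)" if "trig p" for p :: "'a \<Rightarrow> complex"
    using that
  proof induction
    case (base c u)
    then show ?case using tendsto_mult_left[OF conv[of u], of c] by (simp add: charf_def)
  next
    case (add p q)
    have i: "integrable M p" "integrable M q" if "prob_space M" "sets M = sets borel" for M
      using trig_bounded[OF add(1)] trig_bounded[OF add(2)] trig_measurable[OF add(1)] trig_measurable[OF add(2)]
      by (auto intro: borel_prob_integrable[OF that])
    show ?case using tendsto_add[OF add.IH] i[OF N] i[OF N0] by simp
  qed
  have realconv: "(\<lambda>n. LINT x|N n. p x) ----> (LINT x|N0. p x)" if "trig (\<lambda>x. of_real (p x))" for p :: "'a \<Rightarrow> real"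
    using tendsto_Re[OF trigconv[OF that]] by (simp)
  obtain B where B: "B \<ge> 0" "\<And>x. \<bar>f x\<bar> \<le> B" using bcontfun_bounded[OF f] by blast
  have fc: "continuous_on UNIV f" using f by (simp add: bcontfun_def)
  show ?thesis
  proof (rule LIMSEQ_I)
    fix r :: real assume r: "r > 0"
    \<comment> \<open>Replacing \<open>f\<close> by \<open>p\<close> costs at most
      \<open>eps + (2 * B + 2) * eps\<close> under a measure with tail at most \<open>eps\<close>;
      the choice makes this at most \<open>r / 4\<close>. The bound 1 absorbs the \<open>eps\<close>
      in the bound of \<open>p\<close>.\<close>
    define eps where "eps = min 1 (r / (4 * (2 * B + 3)))"
    have eps: "eps > 0" "eps \<le> 1" using r B by (auto simp: eps_def)
    have "eps \<le> r / (4 * (2 * B + 3))" by (simp add: eps_def)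
    then have "eps * (4 * (2 * B + 3)) \<le> r" using B pos_le_divide_eq[of "4 * (2 * B + 3)" eps r] by simp
    then have epsr: "eps * (2 * B + 3) \<le> r / 4" by (simp add: algebra_simps)
    obtain R0 where R0: "EV n. measure (N n) {x. norm x > R0} \<le> eps" using tight[OF eps(1)] by auto
    obtain R1 where R1: "R1 > 0" "measure N0 {x. norm x > R1} \<le> eps" using norm_tail_tendsto_0[OF N0 eps(1)] by auto
    define R where "R = max R0 R1"
    have Rpos: "R > 0" using R1 by (simp add: R_def less_max_iff_disj)
    obtain p where p: "trig (\<lambda>x. of_real (p x))" "\<And>x. \<bar>p x\<bar> \<le> B + eps" "\<And>x. norm x \<le> R ==> \<bar>p x - f x\<bar> \<le> eps"
      using trig_approximation[OF fc B(2) Rpos eps(1)] by blast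
    have pm: "p \<in> borel_measurable borel"
      using measurable_compose[OF trig_measurable[OF p(1)] borel_measurable_Re] by simp
    have cl: "\<bar>(LINT x|M. p x) - (LINT x|M. f x)\<bar> \<le> r / 4"
      if M: "prob_space M" "sets M = sets borel" "measure M {x. norm x > R} \<le> eps" for M
    proof -
      have "\<bar>(LINT x|M. p x) - (LINT x|M. f x)\<bar> \<le> eps + ((B + eps) + B) * eps"
        by (rule integral_close_of_tail[OF M(1,2) pm bcontfun_measurable[OF f] p(2) B(2) p(3) M(3)])
           (use B eps in auto)
      also have "\<dots> \<le> eps + (2 * B + 2) * eps" using eps B by (intro add_left_mono mult_right_mono) auto
      also have "\<dots> \<le> r / 4" using epsr by (simp add: algebra_simps)
      finally show ?thesis .
    qed
    have mono: "measure M {x. norm x > R} \<le> measure M {x. norm x > R'}"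
      if "prob_space M" "sets M = sets borel" "R' \<le> R" for M :: "'a measure" and R'
    proof -
      interpret prob_space M by fact
      show ?thesis by (rule finite_measure_mono) (use that in auto)
    qed
    have c0: "\<bar>(LINT x|N0. p x) - (LINT x|N0. f x)\<bar> \<le> r / 4"
      using mono[OF N0, of R1] R1 by (intro cl N0) (auto simp: R_def)
    have "EV n. dist (LINT x|N n. p x) (LINT x|N0. p x) < r / 4"
      using tendstoD[OF realconv[OF p(1)], of "r/4"] r by simp
    with R0 have "EV n. norm ((LINT x|N n. f x) - (LINT x|N0. f x)) < r"
    proof eventually_elim
      case (elim n)
      have "\<bar>(LINT x|N n. p x) - (LINT x|N n. f x)\<bar> \<le> r / 4"
        using mono[OF N, of R0 n] elim(1) by (intro cl N) (auto simp: R_def)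
      then show ?case using elim(2) c0 r unfolding dist_real_def real_norm_def by linarith
    qed
    then show "\<exists>no. \<forall>n\<ge>no. norm ((LINT x|N n. f x) - (LINT x|N0. f x)) < r"
      by (simp add: eventually_sequentially)
  qed
qed

lemma closed_indicator_approx:
  fixes C :: "'a::euclidean_space set"
  assumes "closed C"
  obtains f :: "nat \<Rightarrow> 'a \<Rightarrow> real" where "\<And>k. blip 1 (real k) (f k)" "\<And>x. (\<lambda>k. f k x) ----> indicator C x" "\<And>k x. 0 \<le> f k x"
proof (cases "C = {}")
  case True
  then show ?thesis by (intro that[of "\<lambda>_ _. 0"]) (auto simp: blip_def)
next
  case False
  define f :: "nat \<Rightarrow> 'a \<Rightarrow> real" where "f k x = max 0 (1 - real k * infdist x C)" for k x
  show ?thesis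
  proof (rule that[of f])
    fix k :: nat
    have "\<bar>f k x - f k y\<bar> \<le> real k * norm (x - y)" for x y
    proof -
      have "\<bar>f k x - f k y\<bar> \<le> \<bar>real k * (infdist x C - infdist y C)\<bar>"
        unfolding f_def by (simp add: right_diff_distrib)
      also have "\<dots> \<le> real k * norm (x - y)"
        unfolding abs_mult using infdist_triangle_abs[of x C y] by (auto simp: dist_norm intro!: mult_left_mono)
      finally show ?thesis .
    qed
    then show "blip 1 (real k) (f k)" using infdist_nonneg[of _ C] by (auto simp: blip_def f_def)
    show "0 \<le> f k x" for x by (simp add: f_def)
  next
    fix x
    show "(\<lambda>k. f k x) ----> indicator C x"
    proof (cases "x \<in> C")
      case True
      then show ?thesis by (simp add: f_def)
    next
      case xC: False
      then have d: "infdist x C > 0" using assms False infdist_nonneg[of x C] in_closed_iff_infdist_zero[of C x] by auto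
      obtain K :: nat where K: "1 / infdist x C < real K" using reals_Archimedean2 by blast
      have "EV k. f k x = 0"
        unfolding eventually_sequentially
      proof (intro exI[of _ K] allI impI)
        fix k assume "k \<ge> K"
        then have "1 / infdist x C < real k" using K by linarith
        then have "1 < real k * infdist x C" using d by (simp add: field_simps)
        then show "f k x = 0" by (simp add: f_def)
      qed
      then show ?thesis using xC by (simp add: tendsto_eventually)
    qed
  qed
qed

text \<open>Lipschitz functions decrease to the indicators of closed sets, and closed sets are an
  intersection-stable generator of the Borel sets.\<close>

lemma measure_eq_blip:
  fixes N N' :: "'a::euclidean_space measure"
  assumes N: "prob_space N" "sets N = sets borel" and N': "prob_space N'" "sets N' = sets borel"
    and eq: "\<And>f B L. blip B L f ==> (LINT x|N. f x) = (LINT x|N'. f x)"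
  shows "N = N'"
proof (rule measure_eqI_generator_eq)
  interpret N: prob_space N by fact
  interpret N': prob_space N' by fact
  show "Int_stable (Collect closed :: 'a set set)" by (auto simp: Int_stable_def)
  show "sets N = sigma_sets UNIV (Collect closed)" "sets N' = sigma_sets UNIV (Collect closed)"
    unfolding N N' borel_eq_closed by auto
  fix C :: "'a set" assume "C \<in> Collect closed"
  then have C: "closed C" by simp
  obtain f :: "nat \<Rightarrow> 'a \<Rightarrow> real" where f: "\<And>k. blip 1 (real k) (f k)" "\<And>x. (\<lambda>k. f k x) ----> indicator C x"
    using closed_indicator_approx[OF C] by metis
  have lim: "(\<lambda>k. LINT x|M. f k x) ----> measure M C" if M: "prob_space M" "sets M = sets borel" for M
  proof -
    interpret prob_space M by fact
    have "(\<lambda>k. LINT x|M. f k x) ----> (LINT x|M. indicator C x)"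
    proof (rule integral_dominated_convergence[where w="\<lambda>_. 1"])
      show "AE x in M. (\<lambda>k. f k x) ----> indicator C x" using f by simp
      show "f k \<in> borel_measurable M" for k
        using bcontfun_measurable[OF blip_bcontfun[OF f(1)]] M by (simp cong: measurable_cong_sets)
      show "AE x in M. norm (f k x) \<le> 1" for k using f(1)[of k] by (simp add: blip_def)
      show "indicator C \<in> borel_measurable M" using C M by (intro borel_measurable_indicator) auto
    qed simp
    then show ?thesis using C M sets_eq_imp_space_eq[OF M(2)] by simp
  qed
  have "measure N C = measure N' C" using lim[OF N] lim[OF N'] eq[OF f(1)] LIMSEQ_unique by auto
  then show "emeasure N C = emeasure N' C" by (simp add: N.emeasure_eq_measure N'.emeasure_eq_measure)
next
  show "range (\<lambda>_::nat. UNIV) \<subseteq> (Collect closed :: 'a set set)" by auto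
  interpret N: prob_space N by fact
  show "\<And>i. emeasure N UNIV \<noteq> \<infinity>" using N.emeasure_finite by (simp add: less_top[symmetric])
qed auto

section \<open>Random walks\<close>

abbreviation iid :: "'a measure \<Rightarrow> (nat \<Rightarrow> 'a) measure" where
  "iid N \<equiv> PiM UNIV (\<lambda>_. N)"

text \<open>A recursion driven by a sequence. Both the scheme (\<open>state\<close>) and the
  approximation of the solution (\<open>splitting\<close>) are instances, so that one expectation
  formula serves both.\<close>

primrec chain :: "('a \<Rightarrow> 'b \<Rightarrow> 'a) \<Rightarrow> 'a \<Rightarrow> (nat \<Rightarrow> 'b) \<Rightarrow> nat \<Rightarrow> 'a" where
  "chain a x \<omega> 0 = x"
| "chain a x \<omega> (Suc i) = a (chain a x \<omega> i) (\<omega> i)"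

text \<open>The recursion removes the last step; expectations are computed by removing the
  first.\<close>

lemma chain_case_nat: "chain a x (case_nat y \<omega>) (Suc k) = chain a (a x y) \<omega> k" by (induction k) auto

lemma chain_cong: "(\<And>i. i < k ==> \<omega> i = \<omega>' i) ==> chain a x \<omega> k = chain a x \<omega>' k"
  by (induction k) auto

locale borel_prob = prob_space N for N :: "'a::euclidean_space measure" +
  assumes setsN [simp, measurable_cong]: "sets N = sets borel"
begin

lemma spaceN [simp]: "space N = UNIV" using sets_eq_imp_space_eq[OF setsN] by simp

sublocale seq: sequence_space N ..

lemma space_iid [simp]: "space (iid N) = UNIV" by (simp add: space_PiM)

lemma prob_UNIV [simp]: "measure N UNIV = 1" "measure (iid N) UNIV = 1" using prob_space seq.P.prob_space by simp_all

lemma prob_space_iid: "prob_space (iid N)" by (rule seq.P.prob_space_axioms)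

lemma coord_measurable [measurable]: "(\<lambda>\<omega>. \<omega> i) \<in> borel_measurable (iid N)"
proof -
  have "(\<lambda>\<omega>. \<omega> i) \<in> measurable (iid N) N" by (rule measurable_component_singleton) simp
  then show ?thesis by simp
qed

lemma iid_sets: "X \<in> borel_measurable (iid N) ==> A \<in> sets borel ==> {\<omega>. X \<omega> \<in> A} \<in> sets (iid N)"
  using measurable_sets[of X "iid N" borel A] by (simp add: vimage_def)

lemma case_nat_measurable [measurable]: "(\<lambda>(y, \<omega>). case_nat y \<omega>) \<in> measurable (N \<Otimes>\<^sub>M iid N) (iid N)"
  by measurable

lemma iid_integrable:
  fixes G :: "(nat \<Rightarrow> 'a) \<Rightarrow> 'b::{banach, second_countable_topology}"
  assumes "G \<in> borel_measurable (iid N)" "\<And>\<omega>. norm (G \<omega>) \<le> B"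
  shows "integrable (iid N) G" using assms by (intro seq.P.integrable_const_bound[of _ B]) auto

lemma iid_integral_Suc:
  fixes G :: "(nat \<Rightarrow> 'a) \<Rightarrow> 'b::{banach, second_countable_topology}"
  assumes [measurable]: "G \<in> borel_measurable (iid N)" and bd: "\<And>\<omega>. norm (G \<omega>) \<le> B"
  shows "(LINT \<omega>|iid N. G \<omega>) = (LINT y|N. (LINT \<omega>|iid N. G (case_nat y \<omega>)))"
proof -
  interpret pair_prob_space N "iid N" ..
  have "(LINT \<omega>|iid N. G \<omega>) = (LINT \<omega>|(distr (N \<Otimes>\<^sub>M iid N) (iid N) (\<lambda>(y, \<omega>). case_nat y \<omega>)). G \<omega>)"
    by (simp only: seq.PiM_iter)
  also have "\<dots> = (LINT p|(N \<Otimes>\<^sub>M iid N). G (case p of (y, \<omega>) \<Rightarrow> case_nat y \<omega>))"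
    by (rule integral_distr) auto
  also have "\<dots> = (LINT y|N. (LINT \<omega>|iid N. G (case_nat y \<omega>)))"
  proof (subst integral_fst'[symmetric])
    show "integrable (N \<Otimes>\<^sub>M iid N) (\<lambda>p. G (case p of (y, \<omega>) \<Rightarrow> case_nat y \<omega>))"
      using bd by (intro integrable_const_bound[of _ B]) auto
  qed simp
  finally show ?thesis .
qed

text \<open>Independence of the first \<open>i\<close> coordinates from the rest: from position
  \<open>i\<close> on a fresh copy may be spliced in.\<close>

lemma iid_integral_comb:
  fixes G :: "(nat \<Rightarrow> 'a) \<Rightarrow> 'b::{banach, second_countable_topology}"
  assumes [measurable]: "G \<in> borel_measurable (iid N)" and bd: "\<And>\<omega>. norm (G \<omega>) \<le> B"
  shows "(LINT \<omega>|iid N. G \<omega>) = (LINT \<omega>|iid N. (LINT \<omega>'|iid N. G (comb_seq i \<omega> \<omega>')))"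
proof -
  interpret pair_prob_space "iid N" "iid N" ..
  have [measurable]: "(\<lambda>(\<omega>, \<omega>'). comb_seq i \<omega> \<omega>') \<in> measurable (iid N \<Otimes>\<^sub>M iid N) (iid N)"
    by (rule measurable_comb_seq)
  have "(LINT \<omega>|iid N. G \<omega>) = (LINT \<omega>|(distr (iid N \<Otimes>\<^sub>M iid N) (iid N) (\<lambda>(\<omega>, \<omega>'). comb_seq i \<omega> \<omega>')). G \<omega>)"
    by (simp only: seq.PiM_comb_seq)
  also have "\<dots> = (LINT p|(iid N \<Otimes>\<^sub>M iid N). G (case p of (\<omega>, \<omega>') \<Rightarrow> comb_seq i \<omega> \<omega>'))"
    by (rule integral_distr) auto
  also have "\<dots> = (LINT \<omega>|iid N. (LINT \<omega>'|iid N. G (comb_seq i \<omega> \<omega>')))"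
  proof (subst integral_fst'[symmetric])
    show "integrable (iid N \<Otimes>\<^sub>M iid N) (\<lambda>p. G (case p of (\<omega>, \<omega>') \<Rightarrow> comb_seq i \<omega> \<omega>'))"
      using bd by (intro integrable_const_bound[of _ B]) auto
  qed simp
  finally show ?thesis .
qed

lemma chain_measurable:
  assumes a: "(\<lambda>(x, y). a x y) \<in> borel_measurable (borel \<Otimes>\<^sub>M borel :: ('b::euclidean_space \<times> 'a) measure)"
  shows "(\<lambda>\<omega>. chain a x \<omega> k) \<in> borel_measurable (iid N)"
proof (induction k)
  case (Suc k)
  have "(\<lambda>\<omega>. (\<lambda>(x, y). a x y) (chain a x \<omega> k, \<omega> k)) \<in> borel_measurable (iid N)"
    by (rule measurable_compose[OF _ a]) (intro measurable_Pair Suc coord_measurable)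
  then show ?case by simp
qed simp

text \<open>In an iterated operator the first transition is outermost. The induction therefore
  removes the first step, and the starting point has to stay arbitrary.\<close>

lemma chain_integral:
  fixes g :: "'b::euclidean_space \<Rightarrow> real"
  assumes a: "(\<lambda>(x, y). a x y) \<in> borel_measurable (borel \<Otimes>\<^sub>M borel :: ('b \<times> 'a) measure)"
    and g: "g \<in> borel_measurable borel" and bd: "\<And>x. \<bar>g x\<bar> \<le> B"
  shows "((\<lambda>g x. LINT y|N. g (a x y)) ^^ k) g x = (LINT \<omega>|iid N. g (chain a x \<omega> k))"
proof (induction k arbitrary: x)
  case 0
  show ?case by simp
next
  case (Suc k)
  have "((\<lambda>g x. LINT y|N. g (a x y)) ^^ Suc k) g x = (LINT y|N. (LINT \<omega>|iid N. g (chain a (a x y) \<omega> k)))"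
    using Suc.IH by simp
  also have "\<dots> = (LINT y|N. (LINT \<omega>|iid N. g (chain a x (case_nat y \<omega>) (Suc k))))"
    by (simp only: chain_case_nat)
  also have "\<dots> = (LINT \<omega>|iid N. g (chain a x \<omega> (Suc k)))"
    by (rule iid_integral_Suc[symmetric, where B=B and G="\<lambda>\<omega>. g (chain a x \<omega> (Suc k))"])
       (rule measurable_compose[OF chain_measurable[OF a] g], simp add: bd)
  finally show ?case .
qed

end

section \<open>Sums of independent steps: moments, tails, increments\<close>

text \<open>The map \<open>\<xi>\<close> lets one set of moment formulas serve both the raw steps
  (\<open>psum\<close>) and the truncated ones.\<close>

definition walk :: "('b \<Rightarrow> 'a::euclidean_space) \<Rightarrow> (nat \<Rightarrow> 'b) \<Rightarrow> nat \<Rightarrow> 'a" where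
  "walk \<xi> \<omega> j = (\<Sum>i<j. \<xi> (\<omega> i))"

abbreviation psum :: "(nat \<Rightarrow> 'a) \<Rightarrow> nat \<Rightarrow> 'a::euclidean_space" where
  "psum \<equiv> walk (\<lambda>x. x)"

lemma walk_case_nat: "walk \<xi> (case_nat y \<omega>) (Suc j) = \<xi> y + walk \<xi> \<omega> j"
  unfolding walk_def by (subst sum.lessThan_Suc_shift) simp

lemma walk_0 [simp]: "walk \<xi> \<omega> 0 = 0" and walk_Suc [simp]: "walk \<xi> \<omega> (Suc j) = walk \<xi> \<omega> j + \<xi> (\<omega> j)"
  by (auto simp: walk_def)

lemma walk_comb_le: "j \<le> i ==> walk \<xi> (comb_seq i \<omega> \<omega>') j = walk \<xi> \<omega> j"
  unfolding walk_def by (intro sum.cong) (auto simp: comb_seq_less)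

lemma walk_comb_add: "walk \<xi> (comb_seq i \<omega> \<omega>') (i + r) = walk \<xi> \<omega> i + walk \<xi> \<omega>' r"
proof (induction r)
  case 0
  show ?case by (simp add: walk_comb_le)
next
  case (Suc r)
  then show ?case using comb_seq_add[of i \<omega> \<omega>' r] by (simp add: add.commute[of i r] add.assoc)
qed

context borel_prob begin

lemma walk_measurable [measurable]:
  "\<xi> \<in> borel_measurable borel ==> (\<lambda>\<omega>. walk \<xi> \<omega> j) \<in> borel_measurable (iid N)"
  unfolding walk_def by (intro borel_measurable_sum measurable_compose[OF coord_measurable])

lemma norm_walk_le: "(\<And>x. norm (\<xi> x) \<le> K) ==> norm (walk \<xi> \<omega> j) \<le> real j * K"
  unfolding walk_def using sum_norm_bound[of "{..<j}" "\<lambda>i. \<xi> (\<omega> i)" K] by simp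

lemma walk_first_moment:
  assumes \<xi>: "\<xi> \<in> borel_measurable borel" "\<And>x. norm (\<xi> x) \<le> K"
  shows "(LINT \<omega>|iid N. walk \<xi> \<omega> j) = real j *\<^sub>R (LINT y|N. \<xi> y)"
proof (induction j)
  case (Suc j)
  have i: "integrable (iid N) (\<lambda>\<omega>. walk \<xi> \<omega> j)" "integrable N \<xi>"
    using iid_integrable[OF walk_measurable[OF \<xi>(1)] norm_walk_le[OF \<xi>(2)]]
      borel_prob_integrable[OF prob_space_axioms setsN \<xi>] by auto
  have "(LINT \<omega>|iid N. walk \<xi> \<omega> (Suc j)) = (LINT y|N. (LINT \<omega>|iid N. walk \<xi> (case_nat y \<omega>) (Suc j)))"
    by (rule iid_integral_Suc[OF walk_measurable[OF \<xi>(1)] norm_walk_le[OF \<xi>(2)]])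
  also have "\<dots> = (LINT y|N. \<xi> y + real j *\<^sub>R (LINT y|N. \<xi> y))"
    unfolding walk_case_nat using i Suc by simp
  also have "\<dots> = real (Suc j) *\<^sub>R (LINT y|N. \<xi> y)" using i by (simp add: scaleR_add_left)
  finally show ?case .
qed simp

lemma walk_second_moment:
  assumes \<xi>: "\<xi> \<in> borel_measurable borel" "\<And>x. norm (\<xi> x) \<le> K"
  shows "(LINT \<omega>|iid N. (norm (walk \<xi> \<omega> j))\<^sup>2) =
    real j * (LINT y|N. (norm (\<xi> y))\<^sup>2) + real j * (real j - 1) * (norm (LINT y|N. \<xi> y))\<^sup>2"
proof (induction j)
  case (Suc j)
  let ?b = "LINT y|N. \<xi> y"
  have K: "K \<ge> 0" using \<xi>(2)[of undefined] norm_ge_zero order_trans by blast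
  have sqb: "\<bar>(norm (walk \<xi> \<omega> j))\<^sup>2\<bar> \<le> (real j * K)\<^sup>2" for \<omega> j
    using norm_walk_le[of \<xi> K \<omega> j, OF \<xi>(2)] by (simp add: power_mono)
  have i: "integrable (iid N) (\<lambda>\<omega>. walk \<xi> \<omega> j)" "integrable N \<xi>"
      "integrable (iid N) (\<lambda>\<omega>. (norm (walk \<xi> \<omega> j))\<^sup>2)" "integrable N (\<lambda>y. (norm (\<xi> y))\<^sup>2)"
    using iid_integrable[OF walk_measurable[OF \<xi>(1)] norm_walk_le[OF \<xi>(2)]]
      borel_prob_integrable[OF prob_space_axioms setsN \<xi>]
      iid_integrable[of "\<lambda>\<omega>. (norm (walk \<xi> \<omega> j))\<^sup>2" "(real j * K)\<^sup>2"] sqb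
      borel_prob_integrable[OF prob_space_axioms setsN, of "\<lambda>y. (norm (\<xi> y))\<^sup>2" "K\<^sup>2"] walk_measurable[OF \<xi>(1)] \<xi>
    by (auto simp: power_mono)
  have "(LINT \<omega>|iid N. (norm (walk \<xi> \<omega> (Suc j)))\<^sup>2) = (LINT y|N. (LINT \<omega>|iid N. (norm (walk \<xi> (case_nat y \<omega>) (Suc j)))\<^sup>2))"
  proof (rule iid_integral_Suc[where G="\<lambda>\<omega>. (norm (walk \<xi> \<omega> (Suc j)))\<^sup>2"])
    have [measurable]: "(\<lambda>\<omega>. walk \<xi> \<omega> (Suc j)) \<in> borel_measurable (iid N)" by (rule walk_measurable[OF \<xi>(1)])
    show "(\<lambda>\<omega>. (norm (walk \<xi> \<omega> (Suc j)))\<^sup>2) \<in> borel_measurable (iid N)" by (simp del: walk_Suc)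
    show "norm ((norm (walk \<xi> \<omega> (Suc j)))\<^sup>2) \<le> (real (Suc j) * K)\<^sup>2" for \<omega> using sqb[of \<omega> "Suc j"] by (simp del: walk_Suc)
  qed
  also have "\<dots> = (LINT y|N. (norm (\<xi> y))\<^sup>2 + 2 * (\<xi> y \<bullet> (real j *\<^sub>R ?b)) + (LINT \<omega>|iid N. (norm (walk \<xi> \<omega> j))\<^sup>2))"
  proof (rule Bochner_Integration.integral_cong[OF refl])
    fix y
    have "(LINT \<omega>|iid N. (norm (walk \<xi> (case_nat y \<omega>) (Suc j)))\<^sup>2) =
      (LINT \<omega>|iid N. (norm (\<xi> y))\<^sup>2 + 2 * (\<xi> y \<bullet> walk \<xi> \<omega> j) + (norm (walk \<xi> \<omega> j))\<^sup>2)"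
      unfolding walk_case_nat power2_norm_eq_inner by (simp add: inner_add_left inner_add_right inner_commute algebra_simps)
    also have "\<dots> = (norm (\<xi> y))\<^sup>2 + 2 * (\<xi> y \<bullet> (LINT \<omega>|iid N. walk \<xi> \<omega> j)) + (LINT \<omega>|iid N. (norm (walk \<xi> \<omega> j))\<^sup>2)"
      using i by simp
    finally show "(LINT \<omega>|iid N. (norm (walk \<xi> (case_nat y \<omega>) (Suc j)))\<^sup>2) =
      (norm (\<xi> y))\<^sup>2 + 2 * (\<xi> y \<bullet> (real j *\<^sub>R ?b)) + (LINT \<omega>|iid N. (norm (walk \<xi> \<omega> j))\<^sup>2)"
      by (simp only: walk_first_moment[OF \<xi>])
  qed
  also have "\<dots> = (LINT y|N. (norm (\<xi> y))\<^sup>2) + 2 * (?b \<bullet> (real j *\<^sub>R ?b)) + (LINT \<omega>|iid N. (norm (walk \<xi> \<omega> j))\<^sup>2)"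
    using i by simp
  also have "\<dots> = real (Suc j) * (LINT y|N. (norm (\<xi> y))\<^sup>2) + real (Suc j) * (real (Suc j) - 1) * (norm ?b)\<^sup>2"
    unfolding Suc by (simp add: power2_norm_eq_inner algebra_simps)
  finally show ?case .
qed simp

lemma big_jump_sets: "{\<omega>. K < norm (\<omega> i)} \<in> sets (iid N)"
  using iid_sets[OF coord_measurable, of "{y. K < norm y}" i] by simp

lemma ex_big_jump_sets: "{\<omega>. \<exists>i<j. K < norm (\<omega> i)} \<in> sets (iid N)"
proof -
  have "{\<omega>. \<exists>i<j. K < norm (\<omega> i)} = (\<Union>i<j. {\<omega>. K < norm (\<omega> i)})" by auto
  also have "\<dots> \<in> sets (iid N)" by (intro sets.finite_UN big_jump_sets) simp
  finally show ?thesis .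
qed

lemma iid_big_jump:
  "measure (iid N) {\<omega>. \<exists>i<j. norm (\<omega> i) > K} \<le> real j * measure N {y. norm y > K}"
proof -
  have "measure (iid N) {\<omega>. norm (\<omega> i) > K} = measure N {y. norm y > K}" for i
  proof -
    have "measure N {y. norm y > K} = measure (distr (iid N) N (\<lambda>\<omega>. \<omega> i)) {y. norm y > K}"
      using seq.PiM_component[of i] by simp
    also have "\<dots> = measure (iid N) ((\<lambda>\<omega>. \<omega> i) -` {y. norm y > K} \<inter> space (iid N))"
      by (rule measure_distr) (auto intro: measurable_component_singleton)
    finally show ?thesis by (simp add: vimage_def)
  qed
  note single = this
  have "measure (iid N) {\<omega>. \<exists>i<j. norm (\<omega> i) > K} = measure (iid N) (\<Union>i<j. {\<omega>. norm (\<omega> i) > K})"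
    by (rule arg_cong[of _ _ "measure (iid N)"]) auto
  also have "\<dots> \<le> (\<Sum>i<j. measure (iid N) {\<omega>. norm (\<omega> i) > K})"
    by (rule seq.P.finite_measure_subadditive_finite) (auto intro: big_jump_sets)
  also have "\<dots> = real j * measure N {y. norm y > K}"
    unfolding single by simp
  finally show ?thesis .
qed

lemma walk_eq_trunc: "(\<And>i. i < j ==> norm (\<omega> i) \<le> K) ==> psum \<omega> j = walk (trunc K) \<omega> j"
  unfolding walk_def by (intro sum.cong) (auto simp: trunc_def)

text \<open>Mean and second moment of a step are both of order \<open>h\<close>, so the bound
  depends on the elapsed time \<open>real j * h\<close> alone and is uniform as \<open>h\<close>
  tends to 0.\<close>

lemma walk_trunc_second_moment_le:
  assumes "K > 0" and h: "h \<ge> 0" and C: "C \<ge> 0"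
    and b: "norm (LINT y|N. trunc K y) \<le> C * h" and c: "(LINT y|N. (norm (trunc K y))\<^sup>2) \<le> C * h"
  shows "(LINT \<omega>|iid N. (norm (walk (trunc K) \<omega> j))\<^sup>2) \<le> C * (real j * h) + (C * (real j * h))\<^sup>2"
proof -
  have "(LINT \<omega>|iid N. (norm (walk (trunc K) \<omega> j))\<^sup>2) =
    real j * (LINT y|N. (norm (trunc K y))\<^sup>2) + real j * (real j - 1) * (norm (LINT y|N. trunc K y))\<^sup>2"
    using assms(1) by (intro walk_second_moment[of _ K]) (auto simp: norm_trunc_le)
  also have "\<dots> \<le> real j * (C * h) + real j * real j * (C * h)\<^sup>2"
  proof (rule add_mono)
    show "real j * (LINT y|N. (norm (trunc K y))\<^sup>2) \<le> real j * (C * h)" using c by (rule mult_left_mono) simp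
    have "real j * (real j - 1) * (norm (LINT y|N. trunc K y))\<^sup>2 \<le> real j * real j * (norm (LINT y|N. trunc K y))\<^sup>2"
      by (intro mult_right_mono mult_left_mono) auto
    also have "\<dots> \<le> real j * real j * (C * h)\<^sup>2" by (intro mult_left_mono power_mono b) auto
    finally show "real j * (real j - 1) * (norm (LINT y|N. trunc K y))\<^sup>2 \<le> real j * real j * (C * h)\<^sup>2" .
  qed
  finally show ?thesis by (simp add: power2_eq_square mult_ac)
qed

text \<open>Unless some jump exceeds \<open>K\<close>, the walk equals the truncated one. A union
  bound takes care of the big jumps, the Markov inequality for the squared norm of the rest.\<close>

lemma walk_tail:
  assumes "K > 0" and h: "h \<ge> 0" and C: "C \<ge> 0" and l: "l > 0"
    and b: "norm (LINT y|N. trunc K y) \<le> C * h" and c: "(LINT y|N. (norm (trunc K y))\<^sup>2) \<le> C * h"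
  shows "measure (iid N) {\<omega>. norm (psum \<omega> j) > l} \<le>
    real j * measure N {y. norm y > K} + (C * (real j * h) + (C * (real j * h))\<^sup>2) / l\<^sup>2"
proof -
  have sqb: "\<bar>(norm (walk (trunc K) \<omega> j))\<^sup>2\<bar> \<le> (real j * K)\<^sup>2" for \<omega> :: "nat \<Rightarrow> 'a"
    using norm_walk_le[of "trunc K" K \<omega> j, OF norm_trunc_le] assms(1) by (simp add: power_mono)
  have m [measurable]: "(\<lambda>\<omega>. walk (trunc K) \<omega> j) \<in> borel_measurable (iid N)"
    by (rule walk_measurable) simp
  have s: "{\<omega>. (norm (walk (trunc K) \<omega> j))\<^sup>2 \<ge> l\<^sup>2} \<in> sets (iid N)"
    using iid_sets[OF m, of "{y. (norm y)\<^sup>2 \<ge> l\<^sup>2}"] by simp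
  have "measure (iid N) {\<omega>. norm (psum \<omega> j) > l} \<le>
    measure (iid N) ({\<omega>. \<exists>i<j. norm (\<omega> i) > K} \<union> {\<omega>. (norm (walk (trunc K) \<omega> j))\<^sup>2 \<ge> l\<^sup>2})"
  proof (rule seq.P.finite_measure_mono)
    show "{\<omega> :: nat \<Rightarrow> 'a. norm (psum \<omega> j) > l} \<subseteq> {\<omega>. \<exists>i<j. norm (\<omega> i) > K} \<union> {\<omega>. (norm (walk (trunc K) \<omega> j))\<^sup>2 \<ge> l\<^sup>2}"
    proof
      fix \<omega> :: "nat \<Rightarrow> 'a" assume *: "\<omega> \<in> {\<omega>. norm (psum \<omega> j) > l}"
      show "\<omega> \<in> {\<omega>. \<exists>i<j. norm (\<omega> i) > K} \<union> {\<omega>. (norm (walk (trunc K) \<omega> j))\<^sup>2 \<ge> l\<^sup>2}"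
      proof (cases "\<exists>i<j. norm (\<omega> i) > K")
        case False
        then have "psum \<omega> j = walk (trunc K) \<omega> j" by (intro walk_eq_trunc) auto
        then show ?thesis using * l by (auto intro!: power_mono)
      qed auto
    qed
  qed (use s ex_big_jump_sets in auto)
  also have "\<dots> \<le> measure (iid N) {\<omega>. \<exists>i<j. norm (\<omega> i) > K} + measure (iid N) {\<omega>. (norm (walk (trunc K) \<omega> j))\<^sup>2 \<ge> l\<^sup>2}"
    by (rule measure_Un_le[OF ex_big_jump_sets s])
  also have "measure (iid N) {\<omega>. (norm (walk (trunc K) \<omega> j))\<^sup>2 \<ge> l\<^sup>2} \<le> (LINT \<omega>|iid N. (norm (walk (trunc K) \<omega> j))\<^sup>2) / l\<^sup>2"
  proof -
    have "(\<lambda>\<omega>. (norm (walk (trunc K) \<omega> j))\<^sup>2) \<in> borel_measurable (iid N)" using m by measurable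
    then have i: "integrable (iid N) (\<lambda>\<omega>. (norm (walk (trunc K) \<omega> j))\<^sup>2)"
      by (rule iid_integrable[where B="(real j * K)\<^sup>2"]) (use sqb in simp)
    have "0 < l\<^sup>2" using l by simp
    then show ?thesis using integral_Markov_inequality_measure[OF i, of "{}" "l\<^sup>2"] by simp
  qed
  also have "\<dots> \<le> (C * (real j * h) + (C * (real j * h))\<^sup>2) / l\<^sup>2"
    by (intro divide_right_mono walk_trunc_second_moment_le assms) auto
  finally show ?thesis using iid_big_jump[of j K] by simp
qed

lemma charf_walk: "charf (distr (iid N) borel (\<lambda>\<omega>. psum \<omega> j)) u = charf N u ^ j"
proof -
  have m: "(\<lambda>\<omega>. psum \<omega> j) \<in> borel_measurable (iid N)" for j by (intro walk_measurable) simp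
  have m2: "(\<lambda>\<omega>. cis (u \<bullet> psum \<omega> j)) \<in> borel_measurable (iid N)" for j
    using m by measurable
  have "(LINT \<omega>|iid N. cis (u \<bullet> psum \<omega> j)) = charf N u ^ j"
  proof (induction j)
    case 0
    show ?case by simp
  next
    case (Suc j)
    have "(LINT \<omega>|iid N. cis (u \<bullet> psum \<omega> (Suc j))) = (LINT y|N. (LINT \<omega>|iid N. cis (u \<bullet> psum (case_nat y \<omega>) (Suc j))))"
      by (rule iid_integral_Suc[where B=1], rule m2) simp
    also have "\<dots> = (LINT y|N. cis (u \<bullet> y) * (LINT \<omega>|iid N. cis (u \<bullet> psum \<omega> j)))"
      unfolding walk_case_nat by (simp add: inner_add_right cis_mult[symmetric])
    finally show ?case unfolding Suc charf_def by simp
  qed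
  moreover have "charf (distr (iid N) borel (\<lambda>\<omega>. psum \<omega> j)) u = (LINT \<omega>|iid N. cis (u \<bullet> psum \<omega> j))"
    unfolding charf_def by (rule integral_distr[OF m]) simp
  ultimately show ?thesis by simp
qed

text \<open>Independence and stationarity of the increments in a form that survives weak limits, as
  an identity between expectations.\<close>

lemma walk_increments:
  fixes f :: "nat \<Rightarrow> 'a \<Rightarrow> real"
  assumes f: "\<And>l. f l \<in> borel_measurable borel" "\<And>l x. \<bar>f l x\<bar> \<le> B l"
    and k: "\<And>l. l < n ==> k l \<le> k (Suc l)"
  shows "(LINT \<omega>|iid N. (\<Prod>l<n. f l (psum \<omega> (k (Suc l)) - psum \<omega> (k l)))) =
    (\<Prod>l<n. LINT \<omega>|iid N. f l (psum \<omega> (k (Suc l) - k l)))" using k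
proof (induction n)
  case 0
  show ?case by simp
next
  case (Suc n)
  have m: "(\<lambda>\<omega>. psum \<omega> j) \<in> borel_measurable (iid N)" for j by (intro walk_measurable) simp
  have kk: "k l \<le> k n" if "l \<le> n" for l using that
  proof (induction rule: inc_induct)
    case (step m)
    then show ?case using Suc.prems[of m] by simp
  qed simp
  have B: "B l \<ge> 0" for l using f(2)[of l undefined] abs_ge_zero order_trans by blast
  define G where "G \<omega> = (\<Prod>l<Suc n. f l (psum \<omega> (k (Suc l)) - psum \<omega> (k l)))" for \<omega>
  have Gm: "G \<in> borel_measurable (iid N)"
    unfolding G_def using f(1) m by measurable
  have Gb: "norm (G \<omega>) \<le> (\<Prod>l<Suc n. B l)" for \<omega>
    unfolding G_def real_norm_def abs_prod using f(2) by (intro prod_mono) auto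
  \<comment> \<open>Splicing in a fresh sequence at position \<open>k n\<close> separates the last
    increment from all earlier ones.\<close>
  have "(LINT \<omega>|iid N. G \<omega>) = (LINT \<omega>|iid N. (LINT \<omega>'|iid N. G (comb_seq (k n) \<omega> \<omega>')))"
    by (rule iid_integral_comb[OF Gm Gb])
  also have "\<dots> = (LINT \<omega>|iid N. (LINT \<omega>'|iid N. (\<Prod>l<n. f l (psum \<omega> (k (Suc l)) - psum \<omega> (k l))) *
      f n (psum \<omega>' (k (Suc n) - k n))))"
  proof (intro Bochner_Integration.integral_cong refl)
    fix \<omega> \<omega>' :: "nat \<Rightarrow> 'a"
    have "psum (comb_seq (k n) \<omega> \<omega>') (k (Suc n)) - psum (comb_seq (k n) \<omega> \<omega>') (k n) = psum \<omega>' (k (Suc n) - k n)"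
      using walk_comb_add[of "\<lambda>x. x" "k n" \<omega> \<omega>' "k (Suc n) - k n"] Suc.prems[of n] by (simp add: walk_comb_le)
    moreover have "psum (comb_seq (k n) \<omega> \<omega>') (k l) = psum \<omega> (k l)" if "l \<le> n" for l
      using kk[OF that] by (rule walk_comb_le)
    ultimately show "G (comb_seq (k n) \<omega> \<omega>') = (\<Prod>l<n. f l (psum \<omega> (k (Suc l)) - psum \<omega> (k l))) *
      f n (psum \<omega>' (k (Suc n) - k n))"
      unfolding G_def by simp
  qed
  also have "\<dots> = (LINT \<omega>|iid N. (\<Prod>l<n. f l (psum \<omega> (k (Suc l)) - psum \<omega> (k l)))) *
      (LINT \<omega>'|iid N. f n (psum \<omega>' (k (Suc n) - k n)))" by simp
  finally show ?case using Suc by (simp add: G_def)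
qed

end

section \<open>Compactness of laws of sequences\<close>

definition squash :: "real \<Rightarrow> real" where "squash x = 1/2 + arctan x / pi"
definition unsquash :: "real \<Rightarrow> real" where "unsquash y = tan (pi * (y - 1/2))"

lemma squash_bounds: "0 < squash x" "squash x < 1"
  using arctan_lbound[of x] arctan_ubound[of x] by (auto simp: squash_def field_simps)

lemma unsquash_squash: "unsquash (squash x) = x" by (simp add: squash_def unsquash_def tan_arctan)

lemma squash_mono: "x \<le> y ==> squash x \<le> squash y" by (simp add: squash_def divide_right_mono arctan_monotone')

lemma squash_uminus: "squash (- x) = 1 - squash x" by (simp add: squash_def arctan_minus)

lemma unsquash_tendsto:
  assumes "xs ----> y" "0 < y" "y < 1" shows "(\<lambda>n. unsquash (xs n)) ----> unsquash y"
proof -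
  have "cos (pi * (y - 1/2)) > 0" using assms(2,3) pi_gt_zero by (intro cos_gt_zero_pi) (auto simp: field_simps)
  then have c: "cos (pi * (y - 1/2)) \<noteq> 0" by simp
  have "(\<lambda>n. pi * (xs n - 1/2)) ----> pi * (y - 1/2)" by (intro tendsto_intros assms)
  then show ?thesis unfolding unsquash_def by (rule isCont_tendsto_compose[OF isCont_tan[OF c]])
qed

lemma squash_measurable [measurable]: "squash \<in> borel_measurable borel"
  unfolding squash_def[abs_def] by (intro borel_measurable_continuous_onI continuous_intros) auto

lemma unsquash_measurable [measurable]: "unsquash \<in> borel_measurable borel"
  unfolding unsquash_def[abs_def] tan_def by measurable

section \<open>Coding a sequence of reals in one real number\<close>

definition bit :: "nat \<Rightarrow> real \<Rightarrow> int" where "bit i s = \<lfloor>2 ^ Suc i * s\<rfloor> mod 2"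

lemma bit_cases: "bit i s = 0 \<or> bit i s = 1" by (auto simp: bit_def)

lemma binary_partial_sum:
  assumes "0 \<le> s" "s < 1"
  shows "(\<Sum>i<n. of_int (bit i s) / 2 ^ Suc i) = of_int \<lfloor>2 ^ n * s\<rfloor> / (2 ^ n :: real)"
proof (induction n)
  case 0
  have "\<lfloor>s\<rfloor> = 0" using assms by linarith
  then show ?case by simp
next
  case (Suc n)
  have "\<lfloor>2 ^ Suc n * s\<rfloor> div 2 = \<lfloor>2 ^ n * s\<rfloor>"
    using floor_divide_real_eq_div[of 2 "2 ^ Suc n * s"] by simp
  then have "\<lfloor>2 ^ Suc n * s\<rfloor> = 2 * \<lfloor>2 ^ n * s\<rfloor> + bit n s"
    unfolding bit_def by (metis div_mult_mod_eq mult.commute)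
  then have "of_int \<lfloor>2 ^ Suc n * s\<rfloor> / (2 ^ Suc n :: real) = of_int \<lfloor>2 ^ n * s\<rfloor> / 2 ^ n + of_int (bit n s) / 2 ^ Suc n"
    by (simp add: add_divide_distrib)
  then show ?case using Suc by simp
qed

lemma binary_expansion:
  assumes "0 \<le> s" "s < 1"
  shows "(\<lambda>i. of_int (bit i s) / 2 ^ Suc i) sums s"
  unfolding sums_def
proof -
  have b: "norm ((\<Sum>i<n. of_int (bit i s) / 2 ^ Suc i) - s) \<le> (1/2) ^ n" for n
  proof -
    have "\<bar>of_int \<lfloor>2 ^ n * s\<rfloor> - 2 ^ n * s\<bar> \<le> 1" by linarith
    then have "\<bar>(of_int \<lfloor>2 ^ n * s\<rfloor> - 2 ^ n * s) / 2 ^ n\<bar> \<le> 1 / 2 ^ n"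
      by (simp add: abs_divide divide_right_mono)
    then show ?thesis unfolding binary_partial_sum[OF assms] by (simp add: diff_divide_distrib power_divide)
  qed
  have "(\<lambda>n. (\<Sum>i<n. of_int (bit i s) / 2 ^ Suc i) - s) ----> 0"
    by (rule Lim_null_comparison[OF always_eventually[OF allI[OF b]]]) (rule LIMSEQ_realpow_zero, auto)
  then show "(\<lambda>n. \<Sum>i<n. of_int (bit i s) / 2 ^ Suc i) ----> s" by (simp add: LIM_zero_iff)
qed

text \<open>
  A sequence of reals is stored bit by bit in a single real number. The bits are written in base \<open>4\<close>, which makes
  decoding continuous on the closed set \<open>cantor_like\<close> and reduces compactness of laws of sequences to the real line.
\<close>

definition encode4 :: "(nat \<Rightarrow> int) \<Rightarrow> real" where
  "encode4 d = (\<Sum>q. of_int (d q) / 4 ^ Suc q)"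

lemma geo4: "(\<lambda>q. 1 / (4::real) ^ Suc q) sums (1/3)"
  using sums_mult[OF geometric_sums[of "1/4::real"], of "1/4"] by (simp add: power_divide)

lemma encode4_step:
  assumes d: "\<And>q. d q = 0 \<or> d q = 1"
  shows "0 \<le> encode4 d" "encode4 d \<le> 1/3" "4 * encode4 d = of_int (d 0) + encode4 (\<lambda>q. d (Suc q))"
proof -
  have s: "summable (\<lambda>q. of_int (d q) / (4::real) ^ Suc q)" if "\<And>q. d q = 0 \<or> d q = 1" for d :: "nat \<Rightarrow> int"
  proof (rule summable_comparison_test'[OF sums_summable[OF geo4], of 0])
    fix n show "norm (of_int (d n) / (4::real) ^ Suc n) \<le> 1 / 4 ^ Suc n" using that[of n] by auto
  qed
  show "0 \<le> encode4 d"
    unfolding encode4_def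
  proof (rule suminf_nonneg[OF s[OF d]])
    show "0 \<le> of_int (d n) / (4::real) ^ Suc n" for n using d[of n] by auto
  qed
  have "encode4 d \<le> (\<Sum>q. 1 / (4::real) ^ Suc q)"
    unfolding encode4_def
  proof (rule suminf_le[OF _ s[OF d] sums_summable[OF geo4]])
    show "of_int (d n) / (4::real) ^ Suc n \<le> 1 / 4 ^ Suc n" for n using d[of n] by auto
  qed
  then show "encode4 d \<le> 1/3" using sums_unique[OF geo4] by simp
  have "encode4 d = of_int (d 0) / 4 + (\<Sum>q. of_int (d (Suc q)) / 4 ^ Suc (Suc q))"
    unfolding encode4_def using suminf_split_head[OF s[of d, OF d]] by simp
  also have "(\<Sum>q. of_int (d (Suc q)) / (4::real) ^ Suc (Suc q)) = (\<Sum>q. (of_int (d (Suc q)) / 4 ^ Suc q) / 4)"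
    by (simp add: mult_ac)
  also have "\<dots> = encode4 (\<lambda>q. d (Suc q)) / 4"
    unfolding encode4_def by (rule suminf_divide[OF s]) (use d in auto)
  finally show "4 * encode4 d = of_int (d 0) + encode4 (\<lambda>q. d (Suc q))" by simp
qed

definition digit4 :: "nat \<Rightarrow> real \<Rightarrow> int" where "digit4 q u = \<lfloor>4 ^ Suc q * u\<rfloor> mod 4"

text \<open>1/3 is \<open>0.111...\<close> in base 4: if all digits are 0 or 1, every shifted
  remainder stays at or below it, hence away from the next integer.\<close>

definition cantor_like :: "real set" where "cantor_like = {u. \<forall>q. frac (4 ^ q * u) \<le> 1/3}"

text \<open>The integer part after \<open>q\<close> shifts is kept in the form
  \<open>4 * z + digit\<close>, so that reduction modulo 4 yields the last digit passed; for
  \<open>q = 0\<close> there is none and 0 takes its place.\<close>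

lemma encode4_shift:
  assumes d: "\<And>q. d q = 0 \<or> d q = 1"
  shows "\<exists>z::int. 4 ^ q * encode4 d = of_int (4 * z + (if q = 0 then 0 else d (q - 1))) + encode4 (\<lambda>i. d (q + i))"
proof (induction q)
  case 0
  show ?case by (intro exI[of _ 0]) simp
next
  case (Suc q)
  then obtain z where z: "4 ^ q * encode4 d = of_int (4 * z + (if q = 0 then 0 else d (q - 1))) + encode4 (\<lambda>i. d (q + i))"
    by auto
  have "4 * encode4 (\<lambda>i. d (q + i)) = of_int (d q) + encode4 (\<lambda>i. d (Suc q + i))"
    using encode4_step(3)[of "\<lambda>i. d (q + i)"] d by simp
  then have "4 ^ Suc q * encode4 d = of_int (4 * (4 * z + (if q = 0 then 0 else d (q - 1))) + d q) + encode4 (\<lambda>i. d (Suc q + i))"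
    using z by simp
  then show ?case by (intro exI[of _ "4 * z + (if q = 0 then 0 else d (q - 1))"]) simp
qed

lemma encode4_floor:
  assumes d: "\<And>q. d q = 0 \<or> d q = 1"
  shows "digit4 q (encode4 d) = d q" "encode4 d \<in> cantor_like"
proof -
  obtain z where z: "4 ^ Suc q * encode4 d = of_int (4 * z + d q) + encode4 (\<lambda>i. d (Suc q + i))"
    using encode4_shift[of d "Suc q", OF d] by auto
  have "0 \<le> encode4 (\<lambda>i. d (Suc q + i))" "encode4 (\<lambda>i. d (Suc q + i)) \<le> 1/3"
    using encode4_step[of "\<lambda>i. d (Suc q + i)"] d by auto
  then have "\<lfloor>4 ^ Suc q * encode4 d\<rfloor> = 4 * z + d q" unfolding z by linarith
  then show "digit4 q (encode4 d) = d q" using d[of q] by (auto simp: digit4_def simp del: power_Suc)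
  show "encode4 d \<in> cantor_like"
    unfolding cantor_like_def
  proof (intro CollectI allI)
    fix q
    obtain z where z: "4 ^ q * encode4 d = of_int z + encode4 (\<lambda>i. d (q + i))"
      using encode4_shift[of d q, OF d] by blast
    have "0 \<le> encode4 (\<lambda>i. d (q + i))" "encode4 (\<lambda>i. d (q + i)) \<le> 1/3"
      using encode4_step[of "\<lambda>i. d (q + i)"] d by auto
    moreover from this have "\<lfloor>of_int z + encode4 (\<lambda>i. d (q + i))\<rfloor> = z" by (simp add: floor_eq_iff)
    ultimately show "frac (4 ^ q * encode4 d) \<le> 1/3" unfolding z frac_def by simp
  qed
qed

text \<open>The floor is discontinuous only where an integer is approached from below, and
  fractional parts of at most 1/3 exclude this.\<close>

lemma floor_eventually_const:
  fixes v :: real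
  assumes v: "vs ----> v" and fr: "\<And>n. frac (vs n) \<le> 1/3"
  shows "EV n. \<lfloor>vs n\<rfloor> = \<lfloor>v\<rfloor>"
proof -
  have "EV n. vs n < of_int \<lfloor>v\<rfloor> + 1" "EV n. vs n > of_int \<lfloor>v\<rfloor> - 1/2"
    by (intro order_tendstoD[OF v]; linarith)+
  then show ?thesis
  proof eventually_elim
    case (elim n)
    then show ?case using fr[of n] unfolding frac_def by linarith
  qed
qed

text \<open>Row \<open>l\<close> of the table of digits, read in base 2. Off the encoded points
  digits may reach 3, but the series still converges, with terms at most
  \<open>3 / 2 ^ Suc i\<close>.\<close>

definition decode :: "nat \<Rightarrow> real \<Rightarrow> real" where
  "decode l u = (\<Sum>i. of_int (digit4 (prod_encode (l, i)) u) / 2 ^ Suc i)"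

lemma digit4_bounds: "0 \<le> digit4 q u" "digit4 q u \<le> 3"
  using pos_mod_bound[of 4 "\<lfloor>4 ^ Suc q * u\<rfloor>"] unfolding digit4_def by auto

lemma geo2: "(\<lambda>q. 3 / (2::real) ^ Suc q) sums 3"
  using sums_mult[OF geometric_sums[of "1/2::real"], of "3/2"] by (simp add: power_divide)

text \<open>Along a convergent sequence in \<open>cantor_like\<close> each digit is eventually
  constant; the summable majorant allows the limit to be taken term by term.\<close>

lemma decode_tendsto:
  assumes us: "us ----> u" and c: "\<And>n. us n \<in> cantor_like"
  shows "(\<lambda>n. decode l (us n)) ----> decode l u"
  unfolding decode_def
proof (rule tannerys_theorem[where M="\<lambda>i. 3 / 2 ^ Suc i", THEN conjunct2, THEN conjunct2])
  fix i
  let ?q = "prod_encode (l, i)"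
  have "(\<lambda>n. 4 ^ Suc ?q * us n) ----> 4 ^ Suc ?q * u" by (intro tendsto_intros us)
  from floor_eventually_const[OF this] c
  have "EV n. of_int (digit4 ?q (us n)) / (2::real) ^ Suc i = of_int (digit4 ?q u) / 2 ^ Suc i"
    unfolding cantor_like_def digit4_def by (auto elim!: eventually_mono simp del: power_Suc)
  then show "(\<lambda>n. of_int (digit4 ?q (us n)) / (2::real) ^ Suc i) ----> of_int (digit4 ?q u) / 2 ^ Suc i"
    by (rule tendsto_eventually)
next
  have "norm (of_int (digit4 (prod_encode (l, i)) u) / (2::real) ^ Suc i) \<le> 3 / 2 ^ Suc i" for i u
    using digit4_bounds[of "prod_encode (l, i)" u] by (auto simp: abs_divide intro!: divide_right_mono)
  then show "\<forall>\<^sub>F (k, n) in sequentially \<times>\<^sub>F sequentially.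
       norm (of_int (digit4 (prod_encode (l, k)) (us n)) / (2::real) ^ Suc k) \<le> 3 / 2 ^ Suc k"
    by (intro always_eventually) (auto simp del: power_Suc)
  show "summable (\<lambda>i. 3 / (2::real) ^ Suc i)" using geo2 by (rule sums_summable)
qed simp

lemma decode_measurable [measurable]: "decode l \<in> borel_measurable borel"
  unfolding decode_def[abs_def] digit4_def by measurable

lemma cantor_like_sets [measurable]: "cantor_like \<in> sets borel"
  unfolding cantor_like_def frac_def by measurable

definition encode :: "(nat \<Rightarrow> real) \<Rightarrow> real" where
  "encode x = encode4 (\<lambda>q. bit (snd (prod_decode q)) (squash (x (fst (prod_decode q)))))"

lemma decode_encode: "decode l (encode x) = squash (x l)"
proof -
  have "digit4 (prod_encode (l, i)) (encode x) = bit i (squash (x l))" for i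
    unfolding encode_def by (subst encode4_floor(1)) (auto simp: bit_cases)
  then show ?thesis
    unfolding decode_def using sums_unique[OF binary_expansion[of "squash (x l)"]] squash_bounds[of "x l"] by simp
qed

lemma encode_cantor_like: "encode x \<in> cantor_like"
  unfolding encode_def by (rule encode4_floor) (rule bit_cases)

lemma encode_bounds: "0 \<le> encode x" "encode x \<le> 1/3"
  unfolding encode_def by (rule encode4_step, rule bit_cases)+

lemma encode_measurable:
  assumes [measurable]: "\<And>i. (\<lambda>\<omega>. X \<omega> i) \<in> borel_measurable M"
  shows "(\<lambda>\<omega>. encode (X \<omega>)) \<in> borel_measurable M"
  unfolding encode_def encode4_def bit_def by measurable

lemma unsquash_decode_measurable:
  "h \<in> borel_measurable M ==> (\<lambda>\<omega> l. unsquash (decode l (h \<omega>))) \<in> measurable M (PiM UNIV (\<lambda>_. borel))"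
  by (intro measurable_PiM_single') auto

text \<open>The codes lie in \<open>[0, 1/3]\<close>, so their laws are tight without any
  assumption, and Skorohod's theorem on the line represents a subsequence by almost surely
  convergent variables. Decoding is continuous along these, since encoded values lie in
  \<open>cantor_like\<close>. The assumed tightness has a different purpose: it keeps the limit
  coordinates finite. The conclusion is phrased with sequentially continuous \<open>G\<close>, which
  may depend on finitely many coordinates or on all of them.\<close>

lemma sequence_compactness:
  fixes \<Omega> :: "nat \<Rightarrow> 'w measure" and X :: "nat \<Rightarrow> 'w \<Rightarrow> nat \<Rightarrow> real"
  assumes \<Omega>: "\<And>n. prob_space (\<Omega> n)"
    and X: "\<And>n i. (\<lambda>\<omega>. X n \<omega> i) \<in> borel_measurable (\<Omega> n)"
    and tight: "\<And>i eps. eps > 0 ==> \<exists>K. \<forall>n. measure (\<Omega> n) {\<omega> \<in> space (\<Omega> n). \<bar>X n \<omega> i\<bar> > K} \<le> eps"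
  obtains r and S :: "real measure" and Z :: "real \<Rightarrow> nat \<Rightarrow> real"
  where "strict_mono r" "prob_space S" "\<And>i. (\<lambda>\<omega>. Z \<omega> i) \<in> borel_measurable S"
    "\<And>G B. G \<in> borel_measurable (PiM UNIV (\<lambda>_. borel)) ==> (\<And>x. \<bar>G x\<bar> \<le> (B::real)) ==>
      (\<And>xs x. (\<And>i. (\<lambda>n. xs n i) ----> x i) ==> (\<lambda>n. G (xs n)) ----> G x) ==>
      (\<lambda>n. LINT \<omega>|\<Omega> (r n). G (X (r n) \<omega>)) ----> (LINT \<omega>|S. G (Z \<omega>))"
proof -
  have em [measurable]: "(\<lambda>\<omega>. encode (X n \<omega>)) \<in> borel_measurable (\<Omega> n)" for n
    by (rule encode_measurable[OF X])
  define \<nu> where "\<nu> n = distr (\<Omega> n) borel (\<lambda>\<omega>. encode (X n \<omega>))" for n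
  have \<nu>: "real_distribution (\<nu> n)" for n
  proof -
    interpret prob_space "\<Omega> n" by fact
    show ?thesis unfolding \<nu>_def by (rule real_distribution_distr) measurable
  qed
  have "tight \<nu>"
    unfolding tight_def
  proof (intro conjI allI impI \<nu>)
    fix eps :: real assume "eps > 0"
    have "measure (\<nu> n) {-1<..1} = 1" for n
    proof -
      interpret prob_space "\<Omega> n" by fact
      have "(\<lambda>\<omega>. encode (X n \<omega>)) -` {-1<..1} \<inter> space (\<Omega> n) = space (\<Omega> n)"
      proof -
        have "- 1 < encode x" "encode x \<le> 1" for x using encode_bounds[of x] by linarith+
        then show ?thesis by auto
      qed
      then show ?thesis
        unfolding \<nu>_def by (subst measure_distr) (auto simp: prob_space)
    qed
    then show "\<exists>a b. a < b \<and> (\<forall>n. 1 - eps < measure (\<nu> n) {a<..b})"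
      using \<open>eps > 0\<close> by (intro exI[of _ "-1"] exI[of _ 1]) auto
  qed
  then obtain r M where r: "strict_mono r" and M: "real_distribution M" and w: "weak_conv_m (\<nu> \<circ> id \<circ> r) M"
    using tight_imp_convergent_subsubsequence[of \<nu> id] by (auto simp: strict_mono_def)
  have "real_distribution ((\<nu> \<circ> id \<circ> r) n)" for n using \<nu> by simp
  from Skorohod[OF this M w] obtain S :: "real measure" and U V where *: "prob_space S \<and>
    (\<forall>n. U n \<in> measurable S borel) \<and> (\<forall>n. distr S borel (U n) = (\<nu> \<circ> id \<circ> r) n) \<and>
    V \<in> measurable S lborel \<and> distr S borel V = M \<and> (\<forall>x \<in> space S. (\<lambda>n. U n x) ----> V x)"
    by blast
  then have S: "prob_space S" and U [measurable]: "\<And>n. U n \<in> borel_measurable S"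
    and dU: "\<And>n. distr S borel (U n) = \<nu> (r n)" and V: "V \<in> measurable S lborel"
    and conv: "\<And>x. x \<in> space S ==> (\<lambda>n. U n x) ----> V x" by simp_all
  have V' [measurable]: "V \<in> borel_measurable S" using V by simp
  interpret S: prob_space S by fact
  have U_int: "(LINT \<omega>|S. h (U n \<omega>)) = (LINT \<omega>|\<Omega> (r n). h (encode (X (r n) \<omega>)))"
    if h: "h \<in> borel_measurable borel" for h :: "real \<Rightarrow> real" and n
  proof -
    have "(LINT \<omega>|S. h (U n \<omega>)) = (LINT u|distr S borel (U n). h u)"
      by (rule integral_distr[symmetric, OF U h])
    also have "\<dots> = (LINT \<omega>|\<Omega> (r n). h (encode (X (r n) \<omega>)))"
      unfolding dU \<nu>_def by (rule integral_distr[OF em h])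
    finally show ?thesis .
  qed
  have Uc: "AE \<omega> in S. U n \<omega> \<in> cantor_like" for n
  proof -
    have "AE u in distr S borel (U n). u \<in> cantor_like"
      unfolding dU \<nu>_def by (subst AE_distr_iff) (auto simp: encode_cantor_like)
    then show ?thesis by (subst (asm) AE_distr_iff) auto
  qed
  then have Uc': "AE \<omega> in S. \<forall>n. U n \<omega> \<in> cantor_like" by (simp add: AE_all_countable)
  have dec: "AE \<omega> in S. \<forall>l. (\<lambda>n. decode l (U n \<omega>)) ----> decode l (V \<omega>)"
    using Uc' AE_space by eventually_elim (auto intro!: decode_tendsto conv)
  \<comment> \<open>Tightness keeps the limit of every squashed coordinate strictly between 0 and 1;
    at these two values \<open>unsquash\<close> has poles.\<close>
  have V01: "AE \<omega> in S. 0 < decode l (V \<omega>) \<and> decode l (V \<omega>) < 1" for l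
  proof -
    let ?A = "{\<omega> \<in> space S. \<not> (0 < decode l (V \<omega>) \<and> decode l (V \<omega>) < 1)}"
    have "measure S ?A \<le> eps" if eps: "eps > 0" for eps
    proof -
      obtain K0 where K0: "\<And>n. measure (\<Omega> n) {\<omega> \<in> space (\<Omega> n). \<bar>X n \<omega> l\<bar> > K0} \<le> eps" using tight[OF eps] by blast
      define a where "a = squash (- K0)"
      \<comment> \<open>A continuous test function that is 1 off \<open>(0, 1)\<close> and 0 on
        \<open>[a, 1 - a]\<close>, the range of the squashed values of all \<open>x\<close> with
        \<open>\<bar>x\<bar> \<le> K0\<close>.\<close>
      define g where "g y = max 0 (min 1 (max (1 - y / a) (1 - (1 - y) / a)))" for y
      have a: "a > 0" by (simp add: a_def squash_bounds)
      have g01: "0 \<le> g y" "g y \<le> 1" for y by (auto simp: g_def)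
      have gc: "continuous_on UNIV g" unfolding g_def[abs_def] using a by (intro continuous_intros) auto
      then have gm [measurable]: "g \<in> borel_measurable borel" by (rule borel_measurable_continuous_onI)
      have g1: "g y = 1" if "\<not> (0 < y \<and> y < 1)" for y
      proof -
        consider "y \<le> 0" | "y \<ge> 1" using \<open>\<not> (0 < y \<and> y < 1)\<close> by linarith
        then have "max (1 - y / a) (1 - (1 - y) / a) \<ge> 1"
          using a by cases (auto simp: le_max_iff_disj divide_le_0_iff)
        then show ?thesis by (simp add: g_def)
      qed
      have g0: "g (squash x) = 0" if "\<bar>x\<bar> \<le> K0" for x
      proof -
        have "a \<le> squash x" "squash x \<le> 1 - a"
          using squash_mono[of "- K0" x] squash_mono[of x K0] that squash_uminus[of K0] by (auto simp: a_def)
        then have "1 - squash x / a \<le> 0" "1 - (1 - squash x) / a \<le> 0" using a by (auto simp: field_simps)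
        then show ?thesis by (simp add: g_def)
      qed
      have "(\<lambda>n. LINT \<omega>|S. g (decode l (U n \<omega>))) ----> (LINT \<omega>|S. g (decode l (V \<omega>)))"
      proof (rule integral_dominated_convergence[where w="\<lambda>_. 1"])
        show "AE \<omega> in S. (\<lambda>n. g (decode l (U n \<omega>))) ----> g (decode l (V \<omega>))" using dec
        proof eventually_elim
          case (elim \<omega>)
          show ?case by (rule continuous_on_tendsto_compose[OF gc]) (use elim in auto)
        qed
      qed (use g01 in auto)
      moreover have "(LINT \<omega>|S. g (decode l (U n \<omega>))) \<le> eps" for n
      proof -
        interpret O: prob_space "\<Omega> (r n)" by fact
        note X[of "r n" l, measurable]
        have "(LINT \<omega>|S. g (decode l (U n \<omega>))) = (LINT \<omega>|\<Omega> (r n). g (squash (X (r n) \<omega> l)))"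
          using U_int[of "\<lambda>u. g (decode l u)" n] by (simp add: decode_encode)
        also have "\<dots> \<le> (LINT \<omega>|\<Omega> (r n). indicator {\<omega> \<in> space (\<Omega> (r n)). \<bar>X (r n) \<omega> l\<bar> > K0} \<omega>)"
        proof (rule integral_mono)
          show "integrable (\<Omega> (r n)) (\<lambda>\<omega>. g (squash (X (r n) \<omega> l)))"
            using g01 by (intro O.integrable_const_bound[of _ 1]) auto
          show "integrable (\<Omega> (r n)) (\<lambda>\<omega>. indicator {\<omega> \<in> space (\<Omega> (r n)). \<bar>X (r n) \<omega> l\<bar> > K0} \<omega> :: real)"
            by (intro O.integrable_const_bound[of _ 1]) (auto simp: indicator_def)
          show "g (squash (X (r n) \<omega> l)) \<le> indicator {\<omega> \<in> space (\<Omega> (r n)). \<bar>X (r n) \<omega> l\<bar> > K0} \<omega>"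
            if "\<omega> \<in> space (\<Omega> (r n))" for \<omega>
            using g0[of "X (r n) \<omega> l"] g01 that by (auto simp: indicator_def)
        qed
        also have "\<dots> = measure (\<Omega> (r n)) {\<omega> \<in> space (\<Omega> (r n)). \<bar>X (r n) \<omega> l\<bar> > K0}"
          by (simp add: Int_absorb2 subset_eq)
        finally show ?thesis using K0[of "r n"] by simp
      qed
      ultimately have "(LINT \<omega>|S. g (decode l (V \<omega>))) \<le> eps" by (intro LIMSEQ_le_const2) auto
      moreover have "(LINT \<omega>|S. indicator ?A \<omega>) \<le> (LINT \<omega>|S. g (decode l (V \<omega>)))"
      proof (rule integral_mono)
        show "integrable S (\<lambda>\<omega>. indicator ?A \<omega> :: real)"
          by (intro S.integrable_const_bound[of _ 1]) (auto simp: indicator_def)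
        show "integrable S (\<lambda>\<omega>. g (decode l (V \<omega>)))"
          using g01 by (intro S.integrable_const_bound[of _ 1]) auto
        show "indicator ?A \<omega> \<le> g (decode l (V \<omega>))" for \<omega>
          using g1[of "decode l (V \<omega>)"] g01 by (auto simp: indicator_def)
      qed
      moreover have "(LINT \<omega>|S. indicator ?A \<omega>) = measure S ?A" by (simp add: Int_absorb2 subset_eq)
      ultimately show ?thesis by simp
    qed
    then have "measure S ?A \<le> 0" by (rule field_le_epsilon[of _ 0, simplified])
    then have "measure S ?A = 0" using measure_nonneg[of S ?A] by linarith
    then show ?thesis by (subst AE_iff_measurable[OF _ refl]) (auto simp: S.emeasure_eq_measure)
  qed
  define Z where "Z \<omega> l = unsquash (decode l (V \<omega>))" for \<omega> l
  show ?thesis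
  proof (rule that[OF r S])
    show Zm: "(\<lambda>\<omega>. Z \<omega> i) \<in> borel_measurable S" for i unfolding Z_def by measurable
    fix G :: "(nat \<Rightarrow> real) \<Rightarrow> real" and B
    assume G [measurable]: "G \<in> borel_measurable (PiM UNIV (\<lambda>_. borel))" and B: "\<And>x. \<bar>G x\<bar> \<le> B"
      and cont: "\<And>xs x. (\<And>i. (\<lambda>n. xs n i) ----> x i) ==> (\<lambda>n. G (xs n)) ----> G x"
    have "(LINT \<omega>|\<Omega> (r n). G (X (r n) \<omega>)) = (LINT \<omega>|S. G (\<lambda>l. unsquash (decode l (U n \<omega>))))" for n
      using U_int[of "\<lambda>u. G (\<lambda>l. unsquash (decode l u))" n] measurable_compose[OF unsquash_decode_measurable[OF measurable_ident] G]
      by (simp add: decode_encode unsquash_squash)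
    moreover have "(\<lambda>n. LINT \<omega>|S. G (\<lambda>l. unsquash (decode l (U n \<omega>)))) ----> (LINT \<omega>|S. G (\<lambda>l. unsquash (decode l (V \<omega>))))"
    proof (rule integral_dominated_convergence[where w="\<lambda>_. B"])
      show "(\<lambda>\<omega>. G (\<lambda>l. unsquash (decode l (V \<omega>)))) \<in> borel_measurable S"
        "\<And>n. (\<lambda>\<omega>. G (\<lambda>l. unsquash (decode l (U n \<omega>)))) \<in> borel_measurable S"
        by (rule measurable_compose[OF unsquash_decode_measurable G], rule V' U)+
      have "AE \<omega> in S. \<forall>l. 0 < decode l (V \<omega>) \<and> decode l (V \<omega>) < 1" using V01 by (simp add: AE_all_countable)
      then show "AE \<omega> in S. (\<lambda>n. G (\<lambda>l. unsquash (decode l (U n \<omega>)))) ----> G (\<lambda>l. unsquash (decode l (V \<omega>)))"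
        using dec by eventually_elim (auto intro!: cont unsquash_tendsto)
    qed (use B in auto)
    ultimately show "(\<lambda>n. LINT \<omega>|\<Omega> (r n). G (X (r n) \<omega>)) ----> (LINT \<omega>|S. G (Z \<omega>))"
      unfolding Z_def by simp
  qed
qed

section \<open>Regularity of paths along the dyadic numbers\<close>

definition dyadics :: "real set" where "dyadics = {t. \<exists>i k::nat. t = real i / 2 ^ k}"

lemma countable_dyadics: "countable dyadics"
proof -
  have "dyadics = (\<lambda>(i, k). real i / 2 ^ k) ` (UNIV \<times> UNIV :: (nat \<times> nat) set)"
    by (auto simp: dyadics_def)
  then show ?thesis by (metis countableI_type countable_image)
qed

lemma dyadics_common_level:
  assumes "t \<in> dyadics" shows "\<exists>k0. \<forall>k\<ge>k0. \<exists>i::nat. t = real i / 2 ^ k"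
proof -
  obtain i k0 where t: "t = real i / 2 ^ k0" using assms by (auto simp: dyadics_def)
  have "t = real (i * 2 ^ (k - k0)) / 2 ^ k" if "k \<ge> k0" for k
  proof -
    have "(2::real) ^ k = 2 ^ k0 * 2 ^ (k - k0)" using that by (simp flip: power_add)
    then show ?thesis unfolding t by simp
  qed
  then show ?thesis by blast
qed

lemma dyadics_nonneg: "t \<in> dyadics ==> 0 \<le> t" by (auto simp: dyadics_def)

text \<open>The grid point lies strictly to the right of \<open>t\<close>, so limits along
  \<open>dup m t\<close> are right limits.\<close>

definition dup :: "nat \<Rightarrow> real \<Rightarrow> real" where "dup m t = (of_int \<lfloor>t * 2 ^ m\<rfloor> + 1) / 2 ^ m"

lemma dup_bounds: "t < dup m t" "dup m t \<le> t + 1 / 2 ^ m"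
  unfolding dup_def by (auto simp: field_simps) linarith+

lemma dup_dyadic: "0 \<le> t ==> dup m t \<in> dyadics"
proof -
  assume "0 \<le> t"
  then have "0 \<le> \<lfloor>t * 2 ^ m\<rfloor>" by simp
  then have "dup m t = real (nat \<lfloor>t * 2 ^ m\<rfloor> + 1) / 2 ^ m" by (simp add: dup_def)
  then show ?thesis unfolding dyadics_def by blast
qed

lemma dup_mono: "s \<le> t ==> dup m s \<le> dup m t"
  unfolding dup_def by (intro divide_right_mono add_mono) (auto intro!: floor_mono mult_right_mono)

lemma dup_tendsto: "(\<lambda>m. dup m t) ----> t"
proof (rule tendsto_sandwich[of "\<lambda>_. t" _ _ "\<lambda>m. t + (1/2) ^ m"])
  show "(\<lambda>m. t + (1/2) ^ m) ----> t"
    using tendsto_add[OF tendsto_const[of t] LIMSEQ_realpow_zero[of "1/2"]] by simp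
  show "EV m. t \<le> dup m t" using dup_bounds(1) by (auto intro: always_eventually less_imp_le)
  show "EV m. dup m t \<le> t + (1/2) ^ m" using dup_bounds(2) by (auto intro: always_eventually simp: power_divide)
qed simp

lemma dyadic_between:
  assumes "0 \<le> s" "s < t" shows "\<exists>d\<in>dyadics. s < d \<and> d < t"
proof -
  have "EV m. dup m s < t" using order_tendstoD(2)[OF dup_tendsto assms(2)] .
  then obtain m where "dup m s < t" by (auto simp: eventually_sequentially)
  then show ?thesis using dup_bounds(1)[of s m] dup_dyadic[OF assms(1), of m] by blast
qed

text \<open>
  Of two adjacent increments at dyadic level \<open>k\<close>, one is at most \<open>a k\<close>. For summable \<open>a\<close> this excludes
  oscillation but allows jumps.
\<close>

definition small_min_jumps :: "(real \<Rightarrow> 'a::real_normed_vector) \<Rightarrow> (nat \<Rightarrow> real) \<Rightarrow> nat \<Rightarrow> nat \<Rightarrow> bool" where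
  "small_min_jumps y a T k \<longleftrightarrow> (\<forall>i. i + 2 \<le> T * 2 ^ k -->
     min (norm (y (real (i + 1) / 2 ^ k) - y (real i / 2 ^ k))) (norm (y (real (i + 2) / 2 ^ k) - y (real (i + 1) / 2 ^ k))) \<le> a k)"

text \<open>Points are moved from each dyadic level to the next coarser one, always across a small
  increment, which costs \<open>a j\<close> at level \<open>j\<close>. The resulting
  \<open>\<pi>\<close> is monotone and leaves no coarse cell; that is all the three-point estimate
  uses of it.\<close>

lemma dyadic_projection:
  fixes y :: "real \<Rightarrow> 'a::real_normed_vector"
  assumes sm: "\<And>j. j \<ge> k ==> small_min_jumps y a T j" and a: "\<And>j. 0 \<le> a j"
  shows "\<exists>\<pi>::nat \<Rightarrow> nat. (\<forall>i\<le>T * 2 ^ (k + d). norm (y (real i / 2 ^ (k + d)) - y (real (\<pi> i) / 2 ^ k)) \<le> (\<Sum>j\<in>{k<..k+d}. a j)) \<and>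
    (\<forall>i c. c * 2 ^ d \<le> i --> c \<le> \<pi> i) \<and> (\<forall>i c. i \<le> c * 2 ^ d --> \<pi> i \<le> c) \<and> (\<forall>i j. i \<le> j --> \<pi> i \<le> \<pi> j)"
proof (induction d)
  case 0
  show ?case by (intro exI[of _ "\<lambda>i. i"]) auto
next
  case (Suc d)
  then obtain \<pi> :: "nat \<Rightarrow> nat" where \<pi>: "\<And>i. i \<le> T * 2 ^ (k + d) ==> norm (y (real i / 2 ^ (k + d)) - y (real (\<pi> i) / 2 ^ k)) \<le> (\<Sum>j\<in>{k<..k+d}. a j)"
    "\<And>i c. c * 2 ^ d \<le> i ==> c \<le> \<pi> i" "\<And>i c. i \<le> c * 2 ^ d ==> \<pi> i \<le> c" "\<And>i j. i \<le> j ==> \<pi> i \<le> \<pi> j"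
    by blast
  let ?n = "k + Suc d"
  \<comment> \<open>An even index already belongs to the coarser grid. An odd one moves left if the
    left increment is small, and otherwise right, where the increment is then small by
    \<open>small_min_jumps\<close>.\<close>
  define \<rho> where "\<rho> i = (if even i \<or> norm (y (real i / 2 ^ ?n) - y (real (i - 1) / 2 ^ ?n)) \<le> a ?n then i div 2 else i div 2 + 1)" for i :: nat
  have \<rho>b: "i div 2 \<le> \<rho> i" "\<rho> i \<le> (i + 1) div 2" for i by (auto simp: \<rho>_def)
  have half: "real (i div 2) / 2 ^ (k + d) = real i / 2 ^ ?n" if "even i" for i using that by (auto elim!: evenE)
  have \<rho>c: "norm (y (real i / 2 ^ ?n) - y (real (\<rho> i) / 2 ^ (k + d))) \<le> a ?n" if i: "i \<le> T * 2 ^ ?n" for i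
  proof (cases "even i")
    case True
    then show ?thesis using half[OF True] a by (simp add: \<rho>_def)
  next
    case False
    then obtain m where m: "i = 2 * m + 1" by (rule oddE)
    have h1: "real m / 2 ^ (k + d) = real (2 * m) / 2 ^ ?n" and h2: "real (m + 1) / 2 ^ (k + d) = real (2 * m + 2) / 2 ^ ?n"
      by (simp_all add: field_simps)
    \<comment> \<open>The last index of the grid is even, hence an odd index has a right neighbour
      within range.\<close>
    have "even (T * 2 ^ ?n)" by simp
    then have "i \<noteq> T * 2 ^ ?n" using False by metis
    with i have "2 * m + 2 \<le> T * 2 ^ ?n" using m by linarith
    then have "min (norm (y (real (2 * m + 1) / 2 ^ ?n) - y (real (2 * m) / 2 ^ ?n))) (norm (y (real (2 * m + 2) / 2 ^ ?n) - y (real (2 * m + 1) / 2 ^ ?n))) \<le> a ?n"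
    proof -
      have "small_min_jumps y a T ?n" by (rule sm) simp
      then show ?thesis using \<open>2 * m + 2 \<le> T * 2 ^ ?n\<close> unfolding small_min_jumps_def by blast
    qed
    then have alt: "norm (y (real (2 * m + 1) / 2 ^ ?n) - y (real (2 * m) / 2 ^ ?n)) \<le> a ?n \<or>
        norm (y (real (2 * m + 1) / 2 ^ ?n) - y (real (2 * m + 2) / 2 ^ ?n)) \<le> a ?n"
      by (simp only: min_le_iff_disj norm_minus_commute)
    show ?thesis
    proof (cases "norm (y (real (2 * m + 1) / 2 ^ ?n) - y (real (2 * m) / 2 ^ ?n)) \<le> a ?n")
      case True
      moreover from this have "\<rho> i = m" by (simp add: \<rho>_def m)
      ultimately show ?thesis by (simp only: h1 m)
    next
      case no: False
      then have r: "\<rho> i = m + 1" by (simp add: \<rho>_def m)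
      have "norm (y (real (2 * m + 1) / 2 ^ ?n) - y (real (2 * m + 2) / 2 ^ ?n)) \<le> a ?n" using alt no by blast
      then show ?thesis unfolding r h2 by (simp only: m)
    qed
  qed
  have \<rho>T: "\<rho> i \<le> T * 2 ^ (k + d)" if "i \<le> T * 2 ^ ?n" for i
  proof -
    have "\<rho> i \<le> (T * 2 ^ ?n + 1) div 2" using \<rho>b(2)[of i] that by linarith
    then show ?thesis by simp
  qed
  have "norm (y (real i / 2 ^ ?n) - y (real (\<pi> (\<rho> i)) / 2 ^ k)) \<le> (\<Sum>j\<in>{k<..?n}. a j)" if i: "i \<le> T * 2 ^ ?n" for i
  proof -
    have "{k<..?n} = insert ?n {k<..k+d}" by auto
    then have "(\<Sum>j\<in>{k<..?n}. a j) = a ?n + (\<Sum>j\<in>{k<..k+d}. a j)" by simp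
    moreover have "norm (y (real i / 2 ^ ?n) - y (real (\<pi> (\<rho> i)) / 2 ^ k)) \<le>
      norm (y (real i / 2 ^ ?n) - y (real (\<rho> i) / 2 ^ (k + d))) + norm (y (real (\<rho> i) / 2 ^ (k + d)) - y (real (\<pi> (\<rho> i)) / 2 ^ k))"
      by (rule norm_diff_triangle_le) auto
    ultimately show ?thesis using \<rho>c[OF i] \<pi>(1)[OF \<rho>T[OF i]] by linarith
  qed
  moreover have "c \<le> \<pi> (\<rho> i)" if "c * 2 ^ Suc d \<le> i" for c i
  proof (rule \<pi>(2))
    have "c * 2 ^ d = (c * 2 ^ Suc d) div 2" by simp
    also have "\<dots> \<le> i div 2" using that by (rule div_le_mono)
    finally show "c * 2 ^ d \<le> \<rho> i" using \<rho>b(1)[of i] by linarith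
  qed
  moreover have "\<pi> (\<rho> i) \<le> c" if "i \<le> c * 2 ^ Suc d" for c i
  proof (rule \<pi>(3))
    have "\<rho> i \<le> (c * 2 ^ Suc d + 1) div 2" using \<rho>b(2)[of i] that by linarith
    then show "\<rho> i \<le> c * 2 ^ d" by simp
  qed
  moreover have "\<pi> (\<rho> i) \<le> \<pi> (\<rho> j)" if "i \<le> j" for i j
  proof (rule \<pi>(4))
    show "\<rho> i \<le> \<rho> j"
    proof (cases "i = j")
      case False
      then have "i + 1 \<le> j" using that by simp
      then have "(i + 1) div 2 \<le> j div 2" by (rule div_le_mono)
      then show ?thesis using \<rho>b(2)[of i] \<rho>b(1)[of j] by linarith
    qed simp
  qed
  ultimately show ?case by (intro exI[of _ "\<lambda>i. \<pi> (\<rho> i)"]) auto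
qed

text \<open>Within a time shorter than \<open>1 / 2 ^ k\<close> three points project to three of at
  most three consecutive points of level \<open>k\<close>. Either two neighbouring ones project to
  the same point, or the images are \<open>c\<close>, \<open>c + 1\<close>, \<open>c + 2\<close> and
  \<open>small_min_jumps\<close> at level \<open>k\<close> applies. Two projection errors
  \<open>S\<close> and one \<open>a k\<close> add up to \<open>2 * S + a k\<close>, hence the factor
  2.\<close>

lemma dyadic_three_points:
  fixes y :: "real \<Rightarrow> 'a::real_normed_vector"
  assumes sm: "\<And>j. j \<ge> k ==> small_min_jumps y a T j" and a: "\<And>j. 0 \<le> a j" "summable a"
    and D: "r \<in> dyadics" "s \<in> dyadics" "t \<in> dyadics" and o: "r \<le> s" "s \<le> t" "t \<le> real T" "t - r < 1 / 2 ^ k"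
  shows "min (norm (y s - y r)) (norm (y t - y s)) \<le> 2 * (\<Sum>j. a (j + k))"
proof -
  obtain k1 where k1: "\<And>n. n \<ge> k1 ==> \<exists>i::nat. r = real i / 2 ^ n" using dyadics_common_level[OF D(1)] by blast
  obtain k2 where k2: "\<And>n. n \<ge> k2 ==> \<exists>i::nat. s = real i / 2 ^ n" using dyadics_common_level[OF D(2)] by blast
  obtain k3 where k3: "\<And>n. n \<ge> k3 ==> \<exists>i::nat. t = real i / 2 ^ n" using dyadics_common_level[OF D(3)] by blast
  define d where "d = k1 + k2 + k3"
  let ?n = "k + d"
  obtain i1 i2 i3 :: nat where i: "r = real i1 / 2 ^ ?n" "s = real i2 / 2 ^ ?n" "t = real i3 / 2 ^ ?n"
    using k1[of ?n] k2[of ?n] k3[of ?n] by (auto simp: d_def)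
  have le: "i1 \<le> i2" "i2 \<le> i3" using o(1,2) unfolding i by (auto simp: divide_le_cancel)
  have "real i3 \<le> real (T * 2 ^ ?n)" using o(3) unfolding i by (simp add: pos_divide_le_eq)
  then have i3T: "i3 \<le> T * 2 ^ ?n" by (simp only: of_nat_le_iff)
  have "(real i3 - real i1) / 2 ^ ?n < 1 / 2 ^ k" using o(4) unfolding i by (simp add: diff_divide_distrib)
  then have "(real i3 - real i1) / 2 ^ ?n * 2 ^ ?n < 1 / 2 ^ k * 2 ^ ?n" by (rule mult_strict_right_mono) simp
  then have "real i3 - real i1 < 2 ^ d" by (simp add: power_add)
  then have "real i3 < real (i1 + 2 ^ d)" by simp
  then have i31: "i3 < i1 + 2 ^ d" by (simp only: of_nat_less_iff)
  obtain \<pi> :: "nat \<Rightarrow> nat" where \<pi>: "\<And>i. i \<le> T * 2 ^ ?n ==> norm (y (real i / 2 ^ ?n) - y (real (\<pi> i) / 2 ^ k)) \<le> (\<Sum>j\<in>{k<..?n}. a j)"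
    "\<And>i c. c * 2 ^ d \<le> i ==> c \<le> \<pi> i" "\<And>i c. i \<le> c * 2 ^ d ==> \<pi> i \<le> c" "\<And>i j. i \<le> j ==> \<pi> i \<le> \<pi> j"
    using dyadic_projection[of k y a T d, OF sm a(1)] by blast
  define S where "S = (\<Sum>j\<in>{k<..?n}. a j)"
  have sk: "summable (\<lambda>j. a (j + k))" using a(2) by (simp add: summable_iff_shift)
  have SS: "a k + S \<le> (\<Sum>j. a (j + k))"
  proof -
    have "(\<Sum>j\<in>{k..?n}. a j) = (\<Sum>j\<in>{0..d}. a (j + k))"
      using sum.shift_bounds_cl_nat_ivl[of a 0 k d] by (simp add: add.commute)
    moreover have "{k..?n} = insert k {k<..?n}" by auto
    then have "(\<Sum>j\<in>{k..?n}. a j) = a k + S" by (simp add: S_def)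
    moreover have "(\<Sum>j\<in>{0..d}. a (j + k)) \<le> (\<Sum>j. a (j + k))" using a(1) by (intro sum_le_suminf sk) auto
    ultimately show ?thesis by simp
  qed
  have e: "norm (y r - y (real (\<pi> i1) / 2 ^ k)) \<le> S" "norm (y s - y (real (\<pi> i2) / 2 ^ k)) \<le> S" "norm (y t - y (real (\<pi> i3) / 2 ^ k)) \<le> S"
    unfolding i S_def using le i3T by (auto intro!: \<pi>(1))
  have m: "\<pi> i1 \<le> \<pi> i2" "\<pi> i2 \<le> \<pi> i3" using le by (auto intro: \<pi>(4))
  define c where "c = i1 div 2 ^ d"
  have "c * 2 ^ d \<le> i1" by (simp add: c_def)
  then have c1: "c \<le> \<pi> i1" by (rule \<pi>(2))
  have "i1 < (c + 1) * 2 ^ d"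
  proof -
    have "i1 mod 2 ^ d < 2 ^ d" by simp
    then have "i1 < c * 2 ^ d + 2 ^ d" using div_mult_mod_eq[of i1 "2 ^ d"] unfolding c_def by linarith
    then show ?thesis by simp
  qed
  then have "i3 \<le> (c + 2) * 2 ^ d" using i31 by (simp add: algebra_simps)
  then have c3: "\<pi> i3 \<le> c + 2" by (rule \<pi>(3))
  have "i3 \<le> (T * 2 ^ k) * 2 ^ d" using i3T by (simp add: power_add mult_ac)
  then have cT: "\<pi> i3 \<le> T * 2 ^ k" by (rule \<pi>(3))
  have tri: "norm (u - v) \<le> S + q + S" if "norm (u - u') \<le> S" "norm (v - v') \<le> S" "norm (u' - v') \<le> q" for u u' v v' :: 'a and q
  proof -
    have "norm (u - v) \<le> norm (u - u') + norm (u' - v') + norm (v' - v)"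
      using norm_triangle_ineq[of "u - u'" "(u' - v') + (v' - v)"] norm_triangle_ineq[of "u' - v'" "v' - v"] by simp
    then show ?thesis using that by (simp add: norm_minus_commute)
  qed
  have A: "2 * S \<le> 2 * (\<Sum>j. a (j + k))" "2 * S + a k \<le> 2 * (\<Sum>j. a (j + k))" using SS a(1)[of k] by linarith+
  consider "\<pi> i1 = \<pi> i2" | "\<pi> i2 = \<pi> i3" | "\<pi> i1 = c" "\<pi> i2 = c + 1" "\<pi> i3 = c + 2"
    using m c1 c3 by linarith
  then show ?thesis
  proof cases
    case 1
    then have "norm (y s - y r) \<le> S + 0 + S" using e by (intro tri) auto
    then show ?thesis using A by linarith
  next
    case 2
    then have "norm (y t - y s) \<le> S + 0 + S" using e by (intro tri) auto
    then show ?thesis using A by linarith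
  next
    case 3
    have "min (norm (y (real (c + 1) / 2 ^ k) - y (real c / 2 ^ k))) (norm (y (real (c + 2) / 2 ^ k) - y (real (c + 1) / 2 ^ k))) \<le> a k"
      using sm[of k] cT 3 unfolding small_min_jumps_def by auto
    then consider "norm (y (real (c + 1) / 2 ^ k) - y (real c / 2 ^ k)) \<le> a k" | "norm (y (real (c + 2) / 2 ^ k) - y (real (c + 1) / 2 ^ k)) \<le> a k"
      by (auto simp: min_le_iff_disj)
    then show ?thesis
    proof cases
      case 1
      have "norm (y s - y r) \<le> S + a k + S" using e 3 1 by (intro tri) auto
      then show ?thesis using A by linarith
    next
      case 2
      have "norm (y t - y s) \<le> S + a k + S" using e 3 2 by (intro tri) auto
      then show ?thesis using A by linarith
    qed
  qed
qed

definition regular_on :: "real set \<Rightarrow> (real \<Rightarrow> 'a::real_normed_vector) \<Rightarrow> bool" where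
  "regular_on D y \<longleftrightarrow> (\<forall>t\<ge>0. \<exists>l. (y \<longlongrightarrow> l) (at t within D \<inter> {t<..})) \<and> (\<forall>t>0. \<exists>l. (y \<longlongrightarrow> l) (at t within D \<inter> {..<t}))"

lemma at_within_dyadics_neq_bot:
  "0 \<le> t ==> at t within dyadics \<inter> {t<..} \<noteq> bot" "0 < t ==> at t within dyadics \<inter> {..<t} \<noteq> bot"
proof -
  show "at t within dyadics \<inter> {t<..} \<noteq> bot" if "0 \<le> t"
    unfolding trivial_limit_within
  proof -
    have "\<exists>x'\<in>dyadics \<inter> {t<..}. x' \<noteq> t \<and> dist x' t < e" if "e > 0" for e
      using dyadic_between[of t "t + e"] \<open>0 \<le> t\<close> that by (force simp: dist_real_def)
    then show "\<not> \<not> t islimpt (dyadics \<inter> {t<..})" by (simp add: islimpt_approachable)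
  qed
  show "at t within dyadics \<inter> {..<t} \<noteq> bot" if "0 < t"
    unfolding trivial_limit_within
  proof -
    have "\<exists>x'\<in>dyadics \<inter> {..<t}. x' \<noteq> t \<and> dist x' t < e" if "e > 0" for e
      using dyadic_between[of "max 0 (t - e)" t] \<open>0 < t\<close> that by (force simp: dist_real_def)
    then show "\<not> \<not> t islimpt (dyadics \<inter> {..<t})" by (simp add: islimpt_approachable)
  qed
qed

text \<open>If the oscillation near \<open>t\<close> on one side did not vanish, there would be two
  disjoint time intervals, arbitrarily close to \<open>t\<close>, with increments of at least
  \<open>eps\<close>. By the three-point estimate the increments that follow the earlier large one
  are small, also those to both ends of the later interval, so its own increment is small: a
  contradiction. For left limits the second pair is chosen to the right of the first, otherwise to
  its left.\<close>

lemma small_min_jumps_imp_regular: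
  fixes y :: "real \<Rightarrow> 'a::euclidean_space"
  assumes sm: "\<And>T. EV k. small_min_jumps y a T k" and a: "\<And>j. 0 \<le> a j" "summable a"
  shows "regular_on dyadics y"
proof -
  have three: "\<exists>\<delta>>0. \<forall>r s u. r \<in> dyadics --> s \<in> dyadics --> u \<in> dyadics --> r \<le> s --> s \<le> u --> u \<le> t + 1 --> u - r < \<delta> -->
      min (norm (y s - y r)) (norm (y u - y s)) < eps" if "eps > 0" for eps t
  proof -
    obtain T :: nat where T: "t + 1 \<le> real T" using real_arch_simple by blast
    obtain k0 where k0: "\<And>k. k \<ge> k0 ==> small_min_jumps y a T k" using sm[of T] by (auto simp: eventually_sequentially)
    have "(\<lambda>k. \<Sum>j. a (j + k)) ----> 0" using suminf_exist_split2[OF a(2)] by simp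
    then have "EV k. (\<Sum>j. a (j + k)) < eps / 2" using \<open>eps > 0\<close> by (intro order_tendstoD) auto
    then obtain k1 where k1: "\<And>k. k \<ge> k1 ==> (\<Sum>j. a (j + k)) < eps / 2" by (auto simp: eventually_sequentially)
    let ?k = "max k0 k1"
    show ?thesis
    proof (intro exI[of _ "1 / 2 ^ ?k"] conjI allI impI)
      fix r s u assume *: "r \<in> dyadics" "s \<in> dyadics" "u \<in> dyadics" "r \<le> s" "s \<le> u" "u \<le> t + 1" "u - r < 1 / 2 ^ ?k"
      have "min (norm (y s - y r)) (norm (y u - y s)) \<le> 2 * (\<Sum>j. a (j + ?k))"
        by (rule dyadic_three_points[of ?k y a T]) (use * T k0 a in auto)
      then show "min (norm (y s - y r)) (norm (y u - y s)) < eps" using k1[of ?k] by simp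
    qed simp
  qed
  have tri: "norm (c - b) < 2 * eps" if "norm (c - x) < eps" "norm (b - x) < eps" for b c x :: 'a and eps
    using norm_triangle_ineq4[of "c - x" "b - x"] that by simp
  show ?thesis
    unfolding regular_on_def
  proof (intro conjI allI impI)
    fix t :: real assume t: "t \<ge> 0"
    show "\<exists>l. (y \<longlongrightarrow> l) (at t within dyadics \<inter> {t<..})"
    proof (rule tendsto_from_approximants[OF at_within_dyadics_neq_bot(1)[OF t]])
      fix eps :: real assume "eps > 0"
      then obtain \<delta> where \<delta>: "\<delta> > 0" "\<And>r s u. r \<in> dyadics ==> s \<in> dyadics ==> u \<in> dyadics ==> r \<le> s ==> s \<le> u ==> u \<le> t + 1 ==> u - r < \<delta> ==>
        min (norm (y s - y r)) (norm (y u - y s)) < eps / 2" using three[of "eps/2" t] by auto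
      define \<delta>' where "\<delta>' = min \<delta> 1"
      have "\<exists>\<theta>>0. \<forall>p q. p \<in> dyadics --> q \<in> dyadics --> t < p --> p \<le> q --> q < t + \<theta> --> norm (y q - y p) < eps"
      proof (rule ccontr)
        assume "\<not> ?thesis"
        then have neg: "\<exists>p q. p \<in> dyadics \<and> q \<in> dyadics \<and> t < p \<and> p \<le> q \<and> q < t + \<theta> \<and> norm (y q - y p) \<ge> eps" if "\<theta> > 0" for \<theta>
          using that by (meson not_le)
        obtain p1 q1 where 1: "p1 \<in> dyadics" "q1 \<in> dyadics" "t < p1" "p1 \<le> q1" "q1 < t + \<delta>'" "norm (y q1 - y p1) \<ge> eps"
          using neg[of \<delta>'] \<delta>(1) by (auto simp: \<delta>'_def)
        obtain p0 q0 where 0: "p0 \<in> dyadics" "q0 \<in> dyadics" "t < p0" "p0 \<le> q0" "q0 < p1" "norm (y q0 - y p0) \<ge> eps"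
          using neg[of "p1 - t"] 1(3) by auto
        have "min (norm (y q0 - y p0)) (norm (y p1 - y q0)) < eps / 2" "min (norm (y q0 - y p0)) (norm (y q1 - y q0)) < eps / 2"
          by (rule \<delta>(2); use 0 1 in \<open>simp add: \<delta>'_def\<close>)+
        then have "norm (y p1 - y q0) < eps / 2" "norm (y q1 - y q0) < eps / 2" using 0(6) \<open>eps > 0\<close> by (auto simp: min_less_iff_disj)
        then show False using tri[of "y q1" "y q0" "eps/2" "y p1"] 1(6) by simp
      qed
      then obtain \<theta> where \<theta>: "\<theta> > 0" "\<And>p q. p \<in> dyadics ==> q \<in> dyadics ==> t < p ==> p \<le> q ==> q < t + \<theta> ==> norm (y q - y p) < eps"
        by blast
      obtain d where d: "d \<in> dyadics" "t < d" "d < t + \<theta>" using dyadic_between[OF t, of "t + \<theta>"] \<theta>(1) by auto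
      have "\<forall>\<^sub>F h in at t within dyadics \<inter> {t<..}. dist (y h) (y d) \<le> eps"
        unfolding eventually_at
      proof (intro exI[of _ \<theta>] conjI \<theta>(1) ballI impI)
        fix h assume h: "h \<in> dyadics \<inter> {t<..}" "h \<noteq> t \<and> dist h t < \<theta>"
        then have "t < h" "h < t + \<theta>" "h \<in> dyadics" by (auto simp: dist_real_def)
        then show "dist (y h) (y d) \<le> eps"
          using \<theta>(2)[of h d] \<theta>(2)[of d h] d by (cases "h \<le> d") (auto simp: dist_norm norm_minus_commute less_imp_le)
      qed
      then show "\<exists>g L. (g \<longlongrightarrow> L) (at t within dyadics \<inter> {t<..}) \<and> (\<forall>\<^sub>F h in at t within dyadics \<inter> {t<..}. dist (y h) (g h) \<le> eps)"
        by (intro exI[of _ "\<lambda>_. y d"] exI[of _ "y d"]) simp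
    qed
  next
    fix t :: real assume t: "t > 0"
    show "\<exists>l. (y \<longlongrightarrow> l) (at t within dyadics \<inter> {..<t})"
    proof (rule tendsto_from_approximants[OF at_within_dyadics_neq_bot(2)[OF t]])
      fix eps :: real assume "eps > 0"
      then obtain \<delta> where \<delta>: "\<delta> > 0" "\<And>r s u. r \<in> dyadics ==> s \<in> dyadics ==> u \<in> dyadics ==> r \<le> s ==> s \<le> u ==> u \<le> t + 1 ==> u - r < \<delta> ==>
        min (norm (y s - y r)) (norm (y u - y s)) < eps / 2" using three[of "eps/2" t] by auto
      have "\<exists>\<theta>>0. \<forall>p q. p \<in> dyadics --> q \<in> dyadics --> t - \<theta> < p --> p \<le> q --> q < t --> norm (y q - y p) < eps"
      proof (rule ccontr)
        assume "\<not> ?thesis"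
        then have neg: "\<exists>p q. p \<in> dyadics \<and> q \<in> dyadics \<and> t - \<theta> < p \<and> p \<le> q \<and> q < t \<and> norm (y q - y p) \<ge> eps" if "\<theta> > 0" for \<theta>
          using that by (meson not_le)
        obtain p1 q1 where 1: "p1 \<in> dyadics" "q1 \<in> dyadics" "t - \<delta> < p1" "p1 \<le> q1" "q1 < t" "norm (y q1 - y p1) \<ge> eps"
          using neg[of \<delta>] \<delta>(1) by auto
        obtain p0 q0 where 0: "p0 \<in> dyadics" "q0 \<in> dyadics" "q1 < p0" "p0 \<le> q0" "q0 < t" "norm (y q0 - y p0) \<ge> eps"
          using neg[of "t - q1"] 1(5) by auto
        have "min (norm (y q1 - y p1)) (norm (y p0 - y q1)) < eps / 2" "min (norm (y q1 - y p1)) (norm (y q0 - y q1)) < eps / 2"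
          by (rule \<delta>(2); use 0 1 t in simp)+
        then have "norm (y p0 - y q1) < eps / 2" "norm (y q0 - y q1) < eps / 2" using 1(6) \<open>eps > 0\<close> by (auto simp: min_less_iff_disj)
        then show False using tri[of "y q0" "y q1" "eps/2" "y p0"] 0(6) by simp
      qed
      then obtain \<theta> where \<theta>: "\<theta> > 0" "\<And>p q. p \<in> dyadics ==> q \<in> dyadics ==> t - \<theta> < p ==> p \<le> q ==> q < t ==> norm (y q - y p) < eps"
        by blast
      obtain d where d: "d \<in> dyadics" "t - \<theta> < d" "d < t" using dyadic_between[of "max 0 (t - \<theta>)" t] \<theta>(1) t by auto
      have "\<forall>\<^sub>F h in at t within dyadics \<inter> {..<t}. dist (y h) (y d) \<le> eps"
        unfolding eventually_at
      proof (intro exI[of _ \<theta>] conjI \<theta>(1) ballI impI)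
        fix h assume h: "h \<in> dyadics \<inter> {..<t}" "h \<noteq> t \<and> dist h t < \<theta>"
        then have "h < t" "t - \<theta> < h" "h \<in> dyadics" by (auto simp: dist_real_def)
        then show "dist (y h) (y d) \<le> eps"
          using \<theta>(2)[of h d] \<theta>(2)[of d h] d by (cases "h \<le> d") (auto simp: dist_norm norm_minus_commute less_imp_le)
      qed
      then show "\<exists>g L. (g \<longlongrightarrow> L) (at t within dyadics \<inter> {..<t}) \<and> (\<forall>\<^sub>F h in at t within dyadics \<inter> {..<t}. dist (y h) (g h) \<le> eps)"
        by (intro exI[of _ "\<lambda>_. y d"] exI[of _ "y d"]) simp
    qed
  qed
qed

lemma regular_dup_limit:
  assumes "regular_on dyadics y" "0 \<le> t" "(y \<longlongrightarrow> l) (at t within dyadics \<inter> {t<..})"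
  shows "(\<lambda>m. y (dup m t)) ----> l"
proof (rule filterlim_compose[OF assms(3)])
  show "filterlim (\<lambda>m. dup m t) (at t within dyadics \<inter> {t<..}) sequentially"
    unfolding filterlim_at using dup_tendsto dup_bounds(1)[of t] dup_dyadic[OF assms(2)]
    by (auto simp: less_imp_neq[symmetric])
qed

text \<open>Each value of \<open>z\<close> is a limit of dyadic values taken just to the right;
  therefore closeness of \<open>y\<close> to a one-sided limit on an open interval carries over to
  \<open>z\<close> (the fact \<open>near\<close>).\<close>

lemma regular_right_limits_cadlag:
  fixes y z :: "real \<Rightarrow> 'a::euclidean_space"
  assumes reg: "regular_on dyadics y" and z: "\<And>t. t \<ge> 0 ==> (\<lambda>m. y (dup m t)) ----> z t"
  shows "cadlag z"
proof -
  have near: "norm (z s - l) \<le> eps" if s: "s \<ge> 0" "s < b" and c: "\<And>d. d \<in> dyadics ==> s < d ==> d < b ==> norm (y d - l) \<le> eps" for s b l eps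
  proof -
    have "EV m. dup m s < b" using order_tendstoD(2)[OF dup_tendsto s(2)] .
    then have "EV m. norm (y (dup m s) - l) \<le> eps"
      by eventually_elim (use c dup_dyadic[OF s(1)] dup_bounds(1) in auto)
    moreover have "(\<lambda>m. norm (y (dup m s) - l)) ----> norm (z s - l)" by (intro tendsto_intros z s)
    ultimately show ?thesis by (intro tendsto_upperbound[of _ _ sequentially]) auto
  qed
  show ?thesis
    unfolding cadlag_def
  proof (intro conjI allI impI)
    fix t :: real assume t: "0 \<le> t"
    obtain l where l: "(y \<longlongrightarrow> l) (at t within dyadics \<inter> {t<..})" using reg t unfolding regular_on_def by blast
    have zl: "z t = l" using LIMSEQ_unique[OF z[OF t] regular_dup_limit[OF reg t l]] .
    show "continuous (at_right t) z"
      unfolding continuous_within zl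
    proof (rule tendstoI)
      fix eps :: real assume "eps > 0"
      then have "\<forall>\<^sub>F x in at t within dyadics \<inter> {t<..}. dist (y x) l < eps / 2" using l by (intro tendstoD) auto
      then obtain \<delta> where \<delta>: "\<delta> > 0" "\<And>x. x \<in> dyadics ==> t < x ==> x < t + \<delta> ==> norm (y x - l) < eps / 2"
        by (force simp: eventually_at dist_real_def dist_norm)
      have "dist (z s) l < eps" if "t < s" "s < t + \<delta>" for s
        using near[of s "t + \<delta>" l "eps/2"] that t \<delta>(2) \<open>eps > 0\<close> by (force simp: dist_norm less_imp_le)
      then show "\<forall>\<^sub>F s in at_right t. dist (z s) l < eps"
        using \<delta>(1) by (auto simp: eventually_at_right_field intro!: exI[of _ "t + \<delta>"])
    qed
  next
    fix t :: real assume t: "0 < t"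
    obtain l where l: "(y \<longlongrightarrow> l) (at t within dyadics \<inter> {..<t})" using reg t unfolding regular_on_def by blast
    have "(z \<longlongrightarrow> l) (at_left t)"
    proof (rule tendstoI)
      fix eps :: real assume "eps > 0"
      then have "\<forall>\<^sub>F x in at t within dyadics \<inter> {..<t}. dist (y x) l < eps / 2" using l by (intro tendstoD) auto
      then obtain \<delta> where \<delta>: "\<delta> > 0" "\<And>x. x \<in> dyadics ==> x < t ==> t - \<delta> < x ==> norm (y x - l) < eps / 2"
        by (force simp: eventually_at dist_real_def dist_norm)
      have "dist (z s) l < eps" if "max 0 (t - \<delta>) < s" "s < t" for s
        using near[of s t l "eps/2"] that t \<delta>(2) \<open>eps > 0\<close> by (force simp: dist_norm less_imp_le)
      then show "\<forall>\<^sub>F s in at_left t. dist (z s) l < eps"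
        using \<delta>(1) t by (auto simp: eventually_at_left_field intro!: exI[of _ "max 0 (t - \<delta>)"])
    qed
    then show "\<exists>l. (z \<longlongrightarrow> l) (at_left t)" ..
  qed
qed

section \<open>Existence of the L\'evy process\<close>

text \<open>For \<open>l > 0\<close> a continuous function between the indicators of
  \<open>norm y \<ge> l\<close> and of \<open>norm y > l / 2\<close>, so that tail bounds pass to
  weak limits.\<close>

definition cut :: "real \<Rightarrow> 'a::real_normed_vector \<Rightarrow> real" where
  "cut l y = max 0 (min 1 (2 * norm y / l - 1))"

lemma cut_bounds: "0 \<le> cut l y" "cut l y \<le> 1" by (auto simp: cut_def)

lemma abs_cut_le [simp]: "\<bar>cut l y\<bar> \<le> 1" using cut_bounds[of l y] by linarith

lemma cut_eq_1: "0 < l ==> l \<le> norm y ==> cut l y = 1" by (simp add: cut_def field_simps)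

lemma cut_eq_0: "0 < l ==> norm y \<le> l / 2 ==> cut l y = 0" by (simp add: cut_def field_simps)

lemma cut_bcontfun: "0 < l ==> cut l \<in> bcontfun"
  by (rule bcontfunI[of _ 1]) (auto simp: cut_def[abs_def] intro!: continuous_intros)

lemma cut_measurable [measurable]: "cut l \<in> borel_measurable borel"
  unfolding cut_def[abs_def] by measurable

definition step_index :: "nat \<Rightarrow> real \<Rightarrow> nat" where "step_index n t = nat \<lfloor>t * 2 ^ n\<rfloor>"

lemma step_index_le: "0 \<le> t ==> real (step_index n t) * (1 / 2 ^ n) \<le> t"
  by (simp add: step_index_def field_simps)

lemma step_index_of_nat: "step_index n (real i / 2 ^ n) = i" by (simp add: step_index_def)

lemma step_index_tendsto:
  assumes "t \<in> dyadics" "strict_mono r"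
  shows "(\<lambda>n. real (step_index (r n) t) * (1 / 2 ^ r n)) ----> t"
proof -
  obtain k0 where k0: "\<And>n. n \<ge> k0 ==> \<exists>i::nat. t = real i / 2 ^ n" using dyadics_common_level[OF assms(1)] by blast
  have "EV n. real (step_index (r n) t) * (1 / 2 ^ r n) = t"
    unfolding eventually_sequentially
  proof (intro exI[of _ k0] allI impI)
    fix n assume "n \<ge> k0"
    then have "r n \<ge> k0" using seq_suble[OF assms(2), of n] by linarith
    then obtain i :: nat where "t = real i / 2 ^ r n" using k0 by blast
    then show "real (step_index (r n) t) * (1 / 2 ^ r n) = t" by (simp add: step_index_of_nat)
  qed
  then show ?thesis by (rule tendsto_eventually)
qed

lemma step_index_diff:
  assumes "s \<in> dyadics" "t \<in> dyadics" "s \<le> t"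
  shows "\<exists>n0. \<forall>n\<ge>n0. step_index n t - step_index n s = step_index n (t - s)"
proof -
  obtain k0 where k0: "\<And>n. n \<ge> k0 ==> \<exists>i::nat. s = real i / 2 ^ n" using dyadics_common_level[OF assms(1)] by blast
  obtain k1 where k1: "\<And>n. n \<ge> k1 ==> \<exists>i::nat. t = real i / 2 ^ n" using dyadics_common_level[OF assms(2)] by blast
  have "step_index n t - step_index n s = step_index n (t - s)" if n: "n \<ge> max k0 k1" for n
  proof -
    obtain i j :: nat where ij: "s = real i / 2 ^ n" "t = real j / 2 ^ n" using k0[of n] k1[of n] n by auto
    then have "real i \<le> real j" using assms(3) by (simp add: divide_le_cancel)
    then have "t - s = real (j - i) / 2 ^ n" unfolding ij by (simp add: diff_divide_distrib of_nat_diff)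
    then show ?thesis unfolding ij(1) by (simp only: ij(2) step_index_of_nat)
  qed
  then show ?thesis by blast
qed

lemma dyadics_diff: "s \<in> dyadics ==> t \<in> dyadics ==> s \<le> t ==> t - s \<in> dyadics"
proof -
  assume st: "s \<in> dyadics" "t \<in> dyadics" "s \<le> t"
  obtain k0 where k0: "\<And>n. n \<ge> k0 ==> \<exists>i::nat. s = real i / 2 ^ n" using dyadics_common_level[OF st(1)] by blast
  obtain k1 where k1: "\<And>n. n \<ge> k1 ==> \<exists>i::nat. t = real i / 2 ^ n" using dyadics_common_level[OF st(2)] by blast
  obtain i j :: nat where ij: "s = real i / 2 ^ (max k0 k1)" "t = real j / 2 ^ (max k0 k1)" using k0[of "max k0 k1"] k1[of "max k0 k1"] by auto
  then have "real i \<le> real j" using st(3) by (simp add: divide_le_cancel)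
  then have "t - s = real (j - i) / 2 ^ (max k0 k1)" unfolding ij by (simp add: diff_divide_distrib of_nat_diff)
  then show ?thesis unfolding dyadics_def by blast
qed

section \<open>Tightness and short-time bounds of the walks\<close>

context jump_family begin

lemma borel_prob_mu: "h > 0 ==> borel_prob (\<mu> h)"
  using prob borel by (simp add: borel_prob_def borel_prob_axioms_def)

lemma walk_tight:
  assumes "eps > 0" "t \<ge> 0"
  shows "\<exists>l>0. \<exists>h1>0. \<forall>h j. 0 < h --> h < h1 --> real j * h \<le> t -->
    measure (iid (\<mu> h)) {\<omega>. norm (psum \<omega> j) > l} \<le> eps"
proof -
  \<comment> \<open>Half of \<open>eps\<close> is spent on big jumps during a time of at most
    \<open>t\<close>; the summand 1 avoids a division by 0.\<close>
  define e where "e = eps / (2 * (t + 1))"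
  have e: "e > 0" using assms by (simp add: e_def)
  obtain K C h1 where K: "K > 0" "C \<ge> 0" "h1 > 0" and *: "\<And>h. 0 < h ==> h < h1 ==>
    measure (\<mu> h) {y. norm y > K} \<le> e * h \<and> norm (LINT y|\<mu> h. trunc K y) \<le> C * h \<and> (LINT y|\<mu> h. (norm (trunc K y))\<^sup>2) \<le> C * h"
    using truncated_moments[OF e] by auto
  \<comment> \<open>Makes the second moment term at most \<open>eps / 2\<close>; the summand 1 keeps
    \<open>l\<close> positive.\<close>
  define l where "l = sqrt (2 * (C * t + (C * t)\<^sup>2) / eps + 1)"
  have q: "0 \<le> C * t + (C * t)\<^sup>2" using K assms by simp
  have l: "l > 0" "l\<^sup>2 = 2 * (C * t + (C * t)\<^sup>2) / eps + 1"
    using q assms by (auto simp: l_def add_nonneg_pos)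
  have "measure (iid (\<mu> h)) {\<omega>. norm (psum \<omega> j) > l} \<le> eps" if h: "0 < h" "h < h1" and jh: "real j * h \<le> t" for h j
  proof -
    interpret borel_prob "\<mu> h" using borel_prob_mu h by simp
    have "measure (iid (\<mu> h)) {\<omega>. norm (psum \<omega> j) > l} \<le>
      real j * measure (\<mu> h) {y. norm y > K} + (C * (real j * h) + (C * (real j * h))\<^sup>2) / l\<^sup>2"
      by (rule walk_tail) (use K h l * in auto)
    also have "\<dots> \<le> real j * (e * h) + (C * t + (C * t)\<^sup>2) / l\<^sup>2"
    proof (rule add_mono)
      show "real j * measure (\<mu> h) {y. norm y > K} \<le> real j * (e * h)" using * h by (intro mult_left_mono) auto
      have "C * (real j * h) \<le> C * t" using jh K by (intro mult_left_mono) auto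
      then show "(C * (real j * h) + (C * (real j * h))\<^sup>2) / l\<^sup>2 \<le> (C * t + (C * t)\<^sup>2) / l\<^sup>2"
        using K h by (intro divide_right_mono add_mono power_mono) auto
    qed
    also have "real j * (e * h) \<le> eps / 2"
    proof -
      have "real j * (e * h) = e * (real j * h)" by simp
      also have "\<dots> \<le> e * (t + 1)" using e jh by (intro mult_left_mono) auto
      also have "\<dots> = eps / 2" using assms by (simp add: e_def field_simps)
      finally show ?thesis .
    qed
    also have "(C * t + (C * t)\<^sup>2) / l\<^sup>2 \<le> eps / 2"
    proof -
      have "eps / 2 * l\<^sup>2 = (C * t + (C * t)\<^sup>2) + eps / 2" unfolding l(2) using assms by (simp add: field_simps)
      then have "C * t + (C * t)\<^sup>2 \<le> eps / 2 * l\<^sup>2" using assms by simp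
      then show ?thesis using l(1) by (simp add: pos_divide_le_eq)
    qed
    finally show ?thesis by simp
  qed
  then show ?thesis using l(1) K(3) by blast
qed

text \<open>What matters is the linear rate in the elapsed time: two adjacent independent increments
  then both exceed \<open>l\<close> with a probability of second order, which path regularity
  requires. For times and levels at most 1 every term is dominated by the elapsed time divided by
  \<open>l^2\<close>.\<close>

lemma walk_small_time:
  "\<exists>C\<ge>0. \<exists>h1>0. \<forall>h j l. 0 < h --> h < h1 --> real j * h \<le> 1 --> 0 < l --> l \<le> 1 -->
    measure (iid (\<mu> h)) {\<omega>. norm (psum \<omega> j) > l} \<le> C * (real j * h) / l\<^sup>2"
proof -
  obtain K C h1 where K: "K > 0" "C \<ge> 0" "h1 > 0" and *: "\<And>h. 0 < h ==> h < h1 ==>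
    measure (\<mu> h) {y. norm y > K} \<le> 1 * h \<and> norm (LINT y|\<mu> h. trunc K y) \<le> C * h \<and> (LINT y|\<mu> h. (norm (trunc K y))\<^sup>2) \<le> C * h"
    using truncated_moments[of 1] by auto
  have "measure (iid (\<mu> h)) {\<omega>. norm (psum \<omega> j) > l} \<le> (1 + C + C\<^sup>2) * (real j * h) / l\<^sup>2"
    if h: "0 < h" "h < h1" and jh: "real j * h \<le> 1" and l: "0 < l" "l \<le> 1" for h j l
  proof -
    interpret borel_prob "\<mu> h" using borel_prob_mu h by simp
    have l2: "0 < l\<^sup>2" "l\<^sup>2 \<le> 1" using l by (auto simp: power_le_one)
    have jh0: "0 \<le> real j * h" using h by simp
    have "measure (iid (\<mu> h)) {\<omega>. norm (psum \<omega> j) > l} \<le>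
      real j * measure (\<mu> h) {y. norm y > K} + (C * (real j * h) + (C * (real j * h))\<^sup>2) / l\<^sup>2"
      by (rule walk_tail) (use K h l * in auto)
    also have "\<dots> \<le> (real j * h) / l\<^sup>2 + (C * (real j * h) + C\<^sup>2 * (real j * h)) / l\<^sup>2"
    proof (rule add_mono)
      have "real j * measure (\<mu> h) {y. norm y > K} \<le> real j * h" using * h by (intro mult_left_mono) auto
      also have "\<dots> \<le> (real j * h) / l\<^sup>2" using l2 jh0 by (simp add: pos_le_divide_eq mult_left_le)
      finally show "real j * measure (\<mu> h) {y. norm y > K} \<le> (real j * h) / l\<^sup>2" .
      have "(real j * h)\<^sup>2 \<le> real j * h" using jh jh0 by (simp add: power2_eq_square mult_left_le)
      then have "(C * (real j * h))\<^sup>2 \<le> C\<^sup>2 * (real j * h)" by (simp add: power_mult_distrib mult_left_mono)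
      then show "(C * (real j * h) + (C * (real j * h))\<^sup>2) / l\<^sup>2 \<le> (C * (real j * h) + C\<^sup>2 * (real j * h)) / l\<^sup>2"
        by (intro divide_right_mono add_mono) auto
    qed
    finally show ?thesis by (simp add: add_divide_distrib algebra_simps)
  qed
  moreover have "0 \<le> 1 + C + C\<^sup>2" using K by simp
  ultimately show ?thesis using K(3) by blast
qed

end

text \<open>The theorem asks for a sample space of functions, whereas the limit process lives on the reals.\<close>

lemma embed_path_space:
  fixes S :: "real measure"
  assumes "prob_space S"
  shows "\<exists>(M :: (real \<Rightarrow> 'a::euclidean_space) measure) \<kappa>. prob_space M \<and> \<kappa> \<in> measurable M S \<and> distr M S \<kappa> = S"
proof -
  obtain b :: 'a where b: "b \<in> Basis" using nonempty_Basis by blast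
  define \<iota> :: "real \<Rightarrow> real \<Rightarrow> 'a" where "\<iota> u = (\<lambda>t. u *\<^sub>R b)" for u
  define \<kappa> where "\<kappa> \<omega> = \<omega> 0 \<bullet> b" for \<omega> :: "real \<Rightarrow> 'a"
  have \<kappa>\<iota>: "\<kappa> (\<iota> u) = u" for u using b by (simp add: \<iota>_def \<kappa>_def)
  have inj: "inj \<iota>" using \<kappa>\<iota> by (metis injI)
  define M where "M = embed_measure S \<iota>"
  have \<iota>m: "\<iota> \<in> measurable S M" unfolding M_def by (rule measurable_embed_measure2[OF inj])
  have \<kappa>m: "\<kappa> \<in> measurable M S" unfolding M_def by (rule measurable_embed_measure1) (simp add: \<kappa>\<iota>)
  have M: "M = distr S M \<iota>" using embed_measure_eq_distr[OF inj, of S] by (simp add: M_def)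
  have "prob_space M" using prob_space.prob_space_distr[OF assms \<iota>m] M by simp
  moreover have "distr M S \<kappa> = S"
  proof -
    have "distr M S \<kappa> = distr (distr S M \<iota>) S \<kappa>" using M by simp
    also have "\<dots> = distr S S (\<kappa> \<circ> \<iota>)" by (rule distr_distr[OF \<kappa>m \<iota>m])
    also have "\<dots> = S" by (simp add: comp_def \<kappa>\<iota> distr_id)
    finally show ?thesis .
  qed
  ultimately show ?thesis using \<kappa>m by blast
qed

lemma eventually_tight_imp_tight:
  fixes P :: "nat \<Rightarrow> real \<Rightarrow> real"
  assumes ev: "\<exists>K. EV n. P n K \<le> eps" and each: "\<And>n. \<exists>K. P n K \<le> eps"
    and mono: "\<And>n K K'. K \<le> K' ==> P n K' \<le> P n K"
  shows "\<exists>K. \<forall>n. P n K \<le> eps"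
proof -
  obtain K N where K: "\<And>n. n \<ge> N ==> P n K \<le> eps" using ev by (auto simp: eventually_sequentially)
  obtain k where k: "\<And>n. P n (k n) \<le> eps" using each by metis
  define L where "L = Max (insert K (k ` {..<N}))"
  have "P n L \<le> eps" for n
  proof (cases "n < N")
    case True
    then have "k n \<le> L" by (auto simp: L_def intro!: Max_ge)
    then show ?thesis using mono[of "k n" L n] k[of n] by linarith
  next
    case False
    have "K \<le> L" by (auto simp: L_def intro!: Max_ge)
    then show ?thesis using mono[of K L n] K[of n] False by linarith
  qed
  then show ?thesis by blast
qed

lemma random_variable_tight:
  fixes X :: "'w \<Rightarrow> real"
  assumes "prob_space M" "X \<in> borel_measurable M" "eps > 0"
  shows "\<exists>K. measure M {\<omega> \<in> space M. \<bar>X \<omega>\<bar> > K} \<le> eps"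
proof -
  interpret prob_space M by fact
  obtain R where R: "measure (distr M borel X) {x. norm x > R} \<le> eps"
    using norm_tail_tendsto_0[of "distr M borel X" eps] prob_space_distr[OF assms(2)] assms(3) by auto
  have "measure (distr M borel X) {x. norm x > R} = measure M (X -` {x. norm x > R} \<inter> space M)"
    by (rule measure_distr[OF assms(2)]) auto
  also have "X -` {x. norm x > R} \<inter> space M = {\<omega> \<in> space M. \<bar>X \<omega>\<bar> > R}" by auto
  finally show ?thesis using R by auto
qed

lemma bcontfun_cos: "(\<lambda>y::'a::euclidean_space. cos (u \<bullet> y)) \<in> bcontfun" and bcontfun_sin: "(\<lambda>y::'a. sin (u \<bullet> y)) \<in> bcontfun"
  by (auto intro!: bcontfunI[of _ 1] continuous_intros)

section \<open>The limit process at dyadic times\<close>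

context jump_family begin

text \<open>A weak limit of the walks with steps from \<open>\<mu> (1 / 2 ^ n)\<close>. Its
  properties are stated as expectations of bounded continuous functions because these pass to the
  limit; proper independence and path regularity are extracted afterwards.\<close>

lemma dyadic_process:
  obtains S :: "(real \<Rightarrow> 'a) measure" and Y :: "real \<Rightarrow> (real \<Rightarrow> 'a) \<Rightarrow> 'a" where
    "prob_space S" "\<And>t. Y t \<in> borel_measurable S"
    "\<And>t f n. (\<And>l. l \<le> n ==> t l \<in> dyadics) ==> (\<And>l. l < n ==> t l \<le> t (Suc l)) ==> (\<And>l::nat. (f l :: 'a \<Rightarrow> real) \<in> bcontfun) ==>
      (LINT \<omega>|S. (\<Prod>l<n. f l (Y (t (Suc l)) \<omega> - Y (t l) \<omega>))) = (\<Prod>l<n. (LINT \<omega>|S. f l (Y (t (Suc l) - t l) \<omega>)))"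
    "\<And>t u. t \<in> dyadics ==> charf (distr S borel (Y t)) u = exp (of_real t * \<eta> u)"
    "\<exists>C\<ge>0. \<forall>t l. t \<in> dyadics --> t \<le> 1 --> 0 < l --> l \<le> 1 --> (LINT \<omega>|S. cut l (Y t \<omega>)) \<le> C * t / l\<^sup>2"
proof -
  define h where "h n = 1 / (2::real) ^ n" for n
  have h0: "h n > 0" for n by (simp add: h_def)
  define W where "W n \<omega> t = psum \<omega> (step_index n t)" for n t and \<omega> :: "nat \<Rightarrow> 'a"
  \<comment> \<open>An index \<open>c\<close> codes a dyadic time together with a basis vector, so
    the walk at all dyadic times is a single sequence of reals; \<open>YY\<close> reassembles the
    vectors.\<close>
  define X :: "nat \<Rightarrow> (nat \<Rightarrow> 'a) \<Rightarrow> nat \<Rightarrow> real" where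
    "X n \<omega> c = W n \<omega> (from_nat_into dyadics (fst (prod_decode c))) \<bullet> from_nat_into Basis (snd (prod_decode c))" for n \<omega> c
  define YY :: "(nat \<Rightarrow> real) \<Rightarrow> real \<Rightarrow> 'a" where
    "YY z t = (\<Sum>b\<in>Basis. z (prod_encode (to_nat_on dyadics t, to_nat_on Basis b)) *\<^sub>R b)" for z t
  have cB: "countable (Basis :: 'a set)" by (simp add: countable_finite)
  have YYX: "YY (X n \<omega>) t = W n \<omega> t" if "t \<in> dyadics" for n \<omega> t
    unfolding YY_def X_def using that cB countable_dyadics
    by (simp add: from_nat_into_to_nat_on euclidean_representation cong: sum.cong)
  have bp: "borel_prob (\<mu> (h n))" for n using borel_prob_mu h0 by simp
  have Wm: "(\<lambda>\<omega>. W n \<omega> t) \<in> borel_measurable (iid (\<mu> (h n)))" for n t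
  proof -
    interpret borel_prob "\<mu> (h n)" by (rule bp)
    show ?thesis unfolding W_def by (rule walk_measurable) simp
  qed
  have Xm: "(\<lambda>\<omega>. X n \<omega> c) \<in> borel_measurable (iid (\<mu> (h n)))" for n c
    unfolding X_def using Wm by measurable
  have P: "prob_space (iid (\<mu> (h n)))" for n using borel_prob.prob_space_iid[OF bp] .
  have sp: "space (iid (\<mu> (h n))) = UNIV" for n using borel_prob.space_iid[OF bp] .
  have hev: "EV n. h n < e" if "e > 0" for e
  proof -
    have "(\<lambda>n. (1/2::real) ^ n) ----> 0" by (rule LIMSEQ_realpow_zero) auto
    then have "h ----> 0" by (simp add: h_def[abs_def] power_divide)
    then show ?thesis using that by (rule order_tendstoD)
  qed
  have tight: "\<exists>K. \<forall>n. measure (iid (\<mu> (h n))) {\<omega> \<in> space (iid (\<mu> (h n))). \<bar>X n \<omega> c\<bar> > K} \<le> eps" if eps: "eps > 0" for c eps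
  proof (rule eventually_tight_imp_tight)
    define t where "t = from_nat_into dyadics (fst (prod_decode c))"
    define b :: 'a where "b = from_nat_into Basis (snd (prod_decode c))"
    have "dyadics \<noteq> {}" by (auto simp: dyadics_def)
    then have t: "t \<in> dyadics" unfolding t_def by (rule from_nat_into)
    have b: "b \<in> Basis" unfolding b_def using nonempty_Basis by (rule from_nat_into)
    obtain l h1 where lh: "l > 0" "h1 > 0" "\<And>h j. 0 < h ==> h < h1 ==> real j * h \<le> t ==>
        measure (iid (\<mu> h)) {\<omega>. norm (psum \<omega> j) > l} \<le> eps"
      using walk_tight[OF eps dyadics_nonneg[OF t]] by blast
    have "EV n. measure (iid (\<mu> (h n))) {\<omega> \<in> space (iid (\<mu> (h n))). \<bar>X n \<omega> c\<bar> > l} \<le> eps"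
      using hev[OF lh(2)]
    proof eventually_elim
      case (elim n)
      interpret borel_prob "\<mu> (h n)" by (rule bp)
      have "measure (iid (\<mu> (h n))) {\<omega>. \<bar>X n \<omega> c\<bar> > l} \<le> measure (iid (\<mu> (h n))) {\<omega>. norm (W n \<omega> t) > l}"
      proof (rule seq.P.finite_measure_mono)
        show "{\<omega>. \<bar>X n \<omega> c\<bar> > l} \<subseteq> {\<omega>. norm (W n \<omega> t) > l}"
          using Basis_le_norm[OF b] unfolding X_def t_def[symmetric] b_def[symmetric] by (auto intro: less_le_trans)
        show "{\<omega>. norm (W n \<omega> t) > l} \<in> sets (iid (\<mu> (h n)))"
          using iid_sets[OF Wm, of "{y. norm y > l}"] by simp
      qed
      also have "\<dots> \<le> eps" unfolding W_def
        using step_index_le[OF dyadics_nonneg[OF t], of n] elim h0 by (intro lh(3)) (auto simp: h_def)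
      finally show ?case by simp
    qed
    then show "\<exists>K. EV n. measure (iid (\<mu> (h n))) {\<omega> \<in> space (iid (\<mu> (h n))). \<bar>X n \<omega> c\<bar> > K} \<le> eps" by blast
    show "\<exists>K. measure (iid (\<mu> (h n))) {\<omega> \<in> space (iid (\<mu> (h n))). \<bar>X n \<omega> c\<bar> > K} \<le> eps" for n
      by (rule random_variable_tight[OF P Xm eps])
    show "measure (iid (\<mu> (h n))) {\<omega> \<in> space (iid (\<mu> (h n))). \<bar>X n \<omega> c\<bar> > K'} \<le> measure (iid (\<mu> (h n))) {\<omega> \<in> space (iid (\<mu> (h n))). \<bar>X n \<omega> c\<bar> > K}"
      if "K \<le> K'" for n K K'
    proof -
      interpret prob_space "iid (\<mu> (h n))" by (rule P)
      note Xm[of n c, measurable]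
      show ?thesis by (rule finite_measure_mono) (use that in auto)
    qed
  qed
  show ?thesis
  proof (rule sequence_compactness[of "\<lambda>n. iid (\<mu> (h n))" X, OF P Xm tight])
    fix eps :: real assume "0 < eps" then show "0 < eps" .
  next
  fix r and S0 :: "real measure" and Z
  assume r: "strict_mono r" and S0: "prob_space S0" and Zm0: "\<And>i. (\<lambda>\<omega>. Z \<omega> i) \<in> borel_measurable S0"
    and lim: "\<And>G B. G \<in> borel_measurable (PiM UNIV (\<lambda>_. borel)) ==> (\<And>x. \<bar>G x\<bar> \<le> (B::real)) ==>
      (\<And>xs x. (\<And>i. (\<lambda>n. xs n i) ----> x i) ==> (\<lambda>n. G (xs n)) ----> G x) ==>
      (\<lambda>n. LINT \<omega>|iid (\<mu> (h (r n))). G (X (r n) \<omega>)) ----> (LINT \<omega>|S0. G (Z \<omega>))"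
  obtain S :: "(real \<Rightarrow> 'a) measure" and \<kappa> where S: "prob_space S" and \<kappa>: "\<kappa> \<in> measurable S S0" and d\<kappa>: "distr S S0 \<kappa> = S0"
    using embed_path_space[OF S0] by blast
  interpret S: prob_space S by (rule S)
  define Y where "Y t \<omega> = YY (Z (\<kappa> \<omega>)) t" for t \<omega>
  have Zm: "(\<lambda>\<omega>. Z (\<kappa> \<omega>) i) \<in> borel_measurable S" for i using measurable_compose[OF \<kappa> Zm0] .
  have Ym: "Y t \<in> borel_measurable S" for t
    unfolding Y_def[abs_def] YY_def using Zm by measurable
  have YYm: "(\<lambda>z. YY z t) \<in> borel_measurable (PiM UNIV (\<lambda>_. borel))" for t
    unfolding YY_def by measurable
  have YYc: "(\<lambda>n. YY (xs n) t) ----> YY x t" if "\<And>i. (\<lambda>n. xs n i) ----> x i" for xs x t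
    unfolding YY_def by (intro tendsto_intros that)
  have lim': "(\<lambda>n. LINT \<omega>|iid (\<mu> (h (r n))). G (X (r n) \<omega>)) ----> (LINT \<omega>|S. G (Z (\<kappa> \<omega>)))"
    if G: "G \<in> borel_measurable (PiM UNIV (\<lambda>_. borel))" "\<And>x. \<bar>G x\<bar> \<le> (B::real)"
      "\<And>xs x. (\<And>i. (\<lambda>n. xs n i) ----> x i) ==> (\<lambda>n. G (xs n)) ----> G x" for G B
  proof -
    have "(\<lambda>\<omega>. G (Z \<omega>)) \<in> borel_measurable S0"
      by (rule measurable_compose[OF _ G(1)]) (intro measurable_PiM_single', use Zm0 in auto)
    then have "(LINT \<omega>|distr S S0 \<kappa>. G (Z \<omega>)) = (LINT \<omega>|S. G (Z (\<kappa> \<omega>)))"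
      by (rule integral_distr[OF \<kappa>])
    then show ?thesis using lim[OF G] unfolding d\<kappa> by simp
  qed
  have single: "(\<lambda>n. LINT \<omega>|iid (\<mu> (h (r n))). f (W (r n) \<omega> t)) ----> (LINT \<omega>|S. f (Y t \<omega>))"
    if f: "f \<in> bcontfun" and t: "t \<in> dyadics" for f :: "'a \<Rightarrow> real" and t
  proof -
    obtain B where B: "\<And>x. \<bar>f x\<bar> \<le> B" using bcontfun_bounded[OF f] by blast
    have "(\<lambda>n. LINT \<omega>|iid (\<mu> (h (r n))). f (YY (X (r n) \<omega>) t)) ----> (LINT \<omega>|S. f (YY (Z (\<kappa> \<omega>)) t))"
    proof (rule lim'[of "\<lambda>z. f (YY z t)" B])
      show "(\<lambda>z. f (YY z t)) \<in> borel_measurable (PiM UNIV (\<lambda>_. borel))"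
        by (rule measurable_compose[OF YYm bcontfun_measurable[OF f]])
      show "(\<lambda>n. f (YY (xs n) t)) ----> f (YY x t)" if "\<And>i. (\<lambda>n. xs n i) ----> x i" for xs x
        using f YYc[OF that] unfolding bcontfun_def by (auto intro: continuous_on_tendsto_compose)
    qed (rule B)
    then show ?thesis using t by (simp add: YYX Y_def)
  qed
  show ?thesis
  proof (rule that[OF S Ym])
    fix t :: "nat \<Rightarrow> real" and f :: "nat \<Rightarrow> 'a \<Rightarrow> real" and n
    assume t: "\<And>l. l \<le> n ==> t l \<in> dyadics" and mono: "\<And>l. l < n ==> t l \<le> t (Suc l)" and f: "\<And>l::nat. f l \<in> bcontfun"
    have "\<exists>B. \<forall>x. \<bar>f l x\<bar> \<le> B" for l using bcontfun_bounded[OF f[of l]] by metis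
    then obtain B where B: "\<And>l x. \<bar>f l x\<bar> \<le> B l" by metis
    have "(\<lambda>m. LINT \<omega>|iid (\<mu> (h (r m))). (\<Prod>l<n. f l (YY (X (r m) \<omega>) (t (Suc l)) - YY (X (r m) \<omega>) (t l)))) ---->
      (LINT \<omega>|S. (\<Prod>l<n. f l (YY (Z (\<kappa> \<omega>)) (t (Suc l)) - YY (Z (\<kappa> \<omega>)) (t l))))"
    proof (rule lim'[of "\<lambda>z. (\<Prod>l<n. f l (YY z (t (Suc l)) - YY z (t l)))"  "\<Prod>l<n. B l"])
      show "(\<lambda>z. (\<Prod>l<n. f l (YY z (t (Suc l)) - YY z (t l)))) \<in> borel_measurable (PiM UNIV (\<lambda>_. borel))"
        by (intro borel_measurable_prod measurable_compose[OF _ bcontfun_measurable[OF f]] borel_measurable_diff YYm)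
      show "\<bar>\<Prod>l<n. f l (YY x (t (Suc l)) - YY x (t l))\<bar> \<le> (\<Prod>l<n. B l)" for x
        unfolding abs_prod by (intro prod_mono) (use B in auto)
      show "(\<lambda>n'. \<Prod>l<n. f l (YY (xs n') (t (Suc l)) - YY (xs n') (t l))) ----> (\<Prod>l<n. f l (YY x (t (Suc l)) - YY x (t l)))"
        if "\<And>i. (\<lambda>n. xs n i) ----> x i" for xs x
      proof (rule tendsto_prod)
        fix l
        have "(\<lambda>n'. YY (xs n') (t (Suc l)) - YY (xs n') (t l)) ----> YY x (t (Suc l)) - YY x (t l)"
          by (intro tendsto_diff YYc that)
        then show "(\<lambda>n'. f l (YY (xs n') (t (Suc l)) - YY (xs n') (t l))) ----> f l (YY x (t (Suc l)) - YY x (t l))"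
          using f[of l] unfolding bcontfun_def by (auto intro: continuous_on_tendsto_compose)
      qed
    qed
    then have L1: "(\<lambda>m. LINT \<omega>|iid (\<mu> (h (r m))). (\<Prod>l<n. f l (W (r m) \<omega> (t (Suc l)) - W (r m) \<omega> (t l)))) ---->
      (LINT \<omega>|S. (\<Prod>l<n. f l (Y (t (Suc l)) \<omega> - Y (t l) \<omega>)))" using t by (simp add: YYX Y_def)
    have L2: "(\<lambda>m. \<Prod>l<n. LINT \<omega>|iid (\<mu> (h (r m))). f l (W (r m) \<omega> (t (Suc l) - t l))) ---->
      (\<Prod>l<n. LINT \<omega>|S. f l (Y (t (Suc l) - t l) \<omega>))"
    proof (rule tendsto_prod)
      fix l assume "l \<in> {..<n}"
      then have "t (Suc l) - t l \<in> dyadics" using t mono by (intro dyadics_diff) auto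
      then show "(\<lambda>m. LINT \<omega>|iid (\<mu> (h (r m))). f l (W (r m) \<omega> (t (Suc l) - t l))) ----> (LINT \<omega>|S. f l (Y (t (Suc l) - t l) \<omega>))"
        by (rule single[OF f])
    qed
    \<comment> \<open>Finitely many dyadic times lie on every sufficiently fine grid. From there on
      step counts are additive and the product formula of the walk holds exactly.\<close>
    have "\<exists>n0. \<forall>m\<ge>n0. step_index m (t (Suc l)) - step_index m (t l) = step_index m (t (Suc l) - t l)" if "l < n" for l
      using that t mono by (intro step_index_diff) auto
    then have "\<forall>l\<in>{..<n}. EV m. step_index m (t (Suc l)) - step_index m (t l) = step_index m (t (Suc l) - t l)"
      by (auto simp: eventually_sequentially)
    then have "EV m. \<forall>l\<in>{..<n}. step_index m (t (Suc l)) - step_index m (t l) = step_index m (t (Suc l) - t l)"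
      by (rule eventually_ball_finite[rotated]) simp
    then have "EV m. \<forall>l\<in>{..<n}. step_index (r m) (t (Suc l)) - step_index (r m) (t l) = step_index (r m) (t (Suc l) - t l)"
      using filterlim_subseq[OF r] by (rule eventually_compose_filterlim)
    then have ev: "EV m. (LINT \<omega>|iid (\<mu> (h (r m))). (\<Prod>l<n. f l (W (r m) \<omega> (t (Suc l)) - W (r m) \<omega> (t l))))
        = (\<Prod>l<n. LINT \<omega>|iid (\<mu> (h (r m))). f l (W (r m) \<omega> (t (Suc l) - t l)))"
    proof eventually_elim
      case (elim m)
      interpret borel_prob "\<mu> (h (r m))" by (rule bp)
      have "step_index (r m) (t l) \<le> step_index (r m) (t (Suc l))" if "l < n" for l
        unfolding step_index_def using mono[OF that] by (intro nat_mono floor_mono mult_right_mono) auto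
      then show ?case
        unfolding W_def using bcontfun_measurable[OF f] B elim
        by (subst walk_increments[where B=B]) (auto intro!: prod.cong)
    qed
    show "(LINT \<omega>|S. (\<Prod>l<n. f l (Y (t (Suc l)) \<omega> - Y (t l) \<omega>))) = (\<Prod>l<n. (LINT \<omega>|S. f l (Y (t (Suc l) - t l) \<omega>)))"
      using LIMSEQ_unique[OF Lim_transform_eventually[OF L1 ev] L2] .
  next
    fix t u assume t: "t \<in> dyadics"
    have ns: "null_seq (\<lambda>n. h (r n))"
    proof -
      have "(\<lambda>n. (1/2::real) ^ n) ----> 0" by (rule LIMSEQ_realpow_zero) auto
      then have "h ----> 0" by (simp add: h_def[abs_def] power_divide)
      then show ?thesis unfolding null_seq_def using LIMSEQ_subseq_LIMSEQ[OF _ r, of h] h0 by (auto simp: comp_def)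
    qed
    have "(\<lambda>n. charf (\<mu> (h (r n))) u ^ step_index (r n) t) ----> exp (of_real t * \<eta> u)"
      using step_index_tendsto[OF t r] by (intro charf_power_tendsto[OF ns]) (simp add: h_def)
    moreover have "charf (\<mu> (h (r n))) u ^ step_index (r n) t =
      Complex (LINT \<omega>|iid (\<mu> (h (r n))). cos (u \<bullet> W (r n) \<omega> t)) (LINT \<omega>|iid (\<mu> (h (r n))). sin (u \<bullet> W (r n) \<omega> t))" for n
    proof -
      interpret borel_prob "\<mu> (h (r n))" by (rule bp)
      have d: "prob_space (distr (iid (\<mu> (h (r n)))) borel (\<lambda>\<omega>. W (r n) \<omega> t))"
        using seq.P.prob_space_distr[OF Wm] .
      have "charf (\<mu> (h (r n))) u ^ step_index (r n) t = charf (distr (iid (\<mu> (h (r n)))) borel (\<lambda>\<omega>. W (r n) \<omega> t)) u"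
        unfolding W_def by (rule charf_walk[symmetric])
      then show ?thesis using charf_eq[OF d, of u] by (simp add: integral_distr[OF Wm])
    qed
    moreover have "(\<lambda>n. Complex (LINT \<omega>|iid (\<mu> (h (r n))). cos (u \<bullet> W (r n) \<omega> t)) (LINT \<omega>|iid (\<mu> (h (r n))). sin (u \<bullet> W (r n) \<omega> t)))
      ----> Complex (LINT \<omega>|S. cos (u \<bullet> Y t \<omega>)) (LINT \<omega>|S. sin (u \<bullet> Y t \<omega>))"
      by (intro tendsto_Complex single[OF bcontfun_cos t] single[OF bcontfun_sin t])
    ultimately have "exp (of_real t * \<eta> u) = Complex (LINT \<omega>|S. cos (u \<bullet> Y t \<omega>)) (LINT \<omega>|S. sin (u \<bullet> Y t \<omega>))"
      using LIMSEQ_unique by auto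
    then show "charf (distr S borel (Y t)) u = exp (of_real t * \<eta> u)"
      using charf_eq[of "distr S borel (Y t)" u] S.prob_space_distr[OF Ym] by (simp add: integral_distr[OF Ym])
  next
    obtain C h1 where C: "C \<ge> 0" "h1 > 0" "\<And>h j l. 0 < h ==> h < h1 ==> real j * h \<le> 1 ==> 0 < l ==> l \<le> 1 ==>
      measure (iid (\<mu> h)) {\<omega>. norm (psum \<omega> j) > l} \<le> C * (real j * h) / l\<^sup>2"
      using walk_small_time by blast
    \<comment> \<open>The factor 4 arises because \<open>cut l\<close> is supported where the norm
      exceeds \<open>l / 2\<close>.\<close>
    have "(LINT \<omega>|S. cut l (Y t \<omega>)) \<le> 4 * C * t / l\<^sup>2" if t: "t \<in> dyadics" "t \<le> 1" and l: "0 < l" "l \<le> 1" for t l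
    proof (rule tendsto_upperbound[OF single[OF cut_bcontfun[OF l(1)] t(1)]])
      have "EV n. h (r n) < h1" using hev[OF C(2)] filterlim_subseq[OF r] by (rule eventually_compose_filterlim)
      then show "EV n. (LINT \<omega>|iid (\<mu> (h (r n))). cut l (W (r n) \<omega> t)) \<le> 4 * C * t / l\<^sup>2"
      proof eventually_elim
        case (elim n)
        interpret borel_prob "\<mu> (h (r n))" by (rule bp)
        have st: "{\<omega>. norm (W (r n) \<omega> t) > l / 2} \<in> sets (iid (\<mu> (h (r n))))"
          using iid_sets[OF Wm, of "{y. norm y > l / 2}"] by simp
        have jh: "real (step_index (r n) t) * h (r n) \<le> t"
          using step_index_le[OF dyadics_nonneg[OF t(1)], of "r n"] by (simp add: h_def)
        have "(LINT \<omega>|iid (\<mu> (h (r n))). cut l (W (r n) \<omega> t)) \<le> (LINT \<omega>|iid (\<mu> (h (r n))). indicator {\<omega>. norm (W (r n) \<omega> t) > l / 2} \<omega>)"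
        proof (rule integral_mono)
          show "integrable (iid (\<mu> (h (r n)))) (\<lambda>\<omega>. cut l (W (r n) \<omega> t))"
            by (intro iid_integrable[of _ 1] measurable_compose[OF Wm cut_measurable]) auto
          show "integrable (iid (\<mu> (h (r n)))) (\<lambda>\<omega>. indicator {\<omega>. norm (W (r n) \<omega> t) > l / 2} \<omega> :: real)"
            by (rule iid_integrable[of _ 1], rule borel_measurable_indicator[OF st]) (simp add: indicator_def)
          show "cut l (W (r n) \<omega> t) \<le> indicator {\<omega>. norm (W (r n) \<omega> t) > l / 2} \<omega>" for \<omega>
            using cut_bounds[of l "W (r n) \<omega> t"] cut_eq_0[OF l(1), of "W (r n) \<omega> t"] by (auto simp: indicator_def not_less)
        qed
        also have "\<dots> = measure (iid (\<mu> (h (r n)))) {\<omega>. norm (W (r n) \<omega> t) > l / 2}" by simp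
        also have "\<dots> \<le> C * (real (step_index (r n) t) * h (r n)) / (l / 2)\<^sup>2"
          unfolding W_def using l t jh elim h0 by (intro C(3)) auto
        also have "\<dots> \<le> C * t / (l / 2)\<^sup>2" using jh C(1) by (intro divide_right_mono mult_left_mono) auto
        also have "\<dots> = 4 * C * t / l\<^sup>2" using l by (simp add: power_divide)
        finally show ?case .
      qed
    qed simp
    then show "\<exists>C\<ge>0. \<forall>t l. t \<in> dyadics --> t \<le> 1 --> 0 < l --> l \<le> 1 --> (LINT \<omega>|S. cut l (Y t \<omega>)) \<le> C * t / l\<^sup>2"
      using C(1) by (intro exI[of _ "4 * C"]) auto
  qed
  qed
qed

end

section \<open>Independence and path regularity from product formulas\<close>

text \<open>The continuity theorem for a constant sequence.\<close>

lemma charf_inj: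
  fixes N N' :: "'a::euclidean_space measure"
  assumes N: "prob_space N" "sets N = sets borel" and N': "prob_space N'" "sets N' = sets borel"
    and eq: "\<And>u. charf N u = charf N' u"
  shows "N = N'"
proof (rule measure_eq_blip[OF N N'])
  fix f :: "'a \<Rightarrow> real" and B L assume f: "blip B L f"
  have "(\<lambda>n::nat. LINT x|N. f x) ----> (LINT x|N'. f x)"
  proof (rule charf_tendsto_imp_weak[OF N N'])
    show "(\<lambda>n::nat. charf N u) ----> charf N' u" for u by (simp add: eq)
    show "\<exists>R. \<forall>\<^sub>F n::nat in sequentially. measure N {x. norm x > R} \<le> eps" if "eps > 0" for eps
      using norm_tail_tendsto_0[OF N that] by auto
    show "f \<in> bcontfun" by (rule blip_bcontfun[OF f])
  qed
  then show "(LINT x|N. f x) = (LINT x|N'. f x)" by (simp add: LIMSEQ_const_iff)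
qed

text \<open>Bounded Lipschitz functions converge to indicators of closed sets, so the product
  formula extends to preimages of closed sets; these are intersection-stable and generate the sigma
  algebras of the variables.\<close>

lemma (in prob_space) indep_vars_of_product:
  fixes Z :: "nat \<Rightarrow> 'a \<Rightarrow> 'b::euclidean_space"
  assumes Z: "\<And>l. l < n ==> Z l \<in> borel_measurable M"
    and prod: "\<And>f. (\<And>l::nat. (f l :: 'b \<Rightarrow> real) \<in> bcontfun) ==>
      expectation (\<lambda>\<omega>. \<Prod>l<n. f l (Z l \<omega>)) = (\<Prod>l<n. expectation (\<lambda>\<omega>. f l (Z l \<omega>)))"
  shows "indep_vars (\<lambda>_. borel) Z {..<n}"
proof -
  define E where "E l = {Z l -` C \<inter> space M | C. closed C}" for l
  have closed_prod: "expectation (\<lambda>\<omega>. \<Prod>l<n. indicat_real (C l) (Z l \<omega>)) = (\<Prod>l<n. prob (Z l -` C l \<inter> space M))"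
    if C: "\<And>l. closed (C l)" for C :: "nat \<Rightarrow> 'b set"
  proof -
    have "\<exists>f :: nat \<Rightarrow> 'b \<Rightarrow> real. (\<forall>k. blip 1 (real k) (f k)) \<and> (\<forall>x. (\<lambda>k. f k x) ----> indicator (C l) x)" for l
      using closed_indicator_approx[OF C[of l]] by metis
    then obtain f :: "nat \<Rightarrow> nat \<Rightarrow> 'b \<Rightarrow> real" where f: "\<And>l k. blip 1 (real k) (f l k)"
      "\<And>l x. (\<lambda>k. f l k x) ----> indicator (C l) x" by metis
    have fm: "(\<lambda>\<omega>. f l k (Z l \<omega>)) \<in> borel_measurable M" if "l < n" for l k
      by (rule measurable_compose[OF Z[OF that] bcontfun_measurable[OF blip_bcontfun[OF f(1)]]])
    have im: "(\<lambda>\<omega>. indicat_real (C l) (Z l \<omega>)) \<in> borel_measurable M" if "l < n" for l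
      using C[of l] by (intro measurable_compose[OF Z[OF that]] borel_measurable_indicator) auto
    have f1: "\<bar>f l k x\<bar> \<le> 1" for l k x using f(1)[of k l] by (simp add: blip_def)
    have "(\<lambda>k. expectation (\<lambda>\<omega>. \<Prod>l<n. f l k (Z l \<omega>))) ----> expectation (\<lambda>\<omega>. \<Prod>l<n. indicat_real (C l) (Z l \<omega>))"
    proof (rule integral_dominated_convergence[where w="\<lambda>_. 1"])
      show "(\<lambda>\<omega>. \<Prod>l<n. indicat_real (C l) (Z l \<omega>)) \<in> borel_measurable M" by (rule borel_measurable_prod) (use im in auto)
      show "(\<lambda>\<omega>. \<Prod>l<n. f l k (Z l \<omega>)) \<in> borel_measurable M" for k by (rule borel_measurable_prod) (use fm in auto)
      show "AE \<omega> in M. (\<lambda>k. \<Prod>l<n. f l k (Z l \<omega>)) ----> (\<Prod>l<n. indicat_real (C l) (Z l \<omega>))"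
        by (intro AE_I2 tendsto_prod f(2))
      show "AE \<omega> in M. norm (\<Prod>l<n. f l k (Z l \<omega>)) \<le> 1" for k
        unfolding real_norm_def abs_prod using f1 by (intro AE_I2 prod_le_1) auto
    qed simp
    moreover have "(\<lambda>k. \<Prod>l<n. expectation (\<lambda>\<omega>. f l k (Z l \<omega>))) ----> (\<Prod>l<n. expectation (\<lambda>\<omega>. indicat_real (C l) (Z l \<omega>)))"
    proof (rule tendsto_prod)
      fix l assume "l \<in> {..<n}"
      then have l: "l < n" by simp
      show "(\<lambda>k. expectation (\<lambda>\<omega>. f l k (Z l \<omega>))) ----> expectation (\<lambda>\<omega>. indicat_real (C l) (Z l \<omega>))"
      proof (rule integral_dominated_convergence[where w="\<lambda>_. 1"])
        show "AE \<omega> in M. (\<lambda>k. f l k (Z l \<omega>)) ----> indicat_real (C l) (Z l \<omega>)" by (intro AE_I2 f(2))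
      qed (use f1 fm[OF l] im[OF l] in auto)
    qed
    moreover have "expectation (\<lambda>\<omega>. \<Prod>l<n. f l k (Z l \<omega>)) = (\<Prod>l<n. expectation (\<lambda>\<omega>. f l k (Z l \<omega>)))" for k
      by (rule prod) (rule blip_bcontfun[OF f(1)])
    ultimately have "expectation (\<lambda>\<omega>. \<Prod>l<n. indicat_real (C l) (Z l \<omega>)) = (\<Prod>l<n. expectation (\<lambda>\<omega>. indicat_real (C l) (Z l \<omega>)))"
      using LIMSEQ_unique by auto
    moreover have "expectation (\<lambda>\<omega>. indicat_real (C l) (Z l \<omega>)) = prob (Z l -` C l \<inter> space M)" for l
    proof -
      have "expectation (\<lambda>\<omega>. indicat_real (C l) (Z l \<omega>)) = expectation (\<lambda>\<omega>. indicator (Z l -` C l \<inter> space M) \<omega>)"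
        by (rule Bochner_Integration.integral_cong) (auto simp: indicator_def)
      then show ?thesis by (simp add: Int_absorb2)
    qed
    ultimately show ?thesis by simp
  qed
  have "indep_sets E {..<n}"
  proof (rule indep_setsI)
    show "E l \<subseteq> events" if "l \<in> {..<n}" for l
      using Z[of l] that by (auto simp: E_def intro!: measurable_sets)
    fix A J assume J: "J \<noteq> {}" "J \<subseteq> {..<n}" "finite J" and A: "\<forall>j\<in>J. A j \<in> E j"
    from A have "\<forall>j\<in>J. \<exists>C. closed C \<and> A j = Z j -` C \<inter> space M" unfolding E_def by blast
    then obtain C0 where C0: "\<And>j. j \<in> J ==> closed (C0 j) \<and> A j = Z j -` C0 j \<inter> space M" by metis
    \<comment> \<open>Indices outside \<open>J\<close> receive the whole space, so the formula over
      all of \<open>{..<n}\<close> covers every subfamily.\<close>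
    define C where "C j = (if j \<in> J then C0 j else UNIV)" for j
    have C: "closed (C j)" for j using C0 by (auto simp: C_def)
    have Aj: "A j = Z j -` C j \<inter> space M" if "j \<in> J" for j using C0 that by (auto simp: C_def)
    have "prob (\<Inter>j\<in>J. A j) = expectation (\<lambda>\<omega>. indicator (\<Inter>j\<in>J. A j) \<omega>)"
    proof -
      have "(\<Inter>j\<in>J. A j) \<subseteq> space M" using J Aj by auto
      then show ?thesis by (simp add: Int_absorb2)
    qed
    also have "\<dots> = expectation (\<lambda>\<omega>. \<Prod>l<n. indicat_real (C l) (Z l \<omega>))"
    proof (rule Bochner_Integration.integral_cong[OF refl])
      fix \<omega> assume w: "\<omega> \<in> space M"
      show "indicator (\<Inter>j\<in>J. A j) \<omega> = (\<Prod>l<n. indicat_real (C l) (Z l \<omega>))"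
      proof (cases "\<omega> \<in> (\<Inter>j\<in>J. A j)")
        case True
        have "Z l \<omega> \<in> C l" for l
        proof (cases "l \<in> J")
          case lJ: True
          then have "\<omega> \<in> A l" using True by blast
          then show ?thesis using Aj[OF lJ] by auto
        qed (simp add: C_def)
        then show ?thesis using True by simp
      next
        case False
        then obtain j where "j \<in> J" "\<omega> \<notin> A j" by blast
        then have j: "j \<in> J" "Z j \<omega> \<notin> C j" using Aj[of j] w by auto
        then have "(\<Prod>l<n. indicat_real (C l) (Z l \<omega>)) = 0"
          using J(2) by (intro prod_zero bexI[of _ j]) auto
        then show ?thesis using False by simp
      qed
    qed
    also have "\<dots> = (\<Prod>l<n. prob (Z l -` C l \<inter> space M))" by (rule closed_prod[OF C])
    also have "\<dots> = (\<Prod>l\<in>J. prob (Z l -` C l \<inter> space M))"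
      by (rule prod.mono_neutral_right) (use J in \<open>auto simp: C_def prob_space\<close>)
    also have "\<dots> = (\<Prod>j\<in>J. prob (A j))" using Aj by simp
    finally show "prob (\<Inter>j\<in>J. A j) = (\<Prod>j\<in>J. prob (A j))" .
  qed
  moreover have "Int_stable (E l)" for l
    unfolding Int_stable_def E_def by (auto intro: closed_Int simp: vimage_Int) (metis closed_Int vimage_Int Int_assoc Int_left_commute inf.idem)
  ultimately have ind: "indep_sets (\<lambda>l. sigma_sets (space M) (E l)) {..<n}" by (rule indep_sets_sigma)
  have "sigma_sets (space M) {Z l -` A \<inter> space M |A. A \<in> sets borel} \<subseteq> sigma_sets (space M) (E l)" for l
  proof -
    have "{Z l -` A \<inter> space M |A. A \<in> sigma_sets UNIV (Collect closed)} = sigma_sets (space M) {Z l -` A \<inter> space M |A. A \<in> Collect closed}"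
      by (rule sigma_sets_vimage_commute) auto
    then have "{Z l -` A \<inter> space M |A. A \<in> sets borel} = sigma_sets (space M) (E l)"
      unfolding borel_eq_closed E_def by (simp add: sets_measure_of)
    then show ?thesis using sigma_sets_sigma_sets_eq[of "E l" "space M"] by (auto simp: E_def)
  qed
  then have "indep_sets (\<lambda>l. sigma_sets (space M) {Z l -` A \<inter> space M |A. A \<in> sets borel}) {..<n}"
    by (intro indep_sets_mono_sets[OF ind])
  then show ?thesis unfolding indep_vars_def using Z by auto
qed

text \<open>Adjacent increments are independent, so at one position both exceed
  \<open>(7/8) ^ k\<close> with probability at most the square of
  \<open>C * (1 / 2 ^ k) / ((7/8) ^ k)^2\<close>, and there are at most \<open>T * 2 ^ k\<close>
  positions. The base of the threshold must be below 1 for summability, while its fourth power must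
  exceed 1/2 for the probabilities to be summable; \<open>(7/8)^4 = 2401/4096\<close> satisfies this
  and leaves the ratio \<open>2048/2401\<close>.\<close>

lemma small_min_jumps_bound:
  fixes Y :: "real \<Rightarrow> 'w \<Rightarrow> 'a::euclidean_space"
  assumes S: "prob_space S" and Ym: "\<And>t. Y t \<in> borel_measurable S"
    and prod: "\<And>t f n. (\<And>l. l \<le> n ==> t l \<in> dyadics) ==> (\<And>l. l < n ==> t l \<le> t (Suc l)) ==> (\<And>l::nat. (f l :: 'a \<Rightarrow> real) \<in> bcontfun) ==>
      (LINT \<omega>|S. (\<Prod>l<n. f l (Y (t (Suc l)) \<omega> - Y (t l) \<omega>))) = (\<Prod>l<n. (LINT \<omega>|S. f l (Y (t (Suc l) - t l) \<omega>)))"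
    and C: "C \<ge> 0" "\<And>t l. t \<in> dyadics ==> t \<le> 1 ==> 0 < l ==> l \<le> 1 ==> (LINT \<omega>|S. cut l (Y t \<omega>)) \<le> C * t / l\<^sup>2"
  shows "{\<omega> \<in> space S. \<not> small_min_jumps (\<lambda>t. Y t \<omega>) (\<lambda>k. (7/8) ^ k) T k} \<in> sets S"
    "measure S {\<omega> \<in> space S. \<not> small_min_jumps (\<lambda>t. Y t \<omega>) (\<lambda>k. (7/8) ^ k) T k} \<le> real T * C\<^sup>2 * (2048/2401) ^ k"
proof -
  interpret prob_space S by fact
  note Ym[measurable]
  let ?l = "(7/8 :: real) ^ k"
  have l: "0 < ?l" "?l \<le> 1" by (auto simp: power_le_one)
  define B where "B i = {\<omega> \<in> space S. ?l < norm (Y (real (i + 1) / 2 ^ k) \<omega> - Y (real i / 2 ^ k) \<omega>) \<and>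
    ?l < norm (Y (real (i + 2) / 2 ^ k) \<omega> - Y (real (i + 1) / 2 ^ k) \<omega>)}" for i
  have Bs: "B i \<in> sets S" for i unfolding B_def by measurable
  have eq: "{\<omega> \<in> space S. \<not> small_min_jumps (\<lambda>t. Y t \<omega>) (\<lambda>k. (7/8) ^ k) T k} = (\<Union>i\<in>{i. i + 2 \<le> T * 2 ^ k}. B i)"
    unfolding small_min_jumps_def B_def by (auto simp: not_le)
  have fin: "finite {i. i + 2 \<le> T * 2 ^ k}" by (rule finite_subset[of _ "{..T * 2 ^ k}"]) auto
  show "{\<omega> \<in> space S. \<not> small_min_jumps (\<lambda>t. Y t \<omega>) (\<lambda>k. (7/8) ^ k) T k} \<in> sets S"
    unfolding eq using fin Bs by auto
  have PB: "prob (B i) \<le> (C * (1 / 2 ^ k) / ?l\<^sup>2)\<^sup>2" for i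
  proof -
    define t where "t l = real (i + l) / 2 ^ k" for l
    have t: "t l \<in> dyadics" for l unfolding t_def dyadics_def by blast
    have tt: "t (Suc l) - t l = 1 / 2 ^ k" for l by (simp add: t_def diff_divide_distrib[symmetric])
    have "prob (B i) = expectation (\<lambda>\<omega>. indicator (B i) \<omega>)" using Bs[of i] by (simp add: sets.sets_into_space Int_absorb2)
    also have "\<dots> \<le> expectation (\<lambda>\<omega>. \<Prod>l<2. cut ?l (Y (t (Suc l)) \<omega> - Y (t l) \<omega>))"
    proof (rule integral_mono)
      show "integrable S (\<lambda>\<omega>. indicator (B i) \<omega> :: real)" using Bs by (intro integrable_const_bound[of _ 1]) (auto simp: indicator_def)
      show "integrable S (\<lambda>\<omega>. \<Prod>l<2. cut ?l (Y (t (Suc l)) \<omega> - Y (t l) \<omega>))"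
        using cut_bounds[of ?l] by (intro integrable_const_bound[of _ 1] AE_I2) (auto simp: abs_prod intro!: prod_le_1)
      show "indicator (B i) \<omega> \<le> (\<Prod>l<2. cut ?l (Y (t (Suc l)) \<omega> - Y (t l) \<omega>))" for \<omega>
      proof (cases "\<omega> \<in> B i")
        case True
        then have "cut ?l (Y (t (Suc 0)) \<omega> - Y (t 0) \<omega>) = 1" "cut ?l (Y (t (Suc 1)) \<omega> - Y (t 1) \<omega>) = 1"
          using l by (auto simp: B_def t_def intro!: cut_eq_1)
        then show ?thesis using True by (simp add: numeral_2_eq_2)
      qed (use cut_bounds[of ?l] in \<open>auto intro!: prod_nonneg\<close>)
    qed
    also have "\<dots> = (\<Prod>l<2. expectation (\<lambda>\<omega>. cut ?l (Y (t (Suc l) - t l) \<omega>)))"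
      by (rule prod) (use t l in \<open>auto simp: t_def divide_right_mono cut_bcontfun\<close>)
    also have "\<dots> = (expectation (\<lambda>\<omega>. cut ?l (Y (1 / 2 ^ k) \<omega>)))\<^sup>2"
      unfolding tt by (simp add: power2_eq_square numeral_2_eq_2)
    also have "\<dots> \<le> (C * (1 / 2 ^ k) / ?l\<^sup>2)\<^sup>2"
    proof (rule power_mono)
      have "1 / 2 ^ k = real 1 / 2 ^ k" by simp
      then have "1 / 2 ^ k \<in> dyadics" unfolding dyadics_def by blast
      then show "expectation (\<lambda>\<omega>. cut ?l (Y (1 / 2 ^ k) \<omega>)) \<le> C * (1 / 2 ^ k) / ?l\<^sup>2"
        using l by (intro C(2)) auto
      show "0 \<le> expectation (\<lambda>\<omega>. cut ?l (Y (1 / 2 ^ k) \<omega>))" using cut_bounds by (intro integral_nonneg_AE) auto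
    qed
    finally show ?thesis .
  qed
  have "prob (\<Union>i\<in>{i. i + 2 \<le> T * 2 ^ k}. B i) \<le> (\<Sum>i\<in>{i. i + 2 \<le> T * 2 ^ k}. prob (B i))"
    using fin Bs by (intro finite_measure_subadditive_finite) auto
  also have "\<dots> \<le> (\<Sum>i\<in>{i. i + 2 \<le> T * 2 ^ k}. (C * (1 / 2 ^ k) / ?l\<^sup>2)\<^sup>2)" by (intro sum_mono PB)
  also have "\<dots> = real (card {i. i + 2 \<le> T * 2 ^ k}) * (C * (1 / 2 ^ k) / ?l\<^sup>2)\<^sup>2" by simp
  also have "\<dots> \<le> real (T * 2 ^ k) * (C * (1 / 2 ^ k) / ?l\<^sup>2)\<^sup>2"
  proof (rule mult_right_mono)
    have "card {i. i + 2 \<le> T * 2 ^ k} \<le> card {..<T * 2 ^ k}" by (rule card_mono) auto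
    then show "real (card {i. i + 2 \<le> T * 2 ^ k}) \<le> real (T * 2 ^ k)" by (simp only: of_nat_le_iff card_lessThan)
  qed simp
  also have "\<dots> = real T * C\<^sup>2 * (2 ^ k * ((1 / 2 ^ k)\<^sup>2 / (?l\<^sup>2)\<^sup>2))"
    by (simp add: power_mult_distrib power_divide)
  also have "2 ^ k * ((1 / 2 ^ k)\<^sup>2 / (?l\<^sup>2)\<^sup>2) = (2048/2401 :: real) ^ k"
  proof -
    have "(?l\<^sup>2)\<^sup>2 = ((7/8)^4) ^ k" by (simp flip: power_mult add: mult.commute)
    moreover have "2 ^ k * (1 / 2 ^ k)\<^sup>2 = (1/2 :: real) ^ k" by (simp add: power2_eq_square power_divide)
    ultimately have "2 ^ k * ((1 / 2 ^ k)\<^sup>2 / (?l\<^sup>2)\<^sup>2) = (1/2) ^ k / ((7/8)^4) ^ k" by (simp only: times_divide_eq_right)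
    also have "\<dots> = ((1/2) / (7/8)^4) ^ k" by (simp only: power_divide)
    also have "(1/2) / (7/8)^4 = (2048/2401 :: real)" by (simp add: power_divide)
    finally show ?thesis .
  qed
  finally show "prob {\<omega> \<in> space S. \<not> small_min_jumps (\<lambda>t. Y t \<omega>) (\<lambda>k. (7/8) ^ k) T k} \<le> real T * C\<^sup>2 * (2048/2401) ^ k"
    unfolding eq .
qed

section \<open>Extension to all times by right limits\<close>

context jump_family begin

text \<open>By Borel-Cantelli almost all dyadic paths have one-sided limits; \<open>Z\<close>
  consists of the right limits. Each distributional property is obtained by dominated convergence
  along \<open>dup m t\<close>, where the corresponding dyadic property holds.\<close>

lemma levy_process_exists:
  obtains M :: "(real \<Rightarrow> 'a) measure" and Z :: "real \<Rightarrow> (real \<Rightarrow> 'a) \<Rightarrow> 'a" where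
    "levy_process M Z" "\<And>t u. 0 \<le> t ==> charf (distr M borel (Z t)) u = exp (of_real t * \<eta> u)"
proof (rule dyadic_process)
  fix S :: "(real \<Rightarrow> 'a) measure" and Y :: "real \<Rightarrow> (real \<Rightarrow> 'a) \<Rightarrow> 'a"
  assume S: "prob_space S" and Ym [measurable]: "\<And>t. Y t \<in> borel_measurable S"
    and prod: "\<And>t f n. (\<And>l. l \<le> n ==> t l \<in> dyadics) ==> (\<And>l. l < n ==> t l \<le> t (Suc l)) ==> (\<And>l::nat. (f l :: 'a \<Rightarrow> real) \<in> bcontfun) ==>
      (LINT \<omega>|S. (\<Prod>l<n. f l (Y (t (Suc l)) \<omega> - Y (t l) \<omega>))) = (\<Prod>l<n. (LINT \<omega>|S. f l (Y (t (Suc l) - t l) \<omega>)))"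
    and char: "\<And>t u. t \<in> dyadics ==> charf (distr S borel (Y t)) u = exp (of_real t * \<eta> u)"
    and "\<exists>C\<ge>0. \<forall>t l. t \<in> dyadics --> t \<le> 1 --> 0 < l --> l \<le> 1 --> (LINT \<omega>|S. cut l (Y t \<omega>)) \<le> C * t / l\<^sup>2"
  then obtain C where C: "C \<ge> 0" "\<And>t l. t \<in> dyadics ==> t \<le> 1 ==> 0 < l ==> l \<le> 1 ==> (LINT \<omega>|S. cut l (Y t \<omega>)) \<le> C * t / l\<^sup>2"
    by blast
  interpret prob_space S by (rule S)
  have "AE \<omega> in S. EV k. small_min_jumps (\<lambda>t. Y t \<omega>) (\<lambda>k. (7/8) ^ k) T k" for T
  proof -
    let ?A = "\<lambda>k. {\<omega> \<in> space S. \<not> small_min_jumps (\<lambda>t. Y t \<omega>) (\<lambda>k. (7/8) ^ k) T k}"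
    note sb = small_min_jumps_bound[OF S Ym prod C, of T]
    have "summable (\<lambda>k. prob (?A k))"
    proof (rule summable_comparison_test'[of "\<lambda>k. real T * C\<^sup>2 * (2048/2401) ^ k" 0])
      show "summable (\<lambda>k. real T * C\<^sup>2 * (2048/2401) ^ k)" by (intro summable_mult summable_geometric) simp
      show "norm (prob (?A k)) \<le> real T * C\<^sup>2 * (2048/2401) ^ k" for k using sb(2)[of k] by simp
    qed
    then have "AE \<omega> in S. EV k. \<omega> \<in> space S - ?A k"
      using sb(1) by (intro borel_cantelli_AE1) (auto simp: emeasure_eq_measure)
    then show ?thesis by eventually_elim (auto elim: eventually_mono)
  qed
  then have "AE \<omega> in S. \<forall>T. EV k. small_min_jumps (\<lambda>t. Y t \<omega>) (\<lambda>k. (7/8) ^ k) T k"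
    by (simp add: AE_all_countable)
  then have "AE \<omega> in S. regular_on dyadics (\<lambda>t. Y t \<omega>)"
    by eventually_elim (rule small_min_jumps_imp_regular[where a="\<lambda>k. (7/8) ^ k"], auto)
  \<comment> \<open>Measurability of the set of irregular paths is not known; \<open>N\<close> is a
    measurable null set containing it.\<close>
  then obtain N where N: "{\<omega> \<in> space S. \<not> regular_on dyadics (\<lambda>t. Y t \<omega>)} \<subseteq> N" "emeasure S N = 0" "N \<in> sets S"
    by (rule AE_E)
  have AEN: "AE \<omega> in S. \<omega> \<notin> N" using N(2,3) by (intro AE_not_in) (auto simp: null_sets_def)
  have reg: "regular_on dyadics (\<lambda>t. Y t \<omega>)" if "\<omega> \<in> space S - N" for \<omega> using N(1) that by auto
  \<comment> \<open>The value 0 on \<open>N\<close> makes \<open>Z t\<close> a pointwise limit of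
    measurable functions on the whole space.\<close>
  define Z where "Z t \<omega> = (if \<omega> \<in> N then 0 else lim (\<lambda>m. Y (dup m t) \<omega>))" for t \<omega>
  have Zlim: "(\<lambda>m. Y (dup m t) \<omega>) ----> Z t \<omega>" if w: "\<omega> \<in> space S - N" and t: "0 \<le> t" for t \<omega>
  proof -
    obtain l where "((\<lambda>t. Y t \<omega>) \<longlongrightarrow> l) (at t within dyadics \<inter> {t<..})" using reg[OF w] t unfolding regular_on_def by blast
    then have "(\<lambda>m. Y (dup m t) \<omega>) ----> l" by (rule regular_dup_limit[OF reg[OF w] t])
    then show ?thesis using w t by (simp add: Z_def limI)
  qed
  have ZAE: "AE \<omega> in S. (\<lambda>m. Y (dup m t) \<omega>) ----> Z t \<omega>" if "0 \<le> t" for t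
    using AEN AE_space by eventually_elim (use Zlim that in auto)
  have Zm: "Z t \<in> borel_measurable S" if t: "0 \<le> t" for t
  proof (rule borel_measurable_LIMSEQ_metric[where f="\<lambda>m \<omega>. if \<omega> \<in> N then 0 else Y (dup m t) \<omega>"])
    show "(\<lambda>\<omega>. if \<omega> \<in> N then 0 else Y (dup m t) \<omega>) \<in> borel_measurable S" for m using N(3) by measurable
    show "(\<lambda>m. if \<omega> \<in> N then 0 else Y (dup m t) \<omega>) ----> Z t \<omega>" if "\<omega> \<in> space S" for \<omega>
      using Zlim[of \<omega> t] that t by (cases "\<omega> \<in> N") (auto simp: Z_def)
  qed
  have Zcad: "AE \<omega> in S. cadlag (\<lambda>t. Z t \<omega>)" using AEN AE_space
  proof eventually_elim
    case (elim \<omega>)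
    show ?case by (rule regular_right_limits_cadlag[OF reg]) (use elim Zlim in auto)
  qed
  have exp_lim: "(\<lambda>m. LINT \<omega>|S. G (\<lambda>l. Y (dup m (t l)) \<omega>)) ----> (LINT \<omega>|S. G (\<lambda>l. Z (t l) \<omega>))"
    if t: "\<And>l::nat. 0 \<le> t l" and G1: "\<And>X. (\<And>l. X l \<in> borel_measurable S) ==> (\<lambda>\<omega>. G (\<lambda>l. X l \<omega>)) \<in> borel_measurable S"
      and G2: "\<And>x. norm (G x) \<le> B" and G3: "\<And>xs x. (\<And>l. (\<lambda>m. xs m l) ----> x l) ==> (\<lambda>m. G (xs m)) ----> G x"
    for t B and G :: "(nat \<Rightarrow> 'a) \<Rightarrow> complex"
  proof (rule integral_dominated_convergence[where w="\<lambda>_. B"])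
    show "(\<lambda>\<omega>. G (\<lambda>l. Z (t l) \<omega>)) \<in> borel_measurable S" by (rule G1) (rule Zm[OF t])
    show "(\<lambda>\<omega>. G (\<lambda>l. Y (dup m (t l)) \<omega>)) \<in> borel_measurable S" for m by (rule G1) (rule Ym)
    have "AE \<omega> in S. \<forall>l. (\<lambda>m. Y (dup m (t l)) \<omega>) ----> Z (t l) \<omega>"
      using ZAE[OF t] by (simp add: AE_all_countable)
    then show "AE \<omega> in S. (\<lambda>m. G (\<lambda>l. Y (dup m (t l)) \<omega>)) ----> G (\<lambda>l. Z (t l) \<omega>)"
      by eventually_elim (rule G3, auto)
  qed (use G2 in auto)
  have exp_lim_real: "(\<lambda>m. LINT \<omega>|S. f (Y (dup m t) \<omega> - Y (dup m s) \<omega>)) ----> (LINT \<omega>|S. f (Z t \<omega> - Z s \<omega>))"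
    if f: "f \<in> bcontfun" and st: "0 \<le> s" "0 \<le> t" for f :: "'a \<Rightarrow> real" and s t
  proof -
    obtain B where B: "\<And>x. \<bar>f x\<bar> \<le> B" using bcontfun_bounded[OF f] by blast
    note [measurable] = Zm[OF st(1)] Zm[OF st(2)] bcontfun_measurable[OF f]
    show ?thesis
    proof (rule integral_dominated_convergence[where w="\<lambda>_. B"])
      show "AE \<omega> in S. (\<lambda>m. f (Y (dup m t) \<omega> - Y (dup m s) \<omega>)) ----> f (Z t \<omega> - Z s \<omega>)"
        using ZAE[OF st(1)] ZAE[OF st(2)]
      proof eventually_elim
        case (elim \<omega>)
        have "(\<lambda>m. Y (dup m t) \<omega> - Y (dup m s) \<omega>) ----> Z t \<omega> - Z s \<omega>" by (intro tendsto_diff elim)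
        then show ?case using f unfolding bcontfun_def by (auto intro: continuous_on_tendsto_compose)
      qed
    qed (use B in auto)
  qed
  have one: "(LINT \<omega>|S. f (Y t \<omega> - Y s \<omega>)) = (LINT \<omega>|S. f (Y (t - s) \<omega>))"
    if "f \<in> bcontfun" "s \<in> dyadics" "t \<in> dyadics" "s \<le> t" for f :: "'a \<Rightarrow> real" and s t
    using prod[of 1 "\<lambda>l. if l = 0 then s else t" "\<lambda>_. f"] that by simp
  have char_incr: "charf (distr S borel (\<lambda>\<omega>. Z t \<omega> - Z s \<omega>)) u = exp (of_real (t - s) * \<eta> u)" if st: "0 \<le> s" "s \<le> t" for s t u
  proof -
    have t0: "0 \<le> t" using st by simp
    have "Complex (LINT \<omega>|S. cos (u \<bullet> (Y (dup m t) \<omega> - Y (dup m s) \<omega>))) (LINT \<omega>|S. sin (u \<bullet> (Y (dup m t) \<omega> - Y (dup m s) \<omega>)))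
       = exp (of_real (dup m t - dup m s) * \<eta> u)" for m
    proof -
      have d: "dup m s \<in> dyadics" "dup m t \<in> dyadics" "dup m s \<le> dup m t"
        using dup_dyadic[OF st(1)] dup_dyadic[OF t0] dup_mono[OF st(2)] by auto
      have "exp (of_real (dup m t - dup m s) * \<eta> u) = charf (distr S borel (Y (dup m t - dup m s))) u"
        by (rule char[symmetric]) (rule dyadics_diff[OF d])
      also have "\<dots> = Complex (LINT \<omega>|S. cos (u \<bullet> Y (dup m t - dup m s) \<omega>)) (LINT \<omega>|S. sin (u \<bullet> Y (dup m t - dup m s) \<omega>))"
        by (subst charf_eq) (auto simp: prob_space_distr integral_distr)
      finally show ?thesis using one[OF bcontfun_cos d] one[OF bcontfun_sin d] by simp
    qed
    moreover have "(\<lambda>m. Complex (LINT \<omega>|S. cos (u \<bullet> (Y (dup m t) \<omega> - Y (dup m s) \<omega>))) (LINT \<omega>|S. sin (u \<bullet> (Y (dup m t) \<omega> - Y (dup m s) \<omega>))))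
      ----> Complex (LINT \<omega>|S. cos (u \<bullet> (Z t \<omega> - Z s \<omega>))) (LINT \<omega>|S. sin (u \<bullet> (Z t \<omega> - Z s \<omega>)))"
      by (intro tendsto_Complex exp_lim_real[OF bcontfun_cos st(1) t0] exp_lim_real[OF bcontfun_sin st(1) t0])
    moreover have "(\<lambda>m. exp (of_real (dup m t - dup m s) * \<eta> u)) ----> exp (of_real (t - s) * \<eta> u)"
      by (intro tendsto_intros dup_tendsto)
    ultimately have "Complex (LINT \<omega>|S. cos (u \<bullet> (Z t \<omega> - Z s \<omega>))) (LINT \<omega>|S. sin (u \<bullet> (Z t \<omega> - Z s \<omega>))) = exp (of_real (t - s) * \<eta> u)"
      using LIMSEQ_unique by auto
    then show ?thesis using Zm[OF st(1)] Zm[OF t0] by (subst charf_eq) (auto simp: prob_space_distr integral_distr)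
  qed
  have char0: "charf (distr S borel (Z t)) u = exp (of_real t * \<eta> u)" if t: "0 \<le> t" for t u
  proof -
    have "(\<lambda>m. LINT \<omega>|S. cis (u \<bullet> Y (dup m t) \<omega>)) ----> (LINT \<omega>|S. cis (u \<bullet> Z t \<omega>))"
    proof (rule exp_lim[of "\<lambda>_. t" "\<lambda>x. cis (u \<bullet> x 0)" 1])
      show "(\<lambda>m. cis (u \<bullet> xs m 0)) ----> cis (u \<bullet> x 0)" if "\<And>l. (\<lambda>m. xs m l) ----> x l" for xs :: "nat \<Rightarrow> nat \<Rightarrow> 'a" and x
        by (intro tendsto_intros that)
    qed (use t in auto)
    moreover have "(LINT \<omega>|S. cis (u \<bullet> Y (dup m t) \<omega>)) = exp (of_real (dup m t) * \<eta> u)" for m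
      using char[OF dup_dyadic[OF t], of m u] unfolding charf_def by (subst (asm) integral_distr) auto
    moreover have "(\<lambda>m. exp (of_real (dup m t) * \<eta> u)) ----> exp (of_real t * \<eta> u)"
      by (intro tendsto_intros dup_tendsto)
    ultimately have "(LINT \<omega>|S. cis (u \<bullet> Z t \<omega>)) = exp (of_real t * \<eta> u)" using LIMSEQ_unique by auto
    then show ?thesis unfolding charf_def using Zm[OF t] by (subst integral_distr) auto
  qed
  have Z0: "AE \<omega> in S. Z 0 \<omega> = 0"
  proof -
    have "distr S borel (Z 0) = distr S borel (\<lambda>_. 0 :: 'a)"
    proof (rule charf_inj)
      show "charf (distr S borel (Z 0)) u = charf (distr S borel (\<lambda>_. 0)) u" for u
        using char0[of 0 u] unfolding charf_def by (simp add: integral_return)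
    qed (use Zm in \<open>auto simp: prob_space_distr prob_space_return\<close>)
    moreover have "AE x in distr S borel (\<lambda>_. 0 :: 'a). x = 0" by (subst AE_distr_iff) auto
    ultimately have "AE x in distr S borel (Z 0). x = 0" by (simp only:)
    then show ?thesis using Zm[of 0] by (subst (asm) AE_distr_iff) auto
  qed
  have stat: "distr S borel (\<lambda>\<omega>. Z (s + h) \<omega> - Z s \<omega>) = distr S borel (\<lambda>\<omega>. Z h \<omega> - Z 0 \<omega>)" if "0 \<le> s" "0 \<le> h" for s h
    using that Zm char_incr[of s "s + h"] char_incr[of 0 h]
    by (intro charf_inj) (auto intro!: prob_space_distr borel_measurable_diff)
  have indep: "indep_vars (\<lambda>_. borel) (\<lambda>i \<omega>. Z (t (Suc i)) \<omega> - Z (t i) \<omega>) {..<n}"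
    if t0: "0 \<le> t 0" and mono: "\<forall>i<n. t i < t (Suc i)" for n :: nat and t :: "nat \<Rightarrow> real"
  proof (rule indep_vars_of_product)
    have tn: "0 \<le> t i" if "i \<le> n" for i using that
    proof (induction i)
      case (Suc i)
      then have "0 \<le> t i" "t i < t (Suc i)" using mono by auto
      then show ?case by linarith
    qed (rule t0)
    show "(\<lambda>\<omega>. Z (t (Suc l)) \<omega> - Z (t l) \<omega>) \<in> borel_measurable S" if "l < n" for l
      using that by (intro borel_measurable_diff Zm tn) auto
    fix f :: "nat \<Rightarrow> 'a \<Rightarrow> real" assume f: "\<And>l::nat. f l \<in> bcontfun"
    have "\<exists>B. \<forall>x. \<bar>f l x\<bar> \<le> B" for l using bcontfun_bounded[OF f[of l]] by metis
    then obtain B where B: "\<And>l x. \<bar>f l x\<bar> \<le> B l" by metis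
    have "(\<lambda>m. LINT \<omega>|S. (\<Prod>l<n. f l (Y (dup m (t (Suc l))) \<omega> - Y (dup m (t l)) \<omega>))) ----> (LINT \<omega>|S. (\<Prod>l<n. f l (Z (t (Suc l)) \<omega> - Z (t l) \<omega>)))"
    proof (rule integral_dominated_convergence[where w="\<lambda>_. \<Prod>l<n. B l"])
      show "(\<lambda>\<omega>. \<Prod>l<n. f l (Z (t (Suc l)) \<omega> - Z (t l) \<omega>)) \<in> borel_measurable S"
        by (intro borel_measurable_prod measurable_compose[OF _ bcontfun_measurable[OF f]] borel_measurable_diff Zm tn) auto
      show "(\<lambda>\<omega>. \<Prod>l<n. f l (Y (dup m (t (Suc l))) \<omega> - Y (dup m (t l)) \<omega>)) \<in> borel_measurable S" for m
        by (intro borel_measurable_prod measurable_compose[OF _ bcontfun_measurable[OF f]] borel_measurable_diff Ym)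
      show "AE \<omega> in S. norm (\<Prod>l<n. f l (Y (dup m (t (Suc l))) \<omega> - Y (dup m (t l)) \<omega>)) \<le> (\<Prod>l<n. B l)" for m
        unfolding real_norm_def abs_prod by (intro AE_I2 prod_mono) (use B in auto)
      show "AE \<omega> in S. (\<lambda>m. \<Prod>l<n. f l (Y (dup m (t (Suc l))) \<omega> - Y (dup m (t l)) \<omega>)) ----> (\<Prod>l<n. f l (Z (t (Suc l)) \<omega> - Z (t l) \<omega>))"
        using AEN AE_space
      proof eventually_elim
        case (elim \<omega>)
        show ?case
        proof (rule tendsto_prod)
          fix l assume "l \<in> {..<n}"
          then have "(\<lambda>m. Y (dup m (t (Suc l))) \<omega> - Y (dup m (t l)) \<omega>) ----> Z (t (Suc l)) \<omega> - Z (t l) \<omega>"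
            using elim tn by (intro tendsto_diff Zlim) auto
          then show "(\<lambda>m. f l (Y (dup m (t (Suc l))) \<omega> - Y (dup m (t l)) \<omega>)) ----> f l (Z (t (Suc l)) \<omega> - Z (t l) \<omega>)"
            using f[of l] unfolding bcontfun_def by (auto intro: continuous_on_tendsto_compose)
        qed
      qed
    qed simp
    moreover have "(LINT \<omega>|S. (\<Prod>l<n. f l (Y (dup m (t (Suc l))) \<omega> - Y (dup m (t l)) \<omega>))) =
      (\<Prod>l<n. LINT \<omega>|S. f l (Y (dup m (t (Suc l))) \<omega> - Y (dup m (t l)) \<omega>))" for m
    proof -
      have d: "dup m (t l) \<in> dyadics" if "l \<le> n" for l using dup_dyadic[OF tn[OF that]] .
      have le: "dup m (t l) \<le> dup m (t (Suc l))" if "l < n" for l using mono that by (intro dup_mono) auto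
      have "(LINT \<omega>|S. (\<Prod>l<n. f l (Y (dup m (t (Suc l))) \<omega> - Y (dup m (t l)) \<omega>))) = (\<Prod>l<n. LINT \<omega>|S. f l (Y (dup m (t (Suc l)) - dup m (t l)) \<omega>))"
        by (rule prod[of n "\<lambda>l. dup m (t l)"]) (use d le f in auto)
      also have "\<dots> = (\<Prod>l<n. LINT \<omega>|S. f l (Y (dup m (t (Suc l))) \<omega> - Y (dup m (t l)) \<omega>))"
        using d le f by (intro prod.cong refl one[symmetric]) auto
      finally show ?thesis .
    qed
    moreover have "(\<lambda>m. \<Prod>l<n. LINT \<omega>|S. f l (Y (dup m (t (Suc l))) \<omega> - Y (dup m (t l)) \<omega>)) ----> (\<Prod>l<n. LINT \<omega>|S. f l (Z (t (Suc l)) \<omega> - Z (t l) \<omega>))"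
      by (intro tendsto_prod exp_lim_real f tn) auto
    ultimately show "(LINT \<omega>|S. (\<Prod>l<n. f l (Z (t (Suc l)) \<omega> - Z (t l) \<omega>))) = (\<Prod>l<n. LINT \<omega>|S. f l (Z (t (Suc l)) \<omega> - Z (t l) \<omega>))"
      using LIMSEQ_unique by auto
  qed
  \<comment> \<open>The dyadic estimate is available for levels at most 1 only, hence
    \<open>min eps 1\<close>.\<close>
  have cont_bound: "measure S {\<omega> \<in> space S. norm (Z t \<omega> - Z s \<omega>) > eps} \<le> C * (t - s) / (min eps 1)\<^sup>2"
    if st: "0 \<le> s" "s \<le> t" "t - s < 1" and eps: "eps > 0" for s t eps
  proof -
    have t0: "0 \<le> t" using st by simp
    note [measurable] = Zm[OF st(1)] Zm[OF t0]
    let ?e = "min eps 1"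
    have e: "0 < ?e" "?e \<le> 1" using eps by auto
    have "measure S {\<omega> \<in> space S. norm (Z t \<omega> - Z s \<omega>) > eps} = (LINT \<omega>|S. indicator {\<omega> \<in> space S. norm (Z t \<omega> - Z s \<omega>) > eps} \<omega>)"
      by (simp add: Int_absorb2 subset_eq)
    also have "\<dots> \<le> (LINT \<omega>|S. cut ?e (Z t \<omega> - Z s \<omega>))"
    proof (rule integral_mono)
      show "integrable S (\<lambda>\<omega>. indicator {\<omega> \<in> space S. norm (Z t \<omega> - Z s \<omega>) > eps} \<omega> :: real)"
        by (intro integrable_const_bound[of _ 1]) (auto simp: indicator_def)
      show "integrable S (\<lambda>\<omega>. cut ?e (Z t \<omega> - Z s \<omega>))"
        using cut_bounds[of ?e] by (intro integrable_const_bound[of _ 1] AE_I2) auto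
      show "indicator {\<omega> \<in> space S. norm (Z t \<omega> - Z s \<omega>) > eps} \<omega> \<le> cut ?e (Z t \<omega> - Z s \<omega>)" for \<omega>
        using cut_bounds[of ?e] cut_eq_1[OF e(1), of "Z t \<omega> - Z s \<omega>"] by (auto simp: indicator_def)
    qed
    also have "\<dots> \<le> C * (t - s) / ?e\<^sup>2"
    proof (rule LIMSEQ_le[OF exp_lim_real[OF cut_bcontfun[OF e(1)] st(1) t0]])
      show "(\<lambda>m. C * (dup m t - dup m s) / ?e\<^sup>2) ----> C * (t - s) / ?e\<^sup>2"
        using e by (intro tendsto_intros dup_tendsto) auto
      have "(\<lambda>m. dup m t - dup m s) ----> t - s" by (intro tendsto_intros dup_tendsto)
      then have "EV m. dup m t - dup m s < 1" using st(3) by (rule order_tendstoD)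
      then have "EV m. (LINT \<omega>|S. cut ?e (Y (dup m t) \<omega> - Y (dup m s) \<omega>)) \<le> C * (dup m t - dup m s) / ?e\<^sup>2"
      proof eventually_elim
        case (elim m)
        have d: "dup m s \<in> dyadics" "dup m t \<in> dyadics" "dup m s \<le> dup m t"
          using dup_dyadic[OF st(1)] dup_dyadic[OF t0] dup_mono[OF st(2)] by auto
        show ?case
          unfolding one[OF cut_bcontfun[OF e(1)] d] using elim dyadics_diff[OF d] e by (intro C(2)) auto
      qed
      then show "\<exists>N. \<forall>n\<ge>N. (LINT \<omega>|S. cut ?e (Y (dup n t) \<omega> - Y (dup n s) \<omega>)) \<le> C * (dup n t - dup n s) / ?e\<^sup>2"
        by (simp add: eventually_sequentially)
    qed
    finally show ?thesis .
  qed
  have cont: "((\<lambda>t. measure S {\<omega> \<in> space S. norm (Z t \<omega> - Z s \<omega>) > eps}) \<longlongrightarrow> 0) (at s within {0..})"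
    if s: "0 \<le> s" and eps: "eps > 0" for s eps
  proof (rule tendsto_sandwich[of "\<lambda>_. 0" _ _ "\<lambda>t. C * \<bar>t - s\<bar> / (min eps 1)\<^sup>2"])
    have "((\<lambda>t. C * \<bar>t - s\<bar> / (min eps 1)\<^sup>2) \<longlongrightarrow> C * \<bar>s - s\<bar> / (min eps 1)\<^sup>2) (at s within {0..})"
      using eps by (intro tendsto_intros) auto
    then show "((\<lambda>t. C * \<bar>t - s\<bar> / (min eps 1)\<^sup>2) \<longlongrightarrow> 0) (at s within {0..})" by simp
    have "measure S {\<omega> \<in> space S. norm (Z t \<omega> - Z s \<omega>) > eps} \<le> C * \<bar>t - s\<bar> / (min eps 1)\<^sup>2" if "0 \<le> t" "dist t s < 1" for t
      using cont_bound[of s t eps] cont_bound[of t s eps] that s eps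
      by (cases "s \<le> t") (auto simp: dist_real_def norm_minus_commute)
    then show "\<forall>\<^sub>F t in at s within {0..}. measure S {\<omega> \<in> space S. norm (Z t \<omega> - Z s \<omega>) > eps} \<le> C * \<bar>t - s\<bar> / (min eps 1)\<^sup>2"
      unfolding eventually_at by (intro exI[of _ 1]) auto
  qed auto
  have "levy_process S Z"
    unfolding levy_process_def using S Zm Z0 stat indep cont Zcad by blast
  then show thesis using char0 by (rule that)
qed

end

section \<open>Equations with additive noise\<close>

text \<open>\<open>exp (- w * s)\<close> times the right-hand side of the assumption is
  nonincreasing, because the assumption bounds its derivative by 0.\<close>

lemma gronwall:
  fixes u :: "real \<Rightarrow> real"
  assumes c: "continuous_on {0..T} u" and w: "0 \<le> w" and t: "t \<in> {0..T}"
    and le: "\<And>t. t \<in> {0..T} ==> u t \<le> a + w * integral {0..t} u"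
  shows "u t \<le> a * exp (w * t)"
proof -
  define g where "g s = exp (- w * s) * (a + w * integral {0..s} u)" for s
  have ct: "continuous_on {0..t} u" using c t by (auto intro: continuous_on_subset)
  have "g t \<le> g 0"
  proof (rule DERIV_nonpos_imp_decreasing_open[of 0 t g])
    show "0 \<le> t" using t by simp
    have "continuous_on {0..t} (\<lambda>s. integral {0..s} u)"
      by (rule indefinite_integral_continuous_1) (rule integrable_continuous_real[OF ct])
    then show "continuous_on {0..t} g" unfolding g_def by (intro continuous_intros)
    fix x assume x: "0 < x" "x < t"
    have "((\<lambda>s. integral {0..s} u) has_real_derivative u x) (at x within {0..t})"
      by (rule integral_has_real_derivative[OF ct]) (use x in auto)
    then have d: "((\<lambda>s. integral {0..s} u) has_real_derivative u x) (at x)"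
      using x by (simp add: at_within_Icc_at)
    have "(g has_real_derivative exp (- w * x) * (w * u x - w * (a + w * integral {0..x} u))) (at x)"
      unfolding g_def[abs_def] by (auto intro!: derivative_eq_intros d simp: algebra_simps)
    moreover have "u x \<le> a + w * integral {0..x} u" using le[of x] x t by auto
    then have "w * u x \<le> w * (a + w * integral {0..x} u)" using w by (rule mult_left_mono)
    then have "exp (- w * x) * (w * u x - w * (a + w * integral {0..x} u)) \<le> 0" by (intro mult_nonneg_nonpos) auto
    ultimately show "\<exists>y. (g has_real_derivative y) (at x) \<and> y \<le> 0" by blast
  qed
  then have "exp (- (w * t)) * (a + w * integral {0..t} u) \<le> a" by (simp add: g_def)
  then have "exp (w * t) * (exp (- (w * t)) * (a + w * integral {0..t} u)) \<le> exp (w * t) * a" by (intro mult_left_mono) auto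
  moreover have "exp (w * t) * (exp (- (w * t)) * c) = c" for c by (metis exp_minus_inverse mult.assoc mult_1)
  ultimately have "a + w * integral {0..t} u \<le> exp (w * t) * a" by metis
  then have "u t \<le> exp (w * t) * a" using le[OF t] by linarith
  then show ?thesis by (simp only: mult.commute)
qed

lemma bounded_borel_set_integrable:
  fixes g :: "real \<Rightarrow> 'a::euclidean_space"
  assumes "g \<in> borel_measurable borel" "\<And>s. s \<in> {a..b} ==> norm (g s) \<le> B"
  shows "set_integrable lborel {a..b} g"
  unfolding set_integrable_def using assms by (intro integrableI_bounded_set_indicator[where B=B]) (auto simp: emeasure_lborel_Icc_eq)

lemma set_integrable_integrable_on:
  "set_integrable lborel S f ==> f integrable_on S" for f :: "real \<Rightarrow> 'a::euclidean_space"
  by (rule set_borel_integral_eq_integral)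

definition noise :: "(real \<Rightarrow> 'a::euclidean_space) \<Rightarrow> bool" where
  "noise y \<longleftrightarrow> y \<in> borel_measurable borel \<and> (\<forall>T. \<exists>B. \<forall>s\<in>{0..T}. norm (y s) \<le> B)"

text \<open>Integrability is required in the Lebesgue sense, to match
  \<open>strong_solution\<close>, but the value is a gauge integral, for which the calculus on
  intervals is carried out; under this integrability the two agree.\<close>

definition sol_on :: "('a::euclidean_space \<Rightarrow> 'a) \<Rightarrow> 'a \<Rightarrow> (real \<Rightarrow> 'a) \<Rightarrow> real \<Rightarrow> (real \<Rightarrow> 'a) \<Rightarrow> bool" where
  "sol_on F x y T X \<longleftrightarrow> (\<forall>t\<in>{0..T}. set_integrable lborel {0..t} (\<lambda>s. F (X s)) \<and>
     X t = x + integral {0..t} (\<lambda>s. F (X s)) + y t)"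

lemma sol_on_mono: "sol_on F x y T X ==> T' \<le> T ==> sol_on F x y T' X"
  unfolding sol_on_def by auto

text \<open>Subtracting the noise leaves an integral. Gronwall is applied to this part, as
  \<open>X\<close> itself may jump.\<close>

lemma sol_on_drift_continuous:
  assumes "sol_on F x y T X"
  shows "continuous_on {0..T} (\<lambda>t. X t - y t)"
proof (cases "0 \<le> T")
  case True
  then have "(\<lambda>s. F (X s)) integrable_on {0..T}" using assms unfolding sol_on_def by (auto intro: set_integrable_integrable_on)
  then have "continuous_on {0..T} (\<lambda>t. x + integral {0..t} (\<lambda>s. F (X s)))"
    by (intro continuous_intros indefinite_integral_continuous_1)
  moreover have "x + integral {0..t} (\<lambda>s. F (X s)) = X t - y t" if "t \<in> {0..T}" for t
  proof -
    have "X t = x + integral {0..t} (\<lambda>s. F (X s)) + y t" using assms that unfolding sol_on_def by blast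
    then show ?thesis by simp
  qed
  ultimately show ?thesis by (rule continuous_on_eq) simp
qed simp

section \<open>Pathwise solutions: stability, uniqueness, existence\<close>

locale lipschitz_drift =
  fixes F :: "'a::euclidean_space \<Rightarrow> 'a" and w :: real
  assumes w: "0 \<le> w" and lip: "\<And>x y. norm (F x - F y) \<le> w * norm (x - y)"
begin

lemma F_continuous: "continuous_on UNIV F"
  using w lip by (intro lipschitz_on_continuous_on[of w] lipschitz_onI) (auto simp: dist_norm)

lemma F_measurable [measurable]: "F \<in> borel_measurable borel"
  by (rule borel_measurable_continuous_onI[OF F_continuous])

text \<open>Gronwall for the difference of the drift parts: the noises enter only through the
  integral of their distance. One estimate yields uniqueness, Lipschitz dependence on the initial
  value and the comparison with the flow.\<close>

lemma sol_stability:
  assumes X: "sol_on F x y T X" and X': "sol_on F x' y' T X'" and t: "t \<in> {0..T}"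
    and int: "(\<lambda>s. norm (y s - y' s)) integrable_on {0..T}"
  shows "norm ((X t - y t) - (X' t - y' t)) \<le> (norm (x - x') + w * integral {0..T} (\<lambda>s. norm (y s - y' s))) * exp (w * t)"
proof (rule gronwall[OF _ w t])
  let ?d = "\<lambda>t. norm ((X t - y t) - (X' t - y' t))"
  let ?e = "\<lambda>s. norm (y s - y' s)"
  show cd: "continuous_on {0..T} ?d"
    by (intro continuous_intros sol_on_drift_continuous[OF X] sol_on_drift_continuous[OF X'])
  fix t assume t: "t \<in> {0..T}"
  have i: "(\<lambda>s. F (X s)) integrable_on {0..t}" "(\<lambda>s. F (X' s)) integrable_on {0..t}"
    using X X' t unfolding sol_on_def by (auto intro: set_integrable_integrable_on)
  have di: "?d integrable_on {0..t}" using cd t by (intro integrable_continuous_real) (auto intro: continuous_on_subset)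
  have ei: "?e integrable_on {0..t}" using int t by (auto intro: integrable_subinterval_real)
  have "X t = x + integral {0..t} (\<lambda>s. F (X s)) + y t" "X' t = x' + integral {0..t} (\<lambda>s. F (X' s)) + y' t"
    using X X' t unfolding sol_on_def by blast+
  then have "(X t - y t) - (X' t - y' t) = (x - x') + integral {0..t} (\<lambda>s. F (X s) - F (X' s))"
    using i by (simp add: Henstock_Kurzweil_Integration.integral_diff)
  then have "?d t \<le> norm (x - x') + norm (integral {0..t} (\<lambda>s. F (X s) - F (X' s)))"
    by (simp add: norm_triangle_ineq)
  also have "norm (integral {0..t} (\<lambda>s. F (X s) - F (X' s))) \<le> integral {0..t} (\<lambda>s. w * (?d s + ?e s))"
  proof (rule Henstock_Kurzweil_Integration.integral_norm_bound_integral)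
    show "(\<lambda>s. F (X s) - F (X' s)) integrable_on {0..t}" by (intro Henstock_Kurzweil_Integration.integrable_diff i)
    show "(\<lambda>s. w * (?d s + ?e s)) integrable_on {0..t}"
      using Henstock_Kurzweil_Integration.integrable_add[OF di ei] by (rule integrable_on_mult_right)
    fix s assume "s \<in> {0..t}"
    have "norm (X s - X' s) \<le> ?d s + ?e s" using norm_triangle_ineq[of "(X s - y s) - (X' s - y' s)" "y s - y' s"] by simp
    then show "norm (F (X s) - F (X' s)) \<le> w * (?d s + ?e s)"
      using lip[of "X s" "X' s"] mult_left_mono[OF _ w] order_trans by blast
  qed
  also have "\<dots> = w * integral {0..t} ?d + w * integral {0..t} ?e"
    by (subst Henstock_Kurzweil_Integration.integral_mult_right)
       (simp only: Henstock_Kurzweil_Integration.integral_add[OF di ei] distrib_left)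
  also have "integral {0..t} ?e \<le> integral {0..T} ?e" using t by (intro integral_subset_le ei int) auto
  finally show "?d t \<le> norm (x - x') + w * integral {0..T} ?e + w * integral {0..t} ?d"
    using w by (simp add: mult_left_mono)
qed

lemma sol_lipschitz:
  assumes "sol_on F x y T X" "sol_on F x' y T X'" "t \<in> {0..T}"
  shows "norm (X t - X' t) \<le> norm (x - x') * exp (w * t)"
  using sol_stability[OF assms] by (simp add: integrable_const_ivl)

lemma sol_unique:
  assumes "sol_on F x y T X" "sol_on F x y T X'" "t \<in> {0..T}"
  shows "X t = X' t" using sol_lipschitz[OF assms] by simp

text \<open>Banach's theorem for \<open>U s = exp (- k * s) *\<^sub>R (X s - y s)\<close>, which is
  continuous although \<open>X\<close> need not be. The exponential weight makes the iteration a
  contraction with constant \<open>w / k\<close> on the whole interval, and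
  \<open>k = 2 * w + 1\<close> is positive and gives at most 1/2.\<close>

lemma sol_exists_on:
  assumes y: "noise y" and T: "0 \<le> T"
  shows "\<exists>X. sol_on F x y T X"
proof -
  obtain By where By: "\<And>s. s \<in> {0..T} ==> norm (y s) \<le> By" using y unfolding noise_def by meson
  have ym [measurable]: "y \<in> borel_measurable borel" using y by (simp add: noise_def)
  define k where "k = 2 * w + 1"
  have k: "k > 0" "w / k \<le> 1/2" using w by (auto simp: k_def field_simps)
  \<comment> \<open>Clamping time to \<open>[0, T]\<close> turns the iterates into bounded
    continuous functions on the line, which form a complete space.\<close>
  define \<tau> where "\<tau> t = max 0 (min t T)" for t
  have \<tau>: "\<tau> t \<in> {0..T}" for t using T by (auto simp: \<tau>_def)
  have \<tau>c: "continuous_on UNIV \<tau>" unfolding \<tau>_def[abs_def] by (intro continuous_intros)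
  define G where "G U s = F (exp (k * s) *\<^sub>R apply_bcontfun U s + y s)" for U :: "real \<Rightarrow>\<^sub>C 'a" and s
  have Gm: "G U \<in> borel_measurable borel" for U
  proof -
    have [measurable]: "apply_bcontfun U \<in> borel_measurable borel" by (intro borel_measurable_continuous_onI) simp
    show ?thesis unfolding G_def[abs_def] by measurable
  qed
  have Gi: "set_integrable lborel {0..t} (G U)" if t: "t \<in> {0..T}" for t U
  proof (rule bounded_borel_set_integrable[OF Gm])
    fix s assume s: "s \<in> {0..t}"
    have "norm (G U s) \<le> norm (F 0) + norm (G U s - F 0)" using norm_triangle_sub by blast
    also have "norm (G U s - F 0) \<le> w * norm (exp (k * s) *\<^sub>R apply_bcontfun U s + y s)" unfolding G_def using lip[of _ 0] by simp
    also have "norm (exp (k * s) *\<^sub>R apply_bcontfun U s + y s) \<le> exp (k * T) * norm U + By"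
    proof -
      have "norm (exp (k * s) *\<^sub>R apply_bcontfun U s) \<le> exp (k * T) * norm U"
        using s t k norm_bounded[of U s] by (auto intro!: mult_mono)
      then show ?thesis using By[of s] s t by (intro norm_triangle_le add_mono) auto
    qed
    finally show "norm (G U s) \<le> norm (F 0) + w * (exp (k * T) * norm U + By)" using w by (simp add: mult_left_mono)
  qed
  have Gio: "G U integrable_on {0..t}" if "t \<in> {0..T}" for t U using Gi[OF that] by (rule set_integrable_integrable_on)
  define H where "H U r = exp (- k * r) *\<^sub>R (x + integral {0..r} (G U))" for U r
  have Hc: "continuous_on {0..T} (H U)" for U
    unfolding H_def[abs_def] using Gio[of T U] T by (intro continuous_intros indefinite_integral_continuous_1) auto
  have H\<tau>: "(\<lambda>t. H U (\<tau> t)) \<in> bcontfun" for U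
    unfolding bcontfun_def
  proof (intro CollectI conjI)
    show "continuous_on UNIV (\<lambda>t. H U (\<tau> t))" by (rule continuous_on_compose2[OF Hc \<tau>c]) (use \<tau> in auto)
    have "compact (H U ` {0..T})" by (rule compact_continuous_image[OF Hc]) simp
    then show "bounded (range (\<lambda>t. H U (\<tau> t)))" using \<tau> by (intro bounded_subset[OF compact_imp_bounded]) auto
  qed
  define \<Phi> where "\<Phi> U = Bcontfun (\<lambda>t. H U (\<tau> t))" for U
  have \<Phi>: "apply_bcontfun (\<Phi> U) t = H U (\<tau> t)" for U t unfolding \<Phi>_def using H\<tau> by (simp add: Bcontfun_inverse)
  have "dist (\<Phi> U) (\<Phi> U') \<le> 1/2 * dist U U'" for U U'
  proof (rule dist_bound)
    fix t
    let ?r = "\<tau> t"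
    have r: "?r \<in> {0..T}" by (rule \<tau>)
    have "dist (\<Phi> U t) (\<Phi> U' t) = norm (exp (- k * ?r) *\<^sub>R integral {0..?r} (\<lambda>s. G U s - G U' s))"
      unfolding \<Phi> H_def dist_norm using Gio[OF r]
      by (simp add: Henstock_Kurzweil_Integration.integral_diff scaleR_diff_right[symmetric])
    also have "\<dots> = exp (- k * ?r) * norm (integral {0..?r} (\<lambda>s. G U s - G U' s))" by simp
    also have "\<dots> \<le> exp (- k * ?r) * (w * dist U U' / k * exp (k * ?r))"
    proof (rule mult_left_mono)
      have e: "((\<lambda>s. w * dist U U' * exp (k * s)) has_integral (w * dist U U' / k * exp (k * ?r) - w * dist U U' / k * exp (k * 0))) {0..?r}"
      proof (rule fundamental_theorem_of_calculus)
        show "0 \<le> ?r" using r by simp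
        show "((\<lambda>s. w * dist U U' / k * exp (k * s)) has_vector_derivative w * dist U U' * exp (k * s)) (at s within {0..?r})" for s
          using k unfolding has_real_derivative_iff_has_vector_derivative[symmetric]
          by (auto intro!: derivative_eq_intros)
      qed
      have "norm (integral {0..?r} (\<lambda>s. G U s - G U' s)) \<le> integral {0..?r} (\<lambda>s. w * dist U U' * exp (k * s))"
      proof (rule Henstock_Kurzweil_Integration.integral_norm_bound_integral)
        show "(\<lambda>s. G U s - G U' s) integrable_on {0..?r}" by (intro Henstock_Kurzweil_Integration.integrable_diff Gio r)
        show "(\<lambda>s. w * dist U U' * exp (k * s)) integrable_on {0..?r}" using e by blast
        fix s
        have "norm (G U s - G U' s) \<le> w * norm (exp (k * s) *\<^sub>R apply_bcontfun U s - exp (k * s) *\<^sub>R apply_bcontfun U' s)"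
          unfolding G_def using lip[of "exp (k * s) *\<^sub>R apply_bcontfun U s + y s" "exp (k * s) *\<^sub>R apply_bcontfun U' s + y s"] by simp
        also have "norm (exp (k * s) *\<^sub>R apply_bcontfun U s - exp (k * s) *\<^sub>R apply_bcontfun U' s) = exp (k * s) * dist (U s) (U' s)"
          by (simp add: scaleR_diff_right[symmetric] dist_norm)
        also have "w * (exp (k * s) * dist (U s) (U' s)) \<le> w * (exp (k * s) * dist U U')"
          using w dist_bounded[of U s U'] by (intro mult_left_mono) auto
        finally show "norm (G U s - G U' s) \<le> w * dist U U' * exp (k * s)" by (simp add: mult_ac)
      qed
      also have "\<dots> = w * dist U U' / k * exp (k * ?r) - w * dist U U' / k * exp (k * 0)" using e by (rule integral_unique)
      also have "\<dots> \<le> w * dist U U' / k * exp (k * ?r)" using w k by simp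
      finally show "norm (integral {0..?r} (\<lambda>s. G U s - G U' s)) \<le> w * dist U U' / k * exp (k * ?r)" .
    qed simp
    also have "\<dots> = (w / k) * dist U U'" by (simp add: exp_minus field_simps)
    also have "\<dots> \<le> 1/2 * dist U U'" using k by (intro mult_right_mono) auto
    finally show "dist (\<Phi> U t) (\<Phi> U' t) \<le> 1/2 * dist U U'" .
  qed
  then have "\<exists>!U. \<Phi> U = U" by (intro banach_fix_type[of "1/2"]) auto
  then obtain U where U: "\<Phi> U = U" by blast
  define X where "X s = exp (k * s) *\<^sub>R apply_bcontfun U s + y s" for s
  have FX: "(\<lambda>s. F (X s)) = G U" by (simp add: X_def G_def fun_eq_iff)
  have "X t = x + integral {0..t} (G U) + y t" if t: "t \<in> {0..T}" for t
  proof -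
    have "apply_bcontfun U t = H U t" using \<Phi>[of U t] t by (simp add: U \<tau>_def)
    then show ?thesis unfolding X_def H_def by (simp add: exp_minus)
  qed
  then show ?thesis unfolding sol_on_def using Gi by (intro exI[of _ X]) (auto simp: FX)
qed

lemma sol_exists:
  assumes y: "noise y"
  shows "\<exists>X. \<forall>T. sol_on F x y T X"
proof -
  have "\<exists>X. sol_on F x y (real n) X" for n :: nat by (rule sol_exists_on[OF y]) simp
  then obtain V where V: "\<And>n::nat. sol_on F x y (real n) (V n)" by metis
  define X where "X t = V (nat \<lceil>t\<rceil>) t" for t
  have XV: "X s = V n s" if "0 \<le> s" "s \<le> real n" for s n
  proof -
    have "nat \<lceil>s\<rceil> \<le> n" using that by linarith
    then have "sol_on F x y (real (nat \<lceil>s\<rceil>)) (V n)" using V[of n] by (rule_tac sol_on_mono) auto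
    then show ?thesis unfolding X_def by (rule sol_unique[OF V]) (use that in \<open>simp add: of_nat_ceiling\<close>)
  qed
  have "sol_on F x y T X" for T
    unfolding sol_on_def
  proof (intro ballI conjI)
    fix t assume t: "t \<in> {0..T}"
    define n where "n = nat \<lceil>t\<rceil>"
    have n: "t \<le> real n" by (simp add: n_def of_nat_ceiling)
    have s: "set_integrable lborel {0..t} (\<lambda>s. F (V n s))" "V n t = x + integral {0..t} (\<lambda>s. F (V n s)) + y t"
      using V[of n] t n unfolding sol_on_def by auto
    show "set_integrable lborel {0..t} (\<lambda>s. F (X s))"
      using s(1) by (rule set_integrable_cong[THEN iffD1, rotated -1]) (use XV[of _ n] n in auto)
    have "integral {0..t} (\<lambda>s. F (X s)) = integral {0..t} (\<lambda>s. F (V n s))"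
      by (rule Henstock_Kurzweil_Integration.integral_cong) (use XV[of _ n] n in auto)
    then show "X t = x + integral {0..t} (\<lambda>s. F (X s)) + y t" using s(2) XV[of t n] t n by simp
  qed
  then show ?thesis by blast
qed

definition sol :: "'a \<Rightarrow> (real \<Rightarrow> 'a) \<Rightarrow> real \<Rightarrow> 'a" where
  "sol x y = (SOME X. \<forall>T. sol_on F x y T X)"

lemma sol: "noise y ==> sol_on F x y T (sol x y)"
  unfolding sol_def using someI_ex[OF sol_exists[of y x]] by blast

section \<open>The flow of the drift and the splitting approximation\<close>

definition flow :: "real \<Rightarrow> 'a \<Rightarrow> 'a" where "flow t x = sol x (\<lambda>_. 0) t"

lemma noise_zero: "noise (\<lambda>_. 0)" by (auto simp: noise_def intro: exI[of _ 0])

lemma flow_sol: "sol_on F x (\<lambda>_. 0) T (\<lambda>t. flow t x)"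
  unfolding flow_def using sol[OF noise_zero] by simp

lemma flow_eq: "0 \<le> t ==> flow t x = x + integral {0..t} (\<lambda>s. F (flow s x))"
  using flow_sol[of x t] unfolding sol_on_def by auto

lemma flow_0 [simp]: "flow 0 x = x" using flow_eq[of 0 x] by simp

lemma flow_lipschitz: "0 \<le> t ==> norm (flow t x - flow t x') \<le> norm (x - x') * exp (w * t)"
  using sol_lipschitz[OF flow_sol flow_sol] by auto

lemma flow_continuous_time: "continuous_on {0..T} (\<lambda>t. flow t x)"
  using sol_on_drift_continuous[OF flow_sol[of x T]] by simp

lemma flow_continuous: "0 \<le> t ==> continuous_on UNIV (flow t)"
  using w flow_lipschitz[of t] by (intro lipschitz_on_continuous_on[of "exp (w * t)"] lipschitz_onI) (auto simp: dist_norm mult.commute)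

lemma flow_measurable: "0 \<le> t ==> flow t \<in> borel_measurable borel"
  by (rule borel_measurable_continuous_onI[OF flow_continuous])

lemma noise_norm_integrable:
  assumes "noise y" "0 \<le> a" shows "(\<lambda>s. norm (y s - c)) integrable_on {a..b}"
proof -
  obtain B where B: "\<And>s. s \<in> {0..b} ==> norm (y s) \<le> B" using assms(1) unfolding noise_def by meson
  have [measurable]: "y \<in> borel_measurable borel" using assms(1) by (simp add: noise_def)
  show ?thesis
  proof (rule set_integrable_integrable_on, rule bounded_borel_set_integrable)
    show "norm (norm (y s - c)) \<le> B + norm c" if "s \<in> {a..b}" for s
      using B[of s] that assms(2) norm_triangle_ineq4[of "y s" c] by auto
  qed measurable
qed

lemma sol_flow_distance:
  assumes y: "noise y" and t: "0 \<le> t"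
  shows "norm ((sol x y t - y t) - flow t x) \<le> w * integral {0..t} (\<lambda>s. norm (y s)) * exp (w * t)"
  using sol_stability[OF sol[OF y, of x t] flow_sol[of x t], of t] noise_norm_integrable[OF y, of 0 0 t] t by simp

text \<open>One step of the splitting: adding the noise increment first and then following the flow.\<close>

lemma splitting_step:
  assumes y: "noise y" and a: "0 \<le> a" and s: "0 \<le> s"
  shows "norm (flow s (p + (y (a + s) - y a)) - sol x y (a + s)) \<le>
    exp (w * s) * (norm (p - sol x y a) + w * integral {a..a+s} (\<lambda>v. norm (y v - y (a + s))))"
proof -
  let ?X = "sol x y"
  define c where "c = y (a + s)"
  \<comment> \<open>\<open>W\<close> has the drift of the solution, but carries from the start the
    noise value reached at the end of the step. It is therefore continuous and ends at the solution:
    \<open>W s = sol x y (a + s)\<close>.\<close>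
  define W where "W u = ?X (a + u) - y (a + u) + c" for u
  have FXi: "(\<lambda>v. F (?X v)) integrable_on {0..a+u}" if "0 \<le> u" for u
    using sol[OF y, of x "a + u"] a that unfolding sol_on_def by (auto intro: set_integrable_integrable_on)
  have Xeq: "?X t = x + integral {0..t} (\<lambda>v. F (?X v)) + y t" if "0 \<le> t" for t
    using sol[OF y, of x t] that unfolding sol_on_def by auto
  have Weq: "W u = (?X a - y a + c) + integral {0..u} (\<lambda>v. F (?X (a + v)))" if u: "0 \<le> u" for u
  proof -
    have "integral {0..a} (\<lambda>v. F (?X v)) + integral {a..a+u} (\<lambda>v. F (?X v)) = integral {0..a+u} (\<lambda>v. F (?X v))"
      using a u by (intro Henstock_Kurzweil_Integration.integral_combine FXi) auto
    moreover have "integral {a..a+u} (\<lambda>v. F (?X v)) = integral {0..u} (\<lambda>v. F (?X (a + v)))"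
      using integral_shift_real_ivl[of a a "a + u" "\<lambda>v. F (?X v)"] by (simp add: add.commute)
    ultimately show ?thesis using Xeq[of "a + u"] Xeq[of a] a u by (simp add: W_def)
  qed
  have Wc: "continuous_on {0..s} W"
  proof -
    have "continuous_on {0..a+s} (\<lambda>t. ?X t - y t)" by (rule sol_on_drift_continuous[OF sol[OF y]])
    then have "continuous_on {0..s} (\<lambda>u. ?X (a + u) - y (a + u))"
      by (rule continuous_on_compose2[where f="\<lambda>u. a + u"]) (use a in \<open>auto intro!: continuous_intros\<close>)
    then show ?thesis unfolding W_def[abs_def] by (rule continuous_on_add[OF _ continuous_on_const])
  qed
  let ?q = "p + (y (a + s) - y a)"
  let ?d = "\<lambda>u. norm (flow u ?q - W u)"
  let ?e = "\<lambda>v. norm (y v - c)"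
  have cd: "continuous_on {0..s} ?d" by (intro continuous_intros flow_continuous_time Wc)
  have ei: "(\<lambda>v. ?e (a + v)) integrable_on {0..s}"
  proof -
    obtain B where B: "\<And>r. r \<in> {0..a+s} ==> norm (y r) \<le> B" using y unfolding noise_def by meson
    have [measurable]: "y \<in> borel_measurable borel" using y by (simp add: noise_def)
    show ?thesis
    proof (rule set_integrable_integrable_on, rule bounded_borel_set_integrable)
      show "norm (norm (y (a + v) - c)) \<le> B + norm c" if "v \<in> {0..s}" for v
        using B[of "a + v"] that a norm_triangle_ineq4[of "y (a + v)" c] by auto
    qed measurable
  qed
  have es: "integral {0..s} (\<lambda>v. ?e (a + v)) = integral {a..a+s} ?e"
    using integral_shift_real_ivl[of a a "a + s" ?e] by (simp add: add.commute)
  have "?d s \<le> (norm (p - ?X a) + w * integral {a..a+s} ?e) * exp (w * s)"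
  proof (rule gronwall[OF cd w])
    show "s \<in> {0..s}" using s by simp
    fix u assume u: "u \<in> {0..s}"
    have i1: "(\<lambda>v. F (flow v ?q)) integrable_on {0..u}"
      using flow_sol[of ?q u] u unfolding sol_on_def by (auto intro: set_integrable_integrable_on)
    have i2: "(\<lambda>v. F (?X (a + v))) integrable_on {0..u}"
    proof -
      have "(\<lambda>v. F (?X v)) integrable_on {a..a+u}"
        using FXi[of u] a u by (auto intro: integrable_subinterval_real)
      then show ?thesis using integrable_shift_real_ivl[of "\<lambda>v. F (?X v)" a "a+u" a] by (simp add: add.commute)
    qed
    have di: "?d integrable_on {0..u}" using cd u by (intro integrable_continuous_real) (auto intro: continuous_on_subset)
    have ei': "(\<lambda>v. ?e (a + v)) integrable_on {0..u}" using ei u by (auto intro: integrable_subinterval_real)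
    have "flow u ?q - W u = (p - ?X a) + integral {0..u} (\<lambda>v. F (flow v ?q) - F (?X (a + v)))"
      using flow_eq[of u ?q] Weq[of u] u i1 i2 by (simp add: Henstock_Kurzweil_Integration.integral_diff c_def)
    then have "?d u \<le> norm (p - ?X a) + norm (integral {0..u} (\<lambda>v. F (flow v ?q) - F (?X (a + v))))"
      by (simp add: norm_triangle_ineq)
    also have "norm (integral {0..u} (\<lambda>v. F (flow v ?q) - F (?X (a + v)))) \<le> integral {0..u} (\<lambda>v. w * (?d v + ?e (a + v)))"
    proof (rule Henstock_Kurzweil_Integration.integral_norm_bound_integral)
      show "(\<lambda>v. F (flow v ?q) - F (?X (a + v))) integrable_on {0..u}" by (intro Henstock_Kurzweil_Integration.integrable_diff i1 i2)
      show "(\<lambda>v. w * (?d v + ?e (a + v))) integrable_on {0..u}"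
        using Henstock_Kurzweil_Integration.integrable_add[OF di ei'] by (rule integrable_on_mult_right)
      fix v assume "v \<in> {0..u}"
      have "flow v ?q - ?X (a + v) = (flow v ?q - W v) - (y (a + v) - c)" by (simp add: W_def)
      then have "norm (flow v ?q - ?X (a + v)) \<le> ?d v + ?e (a + v)" by (metis norm_triangle_ineq4)
      then show "norm (F (flow v ?q) - F (?X (a + v))) \<le> w * (?d v + ?e (a + v))"
        using lip[of "flow v ?q" "?X (a + v)"] mult_left_mono[OF _ w] order_trans by blast
    qed
    also have "\<dots> = w * integral {0..u} ?d + w * integral {0..u} (\<lambda>v. ?e (a + v))"
      by (subst Henstock_Kurzweil_Integration.integral_mult_right)
         (simp only: Henstock_Kurzweil_Integration.integral_add[OF di ei'] distrib_left)
    also have "integral {0..u} (\<lambda>v. ?e (a + v)) \<le> integral {a..a+s} ?e"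
      unfolding es[symmetric] using u by (intro integral_subset_le ei ei') auto
    finally show "?d u \<le> norm (p - ?X a) + w * integral {a..a+s} ?e + w * integral {0..u} ?d"
      using w by (simp add: mult_left_mono)
  qed
  moreover have "W s = ?X (a + s)" by (simp add: W_def c_def)
  ultimately show ?thesis by (simp add: c_def mult.commute)
qed

definition splitting :: "real \<Rightarrow> nat \<Rightarrow> 'a \<Rightarrow> (nat \<Rightarrow> 'a) \<Rightarrow> 'a" where
  "splitting s m x d = chain (\<lambda>z e. flow s (z + e)) x d m"

lemma splitting_error:
  assumes y: "noise y" and y0: "y 0 = 0" and s: "0 \<le> s"
  shows "norm (splitting s q x (\<lambda>i. y (real (Suc i) * s) - y (real i * s)) - sol x y (real q * s)) \<le>
    exp (w * (real q * s)) * w * (\<Sum>i<q. integral {real i * s..real (Suc i) * s} (\<lambda>v. norm (y v - y (real (Suc i) * s))))"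
proof (induction q)
  case 0
  have "sol x y 0 = x" using sol[OF y, of x 0] y0 unfolding sol_on_def by simp
  then show ?case by (simp add: splitting_def)
next
  case (Suc q)
  let ?I = "\<lambda>i. integral {real i * s..real (Suc i) * s} (\<lambda>v. norm (y v - y (real (Suc i) * s)))"
  let ?d = "\<lambda>i. y (real (Suc i) * s) - y (real i * s)"
  have e: "real q * s + s = real (Suc q) * s" by (simp add: algebra_simps)
  have I0: "0 \<le> ?I i" for i by (intro Henstock_Kurzweil_Integration.integral_nonneg noise_norm_integrable[OF y]) (use s in auto)
  have "norm (splitting s (Suc q) x ?d - sol x y (real (Suc q) * s)) \<le>
    exp (w * s) * (norm (splitting s q x ?d - sol x y (real q * s)) + w * ?I q)"
    using splitting_step[OF y, of "real q * s" s "splitting s q x ?d" x] s unfolding e splitting_def by simp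
  also have "\<dots> \<le> exp (w * s) * (exp (w * (real q * s)) * w * (\<Sum>i<q. ?I i) + exp (w * (real q * s)) * w * ?I q)"
  proof (intro mult_left_mono add_mono Suc.IH)
    have "1 \<le> exp (w * (real q * s))" using w s by simp
    then show "w * ?I q \<le> exp (w * (real q * s)) * w * ?I q"
      using mult_right_mono[of 1 "exp (w * (real q * s))" "w * ?I q"] w I0 by (simp add: mult.assoc)
  qed simp
  also have "\<dots> = (exp (w * s) * exp (w * (real q * s))) * w * (\<Sum>i<Suc q. ?I i)" by (simp add: algebra_simps)
  also have "exp (w * s) * exp (w * (real q * s)) = exp (w * (real (Suc q) * s))"
    by (simp add: exp_add[symmetric] algebra_simps)
  finally show ?case .
qed

text \<open>The accumulated error is the integral of the distance between \<open>y v\<close> and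
  \<open>y\<close> at the next grid point to the right. Right continuity sends this distance to 0
  for every \<open>v\<close>, local boundedness dominates it, so only dominated convergence is
  needed and jumps do no harm.\<close>

lemma splitting_converges:
  assumes y: "noise y" and y0: "y 0 = 0" and rc: "\<And>t. 0 \<le> t ==> continuous (at_right t) y" and t: "0 \<le> t"
  shows "(\<lambda>m. splitting (t / real (Suc m)) (Suc m) x (\<lambda>i. y (real (Suc i) * (t / real (Suc m))) - y (real i * (t / real (Suc m))))) ----> sol x y t"
proof (cases "t = 0")
  case True
  have "splitting 0 q x (\<lambda>_. 0) = x" for q
  proof (induction q)
    case (Suc q) then show ?case by (simp add: splitting_def)
  qed (simp add: splitting_def)
  moreover have "sol x y 0 = x" using sol[OF y, of x 0] y0 unfolding sol_on_def by simp
  ultimately show ?thesis using True by simp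
next
  case False
  with t have t: "0 < t" by simp
  define s where "s m = t / real (Suc m)" for m
  have s: "0 < s m" "real (Suc m) * s m = t" for m using t by (auto simp: s_def)
  \<comment> \<open>The next grid point strictly to the right of \<open>v\<close>, so that it tends
    to \<open>v\<close> within \<open>at_right v\<close>.\<close>
  define R where "R m v = real_of_int (\<lfloor>v / s m\<rfloor> + 1) * s m" for m v
  have Rb: "v < R m v" "R m v \<le> v + s m" for m v
  proof -
    have a: "v / s m < real_of_int (\<lfloor>v / s m\<rfloor> + 1)" and b: "real_of_int (\<lfloor>v / s m\<rfloor> + 1) \<le> v / s m + 1" by linarith+
    have 1: "v / s m * s m < R m v" unfolding R_def by (rule mult_strict_right_mono[OF a s(1)])
    have 2: "R m v \<le> (v / s m + 1) * s m" unfolding R_def by (rule mult_right_mono[OF b less_imp_le[OF s(1)]])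
    have 3: "v / s m * s m = v" using s(1)[of m] by simp
    show "v < R m v" using 1 unfolding 3 .
    show "R m v \<le> v + s m" using 2 unfolding distrib_right mult_1 3 .
  qed
  have s0: "s ----> 0"
    unfolding s_def[abs_def] by (rule LIMSEQ_Suc[OF lim_const_over_n])
  have sb: "s m \<le> t" for m using t by (simp add: s_def field_simps)
  obtain B where B: "\<And>r. r \<in> {0..2*t} ==> norm (y r) \<le> B" using y unfolding noise_def by meson
  have ym [measurable]: "y \<in> borel_measurable borel" using y by (simp add: noise_def)
  have Rm [measurable]: "R m \<in> borel_measurable borel" for m unfolding R_def[abs_def] by measurable
  let ?g = "\<lambda>m v. norm (y v - y (R m v))"
  have gB: "norm (?g m v) \<le> 2 * B" if "v \<in> {0..t}" for m v
    using B[of v] B[of "R m v"] Rb[where m=m and v=v] sb[of m] that t norm_triangle_ineq4[of "y v" "y (R m v)"] by auto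
  have gi: "set_integrable lborel {0..t} (?g m)" for m by (rule bounded_borel_set_integrable[OF _ gB]) measurable
  have Isum: "(\<Sum>i<q. integral {real i * s m..real (Suc i) * s m} (\<lambda>v. norm (y v - y (real (Suc i) * s m)))) = integral {0..real q * s m} (?g m)"
    if "q \<le> Suc m" for q m using that
  proof (induction q)
    case (Suc q)
    have le: "real (Suc q) * s m \<le> t"
    proof -
      have "real (Suc q) * s m \<le> real (Suc m) * s m" using Suc.prems s(1)[of m] by (intro mult_right_mono) auto
      then show ?thesis unfolding s(2) .
    qed
    have q0: "0 \<le> real q * s m" "real q * s m \<le> real (Suc q) * s m" using s(1)[of m] by (auto simp: mult_right_mono)
    have "integral {real q * s m..real (Suc q) * s m} (\<lambda>v. norm (y v - y (real (Suc q) * s m))) = integral {real q * s m..real (Suc q) * s m} (?g m)"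
    \<comment> \<open>At the right end of a cell the floor already belongs to the next cell; this
      single point is discarded.\<close>
    proof (rule integral_spike[of "{real (Suc q) * s m}"])
      fix v assume v: "v \<in> {real q * s m..real (Suc q) * s m} - {real (Suc q) * s m}"
      then have "real q \<le> v / s m" "v / s m < real (Suc q)" using s(1)[of m] by (auto simp: field_simps)
      then have "\<lfloor>v / s m\<rfloor> = int q" by (simp add: floor_eq_iff)
      then show "?g m v = norm (y v - y (real (Suc q) * s m))" by (simp add: R_def algebra_simps)
    qed simp
    moreover have "integral {0..real q * s m} (?g m) + integral {real q * s m..real (Suc q) * s m} (?g m) = integral {0..real (Suc q) * s m} (?g m)"
      using q0 le set_integrable_integrable_on[OF gi[of m]]
      by (intro Henstock_Kurzweil_Integration.integral_combine) (auto intro: integrable_subinterval_real)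
    ultimately show ?case using Suc by simp
  qed simp
  have lim: "(\<lambda>m. integral {0..t} (?g m)) ----> 0"
  proof -
    have "(\<lambda>m. LINT v|lborel. indicator {0..t} v *\<^sub>R ?g m v) ----> (LINT v|(lborel :: real measure). (0 :: real))"
    proof (rule integral_dominated_convergence[where w="\<lambda>v. indicator {0..t} v * (2 * B)"])
      show "AE v in lborel. (\<lambda>m. indicator {0..t} v *\<^sub>R ?g m v) ----> 0"
      proof (rule AE_I2)
        fix v :: real
        show "(\<lambda>m. indicator {0..t} v *\<^sub>R ?g m v) ----> 0"
        proof (cases "v \<in> {0..t}")
          case True
          have "(\<lambda>m. R m v) ----> v"
          proof (rule tendsto_sandwich[of "\<lambda>_. v" _ _ "\<lambda>m. v + s m"])
            show "(\<lambda>m. v + s m) ----> v" using tendsto_add[OF tendsto_const s0, of v] by simp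
          qed (use Rb in \<open>auto intro: always_eventually less_imp_le\<close>)
          then have "filterlim (\<lambda>m. R m v) (at_right v) sequentially"
            unfolding filterlim_at using Rb(1)[of v] by (auto simp: less_imp_neq[symmetric])
          moreover have "(y \<longlongrightarrow> y v) (at_right v)" using rc[of v] True by (simp add: continuous_within)
          ultimately have "(\<lambda>m. y (R m v)) ----> y v" by (rule filterlim_compose[rotated])
          then have "(\<lambda>m. ?g m v) ----> norm (y v - y v)" by (intro tendsto_intros)
          then show ?thesis using True by simp
        qed simp
      qed
      show "integrable lborel (\<lambda>v. indicator {0..t} v * (2 * B))" using t by (intro integrable_mult_left) auto
      show "AE v in lborel. norm (indicator {0..t} v *\<^sub>R ?g m v) \<le> indicator {0..t} v * (2 * B)" for m
        using gB[of _ m] by (auto simp: indicator_def)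
    qed auto
    moreover have "(LINT v|lborel. indicator {0..t} v *\<^sub>R ?g m v) = integral {0..t} (?g m)" for m
      using set_borel_integral_eq_integral(2)[OF gi[of m]] unfolding set_lebesgue_integral_def .
    ultimately show ?thesis by simp
  qed
  show ?thesis
  proof (rule LIM_zero_cancel, rule Lim_null_comparison[of _ "\<lambda>m. exp (w * t) * w * integral {0..t} (?g m)"])
    show "(\<lambda>m. exp (w * t) * w * integral {0..t} (?g m)) ----> 0"
      using tendsto_mult_left[OF lim, of "exp (w * t) * w"] by simp
    show "EV m. norm (splitting (t / real (Suc m)) (Suc m) x (\<lambda>i. y (real (Suc i) * (t / real (Suc m))) - y (real i * (t / real (Suc m)))) - sol x y t) \<le> exp (w * t) * w * integral {0..t} (?g m)"
    proof (rule always_eventually, rule allI)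
      fix m
      show "norm (splitting (t / real (Suc m)) (Suc m) x (\<lambda>i. y (real (Suc i) * (t / real (Suc m))) - y (real i * (t / real (Suc m)))) - sol x y t) \<le> exp (w * t) * w * integral {0..t} (?g m)"
        using splitting_error[OF y y0 less_imp_le[OF s(1)[of m]], of "Suc m" x] unfolding Isum[OF order_refl] s(2) unfolding s_def .
    qed
  qed
qed

end

section \<open>Equations driven by L\'evy processes\<close>

lemma cadlag_locally_bounded:
  assumes c: "cadlag p" and t: "0 \<le> t"
  shows "\<exists>d>0. \<exists>B. \<forall>s. 0 \<le> s --> \<bar>s - t\<bar> < d --> norm (p s) \<le> B"
proof -
  have "(p \<longlongrightarrow> p t) (at_right t)" using c t unfolding cadlag_def continuous_within by auto
  then have "\<forall>\<^sub>F s in at_right t. dist (p s) (p t) < 1" by (rule tendstoD) simp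
  then obtain b where b: "b > t" "\<And>s. t < s ==> s < b ==> dist (p s) (p t) < 1" by (auto simp: eventually_at_right_field)
  have r: "norm (p s) \<le> norm (p t) + 1" if "t \<le> s" "s < b" for s
    using b(2)[of s] that norm_triangle_sub[of "p s" "p t"] by (cases "s = t") (auto simp: dist_norm)
  have "\<exists>a<t. \<exists>B. \<forall>s. 0 \<le> s --> a < s --> s < t --> norm (p s) \<le> B"
  proof (cases "t = 0")
    case True
    then show ?thesis by (intro exI[of _ "-1"]) auto
  next
    case False
    then obtain l where l: "(p \<longlongrightarrow> l) (at_left t)" using c t unfolding cadlag_def by force
    then have "\<forall>\<^sub>F s in at_left t. dist (p s) l < 1" by (rule tendstoD) simp
    then obtain a where a: "a < t" "\<And>s. a < s ==> s < t ==> dist (p s) l < 1" by (auto simp: eventually_at_left_field)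
    have "norm (p s) \<le> norm l + 1" if "a < s" "s < t" for s
      using a(2)[OF that] norm_triangle_sub[of "p s" l] by (simp add: dist_norm)
    then show ?thesis using a(1) by blast
  qed
  then obtain a B where a: "a < t" "\<And>s. 0 \<le> s ==> a < s ==> s < t ==> norm (p s) \<le> B" by blast
  have "norm (p s) \<le> max (norm (p t) + 1) B" if "0 \<le> s" "\<bar>s - t\<bar> < min (b - t) (t - a)" for s
    using r[of s] a(2)[of s] that by (cases "t \<le> s") (auto simp: le_max_iff_disj)
  moreover have "0 < min (b - t) (t - a)" using a b by simp
  ultimately show ?thesis by blast
qed

lemma cadlag_bounded:
  assumes c: "cadlag p"
  shows "\<exists>B. \<forall>s\<in>{0..T}. norm (p s) \<le> B"
proof -
  have "\<exists>d B. d > 0 \<and> (\<forall>s. 0 \<le> s --> \<bar>s - t\<bar> < d --> norm (p s) \<le> B)" if "t \<in> {0..T}" for t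
    using cadlag_locally_bounded[OF c, of t] that by auto
  then obtain d B where dB: "\<And>t. t \<in> {0..T} ==> d t > 0 \<and> (\<forall>s. 0 \<le> s --> \<bar>s - t\<bar> < d t --> norm (p s) \<le> B t)"
    by metis
  have "{0..T} \<subseteq> (\<Union>t\<in>{0..T}. ball t (d t))" using dB by fastforce
  then obtain C where C: "C \<subseteq> {0..T}" "finite C" "{0..T} \<subseteq> (\<Union>t\<in>C. ball t (d t))"
    using compactE_image[OF compact_Icc[of 0 T], of "{0..T}" "\<lambda>t. ball t (d t)"] by auto
  have "norm (p s) \<le> Max (insert 0 (B ` C))" if s: "s \<in> {0..T}" for s
  proof -
    obtain t where t: "t \<in> C" "s \<in> ball t (d t)" using C(3) s by blast
    then have "norm (p s) \<le> B t" using dB[of t] C(1) s by (auto simp: dist_real_def abs_minus_commute)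
    also have "B t \<le> Max (insert 0 (B ` C))" using t C(2) by (intro Max_ge) auto
    finally show ?thesis .
  qed
  then show ?thesis by blast
qed

text \<open>\<open>noise\<close> asks for measurability on the whole line, whereas \<open>Y\<close>
  is uncontrolled at negative times; there the path is set to 0.\<close>

definition path :: "(real \<Rightarrow> 'w \<Rightarrow> 'a::real_vector) \<Rightarrow> 'w \<Rightarrow> real \<Rightarrow> 'a" where
  "path Y \<omega> s = (if s < 0 then 0 else Y s \<omega>)"

text \<open>Measurability in time: by right continuity the path is the limit of the step functions
  \<open>Y (dup m s) \<omega>\<close>.\<close>

lemma cadlag_noise:
  assumes c: "cadlag (\<lambda>t. Y t \<omega>)"
  shows "noise (path Y \<omega>)"
  unfolding noise_def
proof
  let ?f = "\<lambda>m s. if s < 0 then 0 else Y (dup m s) \<omega>"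
  show "path Y \<omega> \<in> borel_measurable borel"
  proof (rule borel_measurable_LIMSEQ_metric[where f="?f"])
    fix m
    have "(\<lambda>s::real. (\<lambda>z::int. Y ((of_int z + 1) / 2 ^ m) \<omega>) \<lfloor>s * 2 ^ m\<rfloor>) \<in> borel_measurable borel"
      by (rule measurable_compose[where N="count_space UNIV"]) auto
    then have "(\<lambda>s. Y (dup m s) \<omega>) \<in> borel_measurable borel" by (simp add: dup_def)
    then show "?f m \<in> borel_measurable borel" by measurable
  next
    fix s :: real
    show "(\<lambda>m. ?f m s) ----> path Y \<omega> s"
    proof (cases "s < 0")
      case False
      then have "((\<lambda>t. Y t \<omega>) \<longlongrightarrow> Y s \<omega>) (at_right s)" using c unfolding cadlag_def continuous_within by auto
      moreover have "filterlim (\<lambda>m. dup m s) (at_right s) sequentially"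
        unfolding filterlim_at using dup_tendsto dup_bounds(1)[of s] by (auto simp: less_imp_neq[symmetric])
      ultimately have "(\<lambda>m. Y (dup m s) \<omega>) ----> Y s \<omega>" by (rule filterlim_compose)
      then show ?thesis using False by (simp add: path_def)
    qed (simp add: path_def)
  qed
  show "\<forall>T. \<exists>B. \<forall>s\<in>{0..T}. norm (path Y \<omega> s) \<le> B"
    using cadlag_bounded[OF c] by (simp add: path_def)
qed

lemma cadlag_path_right_continuous:
  assumes "cadlag (\<lambda>t. Y t \<omega>)" "0 \<le> t" shows "continuous (at_right t) (path Y \<omega>)"
proof -
  have "((\<lambda>t. Y t \<omega>) \<longlongrightarrow> Y t \<omega>) (at_right t)" using assms unfolding cadlag_def continuous_within by auto
  then have "(path Y \<omega> \<longlongrightarrow> Y t \<omega>) (at_right t)"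
    by (rule Lim_transform_eventually) (use assms(2) in \<open>auto simp: path_def eventually_at_right_field intro!: exI[of _ "t + 1"]\<close>)
  then show ?thesis using assms(2) by (simp add: continuous_within path_def)
qed

text \<open>A measurable null set covering all paths that are not cadlag or do not start at 0. It is
  fixed once, so that the same exceptional set serves every initial value and every time.\<close>

definition bad_set :: "'w measure \<Rightarrow> (real \<Rightarrow> 'w \<Rightarrow> 'a::euclidean_space) \<Rightarrow> 'w set" where
  "bad_set M Y = (SOME N. N \<in> null_sets M \<and> {\<omega> \<in> space M. \<not> (cadlag (\<lambda>t. Y t \<omega>) \<and> Y 0 \<omega> = 0)} \<subseteq> N)"

locale levy =
  fixes M :: "'w measure" and Y :: "real \<Rightarrow> 'w \<Rightarrow> 'a::euclidean_space"
  assumes levy: "levy_process M Y"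
begin

sublocale prob_space M using levy by (simp add: levy_process_def)

lemma Y_measurable: "0 \<le> t ==> Y t \<in> borel_measurable M" using levy by (simp add: levy_process_def)

lemma AE_Y0: "AE \<omega> in M. Y 0 \<omega> = 0" using levy by (simp add: levy_process_def)

lemma bad_set: "bad_set M Y \<in> null_sets M" "\<And>\<omega>. \<omega> \<in> space M ==> \<omega> \<notin> bad_set M Y ==> cadlag (\<lambda>t. Y t \<omega>) \<and> Y 0 \<omega> = 0"
proof -
  have "AE \<omega> in M. cadlag (\<lambda>t. Y t \<omega>) \<and> Y 0 \<omega> = 0"
    using levy unfolding levy_process_def by auto
  then obtain N where "{\<omega> \<in> space M. \<not> (cadlag (\<lambda>t. Y t \<omega>) \<and> Y 0 \<omega> = 0)} \<subseteq> N" "emeasure M N = 0" "N \<in> sets M" by (rule AE_E)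
  then have "\<exists>N. N \<in> null_sets M \<and> {\<omega> \<in> space M. \<not> (cadlag (\<lambda>t. Y t \<omega>) \<and> Y 0 \<omega> = 0)} \<subseteq> N" by auto
  from someI_ex[OF this] show "bad_set M Y \<in> null_sets M" "\<And>\<omega>. \<omega> \<in> space M ==> \<omega> \<notin> bad_set M Y ==> cadlag (\<lambda>t. Y t \<omega>) \<and> Y 0 \<omega> = 0"
    unfolding bad_set_def by blast+
qed

lemma AE_good: "AE \<omega> in M. \<omega> \<in> space M \<and> \<omega> \<notin> bad_set M Y"
  using AE_not_in[OF bad_set(1)] AE_space by eventually_elim simp

lemma good_noise:
  assumes "\<omega> \<in> space M" "\<omega> \<notin> bad_set M Y"
  shows "noise (path Y \<omega>)" "path Y \<omega> 0 = 0" "\<And>t. 0 \<le> t ==> continuous (at_right t) (path Y \<omega>)"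
  using bad_set(2)[OF assms] cadlag_noise[of Y \<omega>] cadlag_path_right_continuous[of Y \<omega>] by (auto simp: path_def)

definition \<nu> :: "real \<Rightarrow> 'a measure" where "\<nu> t = distr M borel (Y t)"

lemma borel_prob_\<nu>: "0 \<le> t ==> borel_prob (\<nu> t)"
  using prob_space_distr[OF Y_measurable] by (simp add: \<nu>_def borel_prob_def borel_prob_axioms_def)

lemma law_increment: "0 \<le> s ==> 0 \<le> h ==> distr M borel (\<lambda>\<omega>. Y (s + h) \<omega> - Y s \<omega>) = \<nu> h"
proof -
  assume sh: "0 \<le> s" "0 \<le> h"
  then have "distr M borel (\<lambda>\<omega>. Y (s + h) \<omega> - Y s \<omega>) = distr M borel (\<lambda>\<omega>. Y h \<omega> - Y 0 \<omega>)"
    using levy by (simp add: levy_process_def)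
  also have "\<dots> = distr M borel (Y h)"
    using AE_Y0 sh Y_measurable by (intro distr_cong_AE) (auto elim: eventually_mono)
  finally show ?thesis by (simp add: \<nu>_def)
qed

lemma increments_law:
  assumes s: "0 < s" and q: "0 < q"
  shows "distr M (PiM {..<q} (\<lambda>_. borel)) (\<lambda>\<omega>. \<lambda>i\<in>{..<q}. Y (real (Suc i) * s) \<omega> - Y (real i * s) \<omega>) = PiM {..<q} (\<lambda>_. \<nu> s)"
proof -
  have ind: "indep_vars (\<lambda>_. borel) (\<lambda>i \<omega>. Y (real (Suc i) * s) \<omega> - Y (real i * s) \<omega>) {..<q}"
    using levy s unfolding levy_process_def by (elim conjE allE[where x=q] allE[where x="\<lambda>i. real i * s"]) (auto simp: mult_strict_right_mono)
  have m: "(\<lambda>\<omega>. Y (real (Suc i) * s) \<omega> - Y (real i * s) \<omega>) \<in> borel_measurable M" for i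
    using s by (intro borel_measurable_diff Y_measurable) auto
  have d: "distr M borel (\<lambda>\<omega>. Y (real (Suc i) * s) \<omega> - Y (real i * s) \<omega>) = \<nu> s" for i
    using law_increment[of "real i * s" s] s by (simp add: algebra_simps)
  have "indep_vars (\<lambda>_. borel) (\<lambda>i \<omega>. Y (real (Suc i) * s) \<omega> - Y (real i * s) \<omega>) {..<q} \<longleftrightarrow>
    distr M (PiM {..<q} (\<lambda>_. borel)) (\<lambda>\<omega>. \<lambda>i\<in>{..<q}. Y (real (Suc i) * s) \<omega> - Y (real i * s) \<omega>) =
    PiM {..<q} (\<lambda>i. distr M borel (\<lambda>\<omega>. Y (real (Suc i) * s) \<omega> - Y (real i * s) \<omega>))"
    by (rule indep_vars_iff_distr_eq_PiM') (use q m in auto)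
  then show ?thesis using ind unfolding d by simp
qed

text \<open>Moves expectations over the increments of \<open>Y\<close> to the infinite product space
  used for walks and chains; \<open>G\<close> may look at the first \<open>q\<close> coordinates
  only.\<close>

lemma increments_expectation:
  fixes G :: "(nat \<Rightarrow> 'a) \<Rightarrow> real"
  assumes s: "0 < s" and q: "0 < q" and G: "G \<in> borel_measurable (PiM {..<q} (\<lambda>_. borel))" and cong: "\<And>d. G (restrict d {..<q}) = G d"
  shows "(LINT \<omega>|M. G (\<lambda>i. Y (real (Suc i) * s) \<omega> - Y (real i * s) \<omega>)) = (LINT d|iid (\<nu> s). G d)"
proof -
  interpret n: borel_prob "\<nu> s" using borel_prob_\<nu> s by simp
  let ?D = "\<lambda>\<omega>. \<lambda>i\<in>{..<q}. Y (real (Suc i) * s) \<omega> - Y (real i * s) \<omega>"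
  have Dm: "?D \<in> measurable M (PiM {..<q} (\<lambda>_. borel))"
    using s by (intro measurable_restrict borel_measurable_diff Y_measurable) auto
  have se: "sets (PiM {..<q} (\<lambda>_. \<nu> s)) = sets (PiM {..<q} (\<lambda>_. borel))" by (intro sets_PiM_cong) auto
  have G': "G \<in> borel_measurable (PiM {..<q} (\<lambda>_. \<nu> s))" using G by (simp add: measurable_cong_sets[OF se refl])
  have rm: "(\<lambda>d. restrict d {..<q}) \<in> measurable (iid (\<nu> s)) (PiM {..<q} (\<lambda>_. \<nu> s))"
    by (rule measurable_restrict_subset) simp
  have "(LINT \<omega>|M. G (\<lambda>i. Y (real (Suc i) * s) \<omega> - Y (real i * s) \<omega>)) = (LINT \<omega>|M. G (?D \<omega>))"
    by (subst cong[symmetric]) simp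
  also have "\<dots> = (LINT d|distr M (PiM {..<q} (\<lambda>_. borel)) ?D. G d)" by (rule integral_distr[symmetric, OF Dm G])
  also have "\<dots> = (LINT d|PiM {..<q} (\<lambda>_. \<nu> s). G d)" unfolding increments_law[OF s q] ..
  also have "PiM {..<q} (\<lambda>_. \<nu> s) = distr (iid (\<nu> s)) (PiM {..<q} (\<lambda>_. \<nu> s)) (\<lambda>d. restrict d {..<q})"
    by (rule n.seq.distr_PiM_restrict_finite[symmetric]) auto
  also have "(LINT d|distr (iid (\<nu> s)) (PiM {..<q} (\<lambda>_. \<nu> s)) (\<lambda>d. restrict d {..<q}). G d) = (LINT d|iid (\<nu> s). G (restrict d {..<q}))"
    by (rule integral_distr[OF rm G'])
  finally show ?thesis by (simp add: cong)
qed

lemma space_filtration: "space (augmented_filtration M Y t) = space M"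
  by (simp add: augmented_filtration_def space_measure_of_conv)

lemma filtration_generators:
  "{Y s -` A \<inter> space M | s A. 0 \<le> s \<and> s \<le> t \<and> A \<in> sets borel} \<union> null_sets M \<subseteq> Pow (space M)"
  by (auto dest: sets.sets_into_space)

lemma sets_filtration:
  "sets (augmented_filtration M Y t) = sigma_sets (space M) ({Y s -` A \<inter> space M | s A. 0 \<le> s \<and> s \<le> t \<and> A \<in> sets borel} \<union> null_sets M)"
  unfolding augmented_filtration_def by (rule sets_measure_of[OF filtration_generators])

lemma Y_filtration_measurable: "0 \<le> s ==> s \<le> t ==> Y s \<in> borel_measurable (augmented_filtration M Y t)"
  by (rule measurableI) (auto simp: space_filtration sets_filtration intro!: sigma_sets.Basic)

lemma bad_set_filtration: "bad_set M Y \<in> sets (augmented_filtration M Y t)"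
  using bad_set(1) by (auto simp: sets_filtration)

lemma filtration_sub: "X \<in> borel_measurable (augmented_filtration M Y t) ==> X \<in> borel_measurable M"
proof -
  have "sets (augmented_filtration M Y t) \<subseteq> sets M"
    unfolding sets_filtration by (intro sets.sigma_sets_subset) (auto intro: measurable_sets[OF Y_measurable])
  then show "X \<in> borel_measurable (augmented_filtration M Y t) ==> X \<in> borel_measurable M"
    by (auto simp: measurable_def space_filtration)
qed

end

section \<open>The solution process driven by a Levy process\<close>

locale levy_sde = levy M Y + lipschitz_drift F w
  for M :: "'w measure" and Y :: "real \<Rightarrow> 'w \<Rightarrow> 'a::euclidean_space" and F :: "'a \<Rightarrow> 'a" and w :: real
begin

definition SX :: "'a \<Rightarrow> real \<Rightarrow> 'w \<Rightarrow> 'a" where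
  "SX x t \<omega> = (if \<omega> \<in> bad_set M Y then 0 else sol x (path Y \<omega>) t)"

lemma splitting_measurable:
  assumes "0 \<le> s" "\<And>i. i < q ==> (\<lambda>\<omega>. D \<omega> i) \<in> borel_measurable G"
  shows "(\<lambda>\<omega>. splitting s q x (D \<omega>)) \<in> borel_measurable G" using assms(2)
proof (induction q)
  case (Suc q)
  have "(\<lambda>\<omega>. splitting s q x (D \<omega>) + D \<omega> q) \<in> borel_measurable G"
    using Suc by (intro borel_measurable_add) auto
  from measurable_compose[OF this flow_measurable[OF assms(1)]] show ?case by (simp add: splitting_def)
qed (simp add: splitting_def)

definition approx :: "nat \<Rightarrow> 'a \<Rightarrow> real \<Rightarrow> 'w \<Rightarrow> 'a" where
  "approx m x t \<omega> = splitting (t / real (Suc m)) (Suc m) x (\<lambda>i. Y (real (Suc i) * (t / real (Suc m))) \<omega> - Y (real i * (t / real (Suc m))) \<omega>)"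

lemma approx_tendsto:
  assumes "\<omega> \<in> space M" "\<omega> \<notin> bad_set M Y" "0 \<le> t"
  shows "(\<lambda>m. approx m x t \<omega>) ----> SX x t \<omega>"
proof -
  have n: "path Y \<omega> (real i * (t / real (Suc m))) = Y (real i * (t / real (Suc m))) \<omega>" for i m
  proof -
    have "\<not> real i * (t / real (Suc m)) < 0" using assms(3) by (simp add: not_less)
    then show ?thesis by (simp only: path_def if_False)
  qed
  have "(\<lambda>m. splitting (t / real (Suc m)) (Suc m) x (\<lambda>i. path Y \<omega> (real (Suc i) * (t / real (Suc m))) - path Y \<omega> (real i * (t / real (Suc m))))) ----> sol x (path Y \<omega>) t"
    by (rule splitting_converges[OF good_noise[OF assms(1,2)] assms(3)])
  then show ?thesis using assms(2) unfolding n by (simp add: approx_def SX_def)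
qed

lemma approx_filtration_measurable:
  assumes "0 \<le> t" shows "(\<lambda>\<omega>. approx m x t \<omega>) \<in> borel_measurable (augmented_filtration M Y t)"
  unfolding approx_def
proof (rule splitting_measurable)
  fix i assume i: "i < Suc m"
  have "real (Suc i) * (t / real (Suc m)) \<le> real (Suc m) * (t / real (Suc m))"
    using i assms by (intro mult_right_mono) auto
  then have "real (Suc i) * (t / real (Suc m)) \<le> t" by simp
  moreover have "real i * (t / real (Suc m)) \<le> real (Suc i) * (t / real (Suc m))"
    using assms by (intro mult_right_mono) auto
  ultimately show "(\<lambda>\<omega>. Y (real (Suc i) * (t / real (Suc m))) \<omega> - Y (real i * (t / real (Suc m))) \<omega>) \<in> borel_measurable (augmented_filtration M Y t)"
    using assms by (intro borel_measurable_diff Y_filtration_measurable) auto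
qed (use assms in auto)

text \<open>\<open>sol\<close> is selected without regard to measurability. Adaptedness comes from
  the splitting approximations, which use \<open>Y\<close> up to time \<open>t\<close> only and
  converge to the solution off \<open>bad_set M Y\<close>; this null set belongs to the augmented
  filtration at every time.\<close>

lemma SX_filtration_measurable:
  assumes t: "0 \<le> t" shows "SX x t \<in> borel_measurable (augmented_filtration M Y t)"
proof (rule borel_measurable_LIMSEQ_metric[where f="\<lambda>m \<omega>. if \<omega> \<in> bad_set M Y then 0 else approx m x t \<omega>"])
  show "(\<lambda>\<omega>. if \<omega> \<in> bad_set M Y then 0 else approx m x t \<omega>) \<in> borel_measurable (augmented_filtration M Y t)" for m
  proof (rule measurable_If_set)
    have "bad_set M Y \<inter> space M = bad_set M Y" using null_setsD2[OF bad_set(1)] sets.sets_into_space by blast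
    then show "bad_set M Y \<inter> space (augmented_filtration M Y t) \<in> sets (augmented_filtration M Y t)"
      using bad_set_filtration by (simp add: space_filtration)
  qed (use approx_filtration_measurable[OF t] in auto)
  show "(\<lambda>m. if \<omega> \<in> bad_set M Y then 0 else approx m x t \<omega>) ----> SX x t \<omega>" if "\<omega> \<in> space (augmented_filtration M Y t)" for \<omega>
    using approx_tendsto[of \<omega> t x] that t by (cases "\<omega> \<in> bad_set M Y") (auto simp: SX_def space_filtration)
qed

lemma SX_measurable: "0 \<le> t ==> SX x t \<in> borel_measurable M"
  by (rule filtration_sub[OF SX_filtration_measurable])

lemma SX_sol:
  assumes "\<omega> \<in> space M" "\<omega> \<notin> bad_set M Y" shows "sol_on F x (path Y \<omega>) T (\<lambda>t. SX x t \<omega>)"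
  using sol[OF good_noise(1)[OF assms], of x T] assms by (simp add: SX_def)

lemma SX_strong: "strong_solution M Y F x (SX x)"
  unfolding strong_solution_def
proof (intro conjI allI impI SX_filtration_measurable)
  show "AE \<omega> in M. \<forall>t\<ge>0. set_integrable lborel {0..t} (\<lambda>s. F (SX x s \<omega>)) \<and>
        SX x t \<omega> = x + (LINT s:{0..t}|lborel. F (SX x s \<omega>)) + Y t \<omega>" using AE_good
  proof eventually_elim
    case (elim \<omega>)
    show ?case
    proof (intro allI impI)
      fix t :: real assume t: "0 \<le> t"
      have *: "set_integrable lborel {0..t} (\<lambda>s. F (SX x s \<omega>))" "SX x t \<omega> = x + integral {0..t} (\<lambda>s. F (SX x s \<omega>)) + path Y \<omega> t"
        using SX_sol[of \<omega> x t] elim t unfolding sol_on_def by auto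
      then show "set_integrable lborel {0..t} (\<lambda>s. F (SX x s \<omega>)) \<and> SX x t \<omega> = x + (LINT s:{0..t}|lborel. F (SX x s \<omega>)) + Y t \<omega>"
        using t set_borel_integral_eq_integral(2)[OF *(1)] by (simp add: path_def)
    qed
  qed
qed

lemma SX_unique: "unique_strong_solution M Y F x (SX x)"
  unfolding unique_strong_solution_def
proof (intro conjI allI impI SX_strong)
  fix X' assume "strong_solution M Y F x X'"
  then have "AE \<omega> in M. \<forall>t\<ge>0. set_integrable lborel {0..t} (\<lambda>s. F (X' s \<omega>)) \<and>
        X' t \<omega> = x + (LINT s:{0..t}|lborel. F (X' s \<omega>)) + Y t \<omega>"
    unfolding strong_solution_def by blast
  then show "AE \<omega> in M. \<forall>t\<ge>0. X' t \<omega> = SX x t \<omega>" using AE_good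
  proof eventually_elim
    case (elim \<omega>)
    show ?case
    proof (intro allI impI)
      fix t :: real assume t: "0 \<le> t"
      have so: "sol_on F x (path Y \<omega>) t (\<lambda>t. X' t \<omega>)"
        unfolding sol_on_def
      proof (intro ballI conjI)
        fix s assume s: "s \<in> {0..t}"
        then have *: "set_integrable lborel {0..s} (\<lambda>s. F (X' s \<omega>))" "X' s \<omega> = x + (LINT s:{0..s}|lborel. F (X' s \<omega>)) + Y s \<omega>"
          using elim by auto
        then show "set_integrable lborel {0..s} (\<lambda>s. F (X' s \<omega>))" "X' s \<omega> = x + integral {0..s} (\<lambda>s. F (X' s \<omega>)) + path Y \<omega> s"
          using s set_borel_integral_eq_integral(2)[OF *(1)] by (simp_all add: path_def)
      qed
      show "X' t \<omega> = SX x t \<omega>" using sol_unique[OF so SX_sol[of \<omega> x t], of t] elim t by auto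
    qed
  qed
qed

lemma unique_strong_solution_expectation:
  assumes X: "unique_strong_solution M Y F x X" and t: "0 \<le> t" and f: "f \<in> bcontfun"
  shows "(LINT \<omega>|M. f (X t \<omega>)) = (LINT \<omega>|M. (f (SX x t \<omega>) :: real))"
proof (rule integral_cong_AE)
  have "X t \<in> borel_measurable M"
    using X t filtration_sub unfolding unique_strong_solution_def strong_solution_def by blast
  then show "(\<lambda>\<omega>. f (X t \<omega>)) \<in> borel_measurable M" by (rule measurable_compose[OF _ bcontfun_measurable[OF f]])
  show "(\<lambda>\<omega>. f (SX x t \<omega>)) \<in> borel_measurable M" by (rule measurable_compose[OF SX_measurable[OF t] bcontfun_measurable[OF f]])
  have "AE \<omega> in M. \<forall>t\<ge>0. SX x t \<omega> = X t \<omega>" using X SX_strong unfolding unique_strong_solution_def by blast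
  then show "AE \<omega> in M. f (X t \<omega>) = f (SX x t \<omega>)" by eventually_elim (use t in auto)
qed

lemma SX_0: "AE \<omega> in M. SX x 0 \<omega> = x" using AE_good
proof eventually_elim
  case (elim \<omega>)
  then show ?case using SX_sol[of \<omega> x 0] good_noise(2)[of \<omega>] unfolding sol_on_def by auto
qed

lemma SX_lipschitz: "0 \<le> t ==> \<omega> \<in> space M ==> \<omega> \<notin> bad_set M Y ==> norm (SX x t \<omega> - SX x' t \<omega>) \<le> norm (x - x') * exp (w * t)"
  by (rule sol_lipschitz[OF SX_sol SX_sol, of _ _ t]) auto

definition Q :: "real \<Rightarrow> ('a \<Rightarrow> real) \<Rightarrow> 'a \<Rightarrow> real" where
  "Q s g x = (LINT y|\<nu> s. g (flow s (x + y)))"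

lemma approx_expectation:
  assumes t: "0 \<le> t" and f: "f \<in> bcontfun"
  shows "(LINT \<omega>|M. f (approx m x t \<omega>)) = (Q (t / real (Suc m)) ^^ Suc m) f x"
proof -
  define s where "s = t / real (Suc m)"
  have s0: "0 \<le> s" using t by (simp add: s_def)
  interpret n: borel_prob "\<nu> s" using borel_prob_\<nu>[OF s0] .
  obtain B where B: "\<And>x. \<bar>f x\<bar> \<le> B" using bcontfun_bounded[OF f] by blast
  have fm: "f \<in> borel_measurable borel" by (rule bcontfun_measurable[OF f])
  have Qs: "Q s = (\<lambda>g x. LINT y|\<nu> s. g (flow s (x + y)))" by (simp add: Q_def fun_eq_iff)
  have a: "(\<lambda>(z, e). flow s (z + e)) \<in> borel_measurable (borel \<Otimes>\<^sub>M borel :: ('a \<times> 'a) measure)"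
    unfolding split_beta by (rule measurable_compose[OF _ flow_measurable[OF s0]]) measurable
  have ch: "(Q s ^^ Suc m) f x = (LINT d|iid (\<nu> s). f (splitting s (Suc m) x d))"
    unfolding Qs splitting_def by (rule n.chain_integral[OF a fm B])
  show ?thesis
  \<comment> \<open>Independence of increments is available on strictly increasing times only, so a
    step of length 0 is treated by hand.\<close>
  proof (cases "t = 0")
    case True
    have Y0: "AE d in iid (\<nu> s). \<forall>i. d i = 0"
    proof -
      have "AE y in \<nu> s. y = 0" unfolding \<nu>_def s_def True using AE_Y0 Y_measurable[of 0] by (subst AE_distr_iff) auto
      then have "AE d in iid (\<nu> s). d i = 0" for i by (rule n.seq.AE_component[OF UNIV_I])
      then show ?thesis by (simp add: AE_all_countable)
    qed
    have sz: "splitting s q x d = x" if "\<And>i. d i = 0" for q d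
    proof (induction q)
      case (Suc q) then show ?case using that by (simp add: splitting_def s_def True)
    qed (simp add: splitting_def)
    have "(LINT d|iid (\<nu> s). f (splitting s (Suc m) x d)) = (LINT d|iid (\<nu> s). f x)"
    proof (rule integral_cong_AE)
      show "(\<lambda>d. f (splitting s (Suc m) x d)) \<in> borel_measurable (iid (\<nu> s))"
        unfolding splitting_def by (rule measurable_compose[OF n.chain_measurable[OF a] fm])
      show "AE d in iid (\<nu> s). f (splitting s (Suc m) x d) = f x" using Y0 by eventually_elim (simp add: sz)
    qed simp
    then have 1: "(Q s ^^ Suc m) f x = f x" unfolding ch by simp
    have "approx m x t \<omega> = x" for \<omega> unfolding approx_def using sz[of "\<lambda>_. 0" "Suc m"] by (simp add: True s_def)
    then have "(LINT \<omega>|M. f (approx m x t \<omega>)) = f x" by (simp add: prob_space)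
    then show ?thesis using 1 unfolding s_def by (simp only:)
  next
    case False
    then have s: "0 < s" using t by (simp add: s_def)
    have "(LINT \<omega>|M. f (splitting s (Suc m) x (\<lambda>i. Y (real (Suc i) * s) \<omega> - Y (real i * s) \<omega>))) = (LINT d|iid (\<nu> s). f (splitting s (Suc m) x d))"
    proof (rule increments_expectation[OF s, where q="Suc m"])
      show "0 < Suc m" by simp
      show "(\<lambda>d. f (splitting s (Suc m) x d)) \<in> borel_measurable (PiM {..<Suc m} (\<lambda>_. borel))"
        by (rule measurable_compose[OF splitting_measurable[OF s0] fm]) (rule measurable_component_singleton, simp)
      show "f (splitting s (Suc m) x (restrict d {..<Suc m})) = f (splitting s (Suc m) x d)" for d
        unfolding splitting_def by (subst chain_cong[of "Suc m" "restrict d {..<Suc m}" d]) auto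
    qed
    then show ?thesis using ch unfolding approx_def s_def by (simp only:)
  qed
qed

text \<open>Pathwise convergence of the splitting and dominated convergence. This formula links the
  solution to the scheme, whose blocks converge to the same operators \<open>Q\<close>.\<close>

lemma SX_expectation_limit:
  assumes t: "0 \<le> t" and f: "f \<in> bcontfun"
  shows "(\<lambda>m. (Q (t / real (Suc m)) ^^ Suc m) f x) ----> (LINT \<omega>|M. f (SX x t \<omega>))"
proof -
  obtain B where B: "\<And>x. \<bar>f x\<bar> \<le> B" using bcontfun_bounded[OF f] by blast
  have "(\<lambda>m. LINT \<omega>|M. f (approx m x t \<omega>)) ----> (LINT \<omega>|M. f (SX x t \<omega>))"
  proof (rule integral_dominated_convergence[where w="\<lambda>_. B"])
    show "AE \<omega> in M. (\<lambda>m. f (approx m x t \<omega>)) ----> f (SX x t \<omega>)" using AE_good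
    proof eventually_elim
      case (elim \<omega>)
      then show ?case using f approx_tendsto[of \<omega> t x] t unfolding bcontfun_def by (auto intro: continuous_on_tendsto_compose)
    qed
    show "(\<lambda>\<omega>. f (SX x t \<omega>)) \<in> borel_measurable M" by (rule measurable_compose[OF SX_measurable[OF t] bcontfun_measurable[OF f]])
    show "(\<lambda>\<omega>. f (approx m x t \<omega>)) \<in> borel_measurable M" for m
      by (rule measurable_compose[OF filtration_sub[OF approx_filtration_measurable[OF t]] bcontfun_measurable[OF f]])
  qed (use B in auto)
  then show ?thesis by (simp only: approx_expectation[OF t f])
qed

end

section \<open>Convergence of the scheme\<close>

text \<open>Compare at the points of a finite net of the ball with mesh \<open>d\<close>: two
  Lipschitz terms and the error at the net point give \<open>2 * L * d + d\<close>, which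
  \<open>d = e / (2 * L + 2)\<close> keeps below \<open>e\<close>.\<close>

lemma lipschitz_uniform_limit:
  fixes g :: "nat \<Rightarrow> 'a::euclidean_space \<Rightarrow> 'b::real_normed_vector"
  assumes L: "L \<ge> 0" and lip: "EV n. \<forall>x y. norm (g n x - g n y) \<le> L * norm (x - y)"
    and lim: "\<And>x. (\<lambda>n. g n x) ----> g0 x" and e: "e > 0"
  shows "EV n. \<forall>x. norm x \<le> r --> norm (g n x - g0 x) \<le> e"
proof -
  have lip0: "norm (g0 x - g0 y) \<le> L * norm (x - y)" for x y
    by (rule tendsto_upperbound[OF tendsto_norm[OF tendsto_diff[OF lim lim]]])
       (use lip in \<open>auto elim: eventually_mono\<close>)
  define d where "d = e / (2 * L + 2)"
  have d: "d > 0" using L e by (simp add: d_def)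
  obtain c where c: "finite c" "cball 0 r \<subseteq> (\<Union>x\<in>c. ball (x::'a) d)"
    using compact_cball[of "0::'a" r] d unfolding compact_eq_totally_bounded by metis
  have "EV n. \<forall>x\<in>c. norm (g n x - g0 x) < d"
  proof (rule eventually_ball_finite[OF c(1)], rule ballI)
    fix x show "EV n. norm (g n x - g0 x) < d" using tendstoD[OF lim[of x] d] by (simp add: dist_norm)
  qed
  with lip show ?thesis
  proof eventually_elim
    case (elim n)
    show ?case
    proof (intro allI impI)
      fix x :: 'a assume "norm x \<le> r"
      then obtain p where p: "p \<in> c" "norm (x - p) < d" using c(2) by (auto simp: dist_norm norm_minus_commute)
      have eq: "g n x - g0 x = (g n x - g n p) + (g n p - g0 p) - (g0 x - g0 p)" by simp
      have "norm (g n x - g0 x) \<le> norm (g n x - g n p) + norm (g n p - g0 p) + norm (g0 x - g0 p)"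
        unfolding eq using norm_triangle_ineq4[of "(g n x - g n p) + (g n p - g0 p)" "g0 x - g0 p"]
          norm_triangle_ineq[of "g n x - g n p" "g n p - g0 p"] by linarith
      also have "\<dots> \<le> L * d + d + L * d" using elim p lip0[of x p] L mult_left_mono[of "norm (x - p)" d L]
        by (smt (verit, ccfv_SIG))
      also have "\<dots> \<le> (2 * L + 2) * d" using d by (simp add: algebra_simps)
      also have "\<dots> = e" using L by (simp add: d_def)
      finally show "norm (g n x - g0 x) \<le> e" .
    qed
  qed
qed

text \<open>A discrete Gronwall inequality, based on \<open>1 + a \<le> exp a\<close>.\<close>

lemma affine_recursion_bound:
  fixes E :: "nat \<Rightarrow> real"
  assumes E0: "E 0 = 0" and step: "\<And>i. i < j ==> E (Suc i) \<le> (1 + a) * E i + c i"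
    and a: "0 \<le> a" and c: "\<And>i. 0 \<le> c i" and i: "i \<le> j"
  shows "E i \<le> exp (a * real i) * (\<Sum>l<i. c l)" using i
proof (induction i)
  case (Suc i)
  have s: "0 \<le> (\<Sum>l<i. c l)" by (simp add: c sum_nonneg)
  have "1 + a \<le> exp a" using exp_ge_add_one_self[of a] by simp
  have "E (Suc i) \<le> (1 + a) * E i + c i" using step Suc by simp
  also have "\<dots> \<le> (1 + a) * (exp (a * real i) * (\<Sum>l<i. c l)) + c i"
    using Suc a by (intro add_mono mult_left_mono) auto
  also have "\<dots> \<le> exp a * (exp (a * real i) * (\<Sum>l<i. c l)) + exp (a * real (Suc i)) * c i"
    using \<open>1 + a \<le> exp a\<close> s c[of i] a mult_right_mono[of 1 "exp (a * real (Suc i))" "c i"]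
    by (intro add_mono mult_right_mono) (auto simp del: of_nat_Suc)
  also have "\<dots> = exp (a * real (Suc i)) * (\<Sum>l<Suc i. c l)" by (simp add: algebra_simps exp_add)
  finally show ?case .
qed (simp add: E0)

section \<open>The deterministic steps and the flow of the drift\<close>

locale scheme = jump_family \<mu> + lipschitz_drift F w
  for \<mu> :: "real \<Rightarrow> 'a::euclidean_space measure" and F :: "'a \<Rightarrow> 'a" and w :: real +
  fixes \<psi> :: "real \<Rightarrow> 'a \<Rightarrow> 'a" and h0 :: real
  assumes h0: "0 < h0"
    and \<psi>: "0 < h ==> h < h0 ==> norm (\<psi> h x - \<psi> h x' - (x - x')) \<le> h * w * norm (x - x')"
    and \<psi>_F: "((\<lambda>h. (\<psi> h x - x) /\<^sub>R h) \<longlongrightarrow> F x) (at_right 0)"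
begin

lemma \<psi>_lipschitz: "0 < h ==> h < h0 ==> norm (\<psi> h x - \<psi> h x') \<le> (1 + h * w) * norm (x - x')"
  using \<psi>[of h x x'] norm_triangle_ineq[of "\<psi> h x - \<psi> h x' - (x - x')" "x - x'"] by (simp add: algebra_simps)

abbreviation state :: "real \<Rightarrow> 'a \<Rightarrow> (nat \<Rightarrow> 'a) \<Rightarrow> nat \<Rightarrow> 'a" where
  "state h \<equiv> chain (\<lambda>x y. \<psi> h x + y)"

lemma state_lipschitz:
  assumes h: "0 < h" "h < h0"
  shows "norm (state h z \<omega> j - state h z' \<omega> j) \<le> exp (w * (real j * h)) * norm (z - z')"
proof (induction j)
  case (Suc j)
  have "norm (state h z \<omega> (Suc j) - state h z' \<omega> (Suc j)) \<le> (1 + h * w) * (exp (w * (real j * h)) * norm (z - z'))"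
    using \<psi>_lipschitz[OF h, of "state h z \<omega> j" "state h z' \<omega> j"] mult_left_mono[OF Suc, of "1 + h * w"] h w by simp
  also have "\<dots> \<le> exp (h * w) * (exp (w * (real j * h)) * norm (z - z'))"
    by (intro mult_right_mono) (use exp_ge_add_one_self[of "h * w"] in auto)
  also have "\<dots> = exp (w * (real (Suc j) * h)) * norm (z - z')" by (simp add: algebra_simps exp_add)
  finally show ?case .
qed simp

lemma \<psi>_pow_lipschitz:
  assumes h: "0 < h" "h < h0"
  shows "norm ((\<psi> h ^^ j) x - (\<psi> h ^^ j) x') \<le> exp (w * (real j * h)) * norm (x - x')"
proof -
  have "state h x (\<lambda>_. 0) j = (\<psi> h ^^ j) x" for x by (induction j) auto
  then show ?thesis using state_lipschitz[OF h, of x "\<lambda>_. 0" j x'] by simp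
qed

lemma \<psi>_pow_continuous: "0 < h ==> h < h0 ==> continuous_on UNIV (\<psi> h ^^ j)"
  using \<psi>_pow_lipschitz[of h j]
  by (intro lipschitz_on_continuous_on[of "exp (w * (real j * h))"] lipschitz_onI) (auto simp: dist_norm)

lemma \<psi>_measurable: "0 < h ==> h < h0 ==> \<psi> h \<in> borel_measurable borel"
  using \<psi>_pow_continuous[of h 1] by (intro borel_measurable_continuous_onI) simp

lemma null_seq_small: "null_seq hs ==> 0 < c ==> EV n. 0 < hs n \<and> hs n < c"
  unfolding null_seq_def by (auto simp: order_tendsto_iff elim: eventually_mono)

lemma drift_uniform:
  assumes hs: "null_seq hs" and e: "e > 0"
  shows "EV n. \<forall>x. norm x \<le> r --> norm ((\<psi> (hs n) x - x) /\<^sub>R hs n - F x) \<le> e"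
proof (rule lipschitz_uniform_limit[OF w _ _ e])
  show "EV n. \<forall>x y. norm ((\<psi> (hs n) x - x) /\<^sub>R hs n - (\<psi> (hs n) y - y) /\<^sub>R hs n) \<le> w * norm (x - y)"
    using null_seq_small[OF hs h0]
  proof eventually_elim
    case (elim n)
    show ?case
    proof (intro allI)
      fix x y
      have "norm ((\<psi> (hs n) x - x) /\<^sub>R hs n - (\<psi> (hs n) y - y) /\<^sub>R hs n) = norm (\<psi> (hs n) x - \<psi> (hs n) y - (x - y)) / hs n"
        using elim by (simp add: divide_inverse algebra_simps flip: scaleR_diff_right)
      also have "\<dots> \<le> w * norm (x - y)" using \<psi>[of "hs n" x y] elim by (simp add: field_simps)
      finally show "norm ((\<psi> (hs n) x - x) /\<^sub>R hs n - (\<psi> (hs n) y - y) /\<^sub>R hs n) \<le> w * norm (x - y)" .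
    qed
  qed
  show "(\<lambda>n. (\<psi> (hs n) x - x) /\<^sub>R hs n) ----> F x" for x
    by (rule filterlim_compose[OF \<psi>_F]) (use hs in \<open>auto simp: null_seq_def filterlim_at less_imp_neq[symmetric]\<close>)
qed

lemma flow_bounds:
  assumes T: "0 \<le> T"
  obtains R where "R \<ge> 0" "\<And>t. t \<in> {0..T} ==> norm (flow t z) \<le> R" "\<And>t. t \<in> {0..T} ==> norm (F (flow t z)) \<le> R"
proof -
  have "compact ((\<lambda>t. flow t z) ` {0..T})" "compact ((\<lambda>t. F (flow t z)) ` {0..T})"
    by (auto intro!: compact_continuous_image flow_continuous_time continuous_on_compose2[OF F_continuous])
  from this[THEN compact_imp_bounded] obtain a b
    where a: "\<And>t. t \<in> {0..T} ==> norm (flow t z) \<le> a" and b: "\<And>t. t \<in> {0..T} ==> norm (F (flow t z)) \<le> b"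
    unfolding bounded_iff by blast
  have "a \<ge> 0" using a[of 0] T norm_ge_zero[of "flow 0 z"] by (meson atLeastAtMost_iff order.refl order_trans)
  show ?thesis
    by (rule that[of "max a b"]) (use a b \<open>a \<ge> 0\<close> in \<open>auto intro: max.coboundedI1 max.coboundedI2\<close>)
qed

lemma flow_increment:
  assumes "0 \<le> a" "a \<le> b"
  shows "(\<lambda>v. F (flow v z)) integrable_on {a..b}" "flow b z - flow a z = integral {a..b} (\<lambda>v. F (flow v z))"
proof -
  have i: "(\<lambda>v. F (flow v z)) integrable_on {0..b}"
    by (intro integrable_continuous_interval continuous_on_compose2[OF F_continuous] flow_continuous_time) auto
  show "(\<lambda>v. F (flow v z)) integrable_on {a..b}" using integrable_on_subinterval[OF i] assms by auto
  show "flow b z - flow a z = integral {a..b} (\<lambda>v. F (flow v z))"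
    using flow_eq[of b z] flow_eq[of a z] Henstock_Kurzweil_Integration.integral_combine[OF assms i] assms by (simp add: algebra_simps)
qed

text \<open>Within one step the flow moves by at most \<open>R * h\<close>, so \<open>F\<close>
  along it varies by at most \<open>w * R * h\<close>; \<open>e\<close> measures the drift quotient
  against \<open>F\<close> at the starting point.\<close>

lemma euler_step:
  assumes R: "\<And>t. t \<in> {0..T} ==> norm (F (flow t z)) \<le> R" and a: "0 \<le> a" "a + h \<le> T" and h: "0 < h"
    and e: "norm ((\<psi> h (flow a z) - flow a z) /\<^sub>R h - F (flow a z)) \<le> e"
  shows "norm (\<psi> h (flow a z) - flow (a + h) z) \<le> h * (e + w * R * h)"
proof -
  have lipt: "norm (flow v z - flow a z) \<le> R * h" if v: "v \<in> {a..a + h}" for v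
  proof -
    have "norm (integral {a..v} (\<lambda>v. F (flow v z))) \<le> R * (v - a)"
      by (rule integral_bound[where f = "\<lambda>v. F (flow v z)"])
         (use v a R in \<open>auto intro!: continuous_on_compose2[OF F_continuous] continuous_on_subset[OF flow_continuous_time]\<close>)
    also have "\<dots> \<le> R * h" using v a R[of a] h norm_ge_zero[of "F (flow a z)"] by (intro mult_left_mono) (auto simp del: norm_ge_zero)
    finally show ?thesis using flow_increment[of a v z] v a by simp
  qed
  have b: "norm (integral {a..a + h} (\<lambda>v. F (flow v z) - F (flow a z))) \<le> w * (R * h) * (a + h - a)"
  proof (rule integral_bound)
    show "a \<le> a + h" using h by simp
    show "continuous_on {a..a + h} (\<lambda>v. F (flow v z) - F (flow a z))"
      by (intro continuous_intros continuous_on_compose2[OF F_continuous] continuous_on_subset[OF flow_continuous_time[of "a + h"]]) (use a in auto)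
    fix v assume "v \<in> {a..a + h}"
    then show "norm (F (flow v z) - F (flow a z)) \<le> w * (R * h)"
      using lip[of "flow v z" "flow a z"] lipt[of v] w by (meson mult_left_mono order_trans)
  qed
  have "integral {a..a + h} (\<lambda>v. F (flow v z) - F (flow a z)) = flow (a + h) z - flow a z - h *\<^sub>R F (flow a z)"
    using flow_increment[of a "a + h" z] a h by (subst Henstock_Kurzweil_Integration.integral_diff) auto
  then have "\<psi> h (flow a z) - flow (a + h) z =
      h *\<^sub>R ((\<psi> h (flow a z) - flow a z) /\<^sub>R h - F (flow a z)) - integral {a..a + h} (\<lambda>v. F (flow v z) - F (flow a z))"
    using h by (simp add: algebra_simps)
  also have "norm \<dots> \<le> h * e + w * (R * h) * (a + h - a)"
    using norm_triangle_ineq4[of "h *\<^sub>R ((\<psi> h (flow a z) - flow a z) /\<^sub>R h - F (flow a z))" "integral {a..a + h} (\<lambda>v. F (flow v z) - F (flow a z))"]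
      b mult_left_mono[OF e less_imp_le[OF h]] h by (simp only: norm_scaleR abs_of_pos)
  finally show ?thesis by (simp add: algebra_simps)
qed

text \<open>Errors are measured along the exact flow, whose orbit is compact. The drift quotients
  therefore need to be close to \<open>F\<close> on a ball only, although \<open>F\<close> is
  unbounded in general; the Lipschitz property of \<open>\<psi> h\<close> carries the errors
  forward.\<close>

lemma euler_converges:
  assumes hs: "null_seq hs" and s: "(\<lambda>n. real (js n) * hs n) ----> s"
  shows "(\<lambda>n. (\<psi> (hs n) ^^ js n) z) ----> flow s z"
proof -
  have s0: "0 \<le> s" by (rule LIMSEQ_le_const[OF s]) (use hs in \<open>auto simp: null_seq_def less_imp_le\<close>)
  obtain R where R: "R \<ge> 0" "\<And>t. t \<in> {0..s + 1} ==> norm (flow t z) \<le> R" "\<And>t. t \<in> {0..s + 1} ==> norm (F (flow t z)) \<le> R"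
    using flow_bounds[of "s + 1" z] s0 by auto
  have T: "EV n. real (js n) * hs n < s + 1" using s by (simp add: order_tendsto_iff)
  have key: "EV n. norm ((\<psi> (hs n) ^^ js n) z - flow (real (js n) * hs n) z) \<le> exp (w * (s + 1)) * ((s + 1) * (e + w * R * hs n))"
    if e: "e > 0" for e using T null_seq_small[OF hs h0] drift_uniform[OF hs e, of R]
  proof eventually_elim
    case (elim n)
    let ?h = "hs n" and ?j = "js n"
    define E where "E i = norm ((\<psi> ?h ^^ i) z - flow (real i * ?h) z)" for i
    have h: "0 < ?h" "?h < h0" using elim by auto
    have "E ?j \<le> exp (?h * w * real ?j) * (\<Sum>l<?j. ?h * (e + w * R * ?h))"
    proof (rule affine_recursion_bound)
      show "E 0 = 0" by (simp add: E_def)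
      fix i assume i: "i < ?j"
      have "real (Suc i) * ?h \<le> real ?j * ?h" by (rule mult_right_mono) (use i h in auto)
      then have ih: "real i * ?h + ?h \<le> s + 1" "0 \<le> real i * ?h" using elim h by (auto simp: algebra_simps)
      have "norm (\<psi> ?h (flow (real i * ?h) z) - flow (real i * ?h + ?h) z) \<le> ?h * (e + w * R * ?h)"
        by (rule euler_step[OF R(3) ih(2,1) h(1)]) (use elim R(2)[of "real i * ?h"] ih h in auto)
      then show "E (Suc i) \<le> (1 + ?h * w) * E i + ?h * (e + w * R * ?h)"
        using \<psi>_lipschitz[OF h, of "(\<psi> ?h ^^ i) z" "flow (real i * ?h) z"]
          norm_triangle_ineq[of "\<psi> ?h ((\<psi> ?h ^^ i) z) - \<psi> ?h (flow (real i * ?h) z)" "\<psi> ?h (flow (real i * ?h) z) - flow (real i * ?h + ?h) z"]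
        by (simp add: E_def algebra_simps)
    qed (use w h e R in auto)
    also have "\<dots> = exp (w * (real ?j * ?h)) * ((real ?j * ?h) * (e + w * R * ?h))" by (simp add: algebra_simps)
    also have "\<dots> \<le> exp (w * (s + 1)) * ((s + 1) * (e + w * R * ?h))"
      using w h e R elim s0 by (intro mult_mono iffD2[OF exp_le_cancel_iff] mult_left_mono) auto
    finally show ?case by (simp add: E_def)
  qed
  have h_lim: "hs ----> 0" using hs by (simp add: null_seq_def)
  have "(\<lambda>n. (\<psi> (hs n) ^^ js n) z - flow (real (js n) * hs n) z) ----> 0"
  proof (rule tendstoI)
    fix eps :: real assume "eps > 0"
    define c where "c = exp (w * (s + 1)) * (s + 1)"
    have c: "c > 0" using s0 by (simp add: c_def)
    have "(\<lambda>n. c * (eps / (2 * c) + w * R * hs n)) ----> c * (eps / (2 * c) + w * R * 0)" by (intro tendsto_intros h_lim)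
    then have "EV n. c * (eps / (2 * c) + w * R * hs n) < eps"
      by (rule order_tendstoD) (use c \<open>eps > 0\<close> in \<open>simp add: field_simps\<close>)
    moreover have "eps / (2 * c) > 0" using c \<open>eps > 0\<close> by simp
    ultimately show "EV n. dist ((\<psi> (hs n) ^^ js n) z - flow (real (js n) * hs n) z) 0 < eps"
      using key[of "eps / (2 * c)"] unfolding mult.assoc[symmetric] c_def[symmetric] by (auto elim: eventually_elim2)
  qed
  moreover have "(\<lambda>n. flow (real (js n) * hs n) z) ----> flow s z"
    by (rule continuous_on_tendsto_compose[OF flow_continuous_time[of "s + 1"] s])
       (use s0 T hs in \<open>auto simp: null_seq_def less_imp_le elim!: eventually_mono\<close>)
  ultimately show ?thesis using tendsto_add by fastforce
qed

lemma euler_uniform: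
  assumes hs: "null_seq hs" and s: "(\<lambda>n. real (js n) * hs n) ----> s" and e: "e > 0"
  shows "EV n. \<forall>x. norm x \<le> r --> norm ((\<psi> (hs n) ^^ js n) x - flow s x) \<le> e"
proof (rule lipschitz_uniform_limit[OF _ _ euler_converges[OF hs s] e])
  show "0 \<le> exp (w * (s + 1))" by simp
  have "EV n. real (js n) * hs n < s + 1" using s by (simp add: order_tendsto_iff)
  then show "EV n. \<forall>x y. norm ((\<psi> (hs n) ^^ js n) x - (\<psi> (hs n) ^^ js n) y) \<le> exp (w * (s + 1)) * norm (x - y)"
    using null_seq_small[OF hs h0]
  proof eventually_elim
    case (elim n)
    have "exp (w * (real (js n) * hs n)) \<le> exp (w * (s + 1))" using elim w by (auto intro: mult_left_mono)
    then show ?case using \<psi>_pow_lipschitz[of "hs n" "js n"] elim by (meson mult_right_mono norm_ge_zero order_trans)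
  qed
qed

end

lemma (in prob_space) expectation_le_sqrt:
  fixes X :: "'a \<Rightarrow> real"
  assumes "integrable M X" "integrable M (\<lambda>x. (X x)\<^sup>2)" "expectation (\<lambda>x. (X x)\<^sup>2) \<le> m"
  shows "expectation X \<le> sqrt m"
proof (rule real_le_rsqrt)
  show "(expectation X)\<^sup>2 \<le> m" using variance_eq[OF assms(1,2)] variance_positive[of X] assms(3) by linarith
qed

section \<open>Separating jumps and drift within a block\<close>

context scheme begin

abbreviation P :: "real \<Rightarrow> nat \<Rightarrow> ('a \<Rightarrow> real) \<Rightarrow> 'a \<Rightarrow> real" where
  "P h k \<equiv> transition_op \<mu> \<psi> h ^^ k"

text \<open>All jumps of a block are made first, and then the deterministic steps.\<close>

definition split_op :: "real \<Rightarrow> nat \<Rightarrow> ('a \<Rightarrow> real) \<Rightarrow> 'a \<Rightarrow> real" where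
  "split_op h j g z = (LINT \<omega>|iid (\<mu> h). g ((\<psi> h ^^ j) (z + psum \<omega> j)))"

lemma step_measurable:
  assumes h: "0 < h" "h < h0"
  shows "(\<lambda>(x, y). \<psi> h x + y) \<in> borel_measurable (borel \<Otimes>\<^sub>M borel)"
proof -
  note [measurable] = \<psi>_measurable[OF h]
  show ?thesis by measurable
qed

lemma state_measurable: "0 < h ==> h < h0 ==> (\<lambda>\<omega>. state h z \<omega> j) \<in> borel_measurable (iid (\<mu> h))"
  by (rule borel_prob.chain_measurable[OF borel_prob_mu step_measurable])

lemma P_integral:
  assumes h: "0 < h" "h < h0" and g: "g \<in> borel_measurable borel" "\<And>x. \<bar>g x\<bar> \<le> B"
  shows "P h k g z = (LINT \<omega>|iid (\<mu> h). g (state h z \<omega> k))"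
proof -
  have "transition_op \<mu> \<psi> h = (\<lambda>g x. LINT y|\<mu> h. g (\<psi> h x + y))" by (intro ext) (simp add: transition_op_def)
  then show ?thesis using borel_prob.chain_integral[OF borel_prob_mu[OF h(1)] step_measurable[OF h] g, of k z] by simp
qed

lemma state_integrable:
  assumes h: "0 < h" "h < h0" and g: "g \<in> borel_measurable borel" "\<And>x. \<bar>g x\<bar> \<le> B"
  shows "integrable (iid (\<mu> h)) (\<lambda>\<omega>. g (state h z \<omega> k) :: real)"
  using g by (intro borel_prob.iid_integrable[OF borel_prob_mu[OF h(1)], of _ B]
    measurable_compose[OF state_measurable[OF h] g(1)]) auto

lemma split_measurable:
  "0 < h ==> h < h0 ==> (\<lambda>\<omega>. (\<psi> h ^^ j) (z + psum \<omega> j)) \<in> borel_measurable (iid (\<mu> h))"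
  by (rule measurable_compose[OF _ borel_measurable_continuous_onI[OF \<psi>_pow_continuous]])
     (auto intro!: borel_measurable_add borel_prob.walk_measurable borel_prob_mu)

lemma split_integrable:
  assumes h: "0 < h" "h < h0" and g: "g \<in> borel_measurable borel" "\<And>x. \<bar>g x\<bar> \<le> B"
  shows "integrable (iid (\<mu> h)) (\<lambda>\<omega>. g ((\<psi> h ^^ j) (z + psum \<omega> j)) :: real)"
  using g by (intro borel_prob.iid_integrable[OF borel_prob_mu[OF h(1)], of _ B]
    measurable_compose[OF split_measurable[OF h] g(1)]) auto

lemma integral_blip:
  assumes N: "prob_space N" and X: "\<And>z. X z \<in> borel_measurable N" and g: "blip B L g" and L: "L \<ge> 0"
    and lip: "\<And>z z' \<omega>. norm (X z \<omega> - X z' \<omega>) \<le> c * norm (z - z')"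
  shows "blip B (c * L) (\<lambda>z::'a. LINT \<omega>|N. g (X z \<omega> :: 'a))"
proof -
  interpret N: prob_space N by fact
  have i: "integrable N (\<lambda>\<omega>. g (X z \<omega>))" for z
    using g by (intro N.integrable_const_bound[of _ B] measurable_compose[OF X bcontfun_measurable[OF blip_bcontfun[OF g]]])
      (auto simp: blip_def)
  have "\<bar>LINT \<omega>|N. g (X z \<omega>)\<bar> \<le> B" for z
    by (rule order_trans[OF integral_abs_bound N.integral_le_const]) (use i g in \<open>auto simp: blip_def\<close>)
  moreover have "\<bar>(LINT \<omega>|N. g (X z \<omega>)) - (LINT \<omega>|N. g (X z' \<omega>))\<bar> \<le> c * L * norm (z - z')" for z z'
  proof -
    have b: "\<bar>g (X z \<omega>) - g (X z' \<omega>)\<bar> \<le> c * L * norm (z - z')" for \<omega>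
      using g mult_left_mono[OF lip[of z \<omega> z'] L] unfolding blip_def by (smt (verit) mult.assoc mult.commute)
    have "\<bar>(LINT \<omega>|N. g (X z \<omega>)) - (LINT \<omega>|N. g (X z' \<omega>))\<bar> = \<bar>LINT \<omega>|N. g (X z \<omega>) - g (X z' \<omega>)\<bar>" using i by simp
    also have "\<dots> \<le> (LINT \<omega>|N. \<bar>g (X z \<omega>) - g (X z' \<omega>)\<bar>)" by (rule integral_abs_bound)
    also have "\<dots> \<le> c * L * norm (z - z')" using i b by (intro N.integral_le_const) auto
    finally show ?thesis .
  qed
  ultimately show ?thesis by (simp add: blip_def)
qed

lemma P_blip:
  assumes h: "0 < h" "h < h0" and g: "blip B L g" and L: "L \<ge> 0"
  shows "blip B (exp (w * (real k * h)) * L) (P h k g)"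
proof -
  interpret N: borel_prob "\<mu> h" by (rule borel_prob_mu[OF h(1)])
  have "P h k g = (\<lambda>z. LINT \<omega>|iid (\<mu> h). g (state h z \<omega> k))"
    using P_integral[OF h bcontfun_measurable[OF blip_bcontfun[OF g]]] g by (auto simp: blip_def)
  then show ?thesis using integral_blip[OF N.prob_space_iid state_measurable[OF h] g L state_lipschitz[OF h]] by simp
qed

lemma split_blip:
  assumes h: "0 < h" "h < h0" and g: "blip B L g" and L: "L \<ge> 0"
  shows "blip B (exp (w * (real j * h)) * L) (split_op h j g)"
proof -
  interpret N: borel_prob "\<mu> h" by (rule borel_prob_mu[OF h(1)])
  have "norm ((\<psi> h ^^ j) (z + x) - (\<psi> h ^^ j) (z' + x)) \<le> exp (w * (real j * h)) * norm (z - z')" for z z' x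
    using \<psi>_pow_lipschitz[OF h, of j "z + x" "z' + x"] by simp
  then show ?thesis using integral_blip[OF N.prob_space_iid split_measurable[OF h] g L] unfolding split_op_def by simp
qed

text \<open>
  Moving all jumps to the front changes the argument of each deterministic step by the sum of
  the jumps still to come; a step \<open>x \<mapsto> \<psi> h x - x\<close> is \<open>h * w\<close>-Lipschitz.
\<close>

lemma state_split_distance:
  assumes h: "0 < h" "h < h0"
  shows "norm (state h z \<omega> j - (\<psi> h ^^ j) (z + psum \<omega> j)) \<le>
    exp (w * (real j * h)) * (\<Sum>i<j. h * w * norm (psum \<omega> j - psum \<omega> i))"
proof -
  define d where "d i = psum \<omega> j - psum \<omega> i" for i
  define E where "E i = norm (state h z \<omega> i + d i - (\<psi> h ^^ i) (z + psum \<omega> j))" for i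
  have "E j \<le> exp (h * w * real j) * (\<Sum>l<j. h * w * norm (d l))"
  proof (rule affine_recursion_bound[where j = j])
    show "E 0 = 0" by (simp add: E_def d_def)
    fix i assume "i < j"
    let ?Z = "state h z \<omega> i" and ?b = "(\<psi> h ^^ i) (z + psum \<omega> j)"
    have "state h z \<omega> (Suc i) + d (Suc i) - \<psi> h ?b = (\<psi> h (?Z + d i) - \<psi> h ?b) - (\<psi> h (?Z + d i) - \<psi> h ?Z - d i)"
      by (simp add: d_def algebra_simps)
    then have "E (Suc i) \<le> norm (\<psi> h (?Z + d i) - \<psi> h ?b) + norm (\<psi> h (?Z + d i) - \<psi> h ?Z - d i)"
      by (simp only: E_def funpow.simps comp_apply norm_triangle_ineq4)
    then show "E (Suc i) \<le> (1 + h * w) * E i + h * w * norm (d i)"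
      using \<psi>_lipschitz[OF h, of "?Z + d i" ?b] \<psi>[OF h, of "?Z + d i" ?Z] by (simp add: E_def)
  qed (use w h in auto)
  then show ?thesis by (simp add: E_def d_def algebra_simps)
qed

text \<open>A big jump occurs with probability at most \<open>eps * T\<close> and costs
  \<open>2 * B\<close>. Otherwise the distance is a sum over \<open>j\<close> steps of
  \<open>h * w\<close> times truncated partial sums, whose expected norms are at most the root of
  their second moment. This gives \<open>T * sqrt (C * T + (C * T)^2)\<close>, which is of smaller
  order than \<open>T\<close>; the first term is not, but has an arbitrarily small factor.\<close>

lemma block_error:
  fixes j :: nat
  assumes h: "0 < h" "h < h0" and K: "K > 0" and C: "C \<ge> 0" and eps: "eps \<ge> 0"
    and big: "measure (\<mu> h) {y. norm y > K} \<le> eps * h"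
    and m1: "norm (LINT y|\<mu> h. trunc K y) \<le> C * h" and m2: "(LINT y|\<mu> h. (norm (trunc K y))\<^sup>2) \<le> C * h"
    and g: "blip B L g" and B: "B \<ge> 0" and L: "L \<ge> 0"
  defines "T \<equiv> real j * h"
  shows "\<bar>P h j g z - split_op h j g z\<bar> \<le> 2 * B * eps * T + 2 * L * exp (w * T) * w * T * sqrt (C * T + (C * T)\<^sup>2)"
proof -
  interpret N: borel_prob "\<mu> h" by (rule borel_prob_mu[OF h(1)])
  define big' where "big' = {\<omega> :: nat \<Rightarrow> 'a. \<exists>i<j. norm (\<omega> i) > K}"
  define V where "V i \<omega> = norm (walk (trunc K) \<omega> i)" for i and \<omega> :: "nat \<Rightarrow> 'a"
  define m where "m = sqrt (C * T + (C * T)\<^sup>2)"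
  define c where "c = L * exp (w * T) * (h * w)"
  let ?D = "\<lambda>\<omega>. g (state h z \<omega> j) - g ((\<psi> h ^^ j) (z + psum \<omega> j))"
  have c: "c \<ge> 0" using L h w by (simp add: c_def)
  have gm: "g \<in> borel_measurable borel" "\<And>x. \<bar>g x\<bar> \<le> B"
    using bcontfun_measurable[OF blip_bcontfun[OF g]] g by (auto simp: blip_def)
  have tm: "trunc K \<in> borel_measurable borel" unfolding trunc_def by measurable
  have Vi: "integrable (iid (\<mu> h)) (V i)" "integrable (iid (\<mu> h)) (\<lambda>\<omega>. (V i \<omega>)\<^sup>2)" for i
  proof -
    have b: "V i \<omega> \<le> real i * K" for \<omega> unfolding V_def using norm_trunc_le[of K] K by (intro N.norm_walk_le) auto
    have m: "V i \<in> borel_measurable (iid (\<mu> h))" unfolding V_def using tm by measurable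
    have V0: "0 \<le> V i \<omega>" for \<omega> by (simp add: V_def)
    show "integrable (iid (\<mu> h)) (V i)" using b V0 by (intro N.iid_integrable[OF m, of "real i * K"]) auto
    show "integrable (iid (\<mu> h)) (\<lambda>\<omega>. (V i \<omega>)\<^sup>2)"
      using power_mono[OF b V0] by (intro N.iid_integrable[of _ "(real i * K)\<^sup>2"] borel_measurable_power m) auto
  qed
  have EV: "(LINT \<omega>|iid (\<mu> h). V i \<omega>) \<le> m" if "i \<le> j" for i
    unfolding m_def
  proof (rule N.seq.P.expectation_le_sqrt[OF Vi])
    have "real i * h \<le> T" using that h by (simp add: T_def)
    then have "C * (real i * h) + (C * (real i * h))\<^sup>2 \<le> C * T + (C * T)\<^sup>2"
      using C h by (intro add_mono power_mono mult_left_mono) auto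
    then show "(LINT \<omega>|iid (\<mu> h). (V i \<omega>)\<^sup>2) \<le> C * T + (C * T)\<^sup>2"
      using N.walk_trunc_second_moment_le[OF K less_imp_le[OF h(1)] C m1 m2, of i] by (simp add: V_def)
  qed
  have sets: "big' \<in> sets (iid (\<mu> h))" unfolding big'_def by (rule N.ex_big_jump_sets)
  have R: "integrable (iid (\<mu> h)) (\<lambda>\<omega>. 2 * B * indicat_real big' \<omega>)" "integrable (iid (\<mu> h)) (\<lambda>\<omega>. c * (\<Sum>i<j. V j \<omega> + V i \<omega>))"
    using sets Vi by (auto intro!: integrable_real_indicator simp: N.seq.P.emeasure_eq_measure)
  have pw: "\<bar>?D \<omega>\<bar> \<le> 2 * B * indicat_real big' \<omega> + c * (\<Sum>i<j. V j \<omega> + V i \<omega>)" for \<omega>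
  proof (cases "\<omega> \<in> big'")
    case True
    then show ?thesis using gm(2)[of "state h z \<omega> j"] gm(2)[of "(\<psi> h ^^ j) (z + psum \<omega> j)"] c
      by (simp add: V_def sum_nonneg add_increasing2)
  next
    case False
    have "norm (\<omega> i) \<le> K" if "i < j" for i using False that leI unfolding big'_def by blast
    then have eq: "psum \<omega> i = walk (trunc K) \<omega> i" if "i \<le> j" for i
      using that by (intro N.walk_eq_trunc) auto
    have "\<bar>?D \<omega>\<bar> \<le> L * norm (state h z \<omega> j - (\<psi> h ^^ j) (z + psum \<omega> j))"
      using g by (simp add: blip_def)
    also have "\<dots> \<le> L * (exp (w * T) * (\<Sum>i<j. h * w * norm (psum \<omega> j - psum \<omega> i)))"
      using state_split_distance[OF h, of z \<omega> j] L by (intro mult_left_mono) (auto simp: T_def)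
    also have "\<dots> = c * (\<Sum>i<j. norm (walk (trunc K) \<omega> j - walk (trunc K) \<omega> i))"
      by (simp add: c_def eq sum_distrib_left mult_ac)
    also have "\<dots> \<le> c * (\<Sum>i<j. V j \<omega> + V i \<omega>)"
      using c unfolding V_def by (intro mult_left_mono sum_mono norm_triangle_ineq4)
    finally show ?thesis using False by simp
  qed
  note i1 = state_integrable[OF h gm, of z j] and i2 = split_integrable[OF h gm, of j z]
  have "\<bar>P h j g z - split_op h j g z\<bar> = \<bar>LINT \<omega>|iid (\<mu> h). ?D \<omega>\<bar>"
    using P_integral[OF h gm, of j z] i1 i2 by (simp add: split_op_def)
  also have "\<dots> \<le> (LINT \<omega>|iid (\<mu> h). \<bar>?D \<omega>\<bar>)" by (rule integral_abs_bound)
  also have "\<dots> \<le> (LINT \<omega>|iid (\<mu> h). (2 * B * indicat_real big' \<omega> + c * (\<Sum>i<j. V j \<omega> + V i \<omega>)))"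
    by (intro integral_mono pw Bochner_Integration.integrable_add R integrable_abs Bochner_Integration.integrable_diff i1 i2)
  also have "\<dots> = 2 * B * measure (iid (\<mu> h)) big' + c * (\<Sum>i<j. (LINT \<omega>|iid (\<mu> h). V j \<omega>) + (LINT \<omega>|iid (\<mu> h). V i \<omega>))"
    using R Vi sets by (simp add: Bochner_Integration.integral_sum)
  also have "\<dots> \<le> 2 * B * (eps * T) + c * (\<Sum>i<j. m + m)"
  proof (intro add_mono mult_left_mono sum_mono EV)
    have "measure (iid (\<mu> h)) big' \<le> real j * (eps * h)"
      unfolding big'_def by (rule order_trans[OF N.iid_big_jump mult_left_mono[OF big]]) simp
    then show "measure (iid (\<mu> h)) big' \<le> eps * T" by (simp add: T_def mult_ac)
  qed (use B c in auto)
  also have "\<dots> = 2 * B * eps * T + 2 * L * exp (w * T) * w * T * m" by (simp add: c_def T_def algebra_simps)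
  finally show ?thesis by (simp add: m_def)
qed

end

section \<open>Convergence for bounded Lipschitz functions\<close>

text \<open>Tightness confines the integrals to a ball up to a small error, and there the integrands
  converge uniformly.\<close>

lemma weak_limit_perturb:
  fixes N :: "nat \<Rightarrow> 'a::euclidean_space measure" and f :: "'a \<Rightarrow> real"
  assumes N: "\<And>n. prob_space (N n)" "\<And>n. sets (N n) = sets borel"
    and conv: "(\<lambda>n. LINT x|N n. f x) ----> c"
    and tight: "\<And>eps. eps > 0 ==> \<exists>R. EV n. measure (N n) {x. norm x > R} \<le> eps"
    and f: "f \<in> borel_measurable borel" "\<And>x. \<bar>f x\<bar> \<le> B"
    and fs: "EV n. fs n \<in> borel_measurable borel \<and> (\<forall>x. \<bar>fs n x\<bar> \<le> B)"
    and unif: "\<And>R e. e > 0 ==> EV n. \<forall>x. norm x \<le> R --> \<bar>fs n x - f x\<bar> \<le> e"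
  shows "(\<lambda>n. LINT x|N n. fs n x) ----> c"
proof -
  have B: "B \<ge> 0" using f(2)[of 0] by linarith
  have "(\<lambda>n. (LINT x|N n. fs n x) - (LINT x|N n. f x)) ----> 0"
  proof (rule tendstoI)
    fix e :: real assume e: "e > 0"
    define d where "d = e / 2 / (2 * B + 1)"
    have d: "d > 0" using e B by (simp add: d_def)
    obtain R where R: "EV n. measure (N n) {x. norm x > R} \<le> d" using tight[OF d] by blast
    have "e / 4 > 0" using e by simp
    from fs R unif[OF this, of R]
    show "EV n. dist ((LINT x|N n. fs n x) - (LINT x|N n. f x)) 0 < e"
    proof eventually_elim
      case (elim n)
      have "\<bar>(LINT x|N n. fs n x) - (LINT x|N n. f x)\<bar> \<le> e / 4 + (B + B) * d"
        by (rule integral_close_of_tail[OF N, where R = R]) (use elim f B e in auto)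
      also have "(B + B) * d \<le> (2 * B + 1) * d" using d by simp
      also have "\<dots> = e / 2" using nonzero_eq_divide_eq[of "2 * B + 1" d "e / 2"] B d_def by (simp add: mult.commute)
      finally show ?case using e by simp
    qed
  qed
  from tendsto_add[OF this conv] show ?thesis by simp
qed

lemma blip_limit:
  assumes gs: "EV n. blip B L (gs n)" and lim: "\<And>x. (\<lambda>n. gs n x) ----> g x"
  shows "blip B L g"
  unfolding blip_def
proof (intro conjI allI)
  show "\<bar>g x\<bar> \<le> B" for x
    by (rule tendsto_upperbound[OF tendsto_rabs[OF lim]]) (use gs in \<open>auto simp: blip_def elim: eventually_mono\<close>)
  show "\<bar>g x - g y\<bar> \<le> L * norm (x - y)" for x y
    by (rule tendsto_upperbound[OF tendsto_rabs[OF tendsto_diff[OF lim lim]]])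
       (use gs in \<open>auto simp: blip_def elim: eventually_mono\<close>)
qed

lemma blip_mono: "blip B L g ==> L \<le> L' ==> blip B L' g"
  unfolding blip_def by (meson mult_right_mono norm_ge_zero order_trans)

lemma blip_bound: "blip B L g ==> \<bar>g x\<bar> \<le> B" and blip_lipschitz: "blip B L g ==> \<bar>g x - g y\<bar> \<le> L * norm (x - y)"
  and blip_measurable: "blip B L g ==> g \<in> borel_measurable borel" for g :: "'a::euclidean_space \<Rightarrow> real"
  using bcontfun_measurable[OF blip_bcontfun] by (auto simp: blip_def)

context scheme begin

lemma time_nonneg: "null_seq hs ==> (\<lambda>n. real (js n) * hs n) ----> s ==> 0 \<le> s"
  by (rule LIMSEQ_le_const) (auto simp: null_seq_def less_imp_le)

lemma small_steps:
  assumes "null_seq hs" "(\<lambda>n. real (js n) * hs n) ----> s"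
  shows "EV n. (0 < hs n \<and> hs n < h0) \<and> exp (w * (real (js n) * hs n)) \<le> exp (w * (s + 1))"
proof -
  have "EV n. real (js n) * hs n < s + 1" using assms(2) by (simp add: order_tendsto_iff)
  then show ?thesis using null_seq_small[OF assms(1) h0]
    by eventually_elim (use w in \<open>auto intro: mult_left_mono\<close>)
qed

text \<open>The law of the jumps of a block converges weakly, by its characteristic function, and
  the deterministic steps converge to the flow uniformly on balls. The test functions
  \<open>gs n\<close> may vary with \<open>n\<close>, as needed to iterate over several
  blocks.\<close>

lemma split_converges:
  assumes hs: "null_seq hs" and s: "(\<lambda>n. real (js n) * hs n) ----> s"
    and N0: "prob_space N0" "sets N0 = sets borel" "\<And>u. charf N0 u = exp (of_real s * \<eta> u)"
    and gs: "EV n. blip B L (gs n)" and L: "L \<ge> 0" and lim: "\<And>x. (\<lambda>n. gs n x) ----> g x"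
  shows "(\<lambda>n. split_op (hs n) (js n) (gs n) z) ----> (LINT y|N0. g (flow s (z + y)))"
proof -
  have s0: "0 \<le> s" by (rule time_nonneg[OF hs s])
  have pos: "0 < hs n" for n using hs by (simp add: null_seq_def)
  define N where "N n = distr (iid (\<mu> (hs n))) borel (\<lambda>\<omega>. psum \<omega> (js n))" for n
  have wm: "(\<lambda>\<omega>. psum \<omega> (js n)) \<in> borel_measurable (iid (\<mu> (hs n)))" for n
    by (rule borel_prob.walk_measurable[OF borel_prob_mu[OF pos]]) simp
  have N: "prob_space (N n)" "sets (N n) = sets borel" for n
    unfolding N_def using prob_space.prob_space_distr[OF borel_prob.prob_space_iid[OF borel_prob_mu[OF pos]] wm] by auto
  have tight: "\<exists>R. EV n. measure (N n) {x. norm x > R} \<le> eps" if eps: "eps > 0" for eps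
  proof -
    obtain l h1 where l: "h1 > 0" "\<And>h j. 0 < h ==> h < h1 ==> real j * h \<le> s + 1 ==>
        measure (iid (\<mu> h)) {\<omega>. norm (psum \<omega> j) > l} \<le> eps"
      using walk_tight[OF eps, of "s + 1"] s0 by auto
    have "EV n. real (js n) * hs n < s + 1" using s by (simp add: order_tendsto_iff)
    then have "EV n. measure (N n) {x. norm x > l} \<le> eps" using null_seq_small[OF hs l(1)]
    proof eventually_elim
      case (elim n)
      then show ?case using l(2)[of "hs n" "js n"] borel_prob.space_iid[OF borel_prob_mu[OF pos[of n]]]
        by (simp add: N_def measure_distr[OF wm] vimage_def)
    qed
    then show ?thesis by blast
  qed
  have g: "blip B L g" by (rule blip_limit[OF gs lim])
  define f where "f y = g (flow s (z + y))" for y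
  have fc: "continuous_on UNIV f"
    unfolding f_def by (intro continuous_on_compose2[OF blip_continuous[OF g]] continuous_on_compose2[OF flow_continuous[OF s0]] continuous_intros) auto
  have fB: "\<bar>f y\<bar> \<le> B" for y using blip_bound[OF g] by (simp add: f_def)
  have "(\<lambda>n. LINT x|N n. f x) ----> (LINT x|N0. f x)"
  proof (rule charf_tendsto_imp_weak[OF N N0(1,2) _ tight bcontfunI[OF fc fB]])
    show "(\<lambda>n. charf (N n) u) ----> charf N0 u" for u
      using charf_power_tendsto[OF hs s, of u] unfolding N_def N0(3) by (simp add: borel_prob.charf_walk[OF borel_prob_mu[OF pos]])
  qed
  note conv = this
  have lim': "(\<lambda>n. LINT y|N n. gs n ((\<psi> (hs n) ^^ js n) (z + y))) ----> (LINT x|N0. f x)"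
  proof (rule weak_limit_perturb[of N f "LINT x|N0. f x" B "\<lambda>n y. gs n ((\<psi> (hs n) ^^ js n) (z + y))",
      OF N conv tight borel_measurable_continuous_onI[OF fc] fB])
    show "EV n. (\<lambda>y. gs n ((\<psi> (hs n) ^^ js n) (z + y))) \<in> borel_measurable borel \<and>
        (\<forall>y. \<bar>gs n ((\<psi> (hs n) ^^ js n) (z + y))\<bar> \<le> B)" using gs null_seq_small[OF hs h0]
    proof eventually_elim
      case (elim n)
      note [measurable] = blip_measurable[OF elim(1)] borel_measurable_continuous_onI[OF \<psi>_pow_continuous[of "hs n" "js n"]]
      show ?case using elim blip_bound[OF elim(1)] by simp
    qed
    fix R e :: real assume e: "e > 0"
    define d where "d = e / 2 / (L + 1)"
    have d: "e / 2 > 0" "d > 0" "d * (L + 1) = e / 2"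
      using e L nonzero_eq_divide_eq[of "L + 1" d "e / 2"] by (auto simp: d_def)
    have "EV n. \<forall>x y. norm (gs n x - gs n y) \<le> L * norm (x - y)"
      using gs by eventually_elim (simp add: blip_def)
    from gs euler_uniform[OF hs s d(2), of "norm z + R"]
      lipschitz_uniform_limit[OF L this lim d(1), of "norm (flow s 0) + (norm z + R) * exp (w * s)"]
    show "EV n. \<forall>y. norm y \<le> R --> \<bar>gs n ((\<psi> (hs n) ^^ js n) (z + y)) - f y\<bar> \<le> e"
    proof eventually_elim
      case (elim n)
      show ?case
      proof (intro allI impI)
        fix y :: 'a assume y: "norm y \<le> R"
        have zy: "norm (z + y) \<le> norm z + R" using norm_triangle_ineq[of z y] y by simp
        have "norm (flow s (z + y)) \<le> norm (flow s 0) + (norm z + R) * exp (w * s)"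
          using flow_lipschitz[OF s0, of "z + y" 0] norm_triangle_ineq2[of "flow s (z + y)" "flow s 0"]
            mult_right_mono[OF zy exp_ge_zero[of "w * s"]] unfolding diff_zero by linarith
        then have "\<bar>gs n (flow s (z + y)) - g (flow s (z + y))\<bar> \<le> e / 2" using elim(3) by simp
        moreover have "\<bar>gs n ((\<psi> (hs n) ^^ js n) (z + y)) - gs n (flow s (z + y))\<bar> \<le> L * d"
          using elim zy L by (intro order_trans[OF blip_lipschitz mult_left_mono]) auto
        moreover have "L * d \<le> e / 2" using d(2) unfolding d(3)[symmetric] by (simp add: algebra_simps)
        ultimately show "\<bar>gs n ((\<psi> (hs n) ^^ js n) (z + y)) - f y\<bar> \<le> e" unfolding f_def by linarith
      qed
    qed
  qed
  have "EV n. (LINT y|N n. gs n ((\<psi> (hs n) ^^ js n) (z + y))) = split_op (hs n) (js n) (gs n) z"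
    using gs null_seq_small[OF hs h0]
  proof eventually_elim
    case (elim n)
    note [measurable] = blip_measurable[OF elim(1)] borel_measurable_continuous_onI[OF \<psi>_pow_continuous[of "hs n" "js n"]]
    show ?case unfolding N_def split_op_def by (rule integral_distr[OF wm]) (use elim in simp)
  qed
  then show ?thesis using Lim_transform_eventually[OF lim'] by (simp add: f_def)
qed

text \<open>The Lipschitz bound is part of the induction, since the next block needs it as a
  hypothesis. Each block multiplies it by at most \<open>exp (w * (s + 1))\<close>, because the
  block length is eventually below \<open>s + 1\<close>; the number of blocks is fixed.\<close>

lemma split_iterate_converges:
  assumes hs: "null_seq hs" and s: "(\<lambda>n. real (js n) * hs n) ----> s"
    and N0: "prob_space N0" "sets N0 = sets borel" "\<And>u. charf N0 u = exp (of_real s * \<eta> u)"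
    and f: "blip B L f" and L: "L \<ge> 0"
  shows "(EV n. blip B (exp (w * (s + 1)) ^ i * L) ((split_op (hs n) (js n) ^^ i) f)) \<and>
    (\<forall>z. (\<lambda>n. (split_op (hs n) (js n) ^^ i) f z) ----> ((\<lambda>g z. LINT y|N0. g (flow s (z + y))) ^^ i) f z)"
proof (induction i)
  case (Suc i)
  have ex: "0 \<le> exp (w * (s + 1)) ^ i * L" using L by simp
  have "EV n. blip B (exp (w * (s + 1)) ^ Suc i * L) ((split_op (hs n) (js n) ^^ Suc i) f)"
    using conjunct1[OF Suc] small_steps[OF hs s]
  proof eventually_elim
    case (elim n)
    have "blip B (exp (w * (real (js n) * hs n)) * (exp (w * (s + 1)) ^ i * L)) ((split_op (hs n) (js n) ^^ Suc i) f)"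
      using split_blip[OF _ _ elim(1) ex, of "hs n" "js n"] elim by simp
    then show ?case
      by (rule blip_mono) (use elim ex mult_right_mono[of "exp (w * (real (js n) * hs n))" "exp (w * (s + 1))" "exp (w * (s + 1)) ^ i * L"] in \<open>simp add: mult.assoc\<close>)
  qed
  moreover have "(\<lambda>n. (split_op (hs n) (js n) ^^ Suc i) f z) ----> ((\<lambda>g z. LINT y|N0. g (flow s (z + y))) ^^ Suc i) f z" for z
    using split_converges[OF hs s N0 conjunct1[OF Suc] ex spec[OF conjunct2[OF Suc]], of z] by simp
  ultimately show ?case by blast
qed (use f in simp)

lemma split_contraction:
  assumes h: "0 < h" "h < h0" and g: "g \<in> borel_measurable borel" "\<And>x. \<bar>g x\<bar> \<le> B"
    and g': "g' \<in> borel_measurable borel" "\<And>x. \<bar>g' x\<bar> \<le> B" and d: "\<And>x. \<bar>g x - g' x\<bar> \<le> d"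
  shows "\<bar>split_op h j g z - split_op h j g' z\<bar> \<le> d"
proof -
  interpret N: borel_prob "\<mu> h" by (rule borel_prob_mu[OF h(1)])
  have "\<bar>split_op h j g z - split_op h j g' z\<bar> = \<bar>LINT \<omega>|iid (\<mu> h). g ((\<psi> h ^^ j) (z + psum \<omega> j)) - g' ((\<psi> h ^^ j) (z + psum \<omega> j))\<bar>"
    using split_integrable[OF h g] split_integrable[OF h g'] by (simp add: split_op_def)
  also have "\<dots> \<le> (LINT \<omega>|iid (\<mu> h). \<bar>g ((\<psi> h ^^ j) (z + psum \<omega> j)) - g' ((\<psi> h ^^ j) (z + psum \<omega> j))\<bar>)"
    by (rule integral_abs_bound)
  also have "\<dots> \<le> d"
    using split_integrable[OF h g] split_integrable[OF h g'] d by (intro N.seq.P.integral_le_const) auto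
  finally show ?thesis .
qed

text \<open>Errors of the blocks add up. The outermost block acts on \<open>P h (j * i) f\<close>,
  whose Lipschitz constant is at most \<open>c * L\<close>, and costs \<open>\<rho>\<close>; the
  earlier error passes through \<open>split_op\<close>, a contraction in the supremum norm.\<close>

lemma P_split_distance:
  assumes h: "0 < h" "h < h0" and f: "blip B L f" and L: "L \<ge> 0" and c: "exp (w * (real (j * i) * h)) \<le> c"
    and \<rho>: "\<And>g z. blip B (c * L) g ==> \<bar>P h j g z - split_op h j g z\<bar> \<le> \<rho>"
  shows "\<bar>P h (j * i) f z - (split_op h j ^^ i) f z\<bar> \<le> real i * \<rho>" using c
proof (induction i arbitrary: z)
  case (Suc i)
  have "exp (w * (real (j * i) * h)) \<le> exp (w * (real (j * Suc i) * h))" using w h by (auto intro!: mult_left_mono)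
  then have c: "exp (w * (real (j * i) * h)) \<le> c" using Suc.prems by linarith
  have b: "blip B (exp (w * (real (j * i) * h)) * L) (P h (j * i) f)" by (rule P_blip[OF h f L])
  have "\<exists>L'\<ge>0. blip B L' ((split_op h j ^^ i) f)"
  proof (induction i)
    case (Suc i)
    then obtain L' where "L' \<ge> 0" "blip B L' ((split_op h j ^^ i) f)" by blast
    then show ?case using split_blip[OF h, of B L' "(split_op h j ^^ i) f" j] by (auto intro!: exI[of _ "exp (w * (real j * h)) * L'"])
  qed (use f L in auto)
  then obtain L' where b': "blip B L' ((split_op h j ^^ i) f)" by blast
  have "P h (j * Suc i) f = P h j (P h (j * i) f)" by (simp add: funpow_add)
  moreover have "\<bar>P h j (P h (j * i) f) z - split_op h j (P h (j * i) f) z\<bar> \<le> \<rho>"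
    by (rule \<rho>[OF blip_mono[OF b]]) (use c L in \<open>auto intro: mult_right_mono\<close>)
  moreover have "\<bar>split_op h j (P h (j * i) f) z - split_op h j ((split_op h j ^^ i) f) z\<bar> \<le> real i * \<rho>"
    by (rule split_contraction[OF h blip_measurable[OF b] blip_bound[OF b] blip_measurable[OF b'] blip_bound[OF b'] Suc.IH[OF c]])
  ultimately show ?case by (simp add: algebra_simps)
qed simp

end

context levy begin

lemma integral_\<nu>_0:
  assumes "g \<in> borel_measurable borel" shows "(LINT y|\<nu> 0. g y) = (g 0 :: real)"
proof -
  have "(LINT y|\<nu> 0. g y) = (LINT \<omega>|M. g (Y 0 \<omega>))"
    unfolding \<nu>_def by (rule integral_distr[OF Y_measurable assms]) simp
  also have "\<dots> = (LINT \<omega>|M. g 0)"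
    by (rule integral_cong_AE) (use AE_Y0 measurable_compose[OF Y_measurable[of 0] assms] in \<open>auto elim: eventually_mono\<close>)
  finally show ?thesis by (simp add: prob_space)
qed

end

abbreviation (in levy_sde) sg :: "real \<Rightarrow> ('a \<Rightarrow> real) \<Rightarrow> 'a \<Rightarrow> real" where
  "sg t f x \<equiv> LINT \<omega>|M. f (SX x t \<omega>)"

locale levy_scheme = scheme \<mu> F w \<psi> h0 + levy_sde M Y F w
  for \<mu> :: "real \<Rightarrow> 'a::euclidean_space measure" and F :: "'a \<Rightarrow> 'a" and w :: real
    and \<psi> :: "real \<Rightarrow> 'a \<Rightarrow> 'a" and h0 :: real and M :: "'w measure" and Y :: "real \<Rightarrow> 'w \<Rightarrow> 'a" +
  assumes charf_Y: "0 \<le> t ==> charf (distr M borel (Y t)) u = exp (of_real t * \<eta> u)"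
begin

lemma \<nu>_facts: "0 \<le> s ==> prob_space (\<nu> s)" "sets (\<nu> s) = sets borel" "0 \<le> s ==> charf (\<nu> s) u = exp (of_real s * \<eta> u)"
  using borel_prob_\<nu>[of s] charf_Y[of s u] by (auto simp: borel_prob_def \<nu>_def)

lemma Q_eq: "Q s = (\<lambda>g z. LINT y|\<nu> s. g (flow s (z + y)))" by (intro ext) (simp add: Q_def)

text \<open>First \<open>eps\<close> makes the contribution of big jumps small over the whole time
  \<open>t\<close>; then the number \<open>q\<close> of blocks is taken so large that the remaining
  block errors and the distance of the powers of \<open>Q\<close> to the solution are small; finally
  \<open>n\<close> tends to infinity with \<open>q\<close> fixed.\<close>

lemma P_converges_pointwise:
  assumes hs: "null_seq hs" and t: "(\<lambda>n. real (ks n) * hs n) ----> t" and f: "blip B L f" and B: "B \<ge> 0" and L: "L \<ge> 0"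
  shows "(\<lambda>n. P (hs n) (ks n) f z) ----> sg t f z"
proof (rule tendstoI)
  fix e :: real assume e: "e > 0"
  have t0: "0 \<le> t" by (rule time_nonneg[OF hs t])
  have pos: "0 < hs n" for n using hs by (simp add: null_seq_def)
  have hlim: "hs ----> 0" using hs by (simp add: null_seq_def)
  define eps where "eps = e / 8 / (B * t + 1)"
  have Bt: "B * t + 1 > 0" using B t0 by (simp add: add_nonneg_pos)
  have eps: "eps > 0" using e Bt by (simp add: eps_def)
  have "2 * B * eps * t \<le> 2 * (eps * (B * t + 1))" using eps by (simp add: algebra_simps)
  also have "eps * (B * t + 1) = e / 8" using nonzero_eq_divide_eq[of "B * t + 1" eps "e / 8"] Bt eps_def by simp
  finally have small: "2 * B * eps * t < e / 3" using e by simp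
  obtain K C h1 where K: "K > 0" "C \<ge> 0" "h1 > 0"
    and KC: "\<And>h. 0 < h ==> h < h1 ==> measure (\<mu> h) {y. norm y > K} \<le> eps * h \<and>
      norm (LINT y|\<mu> h. trunc K y) \<le> C * h \<and> (LINT y|\<mu> h. (norm (trunc K y))\<^sup>2) \<le> C * h"
    using truncated_moments[OF eps] by auto
  define L' where "L' = exp (w * (t + 1)) * L"
  have L': "L' \<ge> 0" using L by (simp add: L'_def)
  \<comment> \<open>The bound of \<open>block_error\<close> as a function of the block length. With
    \<open>q\<close> blocks of length \<open>t / q\<close> the total tends to
    \<open>2 * B * eps * t\<close> as \<open>q\<close> grows.\<close>
  define \<rho> where "\<rho> T = 2 * B * eps * T + 2 * L' * exp (w * T) * w * T * sqrt (C * T + (C * T)\<^sup>2)" for T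
  have block: "\<bar>P h j g z - split_op h j g z\<bar> \<le> \<rho> (real j * h)"
    if "0 < h" "h < h0" "h < h1" "blip B L' g" for h j g z
    unfolding \<rho>_def using block_error[OF that(1,2) K(1,2) less_imp_le[OF eps] _ _ _ that(4) B L'] KC[OF that(1,3)] by blast
  have \<rho>_cont: "(\<lambda>n. \<rho> (T n)) ----> \<rho> T0" if "T ----> T0" for T :: "nat \<Rightarrow> real" and T0
    unfolding \<rho>_def by (intro tendsto_intros that)
  have inv: "(\<lambda>m. t / real (Suc m)) ----> 0"
    using tendsto_mult[OF tendsto_const[of t] LIMSEQ_inverse_real_of_nat] by (simp add: divide_inverse)
  have "(\<lambda>m. 2 * B * eps * t + 2 * L' * exp (w * (t / real (Suc m))) * w * t * sqrt (C * (t / real (Suc m)) + (C * (t / real (Suc m)))\<^sup>2))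
      ----> 2 * B * eps * t + 2 * L' * exp (w * 0) * w * t * sqrt (C * 0 + (C * 0)\<^sup>2)"
    by (intro tendsto_intros inv)
  moreover have "real (Suc m) * \<rho> (t / real (Suc m)) =
      2 * B * eps * t + 2 * L' * exp (w * (t / real (Suc m))) * w * t * sqrt (C * (t / real (Suc m)) + (C * (t / real (Suc m)))\<^sup>2)" for m
  proof -
    have "real (Suc m) * (a * (t / real (Suc m)) + b * (t / real (Suc m)) * c) = a * t + b * t * c" for a b c
      by (simp add: field_simps del: of_nat_Suc)
    then show ?thesis unfolding \<rho>_def by blast
  qed
  ultimately have "(\<lambda>m. real (Suc m) * \<rho> (t / real (Suc m))) ----> 2 * B * eps * t" by simp
  then have "EV m. real (Suc m) * \<rho> (t / real (Suc m)) < e / 3" by (rule order_tendstoD) (rule small)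
  moreover have "EV m. dist ((Q (t / real (Suc m)) ^^ Suc m) f z) (sg t f z) < e / 3"
    using SX_expectation_limit[OF t0 blip_bcontfun[OF f]] e by (intro tendstoD) auto
  ultimately obtain m where m: "real (Suc m) * \<rho> (t / real (Suc m)) < e / 3"
      "dist ((Q (t / real (Suc m)) ^^ Suc m) f z) (sg t f z) < e / 3"
    using eventually_happens[OF eventually_conj] by (metis (no_types, lifting) sequentially_bot)
  define q where "q = Suc m"
  define s where "s = t / real q"
  \<comment> \<open>Besides the \<open>q\<close> equal blocks there are \<open>r n < q\<close>
    leftover steps, which form one more block whose duration tends to 0.\<close>
  define j where "j n = ks n div q" for n
  define r where "r n = ks n mod q" for n
  have q: "q > 0" by (simp add: q_def)
  have ks: "ks n = r n + j n * q" for n by (simp add: j_def r_def)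
  have s0: "0 \<le> s" using t0 by (simp add: s_def)
  have rlim: "(\<lambda>n. real (r n) * hs n) ----> 0"
  proof (rule tendsto_sandwich[of "\<lambda>_. 0" _ _ "\<lambda>n. real q * hs n"])
    have "r n \<le> q" for n using q by (simp add: r_def less_imp_le)
    then show "EV n. real (r n) * hs n \<le> real q * hs n"
      using pos by (intro always_eventually allI mult_right_mono) (auto simp: less_imp_le)
    show "(\<lambda>n. real q * hs n) ----> 0" using tendsto_mult[OF tendsto_const[of "real q"] hlim] by simp
  qed (use pos in \<open>auto simp: less_imp_le\<close>)
  have jlim: "(\<lambda>n. real (j n) * hs n) ----> s"
  proof -
    have "(\<lambda>n. (real (ks n) * hs n - real (r n) * hs n) / real q) ----> (t - 0) / real q"
      by (intro tendsto_intros t rlim) (use q in auto)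
    moreover have "(real (ks n) * hs n - real (r n) * hs n) / real q = real (j n) * hs n" for n
      using q ks[of n] by (simp add: field_simps)
    ultimately show ?thesis by (simp add: s_def)
  qed
  note it = split_iterate_converges[OF hs jlim \<nu>_facts(1)[OF s0] \<nu>_facts(2) \<nu>_facts(3)[OF s0] f L, of q]
  have G: "blip B (exp (w * (s + 1)) ^ q * L) ((Q s ^^ q) f)"
    unfolding Q_eq by (rule blip_limit[OF conjunct1[OF it] spec[OF conjunct2[OF it]]])
  \<comment> \<open>In the limit the leftover block takes no time: \<open>flow 0\<close> is the
    identity and \<open>\<nu> 0\<close> is concentrated at 0.\<close>
  have "(\<lambda>n. split_op (hs n) (r n) ((split_op (hs n) (j n) ^^ q) f) z) ----> (LINT y|\<nu> 0. (Q s ^^ q) f (flow 0 (z + y)))"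
    unfolding Q_eq
    by (rule split_converges[OF hs rlim \<nu>_facts(1) \<nu>_facts(2,3) conjunct1[OF it] _ spec[OF conjunct2[OF it]]]) (use L in auto)
  moreover have "(LINT y|\<nu> 0. (Q s ^^ q) f (flow 0 (z + y))) = (Q s ^^ q) f z"
    using integral_\<nu>_0[of "\<lambda>y. (Q s ^^ q) f (z + y)"] measurable_compose[OF _ blip_measurable[OF G], of "\<lambda>y. z + y" borel] by simp
  ultimately have "(\<lambda>n. split_op (hs n) (r n) ((split_op (hs n) (j n) ^^ q) f) z) ----> (Q s ^^ q) f z" by simp
  then have A: "EV n. dist (split_op (hs n) (r n) ((split_op (hs n) (j n) ^^ q) f) z) ((Q s ^^ q) f z) < e / 3"
    by (rule tendstoD) (use e in simp)
  have "(\<lambda>n. \<rho> (real (r n) * hs n) + real q * \<rho> (real (j n) * hs n)) ----> \<rho> 0 + real q * \<rho> s"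
    by (intro tendsto_intros \<rho>_cont rlim jlim)
  moreover have "\<rho> 0 + real q * \<rho> s < e / 3" using m(1) unfolding s_def q_def by (simp add: \<rho>_def)
  ultimately have Bd: "EV n. \<rho> (real (r n) * hs n) + real q * \<rho> (real (j n) * hs n) < e / 3"
    by (rule order_tendstoD)
  from A Bd small_steps[OF hs t] null_seq_small[OF hs K(3)] conjunct1[OF it]
  show "EV n. dist (P (hs n) (ks n) f z) (sg t f z) < e"
  proof eventually_elim
    case (elim n)
    have h: "0 < hs n" "hs n < h0" "hs n < h1" using elim by auto
    have "real (j n * q) * hs n \<le> real (ks n) * hs n" using pos[of n] ks[of n] by (intro mult_right_mono) auto
    then have "exp (w * (real (j n * q) * hs n)) \<le> exp (w * (real (ks n) * hs n))" using w by (auto intro: mult_left_mono)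
    then have c: "exp (w * (real (j n * q) * hs n)) \<le> exp (w * (t + 1))" using elim by linarith
    have b: "blip B L' (P (hs n) (j n * q) f)"
      by (rule blip_mono[OF P_blip[OF h(1,2) f L]]) (use c L in \<open>auto simp: L'_def intro: mult_right_mono\<close>)
    have "\<bar>P (hs n) (j n * q) f x - (split_op (hs n) (j n) ^^ q) f x\<bar> \<le> real q * \<rho> (real (j n) * hs n)" for x
      by (rule P_split_distance[OF h(1,2) f L c]) (use block[OF h] in \<open>simp add: L'_def\<close>)
    then have "\<bar>split_op (hs n) (r n) (P (hs n) (j n * q) f) z - split_op (hs n) (r n) ((split_op (hs n) (j n) ^^ q) f) z\<bar> \<le> real q * \<rho> (real (j n) * hs n)"
      by (rule split_contraction[OF h(1,2) blip_measurable[OF b] blip_bound[OF b] blip_measurable[OF elim(5)] blip_bound[OF elim(5)]])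
    moreover have "\<bar>P (hs n) (r n) (P (hs n) (j n * q) f) z - split_op (hs n) (r n) (P (hs n) (j n * q) f) z\<bar> \<le> \<rho> (real (r n) * hs n)"
      by (rule block[OF h b])
    moreover have "P (hs n) (ks n) f z = P (hs n) (r n) (P (hs n) (j n * q) f) z"
      unfolding ks[of n] funpow_add by simp
    ultimately show ?case using elim(1,2) m(2)[folded q_def, folded s_def] unfolding dist_real_def by linarith
  qed
qed

lemma P_converges_uniform:
  assumes hs: "null_seq hs" and t: "(\<lambda>n. real (ks n) * hs n) ----> t" and f: "blip B L f" and B: "B \<ge> 0" and L: "L \<ge> 0"
    and e: "e > 0"
  shows "EV n. \<forall>x. norm x \<le> r --> \<bar>P (hs n) (ks n) f x - sg t f x\<bar> \<le> e"
proof -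
  have "EV n. \<forall>x y. norm (P (hs n) (ks n) f x - P (hs n) (ks n) f y) \<le> exp (w * (t + 1)) * L * norm (x - y)"
    using small_steps[OF hs t]
  proof eventually_elim
    case (elim n)
    have "blip B (exp (w * (t + 1)) * L) (P (hs n) (ks n) f)"
      by (rule blip_mono[OF P_blip[OF _ _ f L]]) (use elim L in \<open>auto intro: mult_right_mono\<close>)
    then show ?case by (simp add: blip_def)
  qed
  from lipschitz_uniform_limit[OF _ this P_converges_pointwise[OF hs t f B L] e, of r] L show ?thesis by simp
qed

end

section \<open>From Lipschitz functions to the mixed topology\<close>

lemma sup_abs_on_le: "sup_abs_on S f \<le> ereal c \<longleftrightarrow> (\<forall>x\<in>S. \<bar>f x\<bar> \<le> c)"
  by (simp add: sup_abs_on_def SUP_le_iff)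

lemma sup_abs_on_tendsto_0:
  assumes "S \<noteq> {}"
  shows "((\<lambda>n. sup_abs_on S (f n)) \<longlongrightarrow> 0) G \<longleftrightarrow> (\<forall>e>0. \<forall>\<^sub>F n in G. \<forall>x\<in>S. \<bar>f n x\<bar> \<le> e)"
proof
  assume lim: "((\<lambda>n. sup_abs_on S (f n)) \<longlongrightarrow> 0) G"
  show "\<forall>e>0. \<forall>\<^sub>F n in G. \<forall>x\<in>S. \<bar>f n x\<bar> \<le> e"
  proof (intro allI impI)
    fix e :: real assume "e > 0"
    then have "\<forall>\<^sub>F n in G. sup_abs_on S (f n) < ereal e" by (intro order_tendstoD[OF lim]) simp
    then show "\<forall>\<^sub>F n in G. \<forall>x\<in>S. \<bar>f n x\<bar> \<le> e"
      by (rule eventually_mono) (use sup_abs_on_le in \<open>fastforce dest: less_imp_le\<close>)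
  qed
next
  assume R: "\<forall>e>0. \<forall>\<^sub>F n in G. \<forall>x\<in>S. \<bar>f n x\<bar> \<le> e"
  obtain x where x: "x \<in> S" using assms by blast
  have pos: "0 \<le> sup_abs_on S (f n)" for n
  proof -
    have "0 \<le> ereal \<bar>f n x\<bar>" by simp
    also have "\<dots> \<le> sup_abs_on S (f n)" unfolding sup_abs_on_def by (rule SUP_upper[OF x])
    finally show ?thesis .
  qed
  show "((\<lambda>n. sup_abs_on S (f n)) \<longlongrightarrow> 0) G"
  proof (rule order_tendstoI)
    show "\<forall>\<^sub>F n in G. a < sup_abs_on S (f n)" if "a < 0" for a
      using that pos by (intro always_eventually allI) (rule less_le_trans)
    fix a :: ereal assume "0 < a"
    then obtain e where e: "0 < ereal e" "ereal e < a" using ereal_dense2 by blast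
    then have "\<forall>\<^sub>F n in G. \<forall>x\<in>S. \<bar>f n x\<bar> \<le> e" using R by simp
    then show "\<forall>\<^sub>F n in G. sup_abs_on S (f n) < a"
      by (rule eventually_mono) (use e sup_abs_on_le in \<open>fastforce intro: le_less_trans\<close>)
  qed
qed

lemma mixed_tendsto_iff:
  fixes f :: "'a::euclidean_space \<Rightarrow> real"
  shows "mixed_tendsto fs f \<longleftrightarrow> (\<forall>n. fs n \<in> bcontfun) \<and> f \<in> bcontfun \<and> (\<exists>B. \<forall>n x. \<bar>fs n x\<bar> \<le> B) \<and>
     (\<forall>r\<ge>0. \<forall>e>0. EV n. \<forall>x. norm x \<le> r --> \<bar>fs n x - f x\<bar> \<le> e)"
proof -
  have "(SUP n. sup_norm (fs n)) < \<infinity> \<longleftrightarrow> (\<exists>B. \<forall>n x. \<bar>fs n x\<bar> \<le> B)"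
  proof
    assume "(SUP n. sup_norm (fs n)) < \<infinity>"
    then obtain B where B: "(SUP n. sup_norm (fs n)) \<le> ereal B" using ereal_dense2 less_imp_le by blast
    then have "sup_norm (fs n) \<le> ereal B" for n by (meson SUP_le_iff UNIV_I)
    then show "\<exists>B. \<forall>n x. \<bar>fs n x\<bar> \<le> B" unfolding sup_abs_on_le by blast
  next
    assume "\<exists>B. \<forall>n x. \<bar>fs n x\<bar> \<le> B"
    then obtain B where B: "\<forall>n x. \<bar>fs n x\<bar> \<le> B" by blast
    have "(SUP n. sup_norm (fs n)) \<le> ereal B" by (rule SUP_least) (use B in \<open>simp add: sup_abs_on_le\<close>)
    then show "(SUP n. sup_norm (fs n)) < \<infinity>" using le_less_trans by fastforce
  qed
  moreover have "(\<lambda>n. sup_abs_on {x. norm x \<le> r} (\<lambda>x. fs n x - f x)) ----> 0 \<longleftrightarrow>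
      (\<forall>e>0. EV n. \<forall>x. norm x \<le> r --> \<bar>fs n x - f x\<bar> \<le> e)" if "r \<ge> 0" for r
  proof -
    have "{x :: 'a. norm x \<le> r} \<noteq> {}" using that norm_zero by (metis (mono_tags) empty_Collect_eq)
    then show ?thesis by (simp add: sup_abs_on_tendsto_0)
  qed
  ultimately show ?thesis unfolding mixed_tendsto_def by auto
qed

lemma (in prob_space) expectation_diff_le:
  fixes X Y c :: "'a \<Rightarrow> real"
  assumes i: "integrable M X" "integrable M Y" "integrable M c" and le: "\<And>\<omega>. \<bar>X \<omega> - Y \<omega>\<bar> \<le> a + b * c \<omega>"
  shows "\<bar>expectation X - expectation Y\<bar> \<le> a + b * expectation c"
proof -
  have "\<bar>expectation X - expectation Y\<bar> = \<bar>expectation (\<lambda>\<omega>. X \<omega> - Y \<omega>)\<bar>" using i by simp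
  also have "\<dots> \<le> expectation (\<lambda>\<omega>. \<bar>X \<omega> - Y \<omega>\<bar>)" by (rule integral_abs_bound)
  also have "\<dots> \<le> expectation (\<lambda>\<omega>. a + b * c \<omega>)" by (rule integral_mono) (use i le in auto)
  also have "\<dots> = a + b * expectation c" using i prob_space by simp
  finally show ?thesis .
qed

text \<open>A Lipschitz tail function: the convergence already proved for bounded Lipschitz
  functions then bounds the tails of the scheme by those of the solution.\<close>

definition clip :: "real \<Rightarrow> 'a::real_normed_vector \<Rightarrow> real" where
  "clip l y = min 1 (max 0 (norm y - l))"

lemma clip_bounds: "0 \<le> clip l y" "clip l y \<le> 1" "norm y \<le> l ==> clip l y = 0" "l + 1 \<le> norm y ==> clip l y = 1"
  by (auto simp: clip_def)

lemma clip_blip: "blip 1 1 (clip l)"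
proof -
  have "\<bar>clip l x - clip l y\<bar> \<le> norm (x - y)" for x y :: 'a
    using norm_triangle_ineq3[of x y] unfolding clip_def by linarith
  then show ?thesis by (simp add: blip_def abs_of_nonneg[OF clip_bounds(1)] clip_bounds(2))
qed

context levy_sde begin

lemma SX_integrable:
  fixes g :: "'a \<Rightarrow> real"
  assumes "0 \<le> t" "g \<in> borel_measurable borel" "\<And>x. \<bar>g x\<bar> \<le> B"
  shows "integrable M (\<lambda>\<omega>. g (SX x t \<omega>))"
  using assms by (intro integrable_const_bound[of _ B] measurable_compose[OF SX_measurable]) auto

text \<open>Solutions from the ball of radius \<open>r\<close> stay within
  \<open>r * exp (w * t)\<close> of the one from 0 on almost every path, so the tail of that single
  variable controls all of them.\<close>

lemma SX_clip_small:
  assumes t: "0 \<le> t" and e: "eps > 0" and r: "0 \<le> r"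
  shows "\<exists>l\<ge>0. \<forall>x. norm x \<le> r --> sg t (clip l) x \<le> eps"
proof -
  let ?N = "distr M borel (SX 0 t)"
  obtain R where R: "R > 0" "measure ?N {x. norm x > R} \<le> eps"
    using norm_tail_tendsto_0[OF prob_space_distr[OF SX_measurable[OF t, of 0]] _ e] by auto
  define S where "S = {\<omega> \<in> space M. norm (SX 0 t \<omega>) > R}"
  have S: "S \<in> sets M" unfolding S_def using SX_measurable[OF t, of 0] by measurable
  have mS: "measure M S \<le> eps" using R(2) by (simp add: S_def measure_distr[OF SX_measurable[OF t]] vimage_def Int_def conj_commute)
  define l where "l = R + r * exp (w * t)"
  have "sg t (clip l) x \<le> eps" if x: "norm x \<le> r" for x
  proof -
    have "sg t (clip l) x \<le> (LINT \<omega>|M. indicat_real S \<omega>)"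
    proof (rule integral_mono_AE)
      show "integrable M (\<lambda>\<omega>. clip l (SX x t \<omega>))"
        by (rule SX_integrable[OF t blip_measurable[OF clip_blip] blip_bound[OF clip_blip]])
      show "integrable M (indicat_real S)" using S by (simp add: integrable_real_indicator less_top[symmetric])
      show "AE \<omega> in M. clip l (SX x t \<omega>) \<le> indicat_real S \<omega>" using AE_good
      proof eventually_elim
        case (elim \<omega>)
        have "norm (SX x t \<omega>) \<le> norm (SX 0 t \<omega>) + norm x * exp (w * t)"
          using SX_lipschitz[OF t, of \<omega> x 0] elim norm_triangle_ineq2[of "SX x t \<omega>" "SX 0 t \<omega>"] by simp
        also have "norm x * exp (w * t) \<le> r * exp (w * t)" using x by (rule mult_right_mono) simp
        finally have "norm (SX x t \<omega>) \<le> l" if "\<omega> \<notin> S" using that elim by (simp add: S_def l_def)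
        then show ?case using clip_bounds(1,2)[of l "SX x t \<omega>"] clip_bounds(3)[of "SX x t \<omega>" l] by (cases "\<omega> \<in> S") auto
      qed
    qed
    then show ?thesis using mS S by simp
  qed
  moreover have "l \<ge> 0" using R r by (simp add: l_def)
  ultimately show ?thesis by blast
qed

end

context levy_scheme begin

text \<open>Both \<open>fs n\<close> and \<open>f\<close> are replaced by one bounded Lipschitz
  \<open>p\<close>, close to them on a large ball. Outside, the discrepancy is at most a constant
  times \<open>clip l\<close>, whose expectation is small under the solution and, by convergence,
  under the scheme.\<close>

lemma P_converges:
  assumes hs: "null_seq hs" and t: "(\<lambda>n. real (ks n) * hs n) ----> t" and fs: "mixed_tendsto fs f" and r: "0 \<le> r" and e: "0 < e"
  shows "EV n. \<forall>x. norm x \<le> r --> \<bar>P (hs n) (ks n) (fs n) x - sg t f x\<bar> \<le> e"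
proof -
  have t0: "0 \<le> t" by (rule time_nonneg[OF hs t])
  obtain B1 where B1: "\<And>n x. \<bar>fs n x\<bar> \<le> B1" using fs unfolding mixed_tendsto_iff by blast
  have fb: "f \<in> bcontfun" "\<And>n. fs n \<in> bcontfun" using fs unfolding mixed_tendsto_iff by auto
  obtain B2 where B2: "B2 \<ge> 0" "\<And>x. \<bar>f x\<bar> \<le> B2" using bcontfun_bounded[OF fb(1)] by blast
  define B where "B = max B1 B2"
  have B: "B \<ge> 0" "\<And>n x. \<bar>fs n x\<bar> \<le> B" "\<And>x. \<bar>f x\<bar> \<le> B" using B1 B2 by (auto simp: B_def le_max_iff_disj)
  \<comment> \<open>The errors are \<open>2 * \<delta> + (2 * B + 1) * (2 * \<delta>)\<close> for
    replacing \<open>fs n\<close> by \<open>p\<close>, \<open>\<delta>\<close> for the convergence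
    with \<open>p\<close>, and \<open>\<delta> + (2 * B + 1) * \<delta>\<close> for returning to
    \<open>f\<close>; their sum is \<open>(6 * B + 7) * \<delta>\<close>.\<close>
  define \<delta> where "\<delta> = min 1 (e / (6 * B + 7))"
  have \<delta>: "\<delta> > 0" "\<delta> \<le> 1" using e B(1) by (auto simp: \<delta>_def)
  have \<delta>e: "(6 * B + 7) * \<delta> \<le> e"
  proof -
    have "(6 * B + 7) * \<delta> \<le> (6 * B + 7) * (e / (6 * B + 7))" using B(1) by (intro mult_left_mono) (auto simp: \<delta>_def)
    also have "\<dots> = e" using B(1) by (intro nonzero_mult_div_cancel_left[of "6 * B + 7" e, folded times_divide_eq_right]) simp
    finally show ?thesis .
  qed
  obtain l where l: "l \<ge> 0" "\<And>x. norm x \<le> r ==> sg t (clip l) x \<le> \<delta>" using SX_clip_small[OF t0 \<delta>(1) r] by blast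
  obtain p where p: "trig (\<lambda>x. of_real (p x))" "\<And>x. \<bar>p x\<bar> \<le> B + \<delta>" "\<And>x. norm x \<le> l + 1 ==> \<bar>p x - f x\<bar> \<le> \<delta>"
    using trig_approximation[of f B "l + 1" \<delta>] fb(1) B(3) l(1) \<delta>(1) by (auto simp: bcontfun_def)
  obtain L where L: "L \<ge> 0" "blip (B + \<delta>) L p" using trig_blip[OF p(1,2)] by blast
  have B\<delta>: "B + \<delta> \<ge> 0" using B(1) \<delta>(1) by simp
  have pf: "\<bar>p y - f y\<bar> \<le> \<delta> + (2 * B + 1) * clip l y" for y
  proof (cases "norm y \<le> l + 1")
    case True
    have "0 \<le> (2 * B + 1) * clip l y" using clip_bounds(1)[of l y] B(1) by (intro mult_nonneg_nonneg) auto
    then show ?thesis using p(3)[OF True] by linarith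
  next
    case False
    then show ?thesis using clip_bounds(4)[of l y] p(2)[of y] B(3)[of y] \<delta> by simp
  qed
  have Epf: "\<bar>sg t p x - sg t f x\<bar> \<le> \<delta> + (2 * B + 1) * \<delta>" if "norm x \<le> r" for x
  proof -
    have "\<bar>sg t p x - sg t f x\<bar> \<le> \<delta> + (2 * B + 1) * sg t (clip l) x"
      by (rule expectation_diff_le) (use SX_integrable[OF t0 blip_measurable[OF L(2)] p(2)] SX_integrable[OF t0 bcontfun_measurable[OF fb(1)] B(3)]
        SX_integrable[OF t0 blip_measurable[OF clip_blip] blip_bound[OF clip_blip]] pf in auto)
    then show ?thesis using mult_left_mono[OF l(2)[OF that], of "2 * B + 1"] B(1) by linarith
  qed
  have "EV n. \<forall>x. norm x \<le> l + 1 --> \<bar>fs n x - f x\<bar> \<le> \<delta>"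
    using fs \<delta> l(1) unfolding mixed_tendsto_iff by auto
  then show ?thesis using null_seq_small[OF hs h0] P_converges_uniform[OF hs t L(2) B\<delta> L(1) \<delta>(1), of r]
      P_converges_uniform[OF hs t clip_blip[of l] zero_le_one zero_le_one \<delta>(1), of r]
  proof eventually_elim
    case (elim n)
    have h: "0 < hs n" "hs n < h0" using elim by auto
    interpret N: borel_prob "\<mu> (hs n)" by (rule borel_prob_mu[OF h(1)])
    have fp: "\<bar>fs n y - p y\<bar> \<le> 2 * \<delta> + (2 * B + 1) * clip l y" for y
    proof (cases "norm y \<le> l + 1")
      case True
      have "0 \<le> (2 * B + 1) * clip l y" using clip_bounds(1)[of l y] B(1) by (intro mult_nonneg_nonneg) auto
      moreover have "\<bar>fs n y - f y\<bar> \<le> \<delta>" using elim True by blast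
      ultimately show ?thesis using p(3)[OF True] by linarith
    next
      case False
      then show ?thesis using clip_bounds(4)[of l y] p(2)[of y] B(2)[of n y] \<delta> by simp
    qed
    note m = bcontfun_measurable[OF fb(2)[of n]] blip_measurable[OF L(2)] blip_measurable[OF clip_blip[of l]]
    show ?case
    proof (intro allI impI)
      fix x :: 'a assume x: "norm x \<le> r"
      have "\<bar>P (hs n) (ks n) (fs n) x - P (hs n) (ks n) p x\<bar> \<le> 2 * \<delta> + (2 * B + 1) * P (hs n) (ks n) (clip l) x"
        unfolding P_integral[OF h m(1) B(2)] P_integral[OF h m(2) p(2)] P_integral[OF h m(3) blip_bound[OF clip_blip]]
        by (rule N.seq.P.expectation_diff_le[OF state_integrable[OF h m(1) B(2)] state_integrable[OF h m(2) p(2)]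
          state_integrable[OF h m(3) blip_bound[OF clip_blip]] fp])
      moreover have "P (hs n) (ks n) (clip l) x \<le> 2 * \<delta>" using elim(4) x l(2)[OF x] by fastforce
      then have "(2 * B + 1) * P (hs n) (ks n) (clip l) x \<le> (2 * B + 1) * (2 * \<delta>)" using B(1) by (intro mult_left_mono) auto
      moreover have "\<bar>P (hs n) (ks n) p x - sg t p x\<bar> \<le> \<delta>" using elim(3) x by blast
      moreover have "2 * \<delta> + (2 * B + 1) * (2 * \<delta>) + \<delta> + (\<delta> + (2 * B + 1) * \<delta>) = (6 * B + 7) * \<delta>" by (simp add: algebra_simps)
      ultimately show "\<bar>P (hs n) (ks n) (fs n) x - sg t f x\<bar> \<le> e" using Epf[OF x] \<delta>e by linarith
    qed
  qed
qed

theorem scheme_converges: "scheme_converges \<mu> \<psi> M SX"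
  unfolding scheme_converges_def
proof (intro allI impI, elim conjE)
  fix hs t f ks r and fs :: "nat \<Rightarrow> 'a \<Rightarrow> real"
  assume a: "null_seq hs" "(\<lambda>n. real (ks n) * hs n) ----> t" "mixed_tendsto fs f" and r: "0 \<le> (r :: real)"
  have "{x :: 'a. norm x \<le> r} \<noteq> {}" using r norm_zero by (metis (mono_tags) empty_Collect_eq)
  then show "(\<lambda>n. sup_abs_on {x. norm x \<le> r} (\<lambda>x. P (hs n) (ks n) (fs n) x - sg t f x)) ----> 0"
    using P_converges[OF a r] by (simp add: sup_abs_on_tendsto_0)
qed

end

section \<open>Uniqueness in law\<close>

text \<open>Written as a finite product of indicators, which makes measurability and the splitting
  into independent blocks immediate.\<close>

definition stays :: "nat \<Rightarrow> real \<Rightarrow> (nat \<Rightarrow> 'a::euclidean_space) \<Rightarrow> real" where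
  "stays q c d = (\<Prod>j\<le>q. indicat_real (cball 0 c) (psum d j))"

lemma stays_eq: "stays q c d = (if \<forall>j\<le>q. norm (psum d j) \<le> c then 1 else 0)"
  by (auto simp: stays_def indicator_def)

lemma stays_measurable:
  assumes "\<And>l. l < q ==> (\<lambda>d. f d l) \<in> borel_measurable K"
  shows "(\<lambda>d. stays q c (f d)) \<in> borel_measurable K"
  unfolding stays_def walk_def
proof (intro borel_measurable_prod)
  fix j assume "j \<in> {..q}"
  then have "(\<lambda>d. \<Sum>i<j. f d i) \<in> borel_measurable K" using assms by (intro borel_measurable_sum) auto
  then show "(\<lambda>d. indicat_real (cball 0 c) (\<Sum>i<j. f d i)) \<in> borel_measurable K"
    by (rule measurable_compose) (rule borel_measurable_indicator, simp)
qed

lemma (in borel_prob) stays_blocks: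
  "(LINT d|iid N. (\<Prod>i<n. stays q c (\<lambda>l. d (i * q + l)))) = (LINT d|iid N. stays q c d) ^ n"
proof (induction n)
  case (Suc n)
  let ?G = "\<lambda>n d. \<Prod>i<n. stays q c (\<lambda>l. d (i * q + l))"
  have b: "0 \<le> ?G n d \<and> ?G n d \<le> 1" for n and d :: "nat \<Rightarrow> 'a" by (auto simp: stays_eq intro: prod_nonneg prod_le_1)
  have m: "?G n \<in> borel_measurable (iid N)" for n by (intro borel_measurable_prod stays_measurable coord_measurable)
  have walk: "psum (\<lambda>l. comb_seq q \<omega> \<omega>' l) j = psum \<omega> j" if "j \<le> q" for j and \<omega> \<omega>' :: "nat \<Rightarrow> 'a"
    using that unfolding walk_def by (intro sum.cong) (auto simp: comb_seq_def)
  have split: "?G (Suc n) (comb_seq q \<omega> \<omega>') = stays q c \<omega> * ?G n \<omega>'" for \<omega> \<omega>' :: "nat \<Rightarrow> 'a"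
  proof -
    have "stays q c (\<lambda>l. comb_seq q \<omega> \<omega>' (0 * q + l)) = stays q c \<omega>" using walk by (simp add: stays_eq)
    moreover have "comb_seq q \<omega> \<omega>' (Suc i * q + l) = \<omega>' (i * q + l)" for i l by (simp add: comb_seq_def)
    ultimately show ?thesis by (simp only: prod.lessThan_Suc_shift comp_apply)
  qed
  have "(LINT d|iid N. ?G (Suc n) d) = (LINT \<omega>|iid N. (LINT \<omega>'|iid N. ?G (Suc n) (comb_seq q \<omega> \<omega>')))"
  proof (rule iid_integral_comb[OF m, of _ 1])
    show "norm (?G (Suc n) d) \<le> 1" for d :: "nat \<Rightarrow> 'a" using b[of d "Suc n"] by (simp only: real_norm_def abs_of_nonneg)
  qed
  also have "\<dots> = (LINT \<omega>|iid N. stays q c \<omega>) * (LINT \<omega>'|iid N. ?G n \<omega>')" unfolding split by simp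
  finally show ?case using Suc by simp
qed simp

section \<open>Bounds for the maximum of a Levy path\<close>

context levy begin

text \<open>Only dyadic fractions of \<open>s\<close> are inspected, so the union over all levels is
  measurable; right continuity recovers the other times (\<open>exceed_bound\<close>).\<close>

definition exceed_step :: "real \<Rightarrow> real \<Rightarrow> nat \<Rightarrow> 'w set" where
  "exceed_step s A k = {\<omega>\<in>space M. \<exists>i\<le>2 ^ k. A < norm (Y (s * (real i / 2 ^ k)) \<omega>)}"

definition exceed :: "real \<Rightarrow> real \<Rightarrow> 'w set" where
  "exceed s A = (\<Union>k. exceed_step s A k)"

lemma exceed_sets:
  assumes "0 \<le> s" shows "exceed_step s A k \<in> sets M" "exceed s A \<in> sets M"
proof -
  have [measurable]: "Y (s * (real i / 2 ^ k)) \<in> borel_measurable M" for i k using assms by (intro Y_measurable) simp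
  show "exceed_step s A k \<in> sets M" for k unfolding exceed_step_def by measurable
  then show "exceed s A \<in> sets M" unfolding exceed_def by blast
qed

lemma exceed_bound:
  assumes \<omega>: "\<omega> \<in> space M" "\<omega> \<notin> bad_set M Y" "\<omega> \<notin> exceed s A" and v: "0 \<le> v" "v \<le> s"
  shows "norm (Y v \<omega>) \<le> A"
proof -
  have grid: "norm (Y (s * (real i / 2 ^ k)) \<omega>) \<le> A" if "i \<le> 2 ^ k" for i k
    using \<omega> that by (auto simp: exceed_def exceed_step_def not_less)
  show ?thesis
  \<comment> \<open>The endpoint is itself a grid point. For \<open>v < s\<close> the grid points
    approximating \<open>v\<close> from the right remain at or below \<open>s\<close>.\<close>
  proof (cases "v = s")
    case True
    then show ?thesis using grid[of 1 0] by simp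
  next
    case False
    then have s: "0 < s" "v < s" using v by auto
    let ?d = "\<lambda>k. s * dup k (v / s)"
    have lim: "?d ----> v" using tendsto_mult[OF tendsto_const dup_tendsto[of "v / s"], of s] s by simp
    have gt: "v < ?d k" for k using dup_bounds(1)[of "v / s" k] s by (simp add: field_simps)
    have le: "norm (Y (?d k) \<omega>) \<le> A" for k
    proof -
      let ?i = "nat (\<lfloor>v / s * 2 ^ k\<rfloor> + 1)"
      have f: "0 \<le> \<lfloor>v / s * 2 ^ k\<rfloor>" using v s by simp
      have "v / s * 2 ^ k < 2 ^ k" using s v by (simp add: field_simps)
      then have "\<lfloor>v / s * 2 ^ k\<rfloor> < 2 ^ k" by (simp add: floor_less_iff)
      then have "?i \<le> 2 ^ k" using f by (simp add: nat_le_iff)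
      moreover have "dup k (v / s) = real ?i / 2 ^ k" using f by (simp add: dup_def)
      ultimately show ?thesis using grid[of ?i k] by simp
    qed
    have "continuous (at_right v) (\<lambda>t. Y t \<omega>)" using bad_set(2)[OF \<omega>(1,2)] v by (simp add: cadlag_def)
    then have "(\<lambda>k. Y (?d k) \<omega>) ----> Y v \<omega>"
      by (rule continuous_within_tendsto_compose') (use gt lim in auto)
    then show ?thesis by (rule tendsto_upperbound[OF tendsto_norm]) (use le in auto)
  qed
qed

lemma measure_tendsto_0:
  assumes S: "\<And>n. S n \<in> sets M" and ev: "\<And>\<omega>. \<omega> \<in> space M ==> \<omega> \<notin> bad_set M Y ==> EV n. \<omega> \<notin> S n"
  shows "(\<lambda>n. measure M (S n)) ----> 0"
proof -
  have "(\<lambda>n. LINT \<omega>|M. indicat_real (S n) \<omega>) ----> (LINT \<omega>|M. 0)"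
  proof (rule integral_dominated_convergence[where w = "\<lambda>_. 1"])
    show "AE \<omega> in M. (\<lambda>n. indicat_real (S n) \<omega>) ----> 0" using AE_good
    proof eventually_elim
      case (elim \<omega>)
      from ev[of \<omega>] elim have "EV n. indicat_real (S n) \<omega> = 0" by (auto elim: eventually_mono)
      then show ?case by (rule tendsto_eventually)
    qed
  qed (use S in auto)
  then show ?thesis using S by simp
qed

lemma exceed_short:
  assumes hs: "null_seq hs" and \<eta>: "0 < \<eta>" shows "(\<lambda>n. measure M (exceed (hs n) \<eta>)) ----> 0"
proof (rule measure_tendsto_0)
  have pos: "0 < hs n" for n using hs by (simp add: null_seq_def)
  show "exceed (hs n) \<eta> \<in> sets M" for n using exceed_sets pos[of n] by simp
  fix \<omega> assume \<omega>: "\<omega> \<in> space M" "\<omega> \<notin> bad_set M Y"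
  have "((\<lambda>t. Y t \<omega>) \<longlongrightarrow> 0) (at_right 0)"
    using bad_set(2)[OF \<omega>] unfolding cadlag_def continuous_within by auto
  from tendstoD[OF this \<eta>] obtain d where d: "d > 0" "\<And>t. 0 < t ==> t < d ==> norm (Y t \<omega>) < \<eta>"
    unfolding eventually_at_right_field by auto
  have "EV n. hs n < d" using hs d(1) by (simp add: null_seq_def order_tendsto_iff)
  then show "EV n. \<omega> \<notin> exceed (hs n) \<eta>"
  proof eventually_elim
    case (elim n)
    have "norm (Y (hs n * (real i / 2 ^ k)) \<omega>) \<le> \<eta>" if "i \<le> 2 ^ k" for i k
    proof (cases "i = 0")
      case True
      then show ?thesis using bad_set(2)[OF \<omega>] \<eta> by simp
    next
      case False
      have "real i / 2 ^ k \<le> 1" using that by (simp add: of_nat_le_numeral_power_cancel_iff)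
      then have "hs n * (real i / 2 ^ k) \<le> hs n * 1" using pos[of n] by (intro mult_left_mono) auto
      then show ?thesis using d(2)[of "hs n * (real i / 2 ^ k)"] pos[of n] elim False by simp
    qed
    then show ?case by (auto simp: exceed_def exceed_step_def not_less)
  qed
qed

lemma exceed_high:
  assumes t: "0 \<le> t" and q: "0 < q" shows "\<exists>A>0. measure M (exceed t A) \<le> q"
proof -
  have "(\<lambda>n. measure M (exceed t (real n))) ----> 0"
  proof (rule measure_tendsto_0[OF exceed_sets(2)[OF t]])
    fix \<omega> assume \<omega>: "\<omega> \<in> space M" "\<omega> \<notin> bad_set M Y"
    obtain B where B: "\<And>s. s \<in> {0..t} ==> norm (Y s \<omega>) \<le> B" using cadlag_bounded[of "\<lambda>t. Y t \<omega>" t] bad_set(2)[OF \<omega>] by blast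
    show "EV n. \<omega> \<notin> exceed t (real n)" using eventually_ge_at_top[of "nat \<lceil>B\<rceil>"]
    proof eventually_elim
      case (elim n)
      have "B \<le> real n" using elim by linarith
      moreover have "t * (real i / 2 ^ k) \<in> {0..t}" if "i \<le> 2 ^ k" for i k
        using t that mult_left_mono[of "real i / 2 ^ k" 1 t] by (simp add: of_nat_le_numeral_power_cancel_iff)
      ultimately have "norm (Y (t * (real i / 2 ^ k)) \<omega>) \<le> real n" if "i \<le> 2 ^ k" for i k
        using B that by (meson order_trans)
      then show ?case by (auto simp: exceed_def exceed_step_def not_less)
    qed
  qed
  then have "EV n. measure M (exceed t (real n)) < q" using q by (rule order_tendstoD)
  with eventually_gt_at_top[of 0] have "EV n. 0 < n \<and> measure M (exceed t (real n)) < q" by eventually_elim simp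
  then obtain n where "0 < n" "measure M (exceed t (real n)) < q" by (auto simp: eventually_sequentially)
  then show ?thesis by (intro exI[of _ "real n"]) simp
qed

text \<open>
  If the path of \<open>Y\<close> stays in the ball of radius \<open>A\<close> up to time \<open>t\<close>, then so do, with \<open>2 * A\<close>, the increments
  over each of \<open>n\<close> time blocks; these are independent and identically distributed.
\<close>

lemma exceed_block:
  assumes t: "0 < t" and n: "0 < n" and q: "measure M (exceed t A) \<le> q" "q < 1" and A: "0 < A"
  shows "real n * measure M (exceed (t / real n) (2 * A)) \<le> - ln (1 - q)"
proof -
  have step: "real n * measure M (exceed_step (t / real n) (2 * A) k) \<le> - ln (1 - q)" for k
  proof -
    define N :: nat where "N = 2 ^ k"
    have N: "0 < N" by (simp add: N_def)
    define h where "h = t / real (n * N)"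
    have h: "0 < h" "real (n * N) * h = t" using t n N by (auto simp: h_def)
    define inc where "inc \<omega> i = Y (real (Suc i) * h) \<omega> - Y (real i * h) \<omega>" for \<omega> i
    interpret nu: borel_prob "\<nu> h" using borel_prob_\<nu> h by simp
    have wk: "psum (\<lambda>l. inc \<omega> (i + l)) j = Y (real (i + j) * h) \<omega> - Y (real i * h) \<omega>" for \<omega> i j
      by (induction j) (simp_all add: inc_def)
    have Ym: "Y (real i * h) \<in> borel_measurable M" for i using h by (intro Y_measurable) simp
    have im: "(\<lambda>\<omega>. inc \<omega> i) \<in> borel_measurable M" for i unfolding inc_def by (intro borel_measurable_diff Ym)
    let ?G = "\<lambda>n d. \<Prod>i<n. stays N (2 * A) (\<lambda>l. d (i * N + l))"
    have Gb: "0 \<le> ?G n d \<and> ?G n d \<le> 1" for n and d :: "nat \<Rightarrow> 'a" by (auto simp: stays_eq intro: prod_nonneg prod_le_1)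
    have idx: "i * N + l < n' * N" if "i < n'" "l < N" for i l n' using that mult_le_mono1[of "Suc i" n' N] by simp
    have E: "(LINT \<omega>|M. ?G n' (inc \<omega>)) = (LINT d|iid (\<nu> h). stays N (2 * A) d) ^ n'" if n': "0 < n'" for n'
    proof -
      have "(LINT \<omega>|M. ?G n' (inc \<omega>)) = (LINT d|iid (\<nu> h). ?G n' d)"
        unfolding inc_def
      proof (rule increments_expectation[OF h(1), of "n' * N"])
        show "0 < n' * N" using n' N by simp
        show "?G n' \<in> borel_measurable (PiM {..<n' * N} (\<lambda>_. borel))"
          by (intro borel_measurable_prod stays_measurable measurable_component_singleton) (use idx in auto)
        show "?G n' (restrict d {..<n' * N}) = ?G n' d" for d :: "nat \<Rightarrow> 'a"
        proof (intro prod.cong refl)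
          fix i assume "i \<in> {..<n'}"
          then have "psum (\<lambda>l. restrict d {..<n' * N} (i * N + l)) j = psum (\<lambda>l. d (i * N + l)) j" if "j \<le> N" for j
            using that idx unfolding walk_def by (intro sum.cong) auto
          then show "stays N (2 * A) (\<lambda>l. restrict d {..<n' * N} (i * N + l)) = stays N (2 * A) (\<lambda>l. d (i * N + l))"
            by (simp add: stays_eq)
        qed
      qed
      then show ?thesis by (simp only: nu.stays_blocks)
    qed
    define \<pi> where "\<pi> = (LINT d|iid (\<nu> h). stays N (2 * A) d)"
    have Gi: "integrable M (\<lambda>\<omega>. ?G n (inc \<omega>))" for n
      using Gb by (intro integrable_const_bound[of _ 1] borel_measurable_prod stays_measurable im) auto
    have ind: "integrable M (indicat_real S)" if "S \<in> sets M" for S using that by (simp add: less_top[symmetric])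
    have S: "exceed t A \<in> sets M" using exceed_sets t by simp
    \<comment> \<open>Let \<open>p\<close> be the probability of exceeding \<open>2 * A\<close> on
      the grid of the first block. Staying below \<open>A\<close> until \<open>t\<close> forces all
      blocks to stay, so \<open>1 - q \<le> \<pi> ^ n\<close>, while
      \<open>\<pi> \<le> 1 - p \<le> exp (- p)\<close>. Taking logarithms gives the bound.\<close>
    have "1 - q \<le> 1 - measure M (exceed t A)" using q by simp
    also have "\<dots> = (LINT \<omega>|M. 1 - indicat_real (exceed t A) \<omega>)" using ind[OF S] S by (simp add: prob_space)
    also have "\<dots> \<le> (LINT \<omega>|M. ?G n (inc \<omega>))"
    proof (rule integral_mono_AE[OF _ Gi])
      show "AE \<omega> in M. 1 - indicat_real (exceed t A) \<omega> \<le> ?G n (inc \<omega>)" using AE_good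
      proof eventually_elim
        case (elim \<omega>)
        show ?case
        proof (cases "\<omega> \<in> exceed t A")
          case False
          have Yb: "norm (Y (real l * h) \<omega>) \<le> A" if "l \<le> n * N" for l
          proof -
            have "real l * h \<le> real (n * N) * h" using that h by (intro mult_right_mono of_nat_mono) auto
            then have "real l * h \<le> t" unfolding h(2) .
            then show ?thesis using exceed_bound[of \<omega> t A "real l * h"] elim False h(1) by simp
          qed
          have "norm (psum (\<lambda>l. inc \<omega> (i * N + l)) j) \<le> 2 * A" if "i < n" "j \<le> N" for i j
          proof -
            have "i * N + j \<le> n * N" using that mult_le_mono1[of "Suc i" n N] by simp
            then show ?thesis using Yb[of "i * N + j"] Yb[of "i * N"] norm_triangle_ineq4[of "Y (real (i * N + j) * h) \<omega>" "Y (real (i * N) * h) \<omega>"]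
              unfolding wk by linarith
          qed
          then have "?G n (inc \<omega>) = 1" by (intro prod.neutral) (simp add: stays_eq)
          then show ?thesis by simp
        qed (use Gb in simp)
      qed
    qed (use ind[OF S] in simp)
    also have "\<dots> = \<pi> ^ n" using E[OF n] by (simp add: \<pi>_def)
    finally have pn: "1 - q \<le> \<pi> ^ n" .
    have T: "exceed_step (t / real n) (2 * A) k \<in> sets M" using exceed_sets t by simp
    have "\<pi> = (LINT \<omega>|M. ?G 1 (inc \<omega>))" using E[of 1] by (simp add: \<pi>_def)
    also have "\<dots> \<le> (LINT \<omega>|M. 1 - indicat_real (exceed_step (t / real n) (2 * A) k) \<omega>)"
    proof (rule integral_mono_AE[OF Gi])
      show "AE \<omega> in M. ?G 1 (inc \<omega>) \<le> 1 - indicat_real (exceed_step (t / real n) (2 * A) k) \<omega>"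
        using AE_good
      proof eventually_elim
        case (elim \<omega>)
        show ?case
        proof (cases "\<omega> \<in> exceed_step (t / real n) (2 * A) k")
          case True
          then obtain i where i: "i \<le> N" "2 * A < norm (Y (t / real n * (real i / 2 ^ k)) \<omega>)" by (auto simp: exceed_step_def N_def)
          have "t / real n * (real i / 2 ^ k) = real i * h" using n by (simp add: h_def N_def)
          then have "2 * A < norm (psum (inc \<omega>) i)" using i wk[of \<omega> 0 i] bad_set(2)[of \<omega>] elim by simp
          then have "stays N (2 * A) (inc \<omega>) = 0" using i(1) by (auto simp: stays_eq not_le)
          then show ?thesis using True by simp
        qed (use Gb[of "inc \<omega>" 1] in simp)
      qed
    qed (use ind[OF T] in simp)
    also have "\<dots> = 1 - measure M (exceed_step (t / real n) (2 * A) k)" using ind[OF T] T by (simp add: prob_space)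
    also have "\<dots> \<le> exp (- measure M (exceed_step (t / real n) (2 * A) k))"
      using exp_ge_add_one_self[of "- measure M (exceed_step (t / real n) (2 * A) k)"] by simp
    finally have "\<pi> \<le> exp (- measure M (exceed_step (t / real n) (2 * A) k))" .
    moreover have "0 \<le> \<pi>" unfolding \<pi>_def by (intro Bochner_Integration.integral_nonneg) (simp add: stays_eq)
    ultimately have "\<pi> ^ n \<le> exp (- measure M (exceed_step (t / real n) (2 * A) k)) ^ n" by (rule power_mono)
    then have "1 - q \<le> exp (- (real n * measure M (exceed_step (t / real n) (2 * A) k)))"
      using pn by (simp add: exp_of_nat_mult[symmetric])
    then have "ln (1 - q) \<le> ln (exp (- (real n * measure M (exceed_step (t / real n) (2 * A) k))))"
      using q by (subst ln_le_cancel_iff) auto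
    then show ?thesis by simp
  qed
  \<comment> \<open>The dyadic grids are nested, so a bound that holds at each level passes to the
    union.\<close>
  have "incseq (exceed_step (t / real n) (2 * A))"
  proof (rule incseq_SucI)
    fix k
    have "\<exists>i\<le>2 ^ Suc k. 2 * A < norm (Y (t / real n * (real i / 2 ^ Suc k)) \<omega>)"
      if "i \<le> 2 ^ k" "2 * A < norm (Y (t / real n * (real i / 2 ^ k)) \<omega>)" for i \<omega>
      using that by (intro exI[of _ "2 * i"]) simp
    then show "exceed_step (t / real n) (2 * A) k \<subseteq> exceed_step (t / real n) (2 * A) (Suc k)" unfolding exceed_step_def by blast
  qed
  then have "(\<lambda>k. measure M (exceed_step (t / real n) (2 * A) k)) ----> measure M (exceed (t / real n) (2 * A))"
    unfolding exceed_def by (intro finite_Lim_measure_incseq) (use exceed_sets t in auto)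
  from tendsto_mult[OF tendsto_const[of "real n"] this] show ?thesis by (rule LIMSEQ_le_const2) (use step in blast)
qed

end

context levy begin

lemma \<nu>_multiple:
  fixes g :: "'a \<Rightarrow> real"
  assumes s: "0 < s" and n: "0 < n" and g: "g \<in> bcontfun"
  shows "(LINT y|\<nu> (real n * s). g y) = (LINT d|iid (\<nu> s). g (psum d n))"
proof -
  have gm: "g \<in> borel_measurable borel" by (rule bcontfun_measurable[OF g])
  have Ym: "Y (real i * s) \<in> borel_measurable M" for i using s by (intro Y_measurable) simp
  have wk: "psum (\<lambda>i. Y (real (Suc i) * s) \<omega> - Y (real i * s) \<omega>) j = Y (real j * s) \<omega> - Y 0 \<omega>" for \<omega> j
    by (induction j) simp_all
  have "(LINT y|\<nu> (real n * s). g y) = (LINT \<omega>|M. g (Y (real n * s) \<omega>))"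
    unfolding \<nu>_def by (rule integral_distr[OF Ym gm])
  also have "\<dots> = (LINT \<omega>|M. g (Y (real n * s) \<omega> - Y 0 \<omega>))"
    using AE_Y0 by (intro integral_cong_AE measurable_compose[OF _ gm] borel_measurable_diff Ym Y_measurable) (auto elim: eventually_mono)
  also have "\<dots> = (LINT \<omega>|M. g (psum (\<lambda>i. Y (real (Suc i) * s) \<omega> - Y (real i * s) \<omega>) n))" unfolding wk ..
  also have "\<dots> = (LINT d|iid (\<nu> s). g (psum d n))"
  proof (rule increments_expectation[OF s n])
    show "(\<lambda>d. g (psum d n)) \<in> borel_measurable (PiM {..<n} (\<lambda>_. borel))"
      unfolding walk_def by (intro measurable_compose[OF _ gm] borel_measurable_sum measurable_component_singleton)
    show "g (psum (restrict d {..<n}) n) = g (psum d n)" for d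
      unfolding walk_def by (intro arg_cong[where f = g] sum.cong) auto
  qed
  finally show ?thesis .
qed

lemma charf_\<nu>_multiple:
  assumes s: "0 < s" and n: "0 < n"
  shows "charf (\<nu> (real n * s)) u = charf (\<nu> s) u ^ n"
proof -
  interpret nu: borel_prob "\<nu> s" using borel_prob_\<nu> s by simp
  let ?D = "distr (iid (\<nu> s)) borel (\<lambda>d. psum d n)"
  have wm: "(\<lambda>d. psum d n) \<in> borel_measurable (iid (\<nu> s))" by measurable
  have D: "prob_space ?D" using prob_space.prob_space_distr[OF nu.prob_space_iid wm] .
  have eq: "(LINT y|\<nu> (real n * s). g y) = (LINT y|?D. g y)" if "g \<in> bcontfun" for g :: "'a \<Rightarrow> real"
    unfolding \<nu>_multiple[OF s n that] by (rule integral_distr[symmetric, OF wm bcontfun_measurable[OF that]])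
  have "(\<lambda>y. cos (u \<bullet> y)) \<in> bcontfun" "(\<lambda>y. sin (u \<bullet> y)) \<in> bcontfun"
    by (rule bcontfunI[of _ 1]; auto intro!: continuous_intros)+
  then have "charf (\<nu> (real n * s)) u = charf ?D u"
    using charf_eq[OF D, of u] borel_prob_\<nu>[of "real n * s"] s by (simp add: borel_prob_def borel_prob_axioms_def charf_eq eq)
  then show ?thesis by (simp add: nu.charf_walk)
qed

end

section \<open>Comparison of solution and noise on short times\<close>

context levy_sde begin

lemma SX_noise_distance:
  assumes \<omega>: "\<omega> \<in> space M" "\<omega> \<notin> bad_set M Y" and s: "0 \<le> s" and b: "\<And>v. v \<in> {0..s} ==> norm (Y v \<omega>) \<le> b"
  shows "norm (SX x s \<omega> - Y s \<omega> - flow s x) \<le> w * exp (w * s) * (s * b)"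
proof -
  have I: "integral {0..s} (\<lambda>v. norm (path Y \<omega> v)) \<le> integral {0..s} (\<lambda>v. b)"
    using noise_norm_integrable[OF good_noise(1)[OF \<omega>], of 0 0 s] b s by (intro integral_le) (auto simp: path_def)
  have "norm (SX x s \<omega> - Y s \<omega> - flow s x) \<le> w * integral {0..s} (\<lambda>v. norm (path Y \<omega> v)) * exp (w * s)"
    using sol_flow_distance[OF good_noise(1)[OF \<omega>] s, of x] \<omega> s by (simp add: SX_def path_def)
  also have "\<dots> \<le> w * (s * b) * exp (w * s)" using I s w by (intro mult_right_mono mult_left_mono) auto
  finally show ?thesis by (simp add: mult_ac)
qed

text \<open>Three regimes over a time \<open>s = t / Suc n\<close>. If the path stays below
  \<open>\<eta>\<close>, the error is at most \<open>C * s * \<eta>\<close>. If it exceeds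
  \<open>\<eta>\<close> but stays below \<open>2 * A\<close>, the error is at most
  \<open>C * s * 2 * A\<close>, on an event of vanishing probability. Beyond \<open>2 * A\<close>
  the error is capped by 2, and the probability times \<open>Suc n\<close> is small by
  \<open>exceed_block\<close>.\<close>

lemma small_time_error:
  assumes t: "0 < t" and c: "0 \<le> c"
  shows "(\<lambda>n. real (Suc n) * (LINT \<omega>|M. min 2 (c * norm (SX x (t / real (Suc n)) \<omega> - Y (t / real (Suc n)) \<omega> - flow (t / real (Suc n)) x)))) ----> 0"
proof (rule tendstoI)
  fix e :: real assume e: "e > 0"
  define hs where "hs = (\<lambda>n. t / real (Suc n))"
  have "(\<lambda>n. t / real (Suc n)) ----> 0"
    using tendsto_mult[OF tendsto_const[of t] LIMSEQ_inverse_real_of_nat] by (simp add: divide_inverse)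
  then have hs: "null_seq hs" using t by (simp add: null_seq_def hs_def)
  have h: "0 < hs n" "hs n \<le> t" "real (Suc n) * hs n = t" for n using t by (auto simp: hs_def field_simps)
  define C where "C = c * (w * exp (w * t))"
  have C: "C \<ge> 0" using c w by (simp add: C_def)
  define \<eta> where "\<eta> = e / 4 / (C * t + 1)"
  have Ct: "C * t + 1 > 0" using C t by (simp add: add_nonneg_pos)
  have \<eta>: "\<eta> > 0" "C * t * \<eta> \<le> e / 4"
  proof -
    show "\<eta> > 0" using e Ct by (simp add: \<eta>_def)
    moreover have "\<eta> * (C * t + 1) = e / 4" using nonzero_eq_divide_eq[of "C * t + 1" \<eta> "e / 4"] Ct \<eta>_def by simp
    ultimately show "C * t * \<eta> \<le> e / 4" by (simp add: algebra_simps)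
  qed
  \<comment> \<open>With \<open>q = 1 - exp (- (e / 8))\<close> the bound
    \<open>- ln (1 - q)\<close> of \<open>exceed_block\<close> equals \<open>e / 8\<close>.\<close>
  obtain A where A: "A > 0" "measure M (exceed t A) \<le> 1 - exp (- (e / 8))"
    using exceed_high[of t "1 - exp (- (e / 8))"] t e by auto
  have big: "real (Suc n) * measure M (exceed (hs n) (2 * A)) \<le> e / 8" for n
    using exceed_block[OF t _ A(2) _ A(1), of "Suc n"] unfolding hs_def by simp
  have le: "real (Suc n) * (LINT \<omega>|M. min 2 (c * norm (SX x (hs n) \<omega> - Y (hs n) \<omega> - flow (hs n) x))) \<le>
      e / 4 + e / 4 + C * t * (2 * A) * measure M (exceed (hs n) \<eta>)" for n
  proof -
    let ?f = "\<lambda>\<omega>. min 2 (c * norm (SX x (hs n) \<omega> - Y (hs n) \<omega> - flow (hs n) x))"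
    let ?E = "exceed (hs n) (2 * A)" and ?S = "exceed (hs n) \<eta>"
    have S: "?E \<in> sets M" "?S \<in> sets M" using exceed_sets h(1)[of n] by (auto simp: less_imp_le)
    have i: "integrable M (indicat_real ?E)" "integrable M (indicat_real ?S)" using S by (auto simp: less_top[symmetric])
    have [measurable]: "SX x (hs n) \<in> borel_measurable M" "Y (hs n) \<in> borel_measurable M"
      using h(1)[of n] SX_measurable Y_measurable by (auto simp: less_imp_le)
    have m: "?f \<in> borel_measurable M" by measurable
    have fi: "integrable M ?f" using m c by (intro integrable_const_bound[of _ 2]) auto
    have dist: "c * norm (SX x (hs n) \<omega> - Y (hs n) \<omega> - flow (hs n) x) \<le> C * hs n * b"
      if "\<omega> \<in> space M \<and> \<omega> \<notin> bad_set M Y" "\<omega> \<notin> exceed (hs n) b" "0 \<le> b" for \<omega> b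
    proof -
      have "norm (SX x (hs n) \<omega> - Y (hs n) \<omega> - flow (hs n) x) \<le> w * exp (w * hs n) * (hs n * b)"
        by (rule SX_noise_distance) (use exceed_bound[of \<omega> "hs n" b] that h(1)[of n] in auto)
      also have "\<dots> \<le> w * exp (w * t) * (hs n * b)"
        using w h[of n] that by (intro mult_right_mono mult_left_mono) (auto intro: mult_left_mono)
      finally show ?thesis using c by (simp add: C_def mult_left_mono mult.assoc)
    qed
    have "(LINT \<omega>|M. ?f \<omega>) \<le> (LINT \<omega>|M. 2 * indicat_real ?E \<omega> + (C * hs n * \<eta> + C * hs n * (2 * A) * indicat_real ?S \<omega>))"
    proof (rule integral_mono_AE[OF fi])
      show "AE \<omega> in M. ?f \<omega> \<le> 2 * indicat_real ?E \<omega> + (C * hs n * \<eta> + C * hs n * (2 * A) * indicat_real ?S \<omega>)"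
        using AE_good
      proof eventually_elim
        case (elim \<omega>)
        have p: "0 \<le> C * hs n * \<eta>" "0 \<le> C * hs n * (2 * A)" using C h(1)[of n] \<eta> A by auto
        define m where "m = ?f \<omega>"
        have f: "m \<le> 2" "m \<le> c * norm (SX x (hs n) \<omega> - Y (hs n) \<omega> - flow (hs n) x)" by (auto simp: m_def)
        have "m \<le> C * hs n * (2 * A)" if "\<omega> \<notin> ?E" using dist[OF elim that] A(1) f(2) by linarith
        moreover have "m \<le> C * hs n * \<eta>" if "\<omega> \<notin> ?S" using dist[OF elim that] \<eta>(1) f(2) by linarith
        ultimately show ?case
          using p f(1) unfolding m_def[symmetric] by (cases "\<omega> \<in> ?E"; cases "\<omega> \<in> ?S"; simp; linarith)
      qed
    qed (use i in auto)
    also have "\<dots> = 2 * measure M ?E + (C * hs n * \<eta> + C * hs n * (2 * A) * measure M ?S)" using i S by (simp add: prob_space)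
    finally have "real (Suc n) * (LINT \<omega>|M. ?f \<omega>) \<le> real (Suc n) * (2 * measure M ?E + (C * hs n * \<eta> + C * hs n * (2 * A) * measure M ?S))"
      by (rule mult_left_mono) simp
    also have "\<dots> = 2 * (real (Suc n) * measure M ?E) + C * (real (Suc n) * hs n) * \<eta> + C * (real (Suc n) * hs n) * (2 * A) * measure M ?S"
      by (simp only: distrib_left mult_ac)
    also have "\<dots> \<le> e / 4 + e / 4 + C * t * (2 * A) * measure M ?S"
      unfolding h(3) using big[of n] \<eta>(2) by simp
    finally show ?thesis .
  qed
  have "(\<lambda>n. C * t * (2 * A) * measure M (exceed (hs n) \<eta>)) ----> 0"
    using tendsto_mult[OF tendsto_const exceed_short[OF hs \<eta>(1)], of "C * t * (2 * A)"] by simp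
  then have "EV n. C * t * (2 * A) * measure M (exceed (hs n) \<eta>) < e / 2" by (rule order_tendstoD) (use e in simp)
  then have "EV n. dist (real (Suc n) * (LINT \<omega>|M. min 2 (c * norm (SX x (hs n) \<omega> - Y (hs n) \<omega> - flow (hs n) x)))) 0 < e"
  proof eventually_elim
    case (elim n)
    have "0 \<le> real (Suc n) * (LINT \<omega>|M. min 2 (c * norm (SX x (hs n) \<omega> - Y (hs n) \<omega> - flow (hs n) x)))"
      using c by (intro mult_nonneg_nonneg Bochner_Integration.integral_nonneg) auto
    then show ?case using le[of n] elim by (simp only: dist_0_norm dist_commute[of _ "0::real"] real_norm_def)
  qed
  then show "EV n. dist (real (Suc n) * (LINT \<omega>|M. min 2 (c * norm (SX x (t / real (Suc n)) \<omega> - Y (t / real (Suc n)) \<omega> - flow (t / real (Suc n)) x)))) 0 < e"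
    unfolding hs_def .
qed

text \<open>If drift and noise did not interact, the solution would be
  \<open>Y s + flow s x\<close>, whose characteristic function is the product on the left.\<close>

lemma charf_SX_distance:
  assumes s: "0 \<le> s"
  shows "norm (cis (u \<bullet> flow s x) * charf (\<nu> s) u - (LINT \<omega>|M. cis (u \<bullet> SX x s \<omega>))) \<le>
    (LINT \<omega>|M. min 2 (norm u * norm (SX x s \<omega> - Y s \<omega> - flow s x)))"
proof -
  have cm: "(\<lambda>y. cis (u \<bullet> y)) \<in> borel_measurable borel" by (intro borel_measurable_continuous_onI continuous_intros)
  have ci: "integrable M (\<lambda>\<omega>. cis (u \<bullet> Z \<omega>))" if "Z \<in> borel_measurable M" for Z
    using measurable_compose[OF that cm] by (intro integrable_const_bound[of _ 1]) auto
  note m = SX_measurable[OF s, of x] Y_measurable[OF s]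
  have "cis (u \<bullet> flow s x) * charf (\<nu> s) u = (LINT \<omega>|M. cis (u \<bullet> (Y s \<omega> + flow s x)))"
    unfolding charf_def \<nu>_def integral_distr[OF m(2) cm] integral_mult_right_zero[symmetric]
    by (simp add: inner_add_right cis_mult add.commute)
  then have "cis (u \<bullet> flow s x) * charf (\<nu> s) u - (LINT \<omega>|M. cis (u \<bullet> SX x s \<omega>)) =
      (LINT \<omega>|M. cis (u \<bullet> (Y s \<omega> + flow s x)) - cis (u \<bullet> SX x s \<omega>))"
    using ci m by simp
  also have "norm \<dots> \<le> (LINT \<omega>|M. norm (cis (u \<bullet> (Y s \<omega> + flow s x)) - cis (u \<bullet> SX x s \<omega>)))" by (rule integral_norm_bound)
  also have "\<dots> \<le> (LINT \<omega>|M. min 2 (norm u * norm (SX x s \<omega> - Y s \<omega> - flow s x)))"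
  proof (rule integral_mono)
    show "integrable M (\<lambda>\<omega>. norm (cis (u \<bullet> (Y s \<omega> + flow s x)) - cis (u \<bullet> SX x s \<omega>)))" using ci m by simp
    have "(\<lambda>\<omega>. min 2 (norm u * norm (SX x s \<omega> - Y s \<omega> - flow s x))) \<in> borel_measurable M" using m by measurable
    then show "integrable M (\<lambda>\<omega>. min 2 (norm u * norm (SX x s \<omega> - Y s \<omega> - flow s x)))"
      by (intro integrable_const_bound[of _ 2]) auto
    fix \<omega>
    have "norm (cis (u \<bullet> (Y s \<omega> + flow s x)) - cis (u \<bullet> SX x s \<omega>)) \<le> norm u * norm (SX x s \<omega> - Y s \<omega> - flow s x)"
      using norm_cis_diff[of "u \<bullet> (Y s \<omega> + flow s x)" "u \<bullet> SX x s \<omega>"]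
        Cauchy_Schwarz_ineq2[of u "Y s \<omega> + flow s x - SX x s \<omega>"] norm_minus_commute[of "SX x s \<omega>" "Y s \<omega> + flow s x"]
      by (simp add: inner_diff_right algebra_simps)
    moreover have "norm (cis (u \<bullet> (Y s \<omega> + flow s x)) - cis (u \<bullet> SX x s \<omega>)) \<le> 2"
      using norm_triangle_ineq4[of "cis (u \<bullet> (Y s \<omega> + flow s x))" "cis (u \<bullet> SX x s \<omega>)"] by simp
    ultimately show "norm (cis (u \<bullet> (Y s \<omega> + flow s x)) - cis (u \<bullet> SX x s \<omega>)) \<le> min 2 (norm u * norm (SX x s \<omega> - Y s \<omega> - flow s x))" by simp
  qed
  finally show ?thesis .
qed

end

section \<open>Equality of laws\<close>

text \<open>The flow contributes the same factor of modulus 1 for both processes, so it can be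
  inserted and drops out of the norm. Passing from time \<open>t / Suc n\<close> to \<open>t\<close>
  by powers costs a factor \<open>Suc n\<close>, which \<open>small_time_error\<close>
  absorbs.\<close>

lemma levy_marginals_eq:
  fixes Y :: "real \<Rightarrow> 'w \<Rightarrow> 'a::euclidean_space" and Y' :: "real \<Rightarrow> 'v \<Rightarrow> 'a"
  assumes A: "levy_sde M Y F w" and B: "levy_sde M' Y' F w"
    and eq: "\<And>f t. f \<in> bcontfun ==> 0 \<le> t ==>
      (LINT \<omega>|M. f (levy_sde.SX M Y F 0 t \<omega>)) = (LINT \<omega>|M'. f (levy_sde.SX M' Y' F 0 t \<omega>) :: real)"
    and t: "0 \<le> t"
  shows "levy.\<nu> M Y t = levy.\<nu> M' Y' t"
proof -
  interpret A: levy_sde M Y F w by fact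
  interpret B: levy_sde M' Y' F w by fact
  have pr: "prob_space (A.\<nu> t)" "sets (A.\<nu> t) = sets borel" "prob_space (B.\<nu> t)" "sets (B.\<nu> t) = sets borel" if "0 \<le> t" for t
    using A.borel_prob_\<nu>[OF that] B.borel_prob_\<nu>[OF that] by (auto simp: borel_prob_def borel_prob_axioms_def)
  have bc: "(\<lambda>y. cos (u \<bullet> y)) \<in> bcontfun" "(\<lambda>y. sin (u \<bullet> y)) \<in> bcontfun" for u :: 'a
    by (rule bcontfunI[of _ 1]; auto intro!: continuous_intros)+
  have "charf (A.\<nu> t) u = charf (B.\<nu> t) u" for u
  proof (cases "t = 0")
    case True
    then show ?thesis
      using pr[of 0] A.integral_\<nu>_0[OF bcontfun_measurable[OF bc(1)]] A.integral_\<nu>_0[OF bcontfun_measurable[OF bc(2)]]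
        B.integral_\<nu>_0[OF bcontfun_measurable[OF bc(1)]] B.integral_\<nu>_0[OF bcontfun_measurable[OF bc(2)]] by (simp add: charf_eq)
  next
    case False
    then have t: "0 < t" using t by simp
    have z: "(LINT \<omega>|M. cis (u \<bullet> A.SX 0 s \<omega>)) = (LINT \<omega>|M'. cis (u \<bullet> B.SX 0 s \<omega>))" if s: "0 \<le> s" for s
    proof -
      have "prob_space (distr M borel (A.SX 0 s))" "prob_space (distr M' borel (B.SX 0 s))"
        by (intro A.prob_space_distr A.SX_measurable[OF s] B.prob_space_distr B.SX_measurable[OF s])+
      then have "charf (distr M borel (A.SX 0 s)) u = charf (distr M' borel (B.SX 0 s)) u"
        using eq[OF bc(1)[of u] s] eq[OF bc(2)[of u] s]
        by (simp add: charf_eq integral_distr[OF A.SX_measurable[OF s] bcontfun_measurable[OF bc(1)]] integral_distr[OF A.SX_measurable[OF s] bcontfun_measurable[OF bc(2)]]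
          integral_distr[OF B.SX_measurable[OF s] bcontfun_measurable[OF bc(1)]] integral_distr[OF B.SX_measurable[OF s] bcontfun_measurable[OF bc(2)]])
      moreover have "(\<lambda>y. cis (u \<bullet> y)) \<in> borel_measurable borel" by (intro borel_measurable_continuous_onI continuous_intros)
      ultimately show ?thesis
        unfolding charf_def by (simp add: integral_distr[OF A.SX_measurable[OF s]] integral_distr[OF B.SX_measurable[OF s]])
    qed
    let ?s = "\<lambda>n. t / real (Suc n)"
    let ?a = "\<lambda>n. LINT \<omega>|M. min 2 (norm u * norm (A.SX 0 (?s n) \<omega> - Y (?s n) \<omega> - A.flow (?s n) 0))"
    let ?b = "\<lambda>n. LINT \<omega>|M'. min 2 (norm u * norm (B.SX 0 (?s n) \<omega> - Y' (?s n) \<omega> - A.flow (?s n) 0))"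
    have "(\<lambda>n. real (Suc n) * ?a n + real (Suc n) * ?b n) ----> 0 + 0"
      by (intro tendsto_add A.small_time_error B.small_time_error t) auto
    moreover have "norm (charf (A.\<nu> t) u - charf (B.\<nu> t) u) \<le> real (Suc n) * ?a n + real (Suc n) * ?b n" for n
    proof -
      have s: "0 < ?s n" and ts: "t = real (Suc n) * ?s n" using t by auto
      have "norm (charf (A.\<nu> t) u - charf (B.\<nu> t) u) = norm (charf (A.\<nu> (?s n)) u ^ Suc n - charf (B.\<nu> (?s n)) u ^ Suc n)"
        using A.charf_\<nu>_multiple[OF s, of "Suc n" u] B.charf_\<nu>_multiple[OF s, of "Suc n" u] unfolding ts[symmetric] by simp
      also have "\<dots> \<le> real (Suc n) * norm (charf (A.\<nu> (?s n)) u - charf (B.\<nu> (?s n)) u)"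
        by (intro norm_power_diff norm_charf_le_1 pr) (use s in auto)
      also have "norm (charf (A.\<nu> (?s n)) u - charf (B.\<nu> (?s n)) u) =
          norm (cis (u \<bullet> A.flow (?s n) 0) * charf (A.\<nu> (?s n)) u - cis (u \<bullet> A.flow (?s n) 0) * charf (B.\<nu> (?s n)) u)"
        by (simp add: norm_mult flip: right_diff_distrib)
      also have "\<dots> \<le> ?a n + ?b n"
        using A.charf_SX_distance[of "?s n" u 0] B.charf_SX_distance[of "?s n" u 0] z[of "?s n"] s
        by (intro norm_diff_triangle_le[where y = "LINT \<omega>|M. cis (u \<bullet> A.SX 0 (?s n) \<omega>)"]) (auto simp: norm_minus_commute)
      finally show ?thesis by (simp add: distrib_left)
    qed
    ultimately have "norm (charf (A.\<nu> t) u - charf (B.\<nu> t) u) \<le> 0 + 0" by (intro LIMSEQ_le_const) auto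
    then show ?thesis by simp
  qed
  then show ?thesis by (intro charf_inj pr t)
qed

text \<open>Values at finitely many times are partial sums of independent increments along a grid
  \<open>\<tau>\<close> containing these times, and the laws of the increments depend on the gaps
  only. Hence the right-hand side involves nothing but the laws \<open>\<nu>\<close>;
  \<open>idx\<close> locates each time in the grid.\<close>

lemma (in levy) cylinder_law:
  fixes \<tau> :: "nat \<Rightarrow> real"
  assumes \<tau>: "\<tau> 0 = 0" "\<And>i. i < q ==> \<tau> i < \<tau> (Suc i)" and q: "0 < q" and J: "finite J"
    and idx: "\<And>j. j \<in> J ==> idx j \<le> q \<and> \<tau> (idx j) = j" and A: "\<And>j. j \<in> J ==> A j \<in> sets borel"
  shows "emeasure M {\<omega>\<in>space M. \<forall>j\<in>J. Y j \<omega> \<in> A j} =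
    emeasure (PiM {..<q} (\<lambda>i. \<nu> (\<tau> (Suc i) - \<tau> i))) {z\<in>space (PiM {..<q} (\<lambda>_. borel)). \<forall>j\<in>J. (\<Sum>l<idx j. z l) \<in> A j}"
proof -
  let ?P = "PiM {..<q} (\<lambda>_. borel) :: (nat \<Rightarrow> 'a) measure"
  let ?D = "\<lambda>i \<omega>. Y (\<tau> (Suc i)) \<omega> - Y (\<tau> i) \<omega>"
  let ?Z = "\<lambda>\<omega>. \<lambda>i\<in>{..<q}. ?D i \<omega>"
  let ?C = "{z\<in>space ?P. \<forall>j\<in>J. (\<Sum>l<idx j. z l) \<in> A j}"
  have \<tau>0: "0 \<le> \<tau> i" if "i \<le> q" for i using that
  proof (induction i)
    case (Suc i)
    then show ?case using \<tau>(2)[of i] by simp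
  qed (simp add: \<tau>)
  have Dm: "?D i \<in> borel_measurable M" if "i < q" for i using that by (intro borel_measurable_diff Y_measurable \<tau>0) auto
  have Zm: "?Z \<in> measurable M ?P" by (intro measurable_restrict Dm) auto
  have "indep_vars (\<lambda>_. borel) ?D {..<q}" using levy \<tau> unfolding levy_process_def by simp
  moreover have "{..<q} \<noteq> {}" using q by auto
  ultimately have "distr M ?P ?Z = PiM {..<q} (\<lambda>i. distr M borel (?D i))"
    using Dm by (subst indep_vars_iff_distr_eq_PiM'[symmetric]) auto
  also have "\<dots> = PiM {..<q} (\<lambda>i. \<nu> (\<tau> (Suc i) - \<tau> i))"
  proof (intro PiM_cong refl)
    fix i assume "i \<in> {..<q}"
    then show "distr M borel (?D i) = \<nu> (\<tau> (Suc i) - \<tau> i)"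
      using law_increment[of "\<tau> i" "\<tau> (Suc i) - \<tau> i"] \<tau>0[of i] \<tau>(2)[of i] by simp
  qed
  finally have D: "distr M ?P ?Z = PiM {..<q} (\<lambda>i. \<nu> (\<tau> (Suc i) - \<tau> i))" .
  have C: "?C \<in> sets ?P"
  proof -
    have "{z\<in>space ?P. (\<Sum>l<idx j. z l) \<in> A j} \<in> sets ?P" if "j \<in> J" for j
    proof -
      have "(\<lambda>z. \<Sum>l<idx j. z l) \<in> borel_measurable ?P"
        using idx[OF that] by (intro borel_measurable_sum measurable_component_singleton) auto
      from measurable_sets[OF this A[OF that]] show ?thesis by (simp add: vimage_def Int_def conj_commute)
    qed
    then show ?thesis by (intro sets.sets_Collect_finite_All' sets.sets_Collect_finite_All J) auto
  qed
  have Yj: "{\<omega>\<in>space M. \<forall>j\<in>J. Y j \<omega> \<in> A j} \<in> sets M"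
  proof (rule sets.sets_Collect_finite_All[OF _ J])
    fix j assume j: "j \<in> J"
    have "0 \<le> j" using idx[OF j] \<tau>0[of "idx j"] by simp
    from measurable_sets[OF Y_measurable[OF this] A[OF j]] show "{\<omega>\<in>space M. Y j \<omega> \<in> A j} \<in> sets M"
      by (simp add: vimage_def Int_def conj_commute)
  qed
  have sum: "(\<Sum>l<i. ?Z \<omega> l) = Y (\<tau> i) \<omega> - Y 0 \<omega>" if "i \<le> q" for i \<omega>
  proof -
    have "(\<Sum>l<i. ?Z \<omega> l) = (\<Sum>l<i. ?D l \<omega>)" using that by (intro sum.cong) auto
    also have "\<dots> = Y (\<tau> i) \<omega> - Y (\<tau> 0) \<omega>" by (rule sum_lessThan_telescope)
    finally show ?thesis by (simp add: \<tau>)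
  qed
  have "emeasure (distr M ?P ?Z) ?C = emeasure M (?Z -` ?C \<inter> space M)" by (rule emeasure_distr[OF Zm C])
  also have "\<dots> = emeasure M {\<omega>\<in>space M. \<forall>j\<in>J. Y j \<omega> \<in> A j}"
  proof (rule emeasure_eq_AE[OF _ measurable_sets[OF Zm C] Yj])
    show "AE \<omega> in M. \<omega> \<in> ?Z -` ?C \<inter> space M \<longleftrightarrow> \<omega> \<in> {\<omega>\<in>space M. \<forall>j\<in>J. Y j \<omega> \<in> A j}"
      using AE_Y0
    proof eventually_elim
      case (elim \<omega>)
      have "(\<Sum>l<idx j. ?Z \<omega> l) = Y j \<omega>" if "j \<in> J" for j using sum[of "idx j" \<omega>] idx[OF that] elim by simp
      moreover have "\<omega> \<in> space M ==> ?Z \<omega> \<in> space ?P" by (rule measurable_space[OF Zm])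
      ultimately show ?case by auto
    qed
  qed
  finally show ?thesis by (simp add: D)
qed

lemma process_law_eq:
  fixes Y :: "real \<Rightarrow> 'w \<Rightarrow> 'a::euclidean_space" and Y' :: "real \<Rightarrow> 'v \<Rightarrow> 'a"
  assumes A: "levy M Y" and B: "levy M' Y'" and eq: "\<And>t. 0 \<le> t ==> levy.\<nu> M Y t = levy.\<nu> M' Y' t"
  shows "process_law M Y = process_law M' Y'"
proof -
  interpret A: levy M Y by fact
  interpret B: levy M' Y' by fact
  have m: "(\<lambda>\<omega>. restrict (\<lambda>t. Y t \<omega>) {0..}) \<in> measurable M (PiM {0..} (\<lambda>_. borel))"
    "(\<lambda>\<omega>. restrict (\<lambda>t. Y' t \<omega>) {0..}) \<in> measurable M' (PiM {0..} (\<lambda>_. borel))"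
    using A.Y_measurable B.Y_measurable by (auto intro!: measurable_restrict)
  show ?thesis
    unfolding process_law_def
  proof (rule measure_eqI_PiM_infinite[where I = "{0..}" and M = "\<lambda>_. borel"])
    show "finite_measure (distr M (PiM {0..} (\<lambda>_. borel)) (\<lambda>\<omega>. restrict (\<lambda>t. Y t \<omega>) {0..}))"
      by (rule A.finite_measure_distr[OF m(1)])
    fix S :: "real \<Rightarrow> 'a set" and J :: "real set"
    assume J: "finite J" "J \<subseteq> {0..}" and S: "\<And>j. j \<in> J ==> S j \<in> sets borel"
    let ?E = "prod_emb {0..} (\<lambda>_. borel :: 'a measure) J (Pi\<^sub>E J S)"
    have E: "?E \<in> sets (PiM {0..} (\<lambda>_. borel))" using J S by (intro sets_PiM_I) auto
    have pre: "(\<lambda>\<omega>. restrict (\<lambda>t. Z t \<omega>) {0..}) -` ?E \<inter> X = {\<omega>\<in>X. \<forall>j\<in>J. Z j \<omega> \<in> S j}" for Z :: "real \<Rightarrow> 'v \<Rightarrow> 'a" and X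
      using J(2) by (force simp: prod_emb_def PiE_iff subset_iff)
    have pre': "(\<lambda>\<omega>. restrict (\<lambda>t. Z t \<omega>) {0..}) -` ?E \<inter> X = {\<omega>\<in>X. \<forall>j\<in>J. Z j \<omega> \<in> S j}" for Z :: "real \<Rightarrow> 'w \<Rightarrow> 'a" and X
      using J(2) by (force simp: prod_emb_def PiE_iff subset_iff)
    \<comment> \<open>An additional time beyond \<open>J\<close> ensures that the grid from 0 has at
      least one step, even if \<open>J\<close> is empty or contains only 0.\<close>
    define b where "b = Max (insert 0 J) + 1"
    have "0 \<le> Max (insert 0 J)" using J(1) by (intro Max_ge) auto
    then have b: "0 < b" by (simp add: b_def)
    define xs where "xs = sorted_list_of_set (insert 0 (insert b J))"
    have "finite (insert 0 (insert b J))" using J(1) by simp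
    then have set_xs: "set xs = insert 0 (insert b J)" unfolding xs_def by (rule set_sorted_list_of_set)
    have strict: "sorted_wrt (<) xs" unfolding xs_def by (rule strict_sorted_list_of_set)
    define q where "q = length xs - 1"
    have "card {0, b} \<le> card (set xs)" using J(1) set_xs by (intro card_mono) auto
    then have q: "0 < q" "Suc q = length xs" using b card_length[of xs] by (auto simp: q_def)
    have "\<exists>i\<le>q. xs ! i = j" if "j \<in> J" for j
      using that set_xs q(2) by (metis in_set_conv_nth insertCI less_Suc_eq_le)
    then obtain idx where idx: "\<And>j. j \<in> J ==> idx j \<le> q \<and> xs ! idx j = j" by metis
    have incr: "xs ! i < xs ! Suc i" if "i < q" for i using strict that q(2) by (auto simp: sorted_wrt_iff_nth_less)
    have x0: "xs ! 0 = 0"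
    proof -
      have "0 \<in> set xs" by (simp add: set_xs)
      then obtain i where i: "i < length xs" "xs ! i = 0" by (metis in_set_conv_nth)
      have "xs ! 0 \<in> set xs" using q(2) by (metis nth_mem zero_less_Suc)
      then have "0 \<le> xs ! 0" using set_xs b J(2) by auto
      moreover have "xs ! 0 \<le> xs ! i" using strict i(1) by (cases "i = 0") (auto simp: sorted_wrt_iff_nth_less less_imp_le)
      ultimately show ?thesis using i(2) by simp
    qed
    have "PiM {..<q} (\<lambda>i. A.\<nu> (xs ! Suc i - xs ! i)) = PiM {..<q} (\<lambda>i. B.\<nu> (xs ! Suc i - xs ! i))"
      using incr by (intro PiM_cong refl eq) (simp add: less_imp_le)
    then show "emeasure (distr M (PiM {0..} (\<lambda>_. borel)) (\<lambda>\<omega>. restrict (\<lambda>t. Y t \<omega>) {0..})) ?E =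
        emeasure (distr M' (PiM {0..} (\<lambda>_. borel)) (\<lambda>\<omega>. restrict (\<lambda>t. Y' t \<omega>) {0..})) ?E"
      unfolding emeasure_distr[OF m(1) E] emeasure_distr[OF m(2) E] pre pre'
      using A.cylinder_law[of "\<lambda>i. xs ! i" q J idx S] B.cylinder_law[of "\<lambda>i. xs ! i" q J idx S] x0 incr q(1) J(1) idx S by simp
  qed simp_all
qed

section \<open>Rate of convergence\<close>

lemma (in levy_sde) SX_0_expectation: "f \<in> bcontfun ==> sg 0 f x = (f x :: real)"
proof -
  assume f: "f \<in> bcontfun"
  have "sg 0 f x = (LINT \<omega>|M. f x)"
    using SX_0[of x] by (intro integral_cong_AE measurable_compose[OF SX_measurable bcontfun_measurable[OF f]]) (auto elim: eventually_mono)
  then show ?thesis by (simp add: prob_space)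
qed

lemma mixed_tendsto_const:
  fixes f :: "'a::euclidean_space \<Rightarrow> real"
  assumes f: "f \<in> bcontfun" shows "mixed_tendsto (\<lambda>_. f) f"
proof -
  obtain B where "\<And>x. \<bar>f x\<bar> \<le> B" using bcontfun_bounded[OF f] by blast
  then show ?thesis unfolding mixed_tendsto_iff using f by auto
qed

lemma null_seq_divide: "0 < t ==> null_seq (\<lambda>n. t / real (Suc n))"
  using tendsto_mult[OF tendsto_const[of t] LIMSEQ_inverse_real_of_nat] by (simp add: null_seq_def divide_inverse)

context levy_scheme begin

text \<open>The mixed limit bounds the quotients along each null sequence separately. If no common
  bound existed near 0, step sizes with quotients exceeding \<open>n\<close> would form a null
  sequence violating its own bound.\<close>

lemma uniform_small_time:
  assumes mixed: "mixed_tendsto_at_right_0 (\<lambda>h x. (transition_op \<mu> \<psi> h f x - f x) / h) g"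
  shows "\<exists>C\<ge>0. \<exists>h1>0. \<forall>h x. 0 < h --> h < h1 --> \<bar>(transition_op \<mu> \<psi> h f x - f x) / h\<bar> \<le> C"
proof (rule ccontr)
  assume "\<not> ?thesis"
  then have neg: "\<exists>h x. 0 < h \<and> h < h1 \<and> C < \<bar>(transition_op \<mu> \<psi> h f x - f x) / h\<bar>" if "C \<ge> 0" "h1 > 0" for C h1
    using that by (meson not_le)
  have "\<exists>h x. 0 < h \<and> h < 1 / real (Suc n) \<and> real n < \<bar>(transition_op \<mu> \<psi> h f x - f x) / h\<bar>" for n
    by (rule neg) auto
  then obtain hs xs where hx: "\<And>n. 0 < hs n" "\<And>n. hs n < 1 / real (Suc n)" "\<And>n. real n < \<bar>(transition_op \<mu> \<psi> (hs n) f (xs n) - f (xs n)) / hs n\<bar>"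
    by metis
  have "hs ----> 0" by (rule tendsto_sandwich[OF _ _ tendsto_const, of _ _ _ "\<lambda>n. 1 / real (Suc n)"])
       (use hx null_seq_divide[of 1] in \<open>auto simp: null_seq_def less_imp_le simp del: of_nat_Suc\<close>)
  then have "null_seq hs" using hx by (simp add: null_seq_def)
  then obtain B where B: "\<And>n x. \<bar>(transition_op \<mu> \<psi> (hs n) f x - f x) / hs n\<bar> \<le> B"
    using mixed unfolding mixed_tendsto_at_right_0_def mixed_tendsto_iff by blast
  obtain n where "B < real n" using reals_Archimedean2 by blast
  then show False using B[of n "xs n"] hx(3)[of n] by linarith
qed

lemma P_telescope:
  assumes h: "0 < h" "h < h0" and f: "f \<in> bcontfun" "transition_op \<mu> \<psi> h f \<in> bcontfun"
  shows "P h k f x - f x = (\<Sum>j<k. h * P h j (\<lambda>x. (transition_op \<mu> \<psi> h f x - f x) / h) x)"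
proof (induction k)
  case (Suc k)
  let ?T = "transition_op \<mu> \<psi> h f" and ?A = "\<lambda>x. (transition_op \<mu> \<psi> h f x - f x) / h"
  obtain B B' where B: "\<And>x. \<bar>f x\<bar> \<le> B" "\<And>x. \<bar>?T x\<bar> \<le> B'" using bcontfun_bounded[OF f(1)] bcontfun_bounded[OF f(2)] by metis
  note m = bcontfun_measurable[OF f(1)] bcontfun_measurable[OF f(2)]
  have A: "?A \<in> borel_measurable borel" "\<bar>?A x\<bar> \<le> (B' + B) / h" for x
    using m B[of x] h abs_triangle_ineq4[of "?T x" "f x"] by (auto intro!: divide_right_mono)
  have "P h (Suc k) f x - P h k f x = P h k ?T x - P h k f x" by (simp add: funpow_Suc_right del: funpow.simps)
  also have "\<dots> = (LINT \<omega>|iid (\<mu> h). h * ?A (state h x \<omega> k))"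
    unfolding P_integral[OF h m(2) B(2)] P_integral[OF h m(1) B(1)]
    using state_integrable[OF h m(2) B(2)] state_integrable[OF h m(1) B(1)] h by simp
  also have "\<dots> = h * P h k ?A x" unfolding P_integral[OF h A] by simp
  finally show ?case using Suc by simp
qed simp

context
  fixes f g :: "'a \<Rightarrow> real"
  assumes maps_Cb: "\<And>t f. t > 0 ==> f \<in> bcontfun ==> transition_op \<mu> \<psi> t f \<in> bcontfun"
    and f: "f \<in> bcontfun"
    and mixed: "mixed_tendsto_at_right_0 (\<lambda>h x. (transition_op \<mu> \<psi> h f x - f x) / h) g"
begin

abbreviation gen :: "real \<Rightarrow> 'a \<Rightarrow> real" where
  "gen h x \<equiv> (transition_op \<mu> \<psi> h f x - f x) / h"

lemma gen_mixed: "null_seq hs ==> mixed_tendsto (\<lambda>n. gen (hs n)) g"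
  using mixed by (simp add: mixed_tendsto_at_right_0_def)

text \<open>For small \<open>h\<close> both difference quotients are at most \<open>C\<close>: that
  of the scheme by \<open>uniform_small_time\<close>, that of the solution as a limit of telescoped
  sums of the former. For \<open>h \<ge> h1\<close> the trivial bound \<open>2 * B / h1\<close>
  suffices, whence \<open>K\<close>.\<close>

lemma error_bounded:
  "(SUP h\<in>{0<..}. sup_norm (\<lambda>x. (sg h f x - transition_op \<mu> \<psi> h f x) / h)) < \<infinity>"
proof -
  obtain C h1 where C: "C \<ge> 0" "h1 > 0" "\<And>h x. 0 < h ==> h < h1 ==> \<bar>gen h x\<bar> \<le> C" using uniform_small_time[OF mixed] by blast
  obtain B where B: "B \<ge> 0" "\<And>x. \<bar>f x\<bar> \<le> B" using bcontfun_bounded[OF f] by blast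
  define K where "K = max (2 * C) (2 * B / h1)"
  note fm = bcontfun_measurable[OF f]
  have S: "\<bar>sg t f x - f x\<bar> \<le> t * C" if t: "0 < t" for t x
  proof -
    have hs: "null_seq (\<lambda>n. t / real (Suc n))" by (rule null_seq_divide[OF t])
    have lim: "(\<lambda>n. P (t / real (Suc n)) (Suc n) f x) ----> sg t f x"
    proof (rule tendstoI)
      fix e :: real assume "e > 0"
      then have "EV n. \<forall>y. norm y \<le> norm x --> \<bar>P (t / real (Suc n)) (Suc n) f y - sg t f y\<bar> \<le> e / 2"
        by (intro P_converges[OF hs _ mixed_tendsto_const[OF f]]) auto
      then show "EV n. dist (P (t / real (Suc n)) (Suc n) f x) (sg t f x) < e"
      proof eventually_elim
        case (elim n)
        then have "\<bar>P (t / real (Suc n)) (Suc n) f x - sg t f x\<bar> \<le> e / 2" by blast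
        then show ?case using \<open>e > 0\<close> unfolding dist_real_def by linarith
      qed
    qed
    have "0 < min h0 h1" using h0 C(2) by simp
    then have "EV n. \<bar>P (t / real (Suc n)) (Suc n) f x - f x\<bar> \<le> t * C"
    proof (rule eventually_mono[OF null_seq_small[OF hs]])
      fix n assume "0 < t / real (Suc n) \<and> t / real (Suc n) < min h0 h1"
      moreover define h where "h = t / real (Suc n)"
      ultimately have h: "0 < h" "h < h0" "h < h1" by auto
      note A = maps_Cb[OF h(1) f]
      have Am: "gen h \<in> borel_measurable borel" using bcontfun_measurable[OF A] fm by simp
      have "\<bar>P h j (gen h) x\<bar> \<le> C" for j
      proof -
        interpret N: borel_prob "\<mu> h" by (rule borel_prob_mu[OF h(1)])
        have "\<bar>LINT \<omega>|iid (\<mu> h). gen h (state h x \<omega> j)\<bar> \<le> C"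
          by (rule order_trans[OF integral_abs_bound N.seq.P.integral_le_const])
             (intro integrable_abs state_integrable[OF h(1,2) Am C(3)[OF h(1,3)]] AE_I2 C(3)[OF h(1,3)])+
        then show ?thesis unfolding P_integral[OF h(1,2) Am C(3)[OF h(1,3)]] .
      qed
      then have "\<bar>\<Sum>j<Suc n. h * P h j (gen h) x\<bar> \<le> (\<Sum>j<Suc n. h * C)"
        using h by (intro order_trans[OF sum_abs sum_mono]) (simp add: abs_mult)
      also have "\<dots> = t * C" by (simp add: h_def)
      finally show "\<bar>P (t / real (Suc n)) (Suc n) f x - f x\<bar> \<le> t * C"
        unfolding h_def[symmetric] P_telescope[OF h(1,2) f A] .
    qed
    then show ?thesis by (intro tendsto_upperbound[OF tendsto_rabs[OF tendsto_diff[OF lim tendsto_const]]]) auto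
  qed
  have "\<bar>(sg h f x - transition_op \<mu> \<psi> h f x) / h\<bar> \<le> K" if h: "0 < h" for h x
  proof (cases "h < h1")
    case True
    have "(sg h f x - transition_op \<mu> \<psi> h f x) / h = (sg h f x - f x) / h - gen h x"
      using h by (simp add: field_simps)
    moreover have "\<bar>(sg h f x - f x) / h\<bar> \<le> C" using S[OF h, of x] h by (simp add: field_simps)
    ultimately show ?thesis using C(3)[OF h True, of x] unfolding K_def by linarith
  next
    case False
    interpret N: borel_prob "\<mu> h" by (rule borel_prob_mu[OF h])
    have "\<bar>LINT \<omega>|M. f (SX x h \<omega>)\<bar> \<le> B"
      using SX_integrable[OF less_imp_le[OF h] fm B(2)] B by (intro order_trans[OF integral_abs_bound integral_le_const]) auto
    moreover have "\<bar>transition_op \<mu> \<psi> h f x\<bar> \<le> B"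
      unfolding transition_op_def by (rule order_trans[OF integral_abs_bound N.integral_le_const])
         (use integrable_mu[OF h, of "\<lambda>y. f (\<psi> h x + y)" B] measurable_compose[OF _ fm, of "\<lambda>y. \<psi> h x + y" borel] B in auto)
    ultimately have "\<bar>(sg h f x - transition_op \<mu> \<psi> h f x) / h\<bar> \<le> 2 * B / h"
      using h by (auto intro!: divide_right_mono)
    also have "\<dots> \<le> 2 * B / h1" using False B C by (intro divide_left_mono) auto
    finally show ?thesis by (simp add: K_def)
  qed
  note b = this
  have "(SUP h\<in>{0<..}. sup_norm (\<lambda>x. (sg h f x - transition_op \<mu> \<psi> h f x) / h)) \<le> ereal K"
    by (rule SUP_least, unfold sup_abs_on_le) (use b in blast)
  then show ?thesis by (rule le_less_trans) simp
qed

text \<open>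
  By telescoping, the difference quotient of the limit semigroup at time \<open>t\<close> is close to an average of
  \<open>P h j (gen h)\<close> over \<open>j * h \<le> t\<close>. The worst index \<open>j\<close> is a legitimate choice in the convergence theorem at time \<open>0\<close>.
\<close>

lemma semigroup_quotient:
  assumes ts: "null_seq ts" and r: "0 \<le> r" and e: "0 < e"
  shows "EV n. \<forall>x. norm x \<le> r --> \<bar>(sg (ts n) f x - f x) / ts n - g x\<bar> \<le> e"
proof -
  have tpos: "0 < ts n" for n using ts by (simp add: null_seq_def)
  \<comment> \<open>For each fixed \<open>ts n\<close> the mesh is made so fine that the scheme is
    accurate to a small multiple of \<open>ts n\<close>, since the error is later divided by
    \<open>ts n\<close>.\<close>
  have "\<exists>m\<ge>n. \<forall>x. norm x \<le> r --> \<bar>P (ts n / real (Suc m)) (Suc m) f x - sg (ts n) f x\<bar> \<le> ts n * (e / 2)" for n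
  proof -
    have "EV m. \<forall>x. norm x \<le> r --> \<bar>P (ts n / real (Suc m)) (Suc m) f x - sg (ts n) f x\<bar> \<le> ts n * (e / 2)"
      by (rule P_converges[OF null_seq_divide[OF tpos] _ mixed_tendsto_const[OF f] r]) (use tpos[of n] e in auto)
    then show ?thesis unfolding eventually_sequentially by (meson nat_le_linear)
  qed
  then obtain ms where ms: "\<And>n x. norm x \<le> r ==> \<bar>P (ts n / real (Suc (ms n))) (Suc (ms n)) f x - sg (ts n) f x\<bar> \<le> ts n * (e / 2)"
    by metis
  define ks where "ks n = Suc (ms n)" for n
  define hs where "hs n = ts n / real (ks n)" for n
  have h: "0 < hs n" "hs n \<le> ts n" "real (ks n) * hs n = ts n" for n using tpos[of n] by (auto simp: hs_def ks_def field_simps)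
  have tlim: "ts ----> 0" using ts by (simp add: null_seq_def)
  have "hs ----> 0" by (rule tendsto_sandwich[OF _ _ tendsto_const tlim]) (use h in \<open>auto simp: less_imp_le\<close>)
  then have hs: "null_seq hs" using h by (simp add: null_seq_def)
  define bad where "bad n j \<longleftrightarrow> j < ks n \<and> (\<exists>x. norm x \<le> r \<and> e / 2 < \<bar>P (hs n) j (gen (hs n)) x - g x\<bar>)" for n j
  \<comment> \<open>If no index is bad the default 0 does; in every case
    \<open>js n \<le> ks n\<close>, so the times \<open>js n * hs n\<close> are at most
    \<open>ts n\<close> and tend to 0.\<close>
  define js where "js n = (if \<exists>j. bad n j then SOME j. bad n j else 0)" for n
  have js: "bad n (js n)" if "bad n j" for n j using someI[of "bad n" j] that by (auto simp: js_def)
  have jk: "js n \<le> ks n" for n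
  proof (cases "\<exists>j. bad n j")
    case True
    then obtain j where "bad n j" by blast
    from js[OF this] show ?thesis unfolding bad_def by simp
  qed (simp add: js_def)
  have "(\<lambda>n. real (js n) * hs n) ----> 0"
  proof (rule tendsto_sandwich[OF _ _ tendsto_const tlim])
    have "real (js n) * hs n \<le> ts n" for n using mult_right_mono[of "real (js n)" "real (ks n)" "hs n"] jk[of n] h[of n] by simp
    then show "EV n. real (js n) * hs n \<le> ts n" by simp
  qed (use h in \<open>auto simp: less_imp_le\<close>)
  from P_converges[OF hs this gen_mixed[OF hs] r, of "e / 2"] e
  have "EV n. \<forall>x. norm x \<le> r --> \<bar>P (hs n) (js n) (gen (hs n)) x - g x\<bar> \<le> e / 2"
    using gen_mixed[OF hs] by (simp add: SX_0_expectation mixed_tendsto_iff)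
  then show ?thesis using null_seq_small[OF hs h0]
  proof eventually_elim
    case (elim n)
    have nb: "\<not> bad n j" for j using js[of n j] elim(1) unfolding bad_def by (meson not_le)
    show ?case
    proof (intro allI impI)
      fix x :: 'a assume x: "norm x \<le> r"
      have b: "\<bar>P (hs n) j (gen (hs n)) x - g x\<bar> \<le> e / 2" if "j < ks n" for j using nb[of j] that x unfolding bad_def by (meson not_le)
      have "P (hs n) (ks n) f x - f x - ts n * g x = (\<Sum>j<ks n. hs n * (P (hs n) j (gen (hs n)) x - g x))"
        unfolding P_telescope[OF h(1) conjunct2[OF elim(2)] f maps_Cb[OF h(1) f]] h(3)[of n, symmetric]
        by (simp add: sum_subtractf right_diff_distrib)
      also have "\<bar>\<dots>\<bar> \<le> (\<Sum>j<ks n. hs n * (e / 2))"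
        using b h(1)[of n] by (intro order_trans[OF sum_abs sum_mono]) (simp add: abs_mult)
      also have "\<dots> = ts n * (e / 2)" using h(3)[of n] by simp
      finally have 1: "\<bar>P (hs n) (ks n) f x - f x - ts n * g x\<bar> \<le> ts n * (e / 2)" .
      have 2: "\<bar>P (hs n) (ks n) f x - sg (ts n) f x\<bar> \<le> ts n * (e / 2)" using ms[OF x, of n] unfolding hs_def ks_def .
      have "\<bar>sg (ts n) f x - f x - ts n * g x\<bar> \<le> ts n * e" using 1 2 by (simp add: abs_if split: if_splits)
      moreover have "(sg (ts n) f x - f x) / ts n - g x = (sg (ts n) f x - f x - ts n * g x) / ts n"
        using tpos[of n] by (simp add: diff_divide_distrib)
      ultimately show "\<bar>(sg (ts n) f x - f x) / ts n - g x\<bar> \<le> e"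
        using tpos[of n] by (simp add: pos_divide_le_eq mult.commute)
    qed
  qed
qed

lemma error_tendsto_0:
  assumes r: "0 \<le> r"
  shows "((\<lambda>h. sup_abs_on {x. norm x \<le> r} (\<lambda>x. (sg h f x - transition_op \<mu> \<psi> h f x) / h)) \<longlongrightarrow> 0) (at_right 0)"
proof -
  have "{x :: 'a. norm x \<le> r} \<noteq> {}" using r norm_zero by (metis (mono_tags) empty_Collect_eq)
  moreover have "\<forall>\<^sub>F h in at_right 0. \<forall>x\<in>{x. norm x \<le> r}. \<bar>(sg h f x - transition_op \<mu> \<psi> h f x) / h\<bar> \<le> e" if e: "0 < e" for e
  proof (rule sequentially_imp_eventually_at_right[OF zero_less_one])
    fix ts :: "nat \<Rightarrow> real" assume "\<And>n. 0 < ts n" "ts ----> 0"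
    then have ts: "null_seq ts" by (simp add: null_seq_def)
    have e2: "0 < e / 2" using e by simp
    have "EV n. \<forall>x. norm x \<le> r --> \<bar>gen (ts n) x - g x\<bar> \<le> e / 2"
      using gen_mixed[OF ts] r e2 unfolding mixed_tendsto_iff by blast
    with semigroup_quotient[OF ts r e2]
    show "EV n. \<forall>x\<in>{x. norm x \<le> r}. \<bar>(sg (ts n) f x - transition_op \<mu> \<psi> (ts n) f x) / ts n\<bar> \<le> e"
    proof eventually_elim
      case (elim n)
      show ?case
      proof
        fix x :: 'a assume "x \<in> {x. norm x \<le> r}"
        then have "\<bar>(sg (ts n) f x - f x) / ts n - g x\<bar> \<le> e / 2" "\<bar>gen (ts n) x - g x\<bar> \<le> e / 2" using elim by auto
        moreover have "(sg (ts n) f x - transition_op \<mu> \<psi> (ts n) f x) / ts n =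
            ((sg (ts n) f x - f x) / ts n - g x) - (gen (ts n) x - g x)" by (simp add: diff_divide_distrib)
        ultimately show "\<bar>(sg (ts n) f x - transition_op \<mu> \<psi> (ts n) f x) / ts n\<bar> \<le> e" by linarith
      qed
    qed
  qed
  ultimately show ?thesis by (simp add: sup_abs_on_tendsto_0)
qed

end

end

section \<open>From the hypotheses to the theorem\<close>

text \<open>The estimate for short displacements holds at every base point. A long displacement is
  cut into \<open>n\<close> equal pieces of length at most \<open>\<delta>\<close>, and the errors
  add up linearly.\<close>

lemma lipschitz_extend:
  fixes p :: "'a::real_normed_vector \<Rightarrow> 'a"
  assumes \<delta>: "0 < \<delta>" and c: "0 \<le> c" and small: "\<And>x u. norm u \<le> \<delta> ==> norm (p (x + u) - p x - u) \<le> c * norm u"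
  shows "norm (p x - p x' - (x - x')) \<le> c * norm (x - x')"
proof -
  obtain n :: nat where n: "norm (x - x') / \<delta> < real n" using reals_Archimedean2 by blast
  have n0: "0 < n"
  proof (rule ccontr)
    assume "\<not> 0 < n"
    moreover have "0 \<le> norm (x - x') / \<delta>" using \<delta> by simp
    ultimately show False using n by simp
  qed
  define v where "v = (x - x') /\<^sub>R real n"
  have "norm v = norm (x - x') / real n" by (simp add: v_def divide_inverse mult.commute)
  also have "\<dots> \<le> \<delta>" using n n0 \<delta> by (simp add: field_simps)
  finally have v: "norm v \<le> \<delta>" "real n *\<^sub>R v = x - x'" using n0 by (simp_all add: v_def)
  have "norm (p (x' + real i *\<^sub>R v) - p x' - real i *\<^sub>R v) \<le> real i * (c * norm v)" for i
  proof (induction i)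
    case (Suc i)
    have eq: "p (x' + real (Suc i) *\<^sub>R v) - p x' - real (Suc i) *\<^sub>R v =
        (p (x' + real i *\<^sub>R v) - p x' - real i *\<^sub>R v) + (p ((x' + real i *\<^sub>R v) + v) - p (x' + real i *\<^sub>R v) - v)"
      by (simp add: algebra_simps)
    show ?case
      unfolding eq using norm_triangle_le[OF add_mono[OF Suc small[OF v(1), of "x' + real i *\<^sub>R v"]]] by (simp add: algebra_simps)
  qed simp
  moreover have "real n * norm v = norm (x - x')" using arg_cong[OF v(2), of norm] by simp
  ultimately show ?thesis by (metis add_diff_cancel_left' diff_add_cancel mult.left_commute v(2) add.commute)
qed

text \<open>The bound for small displacements extends to all of them by
  \<open>lipschitz_extend\<close>; divided by \<open>h\<close>, it passes to the limit and makes
  \<open>F\<close> Lipschitz with the same constant.\<close>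

lemma scheme_drift:
  fixes \<psi> :: "real \<Rightarrow> 'a::real_normed_vector \<Rightarrow> 'a"
  assumes A3: "\<exists>w\<ge>0. \<exists>\<delta>>0. \<exists>h0>0. \<forall>u. norm u \<le> \<delta> -->
      (SUP h\<in>{0<..<h0}. SUP x. ereal (norm (\<psi> h (x + u) - \<psi> h x - u) / h)) \<le> ereal (w * norm u)"
    and A3_F: "\<And>x. ((\<lambda>h. (\<psi> h x - x) /\<^sub>R h) \<longlongrightarrow> F x) (at_right 0)"
  obtains w h0 where "0 \<le> w" "0 < h0"
    "\<And>h x x'. 0 < h ==> h < h0 ==> norm (\<psi> h x - \<psi> h x' - (x - x')) \<le> h * w * norm (x - x')"
    "\<And>x x'. norm (F x - F x') \<le> w * norm (x - x')"
proof -
  obtain w \<delta> h0 where w: "0 \<le> w" "0 < \<delta>" "0 < h0" and le: "\<And>u. norm u \<le> \<delta> ==>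
      (SUP h\<in>{0<..<h0}. SUP x. ereal (norm (\<psi> h (x + u) - \<psi> h x - u) / h)) \<le> ereal (w * norm u)"
    using A3 by blast
  have lip: "norm (\<psi> h x - \<psi> h x' - (x - x')) \<le> h * w * norm (x - x')" if h: "0 < h" "h < h0" for h x x'
  proof (rule lipschitz_extend[OF w(2)])
    fix x u :: 'a assume u: "norm u \<le> \<delta>"
    have "h \<in> {0<..<h0}" using h by simp
    then have "(SUP x. ereal (norm (\<psi> h (x + u) - \<psi> h x - u) / h)) \<le> ereal (w * norm u)"
      using le[OF u] by (meson SUP_upper order_trans)
    then have "ereal (norm (\<psi> h (x + u) - \<psi> h x - u) / h) \<le> ereal (w * norm u)" by (meson SUP_upper UNIV_I order_trans)
    then show "norm (\<psi> h (x + u) - \<psi> h x - u) \<le> h * w * norm u" using h by (simp add: field_simps)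
  qed (use h w in simp)
  have "norm (F x - F x') \<le> w * norm (x - x')" for x x'
  proof (rule tendsto_upperbound[OF tendsto_norm[OF tendsto_diff[OF A3_F A3_F]]])
    have "norm ((\<psi> h x - x) /\<^sub>R h - (\<psi> h x' - x') /\<^sub>R h) \<le> w * norm (x - x')" if "0 < h" "h < h0" for h
    proof -
      have "norm ((\<psi> h x - x) /\<^sub>R h - (\<psi> h x' - x') /\<^sub>R h) = norm (\<psi> h x - \<psi> h x' - (x - x')) / h"
        using that by (simp add: divide_inverse algebra_simps flip: scaleR_diff_right)
      also have "\<dots> \<le> w * norm (x - x')" using lip[OF that, of x x'] that by (simp add: field_simps)
      finally show ?thesis .
    qed
    then show "\<forall>\<^sub>F h in at_right 0. norm ((\<psi> h x - x) /\<^sub>R h - (\<psi> h x' - x') /\<^sub>R h) \<le> w * norm (x - x')"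
      using w(3) unfolding eventually_at_right_field by blast
  qed simp
  then show ?thesis using that w lip by blast
qed

lemma scheme_limits_eq:
  fixes f :: "'a::euclidean_space \<Rightarrow> real" and X :: "'a \<Rightarrow> real \<Rightarrow> 'w \<Rightarrow> 'a" and X' :: "'a \<Rightarrow> real \<Rightarrow> 'v \<Rightarrow> 'a"
  assumes c: "scheme_converges \<mu> \<psi> M X" "scheme_converges \<mu> \<psi> M' X'" and f: "f \<in> bcontfun" and t: "0 \<le> t"
  shows "(LINT \<omega>|M. f (X x t \<omega>)) = (LINT \<omega>|M'. f (X' x t \<omega>))"
proof -
  \<comment> \<open>For \<open>t = 0\<close> no steps are made while the step sizes must still be
    positive and tend to 0; otherwise \<open>Suc n\<close> steps of size \<open>t / Suc n\<close>
    reach \<open>t\<close> exactly.\<close>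
  define s where "s = (if t = 0 then 1 else t)"
  define ks where "ks n = (if t = 0 then 0 else Suc n)" for n
  have hs: "null_seq (\<lambda>n. s / real (Suc n))" using t by (intro null_seq_divide) (simp add: s_def)
  have ks: "(\<lambda>n. real (ks n) * (s / real (Suc n))) ----> t"
    by (rule tendsto_eventually) (auto simp: ks_def s_def intro!: always_eventually simp del: of_nat_Suc)
  have ne: "{y :: 'a. norm y \<le> norm x} \<noteq> {}" by blast
  have lim: "(\<lambda>n. (transition_op \<mu> \<psi> (s / real (Suc n)) ^^ ks n) f x) ----> (LINT \<omega>|M. f (X x t \<omega>))"
    if "scheme_converges \<mu> \<psi> M X" for M :: "'c measure" and X
  proof (rule tendstoI)
    fix e :: real assume e: "0 < e"
    have "(\<lambda>n. sup_abs_on {y. norm y \<le> norm x} (\<lambda>x. (transition_op \<mu> \<psi> (s / real (Suc n)) ^^ ks n) f x - (LINT \<omega>|M. f (X x t \<omega>)))) ----> 0"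
      using that[unfolded scheme_converges_def, rule_format, of "\<lambda>n. s / real (Suc n)" t f ks "\<lambda>_. f" "norm x"] hs ks t f mixed_tendsto_const[OF f] by simp
    then have "EV n. \<forall>y\<in>{y. norm y \<le> norm x}. \<bar>(transition_op \<mu> \<psi> (s / real (Suc n)) ^^ ks n) f y - (LINT \<omega>|M. f (X y t \<omega>))\<bar> \<le> e / 2"
      unfolding sup_abs_on_tendsto_0[OF ne] using half_gt_zero[OF e] by blast
    then show "EV n. dist ((transition_op \<mu> \<psi> (s / real (Suc n)) ^^ ks n) f x) (LINT \<omega>|M. f (X x t \<omega>)) < e"
    proof eventually_elim
      case (elim n)
      then have "\<bar>(transition_op \<mu> \<psi> (s / real (Suc n)) ^^ ks n) f x - (LINT \<omega>|M. f (X x t \<omega>))\<bar> \<le> e / 2" by blast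
      then show ?case using e unfolding dist_real_def by linarith
    qed
  qed
  show ?thesis by (rule LIMSEQ_unique[OF lim[OF c(1)] lim[OF c(2)]])
qed

theorem corollary2p3:
  fixes \<mu> :: "real \<Rightarrow> (real ^ 'n) measure"
    and \<psi> :: "real \<Rightarrow> real ^ 'n \<Rightarrow> real ^ 'n"
    and F :: "real ^ 'n \<Rightarrow> real ^ 'n"
  assumes prob: "\<And>t. t > 0 \<Longrightarrow> prob_space (\<mu> t)"
    and borel: "\<And>t. t > 0 \<Longrightarrow> sets (\<mu> t) = sets borel"
    and maps_Cb: "\<And>t f. t > 0 \<Longrightarrow> f \<in> bcontfun \<Longrightarrow> transition_op \<mu> \<psi> t f \<in> bcontfun"
    and A1: "\<And>\<phi>. \<phi> \<in> Cc_infinity \<Longrightarrow>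
      \<exists>L. ((\<lambda>h. LINT y|\<mu> h. (\<phi> y - \<phi> 0) / h) \<longlongrightarrow> L) (at_right 0)"
    and A2: "\<And>\<epsilon>. \<epsilon> > 0 \<Longrightarrow>
      \<exists>K>0. Limsup (at_right 0) (\<lambda>h. ereal (1 / h * measure (\<mu> h) {y. norm y > K})) < ereal \<epsilon>"
    and A3: "\<exists>w\<ge>0. \<exists>\<delta>>0. \<exists>h0>0. \<forall>u. norm u \<le> \<delta> \<longrightarrow>
      (SUP h\<in>{0<..<h0}. SUP x. ereal (norm (\<psi> h (x + u) - \<psi> h x - u) / h)) \<le> ereal (w * norm u)"
    and A3_F: "\<And>x. ((\<lambda>h. (\<psi> h x - x) /\<^sub>R h) \<longlongrightarrow> F x) (at_right 0)"
  shows "\<exists>(M :: (real \<Rightarrow> real ^ 'n) measure) Y X.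
      levy_process M Y \<and>
      (\<forall>x. unique_strong_solution M Y F x (X x)) \<and>
      scheme_converges \<mu> \<psi> M X \<and>
      (\<forall>(M' :: 'w measure) Y'. levy_process M' Y' \<and> scheme_limit \<mu> \<psi> F M' Y' \<longrightarrow>
         process_law M' Y' = process_law M Y) \<and>
      (\<forall>f \<in> bcontfun.
         (\<exists>g. mixed_tendsto_at_right_0 (\<lambda>h x. (transition_op \<mu> \<psi> h f x - f x) / h) g) \<longrightarrow>
         (SUP h\<in>{0<..}. sup_norm (\<lambda>x. ((LINT \<omega>|M. f (X x h \<omega>)) - transition_op \<mu> \<psi> h f x) / h)) < \<infinity> \<and>
         (\<forall>r\<ge>0. ((\<lambda>h. sup_abs_on {x. norm x \<le> r}
            (\<lambda>x. ((LINT \<omega>|M. f (X x h \<omega>)) - transition_op \<mu> \<psi> h f x) / h)) \<longlongrightarrow> 0) (at_right 0)))"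
  proof -
  interpret J: jump_family \<mu> by (rule jump_family.intro) (fact prob borel A1 A2)+
  obtain w h0 where w: "0 \<le> w" "0 < h0"
    and \<psi>: "\<And>h x x'. 0 < h \<Longrightarrow> h < h0 \<Longrightarrow> norm (\<psi> h x - \<psi> h x' - (x - x')) \<le> h * w * norm (x - x')"
    and F: "\<And>x x'. norm (F x - F x') \<le> w * norm (x - x')"
    using scheme_drift[OF A3 A3_F] by metis
  obtain M :: "(real \<Rightarrow> real ^ 'n) measure" and Y where MY: "levy_process M Y"
    and cf: "\<And>t u. 0 \<le> t \<Longrightarrow> charf (distr M borel (Y t)) u = exp (of_real t * J.\<eta> u)"
    using J.levy_process_exists by blast
  interpret L: levy_scheme \<mu> F w \<psi> h0 M Y
    by unfold_locales (fact w \<psi> F A3_F MY cf)+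
  have uniq: "process_law M' Y' = process_law M Y" if L': "levy_process M' Y'" "scheme_limit \<mu> \<psi> F M' Y'" for M' :: "'w measure" and Y'
  proof -
    interpret B: levy_sde M' Y' F w by unfold_locales (fact L')
    obtain X' where X': "\<And>x. unique_strong_solution M' Y' F x (X' x)" "scheme_converges \<mu> \<psi> M' X'"
      using L'(2) by (auto simp: scheme_limit_def)
    \<comment> \<open>The given solutions over \<open>M'\<close> have the same expectations as the
      pathwise ones, and the same iterates of the scheme converge to the expectations over both
      spaces; the marginals of the driving processes then agree, and with them the laws.\<close>
    have "B.\<nu> t = L.\<nu> t" if "0 \<le> t" for t
    proof (rule levy_marginals_eq[OF B.levy_sde_axioms L.levy_sde_axioms _ that])
      show "(LINT \<omega>|M'. f (B.SX 0 t \<omega>)) = (LINT \<omega>|M. f (L.SX 0 t \<omega>))" if "f \<in> bcontfun" "0 \<le> t" for f :: "real ^ 'n \<Rightarrow> real" and t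
        using scheme_limits_eq[OF X'(2) L.scheme_converges that, of 0] B.unique_strong_solution_expectation[OF X'(1) that(2,1)] by simp
    qed
    then show ?thesis by (intro process_law_eq B.levy_axioms L.levy_axioms)
  qed
  show ?thesis
    using MY L.SX_unique L.scheme_converges uniq L.error_bounded[OF maps_Cb] L.error_tendsto_0[OF maps_Cb]
    by (intro exI[of _ M] exI[of _ Y] exI[of _ L.SX]) blast
qed

end
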